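(* Consider $dU/d\tau=F(U)$, $U\in\mathbb R^N$, where $F:\mathbb R^N\to\mathbb R^N$ is regular (of class $C^2$), $F(\vec 0)=\vec 0$, $F(U)=\vec 0$ whenever $|U|\ge2\delta$, and all eigenvalues of $DF(\vec 0)$ have non positive real part. Write the equation near the origin in the coordinates $(X^-,X^0)$, $X^0=(\zeta,u_0)$, described in the context, i.e. in the form $$(\ast)\quad\begin{cases} dX^-/d\tau=A^-(X^-,X^0)X^-\\ dX^0/d\tau=\hat A^0(X^-,X^0)X^0.\end{cases}$$ Let $\mathcal S_0$ be an invariant manifold for $(\ast)$ entirely contained in the center manifold $\{X^-=\vec 0\}$, and let $\mathrm S^0$ be its tangent space at the origin. If the constant $\delta$ is sufficiently small, then there exists a continuously differentiable manifold $\mathcal M^{us}_{\mathcal S_0}$, defined in the ball of radius $\delta$ and center at the origin, which satisfies the following properties: 1. $\mathcal M^{us}_{\mathcal S_0}$ is locally invariant for $(\ast)$: if the initial datum lies on the manifold, then the solution $(X^-(\tau),X^0(\tau))$ of $(\ast)$ lies on $\mathcal M^{us}_{\mathcal S_0}$ for $|\tau|$ sufficiently small. 2. $\mathcal M^{us}_{\mathcal S_0}$ is parameterized by $\mathrm S^0\times V^-$ and is tangent to this space at the origin, where $V^-=\{(X^-,\vec 0):X^0=\vec 0\}$. 3. Any orbit $Y(\tau)$ lying on $\mathcal M^{us}_{\mathcal S_0}$ can be decomposed as $$Y(\tau)=Y^0(\tau)+Y^-(\tau)+Y^p(\tau),$$ where $Y^0(\tau)=(\vec 0,\zeta^0(\tau),u_0(\tau))$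 is an orbit lying on $\mathcal S_0$, the component $Y^-(\tau)=(X^-(\tau),\vec 0,\vec 0)$ lies on the stable manifold, and the perturbation term $Y^p(\tau)$ satisfies $$|Y^p(\tau)|\le C\,|\zeta^0(0)|\,|Y^-(0)|\,e^{-c\tau/4}$$ for some positive constant $C$, where $c>0$ is the constant fixed in the context.
   Context: Cut-off convention: the vector field is multiplied by a smooth scalar cut-off function equal to $1$ for $|U|\le\delta$ and to $0$ for $|U|\ge2\delta$; the resulting field is still denoted $F$. "$\delta$ sufficiently small" refers to this choice; $\delta$ is in particular so small that $\mathcal S_0$ is parameterized by $\mathrm S^0$. Coordinates: let $n_-$ be the dimension of the eigenspace of $DF(\vec 0)$ associated to eigenvalues with strictly negative real part and $n_c=N-n_-$ the dimension of that associated to eigenvalues with zero real part. A center manifold around $\vec 0$ is fixed, and by a local diffeomorphism (defined in the ball of radius $2\delta$ centered at $\vec 0$) one passes to coordinates $(X^-,X^0)\in\mathbb R^{n_-}\times\mathbb R^{n_c}$ in which the fixed center manifold is $\{X^-=\vec 0\}$ and the stable manifold is $\{X^0=\vec 0\}$. The equation then reads $dX^-/d\tau=f^-(X^-,X^0)=A^-(X^-,X^0)X^-$, $dX^0/d\tau=f^0(X^-,X^0)=\hat A^0(X^-,X^0)X^0$ for suitable matrix valued functions, where $A^-(\vec 0,\vec 0)$ has only eigenvalues with strictly negative real part and $\hat A^0(\vec 0,\vec 0)$ has only eigenvalues with zero real part. It is assumed that there is a continuously differentiable manifold $\mathcal Z_0$ containing the stable manifold $\{X^0=\vec 0\}$ and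 such that $f^0=\vec 0$ on $\mathcal Z_0$; coordinates on $\mathbb R^{n_c}$ are chosen so that $X^0=(\zeta,u_0)$ and $\mathcal Z_0=\{\zeta=\vec 0\}$. (If $\mathcal Z_0$ is just the stable manifold, one sets $\zeta=X^0$ and $u_0$ is absent.) Points are written $(X^-,\zeta,u_0)$. Constant $c$: $c>0$ is fixed with $\mathrm{Re}\,\lambda<-c$ for every eigenvalue $\lambda$ of $A^-(\vec 0,\vec 0)$, so that $|e^{A^-(\vec 0,\vec 0)t}\underline X^-|\le C_-e^{-ct}|\underline X^-|$ for all $t\ge0$, $\underline X^-\in\mathbb R^{n_-}$, for some $C_->0$. The manifold $\mathcal S_0$ contains the origin. In the paper $\mathcal M^{us}_{\mathcal S_0}$ is called the uniformly stable manifold relative to $\mathcal S_0$. *)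

theory Defs
  imports "HOL-Analysis.Analysis"
begin

subsection \<open>Functions of class \<open>C\<^sup>k\<close>, submanifolds\<close>

text \<open>Intended for open \<open>S\<close>: there, on a Euclidean space, all directional derivatives of \<open>f\<close> are of
  class \<open>C\<^sup>k\<close> iff \<open>f\<close> is of class \<open>C\<^sup>k\<^sup>+\<^sup>1\<close>.\<close>

primrec Ck_on ::
  "nat \<Rightarrow> ('a::euclidean_space \<Rightarrow> 'b::real_normed_vector) \<Rightarrow> 'a set \<Rightarrow> bool" where
  "Ck_on 0 f S = continuous_on S f"
| "Ck_on (Suc k) f S =
     ((\<forall>x\<in>S. f differentiable (at x)) \<and>
      (\<forall>v. Ck_on k (\<lambda>x. frechet_derivative f (at x) v) S))"

definition Ck_diffeo ::
  "nat \<Rightarrow> ('a::euclidean_space \<Rightarrow> 'a) \<Rightarrow> 'a set \<Rightarrow> 'a set \<Rightarrow> bool" where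
  "Ck_diffeo k h A B \<longleftrightarrow>
     open A \<and> open B \<and> bij_betw h A B \<and> Ck_on k h A \<and> Ck_on k (inv_into A h) B"

definition C1_submanifold :: "nat \<Rightarrow> 'a::euclidean_space set \<Rightarrow> bool" where
  "C1_submanifold d S \<longleftrightarrow>
     (\<forall>p\<in>S. \<exists>A B h L. p \<in> A \<and> Ck_diffeo 1 h A B \<and> subspace L \<and> dim L = d \<and>
        h ` (S \<inter> A) = B \<inter> L)"

definition tangent_space_at :: "'a::euclidean_space set \<Rightarrow> 'a \<Rightarrow> 'a set" where
  "tangent_space_at S p =
     {v. \<exists>\<gamma>. \<gamma> 0 = p \<and> (\<forall>\<^sub>F t in nhds (0::real). \<gamma> t \<in> S) \<and>
        (\<gamma> has_vector_derivative v) (at 0)}"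

text \<open>\<open>M\<close> is the part lying in \<open>B\<close> of a \<open>C\<^sup>1\<close> graph over the linear space \<open>E\<close>. The map \<open>g\<close> is
  defined on the whole space only to avoid derivatives along \<open>E\<close>; its values off \<open>E\<close> play no role.\<close>

definition C1_parameterized_by ::
  "'a::euclidean_space set \<Rightarrow> 'a set \<Rightarrow> 'a set \<Rightarrow> bool" where
  "C1_parameterized_by M E B \<longleftrightarrow>
     (\<exists>g. Ck_on 1 g UNIV \<and> (\<forall>v\<in>E. \<forall>w\<in>E. orthogonal (g v) w) \<and>
        M = {v + g v | v. v \<in> E} \<inter> B)"

subsection \<open>Blocks of coordinates, eigenvalues\<close>

text \<open>A splitting of \<open>\<real>\<^sup>N\<close> into factors is given by a partition of the index type; each factor is
  identified with the vectors supported on its index set. Index sets may be empty, so that a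
  factor is allowed to have dimension zero.\<close>

definition block :: "'n set \<Rightarrow> real^'n \<Rightarrow> real^'n" where
  "block J x = (\<chi> i. if i \<in> J then x $ i else 0)"

text \<open>Complex eigenvalues of the square submatrix of \<open>A\<close> with rows and columns in \<open>J\<close>.\<close>

definition block_eigenvalue :: "'n set \<Rightarrow> real^'n^'n \<Rightarrow> complex \<Rightarrow> bool" where
  "block_eigenvalue J A \<mu> \<longleftrightarrow>
     (\<exists>v::complex^'n. v \<noteq> 0 \<and> (\<forall>i. i \<notin> J \<longrightarrow> v $ i = 0) \<and>
        (\<forall>i\<in>J. (\<Sum>j\<in>J. of_real (A $ i $ j) * v $ j) = \<mu> * v $ i))"

subsection \<open>Differential equations\<close>

definition orbit_on ::
  "('a::real_normed_vector \<Rightarrow> 'a) \<Rightarrow> 'a set \<Rightarrow> real set \<Rightarrow> (real \<Rightarrow> 'a) \<Rightarrow> bool" where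
  "orbit_on f \<Omega> T Y \<longleftrightarrow>
     (\<forall>\<tau>\<in>T. Y \<tau> \<in> \<Omega> \<and> (Y has_vector_derivative f (Y \<tau>)) (at \<tau> within T))"

definition locally_invariant ::
  "('a::real_normed_vector \<Rightarrow> 'a) \<Rightarrow> 'a set \<Rightarrow> 'a set \<Rightarrow> bool" where
  "locally_invariant f \<Omega> S \<longleftrightarrow>
     (\<forall>T Y. open T \<and> is_interval T \<and> 0 \<in> T \<and> orbit_on f \<Omega> T Y \<and> Y 0 \<in> S \<longrightarrow>
        (\<forall>\<^sub>F \<tau> in nhds 0. Y \<tau> \<in> S))"

text \<open>The vector field \<open>F\<close> on \<open>D\<close> written in the coordinates \<open>X = \<Theta> U\<close>; meaningful for
  \<open>X \<in> \<Theta> ` D\<close>.\<close>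

definition coord_field ::
  "('a::euclidean_space \<Rightarrow> 'a) \<Rightarrow> 'a set \<Rightarrow> ('a \<Rightarrow> 'a) \<Rightarrow> 'a \<Rightarrow> 'a" where
  "coord_field \<Theta> D F X =
     frechet_derivative \<Theta> (at (inv_into D \<Theta> X)) (F (inv_into D \<Theta> X))"

text \<open>The cut-off is applied to a field \<open>G\<close> by passing to \<open>\<phi> U *\<^sub>R G U\<close>, in the original
  variable \<open>U\<close>. Where \<open>\<phi> > 0\<close> this only changes the speed along the orbits, and it does not change
  the linearization at the origin; so conditions on the equation that are fixed before \<open>\<delta>\<close> can be
  stated with \<open>G\<close>.\<close>

definition cut_off :: "real \<Rightarrow> ('a::euclidean_space \<Rightarrow> real) \<Rightarrow> bool" where
  "cut_off \<delta> \<phi> \<longleftrightarrow>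
     (\<forall>k. Ck_on k \<phi> UNIV) \<and> (\<forall>U. 0 \<le> \<phi> U \<and> \<phi> U \<le> 1) \<and>
     (\<forall>U. norm U \<le> \<delta> \<longrightarrow> \<phi> U = 1) \<and> (\<forall>U. norm U \<ge> 2 * \<delta> \<longrightarrow> \<phi> U = 0)"

text \<open>The passage to the coordinates \<open>(X\<^sup>-, \<zeta>, u\<^sub>0)\<close>, indexed by \<open>Jm\<close>, \<open>Jz\<close>, \<open>Ju\<close>, in two steps.
  The diffeomorphism \<open>\<Phi>\<close>, as regular as the equation, leads to \<open>(X\<^sup>-, X\<^sup>0)\<close>. The second one,
  \<open>\<Psi>\<close>, only changes the coordinates in the factor of \<open>X\<^sup>0\<close>; it straightens the manifold
  \<open>Z\<^sub>0\<close>, which is merely \<open>C\<^sup>1\<close>, so \<open>\<Psi>\<close> is merely \<open>C\<^sup>1\<close>, too.\<close>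

definition coordinate_change ::
  "real \<Rightarrow> 'n::finite set \<Rightarrow> 'n set \<Rightarrow> 'n set \<Rightarrow>
   (real^'n \<Rightarrow> real^'n) \<Rightarrow> (real^'n \<Rightarrow> real^'n) \<Rightarrow> bool" where
  "coordinate_change r Jm Jz Ju \<Phi> \<Psi> \<longleftrightarrow>
     Jm \<inter> Jz = {} \<and> Jm \<inter> Ju = {} \<and> Jz \<inter> Ju = {} \<and> Jm \<union> Jz \<union> Ju = UNIV \<and>
     \<Phi> 0 = 0 \<and> Ck_diffeo 2 \<Phi> (ball 0 r) (\<Phi> ` ball 0 r) \<and>
     \<Psi> 0 = 0 \<and> Ck_diffeo 1 \<Psi> (\<Phi> ` ball 0 r) (\<Psi> ` \<Phi> ` ball 0 r) \<and>
     (\<forall>X\<in>\<Phi> ` ball 0 r. block Jm (\<Psi> X) = block Jm X) \<and>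
     (\<forall>X\<in>\<Phi> ` ball 0 r. \<forall>X'\<in>\<Phi> ` ball 0 r.
        block (Jz \<union> Ju) X = block (Jz \<union> Ju) X' \<longrightarrow>
        block (Jz \<union> Ju) (\<Psi> X) = block (Jz \<union> Ju) (\<Psi> X'))"

text \<open>The form \<open>dX\<^sup>-/d\<tau> = A\<^sup>-(X) X\<^sup>-\<close>, \<open>dX\<^sup>0/d\<tau> = A\<^sup>0(X) X\<^sup>0\<close> of the equation with field \<open>f\<close>,
  together with the spectral conditions at the origin. Thus \<open>{X\<^sup>- = 0}\<close> is a center manifold and
  \<open>{X\<^sup>0 = 0}\<close> is the stable manifold. Only the blocks \<open>Jm \<times> Jm\<close> of \<open>Am\<close> and \<open>Jc \<times> Jc\<close> of \<open>Ac\<close>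
  matter.\<close>

definition split_form ::
  "'n::finite set \<Rightarrow> 'n set \<Rightarrow> (real^'n) set \<Rightarrow> (real^'n \<Rightarrow> real^'n) \<Rightarrow>
   (real^'n \<Rightarrow> real^'n^'n) \<Rightarrow> (real^'n \<Rightarrow> real^'n^'n) \<Rightarrow> bool" where
  "split_form Jm Jc \<Omega> f Am Ac \<longleftrightarrow>
     continuous_on \<Omega> Am \<and> continuous_on \<Omega> Ac \<and>
     (\<forall>X\<in>\<Omega>. block Jm (f X) = block Jm (Am X *v block Jm X)) \<and>
     (\<forall>X\<in>\<Omega>. block Jc (f X) = block Jc (Ac X *v block Jc X)) \<and>
     (\<forall>\<mu>. block_eigenvalue Jm (Am 0) \<mu> \<longrightarrow> Re \<mu> < 0) \<and>
     (\<forall>\<mu>. block_eigenvalue Jc (Ac 0) \<mu> \<longrightarrow> Re \<mu> = 0)"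

definition stable_manifold :: "'n set \<Rightarrow> (real^'n) set \<Rightarrow> (real^'n) set" where
  "stable_manifold Jc \<Omega> = {X \<in> \<Omega>. block Jc X = 0}"

definition center_manifold :: "'n set \<Rightarrow> (real^'n) set \<Rightarrow> (real^'n) set" where
  "center_manifold Jm \<Omega> = {X \<in> \<Omega>. block Jm X = 0}"

text \<open>\<open>Y = Y\<^sup>0 + Y\<^sup>- + Y\<^sup>p\<close>. The perturbation is estimated forward in time. The curve \<open>Y\<^sup>-\<close> lies on
  the stable manifold but need not be an orbit: the \<open>X\<^sup>-\<close> equation depends on \<open>X\<^sup>0\<close>.\<close>

definition decomposes ::
  "'n::finite set \<Rightarrow> 'n set \<Rightarrow> (real^'n) set \<Rightarrow> (real^'n \<Rightarrow> real^'n) \<Rightarrow> (real^'n) set \<Rightarrow>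
   real \<Rightarrow> real \<Rightarrow> real set \<Rightarrow> (real \<Rightarrow> real^'n) \<Rightarrow> bool" where
  "decomposes Jz Jc \<Omega> f S0 C c T Y \<longleftrightarrow>
     (\<exists>Y0 Ym Yp. (\<forall>\<tau>\<in>T. Y \<tau> = Y0 \<tau> + Ym \<tau> + Yp \<tau>) \<and>
        orbit_on f \<Omega> T Y0 \<and> (\<forall>\<tau>\<in>T. Y0 \<tau> \<in> S0) \<and>
        continuous_on T Ym \<and> (\<forall>\<tau>\<in>T. Ym \<tau> \<in> stable_manifold Jc \<Omega>) \<and>
        (\<forall>\<tau>\<in>T. 0 \<le> \<tau> \<longrightarrow>
           norm (Yp \<tau>) \<le> C * norm (block Jz (Y0 0)) * norm (Ym 0) * exp (- c * \<tau> / 4)))"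

end

theory Submission
  imports Defs "HOL-Computational_Algebra.Fundamental_Theorem_Algebra"
begin

text \<open>In the \<open>C\<^sup>2\<close> coordinates given by \<open>\<Phi>\<close> the equation is extended from a small fixed ball to the
  whole space so that the center directions still grow at a small rate and \<open>X\<^sup>-\<close> still decays at a
  rate close to \<open>c\<close>. By the gap between these rates the pull-backs of \<open>P \<circ> flow\<^sub>n\<close> along the flow on the center
  manifold converge, in \<open>C\<^sup>1\<close>, to the asymptotic phase \<open>\<pi>\<close>, a \<open>C\<^sup>1\<close> retraction onto the center manifold
  which commutes with the flow. The manifold is \<open>\<pi>\<^sup>-\<^sup>1(S\<^sub>0)\<close>: since \<open>\<pi>\<close> has derivative \<open>P\<close> at the
  origin, it is a graph over \<open>S\<^sup>0 \<times> V\<^sup>-\<close>, and it inherits invariance from \<open>S\<^sub>0\<close>. The fibres of \<open>\<pi>\<close> over the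
  equilibria with \<open>\<zeta> = 0\<close> are straight, so \<open>\<pi> - P\<close> is bounded by the product of \<open>|X\<^sup>-|\<close> and the distance
  to these equilibria; along an orbit the second factor grows slower than the first one decays.
  Finally \<open>\<pi>\<close> of an orbit solves the equation without cut-off, and a reparametrization of time, which
  changes it only by an exponentially small amount, turns it into an orbit of the cut-off field.\<close>

subsection \<open>Quadratic forms adapted to the spectrum of a matrix\<close>

text \<open>The obstacle is regularity. In the coordinates of the theorem the field is merely
  continuous, because \<open>\<Psi>\<close> is \<open>C\<^sup>1\<close>; in those of
  \<open>\<Phi>\<close> it contains the derivative of \<open>\<Phi>\<close> and so loses one degree.
  Its flow is better than the field, being conjugate by \<open>\<Phi>\<close> to the flow of the
  \<open>C\<^sup>2\<close> field \<open>G\<close>. Hence the field enters through Lipschitz and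
  difference estimates alone, and smoothness is taken from the flow. The extension must respect this
  conjugacy: field and change of coordinates are extended separately, and the one is pushed forward
  by the other.

  Growth is measured in quadratic forms adapted to the spectrum; their distortion against the norm
  is absorbed into the rates by looking at the flow after a long time \<open>T\<close>. The
  derivatives of the increments of the phase are obtained by interpolation between a size
  \<open>(\<mu> * \<beta>) ^ n\<close> and a Lipschitz constant of order
  \<open>\<mu> ^ (4 * n)\<close>; the numbers 17 and 35 in the gap conditions come from
  there.\<close>

locale complex_operator =
  fixes A :: "complex^'n \<Rightarrow> complex^'n"
  assumes add: "A (u + v) = A u + A v"
    and scale: "A (c *s v) = c *s A v"
begin

lemma zero: "A 0 = 0"
  using scale[of 0 0] by simp

lemma diff: "A (u - v) = A u - A v"
  by (metis add add_diff_cancel_right' diff_add_cancel)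

text \<open>This is \<open>p(A) v\<close>, evaluated by Horner's scheme. With \<open>v\<close> fixed
  it is a map from polynomials to vectors, so that no algebra of operators is needed to speak of
  polynomials in \<open>A\<close>.\<close>

definition polyop :: "complex^'n \<Rightarrow> complex poly \<Rightarrow> complex^'n" where
  "polyop v p = fold_coeffs (\<lambda>a w. a *s v + A w) p 0"

lemma polyop_0 [simp]: "polyop v 0 = 0"
  by (simp add: polyop_def)

lemma polyop_pCons [simp]: "polyop v (pCons a p) = a *s v + A (polyop v p)"
proof (cases "p = 0")
  case True
  then show ?thesis
    by (cases "a = 0") (auto simp: zero polyop_def)
next
  case False
  then show ?thesis
    unfolding polyop_def by (subst fold_coeffs_pCons_not_0_0_eq) auto
qed

lemma polyop_add: "polyop v (p + q) = polyop v p + polyop v q"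
  by (induction p q rule: poly_induct2) (auto simp: add zero vector_sadd_rdistrib)

lemma polyop_smult: "polyop v (smult c p) = c *s polyop v p"
  by (induction p) (auto simp: scale vector_add_ldistrib vector_smult_assoc zero)

lemma polyop_monom: "polyop v (monom c n) = c *s (A ^^ n) v"
  by (induction n) (auto simp: monom_0 monom_Suc scale zero)

lemma polyop_sum: "polyop v (sum f S) = (\<Sum>i\<in>S. polyop v (f i))"
  by (induction S rule: infinite_finite_induct) (auto simp: polyop_add)

lemma polyop_linear_factor: "polyop v ([:- z, 1:] * q) = A (polyop v q) - z *s polyop v q"
proof -
  have "[:- z, 1:] * q = smult (- z) q + pCons 0 q"
    by simp
  then show ?thesis
    by (simp only: polyop_add polyop_smult polyop_pCons) (simp add: vec_eq_iff)
qed

lemma polyop_mem: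
  assumes "v \<in> W" and "0 \<in> W" and "\<And>u w. u \<in> W \<Longrightarrow> w \<in> W \<Longrightarrow> u + w \<in> W"
    and "\<And>c w. w \<in> W \<Longrightarrow> c *s w \<in> W" and "\<And>w. w \<in> W \<Longrightarrow> A w \<in> W"
  shows "polyop v p \<in> W"
  by (induction p) (auto simp: assms)

text \<open>By finite dimension the powers \<open>(A ^^ i) v\<close> are linearly dependent, already
  over the reals. A repetition among them is a case of its own, because dependence is a property of
  the set of these vectors and does not see it.\<close>

lemma annihilating_polynomial: "\<exists>p. p \<noteq> 0 \<and> polyop v p = 0"
proof (cases "inj_on (\<lambda>i. (A ^^ i) v) {..DIM(complex^'n)}")
  case True
  let ?S = "(\<lambda>i. (A ^^ i) v) ` {..DIM(complex^'n)}"
  have "card ?S > DIM(complex^'n)"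
    using card_image[OF True] by simp
  then have "dependent ?S"
    using dependent_biggerset by blast
  then obtain u w0 where u: "(\<Sum>w\<in>?S. u w *\<^sub>R w) = 0" and w0: "w0 \<in> ?S" "u w0 \<noteq> 0"
    using dependent_finite[of ?S] by auto
  then obtain i0 where i0: "i0 \<le> DIM(complex^'n)" "u ((A ^^ i0) v) \<noteq> 0"
    by auto
  define p where "p = (\<Sum>i\<le>DIM(complex^'n). monom (of_real (u ((A ^^ i) v)) :: complex) i)"
  have "coeff p i0 = of_real (u ((A ^^ i0) v))"
    using i0 by (simp add: p_def coeff_sum sum.delta if_distrib cong: if_cong)
  then have "p \<noteq> 0" using i0 by auto
  moreover have "polyop v p = (\<Sum>i\<le>DIM(complex^'n). u ((A ^^ i) v) *\<^sub>R (A ^^ i) v)"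
    unfolding p_def polyop_sum polyop_monom
    by (intro sum.cong) (auto simp: vec_eq_iff scaleR_conv_of_real[symmetric])
  moreover have "\<dots> = 0"
    using u[unfolded sum.reindex[OF True] comp_def] .
  ultimately show ?thesis by auto
next
  case False
  then obtain i j where ij: "i \<noteq> j" "(A ^^ i) v = (A ^^ j) v"
    by (auto simp: inj_on_def)
  have "coeff (monom 1 i + monom (- 1) j :: complex poly) i = 1"
    using ij by simp
  then have "monom 1 i + monom (- 1) j \<noteq> (0 :: complex poly)"
    by (metis coeff_0 zero_neq_one)
  moreover have "polyop v (monom 1 i + monom (- 1) j) = 0"
    using ij by (simp add: polyop_add polyop_monom)
  ultimately show ?thesis by blast
qed

definition eigen_on :: "(complex^'n) set \<Rightarrow> complex \<Rightarrow> bool" where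
  "eigen_on W z \<longleftrightarrow> (\<exists>u\<in>W. u \<noteq> 0 \<and> A u = z *s u)"

definition invariant :: "(complex^'n) set \<Rightarrow> bool" where
  "invariant W \<longleftrightarrow> 0 \<in> W \<and> (\<forall>u\<in>W. \<forall>w\<in>W. u + w \<in> W) \<and> (\<forall>c. \<forall>w\<in>W. c *s w \<in> W) \<and>
     (\<forall>w\<in>W. A w \<in> W)"

text \<open>Split a root \<open>z\<close> off an annihilating polynomial of least degree. By
  minimality the cofactor \<open>q\<close> does not annihilate \<open>v\<close>, and
  \<open>A - z\<close> kills \<open>polyop v q\<close>.\<close>

lemma eigen_exists:
  assumes W: "invariant W" and v: "v \<in> W" "v \<noteq> 0"
  shows "\<exists>z. eigen_on W z"
proof -
  obtain p0 where p0: "p0 \<noteq> 0 \<and> polyop v p0 = 0"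
    using annihilating_polynomial by auto
  obtain p where p: "p \<noteq> 0 \<and> polyop v p = 0"
    and min': "\<forall>q. q \<noteq> 0 \<and> polyop v q = 0 \<longrightarrow> degree p \<le> degree q"
    using ex_has_least_nat[of "\<lambda>p. p \<noteq> 0 \<and> polyop v p = 0" p0 degree, OF p0] by auto
  have min: "degree p \<le> degree q" if "q \<noteq> 0" "polyop v q = 0" for q
    using min' that by simp
  have "\<not> constant (poly p)"
  proof
    assume "constant (poly p)"
    then have "degree p = 0"
      by (simp add: constant_degree)
    then obtain a where "p = [:a:]"
      by (auto intro: degree_eq_zeroE)
    then show False
      using p v by (auto simp: zero)
  qed
  then obtain z where "poly p z = 0"
    using fundamental_theorem_of_algebra by blast
  then obtain q where q: "p = [:- z, 1:] * q"
    by (metis dvdE poly_eq_0_iff_dvd)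
  have q0: "q \<noteq> 0" using q p by auto
  have "degree p = Suc (degree q)"
    unfolding q using q0 by (subst degree_mult_eq) auto
  then have "polyop v q \<noteq> 0"
    using min[OF q0] by auto
  moreover have "A (polyop v q) = z *s polyop v q"
    using p unfolding q polyop_linear_factor by simp
  moreover have "polyop v q \<in> W"
    using W v by (intro polyop_mem) (auto simp: invariant_def)
  ultimately show ?thesis
    unfolding eigen_on_def by blast
qed

definition shift :: "complex \<Rightarrow> complex^'n \<Rightarrow> complex^'n" where
  "shift z w = A w - z *s w"

lemma shift_add: "shift z (u + w) = shift z u + shift z w"
  by (simp add: shift_def add vec_eq_iff algebra_simps)

lemma shift_scale: "shift z (c *s w) = c *s shift z w"
  by (simp add: shift_def scale vec_eq_iff algebra_simps)

lemma shift_commute: "shift z (A w) = A (shift z w)"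
  by (simp add: shift_def diff scale)

lemma scaleR_eq_scale: "r *\<^sub>R (w :: complex^'n) = of_real r *s w"
  by (simp add: vec_eq_iff scaleR_conv_of_real[symmetric])

lemma shift_linear: "linear (shift z)"
  by (rule linearI) (auto simp: shift_add scaleR_eq_scale shift_scale)

lemma invariant_subspace: "invariant W \<Longrightarrow> subspace W"
  by (auto simp: invariant_def subspace_def scaleR_eq_scale)

text \<open>A substitute for triangularization. If \<open>z\<close> is an eigenvalue on
  \<open>W\<close>, then \<open>A - z\<close> kills an eigenvector and maps \<open>W\<close> onto an
  invariant subspace of smaller dimension; the induction continues on this image, whose eigenvalues
  are eigenvalues on \<open>W\<close> too.\<close>

lemma annihilating_list:
  assumes "invariant W"
  shows "\<exists>zs. (\<forall>z\<in>set zs. eigen_on W z) \<and> (\<forall>w\<in>W. fold shift zs w = 0)"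
  using assms
proof (induction "dim W" arbitrary: W rule: less_induct)
  case less
  show ?case
  proof (cases "W \<subseteq> {0}")
    case True
    then show ?thesis by (intro exI[of _ "[]"]) auto
  next
    case False
    then obtain z where z: "eigen_on W z"
      using eigen_exists less.prems by blast
    then obtain u where u: "u \<in> W" "u \<noteq> 0" "shift z u = 0"
      by (auto simp: eigen_on_def shift_def)
    have sub: "shift z ` W \<subseteq> W"
    proof -
      have "A w + (- z) *s w \<in> W" if "w \<in> W" for w
        using less.prems that unfolding invariant_def by blast
      then show ?thesis by (auto simp: shift_def)
    qed
    have inv: "invariant (shift z ` W)"
      unfolding invariant_def
    proof (intro conjI ballI allI)
      show "0 \<in> shift z ` W" using u by force
      fix a assume a: "a \<in> shift z ` W"
      then obtain a' where a': "a' \<in> W" "a = shift z a'" by auto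
      show "c *s a \<in> shift z ` W" for c
        using a' less.prems unfolding invariant_def by (auto simp: shift_scale[symmetric])
      show "A a \<in> shift z ` W"
        using a' less.prems unfolding invariant_def by (auto simp: shift_commute[symmetric])
      fix b assume "b \<in> shift z ` W"
      then obtain b' where b': "b' \<in> W" "b = shift z b'" by auto
      show "a + b \<in> shift z ` W"
        using a' b' less.prems unfolding invariant_def by (auto simp: shift_add[symmetric])
    qed
    \<comment> \<open>In a basis through the eigenvector \<open>u\<close> the drop of the dimension
      is visible: the image of \<open>W\<close> is spanned by the images of the other basis
      vectors.\<close>
    obtain B where B: "{u} \<subseteq> B" "B \<subseteq> W" "independent B" "W \<subseteq> span B"
      using maximal_independent_subset_extend[of "{u}" W] u by (auto simp: dependent_single)
    have spB: "span B = W"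
      using B span_minimal[OF B(2) invariant_subspace[OF less.prems]] by auto
    have fB: "finite B"
      using B(3) independent_imp_finite by blast
    have dW: "dim W = card B"
      using B(3) spB dim_eq_card_independent dim_span by metis
    have "shift z ` W = span (shift z ` B)"
      using spB linear_span_image[OF shift_linear] by metis
    also have "\<dots> = span (shift z ` (B - {u}))"
    proof -
      have "shift z ` B = insert 0 (shift z ` (B - {u}))"
        using B(1) u(3) by force
      then show ?thesis by (simp add: span_insert_0)
    qed
    finally have "dim (shift z ` W) \<le> card (shift z ` (B - {u}))"
      using fB by (simp add: dim_le_card')
    also have "\<dots> \<le> card (B - {u})"
      using fB by (intro card_image_le) auto
    also have "\<dots> < card B"
      using fB B(1) by (intro psubset_card_mono) auto
    finally have "dim (shift z ` W) < dim W"
      using dW by simp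
    from less.hyps[OF this inv] obtain zs where
      zs: "\<forall>y\<in>set zs. eigen_on (shift z ` W) y" "\<forall>w\<in>shift z ` W. fold shift zs w = 0"
      by blast
    show ?thesis
    proof (intro exI conjI ballI)
      fix y assume "y \<in> set (z # zs)"
      then show "eigen_on W y"
      proof (cases "y = z")
        case False
        then have "eigen_on (shift z ` W) y"
          using \<open>y \<in> set (z # zs)\<close> zs(1) by simp
        then show ?thesis
          using sub unfolding eigen_on_def by blast
      qed (use z in simp)
    next
      fix w assume "w \<in> W"
      then show "fold shift (z # zs) w = 0"
        using zs by auto
    qed
  qed
qed

text \<open>The sum over \<open>j\<close> of \<open>K ^ (2 * j)\<close> times the inner product of
  \<open>u\<^sub>j\<close> and \<open>w\<^sub>j\<close>, where \<open>u\<^sub>0 = u\<close> and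
  \<open>u\<^sub>j\<^sub>+\<^sub>1 = (A - z\<^sub>j) u\<^sub>j\<close>. For an annihilating list
  nothing is lost at its end, since the next iterate vanishes.\<close>

primrec form :: "real \<Rightarrow> complex list \<Rightarrow> complex^'n \<Rightarrow> complex^'n \<Rightarrow> real" where
  "form K [] u w = 0"
| "form K (z # zs) u w = u \<bullet> w + K\<^sup>2 * form K zs (shift z u) (shift z w)"

lemma form_commute: "form K zs u w = form K zs w u"
  by (induction zs arbitrary: u w) (auto simp: inner_commute)

lemma form_add: "form K zs (u + v) w = form K zs u w + form K zs v w"
  by (induction zs arbitrary: u v w) (auto simp: inner_add_left shift_add algebra_simps)

lemma shift_scaleR: "shift z (r *\<^sub>R w) = r *\<^sub>R shift z w"
  by (simp add: scaleR_eq_scale shift_scale)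

lemma form_scaleR: "form K zs (r *\<^sub>R u) w = r * form K zs u w"
  by (induction zs arbitrary: u w) (auto simp: shift_scaleR algebra_simps)

lemma form_pos: "0 \<le> form K zs w w"
  by (induction zs arbitrary: w) auto

text \<open>The first summand is the squared norm itself. The form of the empty list is zero, but
  there the hypothesis reads \<open>w = 0\<close>.\<close>

lemma form_ge:
  assumes "fold shift zs w = 0"
  shows "(norm w)\<^sup>2 \<le> form K zs w w"
  using assms form_pos by (cases zs) (auto simp: power2_norm_eq_inner)

text \<open>For the real inner product the imaginary part of \<open>z\<close> acts as a rotation,
  which turns \<open>w\<close> into an orthogonal vector. This is why only real parts of eigenvalues
  enter the rates.\<close>

lemma inner_scale: "(z *s w) \<bullet> w = Re z * (norm w)\<^sup>2" for w :: "complex^'n"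
proof -
  have "(z * x) \<bullet> x = Re z * (x \<bullet> x)" for x :: complex
    by (simp add: inner_complex_def algebra_simps)
  then show ?thesis
    by (simp add: power2_norm_eq_inner inner_vec_def sum_distrib_left)
qed

lemma inner_shift_bound:
  fixes u w :: "complex^'n"
  assumes "K > 0"
  shows "\<bar>u \<bullet> w\<bar> \<le> 1 / (2 * K) * ((norm w)\<^sup>2 + K\<^sup>2 * (norm u)\<^sup>2)"
proof -
  have "\<bar>u \<bullet> w\<bar> \<le> norm u * norm w"
    by (rule Cauchy_Schwarz_ineq2)
  then have "K * \<bar>u \<bullet> w\<bar> \<le> K * (norm u * norm w)"
    using assms by (intro mult_left_mono) auto
  moreover have "0 \<le> (norm w - K * norm u)\<^sup>2"
    by simp
  then have "2 * (K * (norm u * norm w)) \<le> (norm w)\<^sup>2 + K\<^sup>2 * (norm u)\<^sup>2"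
    by (simp add: power2_eq_square algebra_simps)
  ultimately have "2 * (K * \<bar>u \<bullet> w\<bar>) \<le> (norm w)\<^sup>2 + K\<^sup>2 * (norm u)\<^sup>2"
    by linarith
  then show ?thesis
    using assms by (simp add: field_simps)
qed

text \<open>Along \<open>w' = A w\<close> the iterates \<open>w\<^sub>j\<close> satisfy \<open>w\<^sub>j' = z\<^sub>j w\<^sub>j + w\<^sub>j\<^sub>+\<^sub>1\<close>; the weights
  \<open>K\<^sup>2\<^sup>j\<close> make the coupling terms of size \<open>1/K\<close>.\<close>

lemma form_upper:
  assumes "K > 0" and "\<And>z. z \<in> set zs \<Longrightarrow> Re z \<le> hi" and "fold shift zs w = 0"
  shows "form K zs (A w) w \<le> (hi + 1 / K) * form K zs w w - 1 / (2 * K) * (norm w)\<^sup>2"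
  using assms(2,3)
proof (induction zs arbitrary: w)
  case Nil
  then show ?case by simp
next
  case (Cons z zs)
  let ?u = "shift z w"
  have Aw: "A w = z *s w + ?u"
    by (simp add: shift_def)
  have "A w \<bullet> w = Re z * (norm w)\<^sup>2 + ?u \<bullet> w"
    by (subst Aw) (simp add: inner_add_left inner_scale)
  moreover have "?u \<bullet> w \<le> 1 / (2 * K) * ((norm w)\<^sup>2 + K\<^sup>2 * (norm ?u)\<^sup>2)"
    using inner_shift_bound[OF assms(1), of ?u w] by linarith
  moreover have "Re z * (norm w)\<^sup>2 \<le> hi * (norm w)\<^sup>2"
    using Cons.prems(1) by (intro mult_right_mono) auto
  \<comment> \<open>The surplus \<open>- 1 / (2 * K) * (norm ?u)\<^sup>2\<close> of the induction
    hypothesis, weighted by \<open>K\<^sup>2\<close>, cancels the part of the coupling term that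
    contains \<open>?u\<close>. The part containing \<open>w\<close> takes one half of
    \<open>1 / K * (norm w)\<^sup>2\<close>; the other half is the new surplus.\<close>
  moreover have "K\<^sup>2 * form K zs (A ?u) ?u
      \<le> K\<^sup>2 * ((hi + 1 / K) * form K zs ?u ?u - 1 / (2 * K) * (norm ?u)\<^sup>2)"
    using Cons by (intro mult_left_mono) auto
  moreover have "1 / K * (norm w)\<^sup>2 = 1 / (2 * K) * (norm w)\<^sup>2 + 1 / (2 * K) * (norm w)\<^sup>2"
    using assms(1) by (simp add: field_simps)
  ultimately show ?case
    by (simp add: shift_commute power2_norm_eq_inner algebra_simps)
qed

lemma form_lower:
  assumes "K > 0" and "\<And>z. z \<in> set zs \<Longrightarrow> lo \<le> Re z" and "fold shift zs w = 0"
  shows "form K zs (A w) w \<ge> (lo - 1 / K) * form K zs w w + 1 / (2 * K) * (norm w)\<^sup>2"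
  using assms(2,3)
proof (induction zs arbitrary: w)
  case Nil
  then show ?case by simp
next
  case (Cons z zs)
  let ?u = "shift z w"
  have Aw: "A w = z *s w + ?u"
    by (simp add: shift_def)
  have "A w \<bullet> w = Re z * (norm w)\<^sup>2 + ?u \<bullet> w"
    by (subst Aw) (simp add: inner_add_left inner_scale)
  moreover have "?u \<bullet> w \<ge> - (1 / (2 * K) * ((norm w)\<^sup>2 + K\<^sup>2 * (norm ?u)\<^sup>2))"
    using inner_shift_bound[OF assms(1), of ?u w] by linarith
  moreover have "Re z * (norm w)\<^sup>2 \<ge> lo * (norm w)\<^sup>2"
    using Cons.prems(1) by (intro mult_right_mono) auto
  moreover have "K\<^sup>2 * form K zs (A ?u) ?u
      \<ge> K\<^sup>2 * ((lo - 1 / K) * form K zs ?u ?u + 1 / (2 * K) * (norm ?u)\<^sup>2)"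
    using Cons by (intro mult_left_mono) auto
  moreover have "1 / K * (norm w)\<^sup>2 = 1 / (2 * K) * (norm w)\<^sup>2 + 1 / (2 * K) * (norm w)\<^sup>2"
    using assms(1) by (simp add: field_simps)
  ultimately show ?case
    by (simp add: shift_commute power2_norm_eq_inner algebra_simps)
qed

end

lemma block_fix_nth:
  assumes "block J x = x" and "i \<notin> J"
  shows "x $ i = 0"
  using arg_cong[OF assms(1), of "\<lambda>v. v $ i"] assms(2) by (simp add: block_def)

text \<open>The Euclidean norm may grow for a while even under a stable matrix. The weighted form of
  the complexified block, restricted to real vectors, is governed at once by the real parts of the
  eigenvalues, up to \<open>e\<close>. It depends on the list of eigenvalues and not on
  \<open>hi\<close> or \<open>lo\<close>, so one form serves both bounds.\<close>

lemma adapted_form: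
  fixes A :: "real^'n^'n"
  assumes "e > 0"
  shows "\<exists>B :: real^'n \<Rightarrow> real^'n \<Rightarrow> real. bounded_bilinear B \<and> (\<forall>u v. B u v = B v u) \<and>
    (\<forall>u. 0 \<le> B u u) \<and> (\<forall>x. block J x = x \<longrightarrow> (norm x)\<^sup>2 \<le> B x x) \<and>
    (\<forall>hi. (\<forall>\<mu>. block_eigenvalue J A \<mu> \<longrightarrow> Re \<mu> \<le> hi) \<longrightarrow>
       (\<forall>x. block J x = x \<longrightarrow> B (block J (A *v x)) x \<le> (hi + e) * B x x)) \<and>
    (\<forall>lo. (\<forall>\<mu>. block_eigenvalue J A \<mu> \<longrightarrow> lo \<le> Re \<mu>) \<longrightarrow>
       (\<forall>x. block J x = x \<longrightarrow> B (block J (A *v x)) x \<ge> (lo - e) * B x x))"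
proof -
  define AC :: "complex^'n \<Rightarrow> complex^'n" where
    "AC v = (\<chi> i. if i \<in> J then \<Sum>j\<in>J. of_real (A $ i $ j) * v $ j else 0)" for v
  define cx :: "real^'n \<Rightarrow> complex^'n" where "cx x = (\<chi> i. of_real (x $ i))" for x
  interpret complex_operator AC
    by unfold_locales
      (auto simp: AC_def vec_eq_iff algebra_simps sum.distrib sum_distrib_left)
  define W where "W = {v :: complex^'n. \<forall>i. i \<notin> J \<longrightarrow> v $ i = 0}"
  have "invariant W"
    by (auto simp: invariant_def W_def AC_def)
  then obtain zs where zs: "\<And>z. z \<in> set zs \<Longrightarrow> eigen_on W z" "\<And>w. w \<in> W \<Longrightarrow> fold shift zs w = 0"
    using annihilating_list by blast
  have ev: "block_eigenvalue J A z" if "z \<in> set zs" for z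
  proof -
    obtain u where u: "u \<in> W" "u \<noteq> 0" "AC u = z *s u"
      using zs(1) \<open>z \<in> set zs\<close> by (auto simp: eigen_on_def)
    have "(\<Sum>j\<in>J. of_real (A $ i $ j) * u $ j) = z * u $ i" if "i \<in> J" for i
      using that arg_cong[OF u(3), of "\<lambda>v. v $ i"] by (simp add: AC_def)
    then show ?thesis
      unfolding block_eigenvalue_def using u by (intro exI[of _ u]) (auto simp: W_def)
  qed
  define K where "K = 1 / e"
  have K: "K > 0" "1 / K = e" using assms by (auto simp: K_def)
  define B where "B u v = form K zs (cx u) (cx v)" for u v
  have cxW: "cx x \<in> W" if "block J x = x" for x
    using block_fix_nth[OF that] by (auto simp: W_def cx_def)
  have cxA: "cx (block J (A *v x)) = AC (cx x)" if "block J x = x" for x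
  proof -
    have x0: "x $ j = 0" if "j \<notin> J" for j
      using block_fix_nth[OF \<open>block J x = x\<close> that] .
    have "(\<Sum>j\<in>UNIV. A $ i $ j * x $ j) = (\<Sum>j\<in>J. A $ i $ j * x $ j)" for i
      by (rule sum.mono_neutral_right) (auto simp: x0)
    then show ?thesis
      by (auto simp: vec_eq_iff cx_def AC_def block_def matrix_vector_mult_def)
  qed
  have ncx: "norm (cx x) = norm x" for x
    by (simp add: cx_def norm_vec_def)
  have cxadd: "cx (x + y) = cx x + cx y" "cx (r *\<^sub>R x) = r *\<^sub>R cx x" for x y r
    by (simp_all add: cx_def vec_eq_iff) (simp add: scaleR_conv_of_real)
  have comm: "B u v = B v u" for u v
    unfolding B_def by (rule form_commute)
  have lin: "linear (\<lambda>u. B u v)" for v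
    by (rule linearI) (auto simp: B_def cxadd form_add form_scaleR)
  have lin2: "linear (B v)" for v
  proof -
    have eq: "B v = (\<lambda>u. B u v)"
      by (intro ext comm)
    show ?thesis
      by (subst eq) (rule lin)
  qed
  have "bilinear B"
    unfolding bilinear_def using lin lin2 by blast
  then have f1: "bounded_bilinear B"
    using bilinear_conv_bounded_bilinear by blast
  have f2: "0 \<le> B u u" for u
    unfolding B_def by (rule form_pos)
  have f3: "(norm x)\<^sup>2 \<le> B x x" if "block J x = x" for x
  proof -
    have "fold shift zs (cx x) = 0"
      using zs(2) cxW[OF that] by blast
    from form_ge[OF this, of K] show ?thesis
      unfolding B_def ncx .
  qed
  have f4: "B (block J (A *v x)) x \<le> (hi + e) * B x x"
    if "\<forall>\<mu>. block_eigenvalue J A \<mu> \<longrightarrow> Re \<mu> \<le> hi" "block J x = x" for hi x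
  proof -
    have "form K zs (AC (cx x)) (cx x)
        \<le> (hi + 1 / K) * form K zs (cx x) (cx x) - 1 / (2 * K) * (norm (cx x))\<^sup>2"
      by (rule form_upper[OF K(1) _ zs(2)[OF cxW[OF that(2)]]]) (use that(1) ev in blast)
    moreover have "0 \<le> 1 / (2 * K) * (norm (cx x))\<^sup>2"
      using K by simp
    ultimately show ?thesis
      unfolding B_def cxA[OF that(2)] K(2) by linarith
  qed
  have f5: "B (block J (A *v x)) x \<ge> (lo - e) * B x x"
    if "\<forall>\<mu>. block_eigenvalue J A \<mu> \<longrightarrow> lo \<le> Re \<mu>" "block J x = x" for lo x
  proof -
    have "form K zs (AC (cx x)) (cx x)
        \<ge> (lo - 1 / K) * form K zs (cx x) (cx x) + 1 / (2 * K) * (norm (cx x))\<^sup>2"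
      by (rule form_lower[OF K(1) _ zs(2)[OF cxW[OF that(2)]]]) (use that(1) ev in blast)
    moreover have "0 \<le> 1 / (2 * K) * (norm (cx x))\<^sup>2"
      using K by simp
    ultimately show ?thesis
      unfolding B_def cxA[OF that(2)] K(2) by linarith
  qed
  show ?thesis
    by (intro exI[of _ B] conjI allI impI; (rule f1 comm f2 | erule f3 | erule (1) f4 f5))
qed

subsection \<open>Maps with Lipschitz derivative\<close>

text \<open>Derivatives and difference quotients are bounded separately because \<open>S\<close>
  need not be convex. The constants are arguments, since iterates and approximating sequences have
  to be estimated uniformly.\<close>

definition C11 ::
  "('a::real_normed_vector \<Rightarrow> 'b::real_normed_vector) \<Rightarrow> ('a \<Rightarrow> 'a \<Rightarrow> 'b) \<Rightarrow> 'a set \<Rightarrow> real \<Rightarrow> real \<Rightarrow> bool"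
  where
  "C11 f f' S L K \<longleftrightarrow> 0 \<le> L \<and> 0 \<le> K \<and>
     (\<forall>x\<in>S. (f has_derivative f' x) (at x)) \<and>
     (\<forall>x\<in>S. \<forall>h. norm (f' x h) \<le> L * norm h) \<and>
     (\<forall>x\<in>S. \<forall>y\<in>S. norm (f x - f y) \<le> L * norm (x - y)) \<and>
     (\<forall>x\<in>S. \<forall>y\<in>S. \<forall>h. norm (f' x h - f' y h) \<le> K * norm (x - y) * norm h)"

lemma C11D:
  assumes "C11 f f' S L K"
  shows "0 \<le> L" "0 \<le> K"
    "\<And>x. x \<in> S \<Longrightarrow> (f has_derivative f' x) (at x)"
    "\<And>x h. x \<in> S \<Longrightarrow> norm (f' x h) \<le> L * norm h"
    "\<And>x y. x \<in> S \<Longrightarrow> y \<in> S \<Longrightarrow> norm (f x - f y) \<le> L * norm (x - y)"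
    "\<And>x y h. x \<in> S \<Longrightarrow> y \<in> S \<Longrightarrow> norm (f' x h - f' y h) \<le> K * norm (x - y) * norm h"
  using assms unfolding C11_def by blast+

lemma C11_linear:
  assumes "C11 f f' S L K" "x \<in> S"
  shows "linear (f' x)"
  using C11D(3)[OF assms] has_derivative_linear by blast

lemma lipschitz_derivative_bound:
  assumes der: "(f has_derivative D) (at x)" and "open S" "x \<in> S" and "0 \<le> L"
    and lip: "\<And>y. y \<in> S \<Longrightarrow> norm (f y - f x) \<le> L * norm (y - x)"
  shows "norm (D h) \<le> L * norm h"
proof (rule field_le_epsilon)
  fix e :: real assume e: "e > 0"
  show "norm (D h) \<le> L * norm h + e"
  proof (cases "h = 0")
    case True
    then show ?thesis
      using der e has_derivative_bounded_linear[OF der] by (simp add: linear_simps(3))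
  next
    case False
    define e' where "e' = e / norm h"
    have e': "e' > 0" using e False by (simp add: e'_def)
    obtain d where d: "d > 0"
      "\<And>y. norm (y - x) < d \<Longrightarrow> norm (f y - f x - D (y - x)) \<le> e' * norm (y - x)"
      using der e' unfolding has_derivative_at_alt by metis
    obtain r where r: "r > 0" "ball x r \<subseteq> S"
      using assms(2,3) open_contains_ball by blast
    define t where "t = min d r / (2 * norm h)"
    have t: "t > 0" using d r False by (simp add: t_def)
    have th: "norm (t *\<^sub>R h) < d" "norm (t *\<^sub>R h) < r"
      using False d r by (auto simp: t_def min_def)
    then have "x + t *\<^sub>R h \<in> S"
      using r by (auto simp: subset_iff dist_norm)
    then have 1: "norm (f (x + t *\<^sub>R h) - f x) \<le> L * norm (t *\<^sub>R h)"
      using lip[of "x + t *\<^sub>R h"] by simp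
    have 2: "norm (f (x + t *\<^sub>R h) - f x - D (t *\<^sub>R h)) \<le> e' * norm (t *\<^sub>R h)"
      using d(2)[of "x + t *\<^sub>R h"] th by simp
    have "norm (D (t *\<^sub>R h)) \<le> L * norm (t *\<^sub>R h) + e' * norm (t *\<^sub>R h)"
      using norm_triangle_ineq4[of "f (x + t *\<^sub>R h) - f x" "f (x + t *\<^sub>R h) - f x - D (t *\<^sub>R h)"] 1 2
      by simp
    then have "t * norm (D h) \<le> t * ((L + e') * norm h)"
      using t has_derivative_bounded_linear[OF der] by (simp add: linear_simps(5) algebra_simps)
    then have "norm (D h) \<le> (L + e') * norm h"
      using t by simp
    then show ?thesis
      using False by (simp add: e'_def algebra_simps)
  qed
qed

lemma derivative_bound_lipschitz:
  assumes "convex S" "\<And>x. x \<in> S \<Longrightarrow> (f has_derivative f' x) (at x)"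
    and "\<And>x h. x \<in> S \<Longrightarrow> norm (f' x h) \<le> L * norm h" "0 \<le> L" "x \<in> S" "y \<in> S"
  shows "norm (f x - f y) \<le> L * norm (x - y)"
proof (rule differentiable_bound[OF assms(1) _ _ assms(5,6)])
  show "(f has_derivative f' z) (at z within S)" if "z \<in> S" for z
    using assms(2)[OF that] has_derivative_at_withinI by blast
  show "onorm (f' z) \<le> L" if "z \<in> S" for z
    using assms(3)[OF that] assms(4) by (intro onorm_bound) auto
qed

lemma derivative_near_linear:
  assumes "convex S" "\<And>x. x \<in> S \<Longrightarrow> (f has_derivative f' x) (at x)" and A: "bounded_linear A"
    and "\<And>x h. x \<in> S \<Longrightarrow> norm (f' x h - A h) \<le> L * norm h" "0 \<le> L" "x \<in> S" "y \<in> S"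
  shows "norm (f x - f y - A (x - y)) \<le> L * norm (x - y)"
proof -
  have "norm ((f x - A x) - (f y - A y)) \<le> L * norm (x - y)"
  proof (rule derivative_bound_lipschitz[OF assms(1) _ _ assms(5,6,7)])
    show "((\<lambda>x. f x - A x) has_derivative (\<lambda>h. f' z h - A h)) (at z)" if "z \<in> S" for z
      using assms(2)[OF that] bounded_linear_imp_has_derivative[OF A]
      by (rule has_derivative_diff)
  qed (use assms in auto)
  moreover have "(f x - A x) - (f y - A y) = f x - f y - A (x - y)"
    using A by (simp add: linear_simps)
  ultimately show ?thesis by simp
qed

lemma C11I_convex:
  assumes "convex S" "0 \<le> L" "0 \<le> K"
    and "\<And>x. x \<in> S \<Longrightarrow> (f has_derivative f' x) (at x)"
    and "\<And>x h. x \<in> S \<Longrightarrow> norm (f' x h) \<le> L * norm h"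
    and "\<And>x y h. x \<in> S \<Longrightarrow> y \<in> S \<Longrightarrow> norm (f' x h - f' y h) \<le> K * norm (x - y) * norm h"
  shows "C11 f f' S L K"
  unfolding C11_def
  using assms derivative_bound_lipschitz[OF assms(1,4,5,2)] by blast

lemma C11I_lipschitz:
  assumes "open S" "0 \<le> L" "0 \<le> K"
    and "\<And>x. x \<in> S \<Longrightarrow> (f has_derivative f' x) (at x)"
    and "\<And>x y. x \<in> S \<Longrightarrow> y \<in> S \<Longrightarrow> norm (f x - f y) \<le> L * norm (x - y)"
    and "\<And>x y h. x \<in> S \<Longrightarrow> y \<in> S \<Longrightarrow> norm (f' x h - f' y h) \<le> K * norm (x - y) * norm h"
  shows "C11 f f' S L K"
  unfolding C11_def
  using assms lipschitz_derivative_bound[OF assms(4) assms(1) _ assms(2)] by blast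

text \<open>The mean value inequality for \<open>f\<close> minus its linear part at
  \<open>x\<close>, on the points of \<open>S\<close> no farther from \<open>x\<close> than
  \<open>y\<close>. The factor 1/2 of the integral form is given up.\<close>

lemma C11_taylor:
  assumes C: "C11 f f' S L K" and "convex S" "x \<in> S" "y \<in> S"
  shows "norm (f y - f x - f' x (y - x)) \<le> K * (norm (y - x))\<^sup>2"
proof -
  define T where "T = S \<inter> cball x (norm (y - x))"
  have "norm (f y - f x - f' x (y - x)) \<le> (K * norm (y - x)) * norm (y - x)"
  proof (rule derivative_near_linear[of T])
    show "convex T" using assms(2) by (auto simp: T_def convex_Int)
    show "bounded_linear (f' x)"
      using C11D(3)[OF C \<open>x \<in> S\<close>] has_derivative_bounded_linear by blast
    show "(f has_derivative f' z) (at z)" if "z \<in> T" for z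
      using C11D(3)[OF C] that by (auto simp: T_def)
    show "norm (f' z h - f' x h) \<le> K * norm (y - x) * norm h" if "z \<in> T" for z h
    proof -
      have "norm (f' z h - f' x h) \<le> K * norm (z - x) * norm h"
        using C11D(6)[OF C] that assms(3) by (auto simp: T_def)
      also have "\<dots> \<le> K * norm (y - x) * norm h"
        using that C11D(2)[OF C]
        by (intro mult_right_mono mult_left_mono) (auto simp: T_def dist_norm norm_minus_commute)
      finally show ?thesis .
    qed
    show "0 \<le> K * norm (y - x)" using C11D(2)[OF C] by simp
    show "y \<in> T" "x \<in> T" using assms by (auto simp: T_def dist_norm norm_minus_commute)
  qed
  then show ?thesis by (simp add: power2_eq_square mult.assoc)
qed

text \<open>The difference \<open>f (x + u) - f u\<close>, as a function of \<open>u\<close>, has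
  derivative of size at most \<open>K * norm x\<close>. A second difference is thus bilinear in the
  two increments; this is the source of the product of two distances in the final estimate.\<close>

lemma C11_mixed_difference:
  assumes C: "C11 f f' UNIV L K"
  shows "norm (f (x + y) - f y - f (x + z) + f z) \<le> K * norm x * norm (y - z)"
proof -
  have "norm ((f (x + y) - f y) - (f (x + z) - f z)) \<le> (K * norm x) * norm (y - z)"
  proof (rule derivative_bound_lipschitz[of UNIV])
    fix u :: 'a
    have d1: "((\<lambda>u. x + u) has_derivative (\<lambda>h. h)) (at u)"
      by (auto intro!: derivative_eq_intros)
    have d2: "((\<lambda>u. f (x + u)) has_derivative f' (x + u)) (at u)"
      using has_derivative_compose[OF d1 C11D(3)[OF C UNIV_I]] by simp
    show "((\<lambda>u. f (x + u) - f u) has_derivative (\<lambda>h. f' (x + u) h - f' u h)) (at u)"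
      by (rule has_derivative_diff[OF d2 C11D(3)[OF C UNIV_I]])
    show "norm (f' (x + u) h - f' u h) \<le> K * norm x * norm h" for h
      using C11D(6)[OF C, of "x + u" u h] by simp
  qed (use C11D(2)[OF C] in auto)
  then show ?thesis by (simp add: algebra_simps)
qed

lemma C11_compose:
  assumes f: "C11 f f' S L K" and g: "C11 g g' T M N" and sub: "f ` S \<subseteq> T"
  shows "C11 (\<lambda>x. g (f x)) (\<lambda>x h. g' (f x) (f' x h)) S (M * L) (M * K + N * L\<^sup>2)"
proof -
  have fS: "f x \<in> T" if "x \<in> S" for x using sub that by blast
  note F = C11D[OF f] and G = C11D[OF g]
  show ?thesis
    unfolding C11_def
  proof (intro conjI ballI allI)
    show "0 \<le> M * L" "0 \<le> M * K + N * L\<^sup>2"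
      using F G by auto
    fix x assume x: "x \<in> S"
    show "((\<lambda>x. g (f x)) has_derivative (\<lambda>h. g' (f x) (f' x h))) (at x)"
      using has_derivative_compose[OF F(3)[OF x] G(3)[OF fS[OF x]]] .
    show "norm (g' (f x) (f' x h)) \<le> M * L * norm h" for h
      using order_trans[OF G(4)[OF fS[OF x]] mult_left_mono[OF F(4)[OF x] G(1)]]
      by (simp add: mult.assoc)
    fix y assume y: "y \<in> S"
    show "norm (g (f x) - g (f y)) \<le> M * L * norm (x - y)"
      using order_trans[OF G(5)[OF fS[OF x] fS[OF y]] mult_left_mono[OF F(5)[OF x y] G(1)]]
      by (simp add: mult.assoc)
    fix h
    have lin: "linear (g' (f x))" by (rule C11_linear[OF g fS[OF x]])
    have eq: "g' (f x) (f' x h) - g' (f y) (f' y h)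
        = g' (f x) (f' x h - f' y h) + (g' (f x) (f' y h) - g' (f y) (f' y h))"
      using lin by (simp add: linear_diff)
    have "norm (g' (f x) (f' x h - f' y h)) \<le> M * (K * norm (x - y) * norm h)"
      using order_trans[OF G(4)[OF fS[OF x]] mult_left_mono[OF F(6)[OF x y] G(1)]] .
    moreover have "norm (g' (f x) (f' y h) - g' (f y) (f' y h)) \<le> N * (L * norm (x - y)) * (L * norm h)"
    proof -
      have "norm (g' (f x) (f' y h) - g' (f y) (f' y h)) \<le> N * norm (f x - f y) * norm (f' y h)"
        using G(6)[OF fS[OF x] fS[OF y]] .
      also have "\<dots> \<le> N * (L * norm (x - y)) * (L * norm h)"
        using F(5)[OF x y] G(2) F(4)[OF y, of h] F(1)
        by (intro mult_mono mult_left_mono) auto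
      finally show ?thesis .
    qed
    ultimately have "norm (g' (f x) (f' x h) - g' (f y) (f' y h))
        \<le> M * (K * norm (x - y) * norm h) + N * (L * norm (x - y)) * (L * norm h)"
      unfolding eq by (rule norm_triangle_mono)
    then show "norm (g' (f x) (f' x h) - g' (f y) (f' y h)) \<le> (M * K + N * L\<^sup>2) * norm (x - y) * norm h"
      by (simp add: algebra_simps power2_eq_square)
  qed
qed

lemma C11_subset: "C11 f f' S L K \<Longrightarrow> T \<subseteq> S \<Longrightarrow> C11 f f' T L K"
  unfolding C11_def by (meson subsetD)

lemma C11_mono: "C11 f f' S L K \<Longrightarrow> L \<le> L' \<Longrightarrow> K \<le> K' \<Longrightarrow> C11 f f' S L' K'"
  unfolding C11_def
  by (meson mult_right_mono norm_ge_zero order_trans)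

lemma C11_add:
  assumes f: "C11 f f' S L K" and g: "C11 g g' S M N"
  shows "C11 (\<lambda>x. f x + g x) (\<lambda>x h. f' x h + g' x h) S (L + M) (K + N)"
  unfolding C11_def
proof (intro conjI ballI allI)
  show "0 \<le> L + M" "0 \<le> K + N" using C11D(1,2)[OF f] C11D(1,2)[OF g] by auto
  fix x assume x: "x \<in> S"
  show "((\<lambda>x. f x + g x) has_derivative (\<lambda>h. f' x h + g' x h)) (at x)"
    using has_derivative_add[OF C11D(3)[OF f x] C11D(3)[OF g x]] .
  show "norm (f' x h + g' x h) \<le> (L + M) * norm h" for h
    using norm_triangle_le[OF add_mono[OF C11D(4)[OF f x, of h] C11D(4)[OF g x, of h]]]
    by (simp add: algebra_simps)
  fix y assume y: "y \<in> S"
  have "norm ((f x - f y) + (g x - g y)) \<le> (L + M) * norm (x - y)"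
    using norm_triangle_le[OF add_mono[OF C11D(5)[OF f x y] C11D(5)[OF g x y]]]
    by (simp add: algebra_simps)
  then show "norm (f x + g x - (f y + g y)) \<le> (L + M) * norm (x - y)"
    by (simp add: algebra_simps)
  fix h
  have "norm ((f' x h - f' y h) + (g' x h - g' y h)) \<le> (K + N) * norm (x - y) * norm h"
    using norm_triangle_le[OF add_mono[OF C11D(6)[OF f x y, of h] C11D(6)[OF g x y, of h]]]
    by (simp add: algebra_simps)
  then show "norm (f' x h + g' x h - (f' y h + g' y h)) \<le> (K + N) * norm (x - y) * norm h"
    by (simp add: algebra_simps)
qed

lemma C11_bounded_linear:
  assumes "bounded_linear A" "\<And>h. norm (A h) \<le> L * norm h" "0 \<le> L"
  shows "C11 A (\<lambda>x. A) S L 0"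
  unfolding C11_def
  using assms bounded_linear_imp_has_derivative[OF assms(1)]
  by (auto simp: linear_simps(2)[OF assms(1), symmetric])

lemma C11_bounded_linear_ex:
  assumes "bounded_linear A"
  shows "\<exists>L. C11 A (\<lambda>x. A) S L 0"
  using bounded_linear.nonneg_bounded[OF assms] C11_bounded_linear[OF assms]
  by (metis mult.commute)

lemma C11_scaleR:
  fixes p :: "'a::real_normed_vector \<Rightarrow> real" and f :: "'a \<Rightarrow> 'b::real_normed_vector"
  assumes p: "C11 p p' S L K" and f: "C11 f f' S M N"
    and pb: "\<And>x. x \<in> S \<Longrightarrow> \<bar>p x\<bar> \<le> a" and fb: "\<And>x. x \<in> S \<Longrightarrow> norm (f x) \<le> b"
    and ab: "0 \<le> a" "0 \<le> b"
  shows "C11 (\<lambda>x. p x *\<^sub>R f x) (\<lambda>x h. p x *\<^sub>R f' x h + p' x h *\<^sub>R f x) S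
    (a * M + L * b) (a * N + 2 * L * M + K * b)"
  unfolding C11_def
proof (intro conjI ballI allI)
  note P = C11D[OF p] and F = C11D[OF f]
  show "0 \<le> a * M + L * b" "0 \<le> a * N + 2 * L * M + K * b"
    using P F ab by auto
  fix x assume x: "x \<in> S"
  show "((\<lambda>x. p x *\<^sub>R f x) has_derivative (\<lambda>h. p x *\<^sub>R f' x h + p' x h *\<^sub>R f x)) (at x)"
    using has_derivative_scaleR[OF P(3)[OF x] F(3)[OF x]] .
  show "norm (p x *\<^sub>R f' x h + p' x h *\<^sub>R f x) \<le> (a * M + L * b) * norm h" for h
  proof -
    have "norm (p x *\<^sub>R f' x h) \<le> a * (M * norm h)"
      unfolding norm_scaleR using pb[OF x] F(4)[OF x, of h] ab by (intro mult_mono) auto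
    moreover have "norm (p' x h *\<^sub>R f x) \<le> (L * norm h) * b"
      unfolding norm_scaleR using fb[OF x] P(4)[OF x, of h] ab P(1) by (intro mult_mono) auto
    ultimately have "norm (p x *\<^sub>R f' x h + p' x h *\<^sub>R f x) \<le> a * (M * norm h) + (L * norm h) * b"
      by (rule norm_triangle_le[OF add_mono])
    then show ?thesis by (simp add: algebra_simps)
  qed
  fix y assume y: "y \<in> S"
  show "norm (p x *\<^sub>R f x - p y *\<^sub>R f y) \<le> (a * M + L * b) * norm (x - y)"
  proof -
    have "norm (p x *\<^sub>R (f x - f y)) \<le> a * (M * norm (x - y))"
      unfolding norm_scaleR using pb[OF x] F(5)[OF x y] ab by (intro mult_mono) auto
    moreover have "norm ((p x - p y) *\<^sub>R f y) \<le> (L * norm (x - y)) * b"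
      unfolding norm_scaleR using fb[OF y] P(5)[OF x y] ab P(1) by (intro mult_mono) auto
    ultimately have "norm (p x *\<^sub>R (f x - f y) + (p x - p y) *\<^sub>R f y)
        \<le> a * (M * norm (x - y)) + (L * norm (x - y)) * b"
      by (rule norm_triangle_mono)
    moreover have "p x *\<^sub>R f x - p y *\<^sub>R f y = p x *\<^sub>R (f x - f y) + (p x - p y) *\<^sub>R f y"
      by (simp add: algebra_simps)
    ultimately have "norm (p x *\<^sub>R f x - p y *\<^sub>R f y)
        \<le> a * (M * norm (x - y)) + (L * norm (x - y)) * b"
      by (simp only:)
    then show ?thesis by (simp add: algebra_simps)
  qed
  fix h
  have 1: "norm (p x *\<^sub>R (f' x h - f' y h)) \<le> a * (N * norm (x - y) * norm h)"
    unfolding norm_scaleR using pb[OF x] F(6)[OF x y, of h] ab by (intro mult_mono) auto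
  have 2: "norm ((p x - p y) *\<^sub>R f' y h) \<le> (L * norm (x - y)) * (M * norm h)"
    unfolding norm_scaleR using P(5)[OF x y] F(4)[OF y, of h] P(1) by (intro mult_mono) auto
  have 3: "norm ((p' x h - p' y h) *\<^sub>R f x) \<le> (K * norm (x - y) * norm h) * b"
    unfolding norm_scaleR using fb[OF x] P(6)[OF x y, of h] ab P(2) by (intro mult_mono) auto
  have 4: "norm (p' y h *\<^sub>R (f x - f y)) \<le> (L * norm h) * (M * norm (x - y))"
    unfolding norm_scaleR using P(4)[OF y, of h] F(5)[OF x y] P(1) by (intro mult_mono) auto
  have "p x *\<^sub>R f' x h + p' x h *\<^sub>R f x - (p y *\<^sub>R f' y h + p' y h *\<^sub>R f y)
     = (p x *\<^sub>R (f' x h - f' y h) + (p x - p y) *\<^sub>R f' y h)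
       + ((p' x h - p' y h) *\<^sub>R f x + p' y h *\<^sub>R (f x - f y))"
    by (simp add: algebra_simps)
  then have "norm (p x *\<^sub>R f' x h + p' x h *\<^sub>R f x - (p y *\<^sub>R f' y h + p' y h *\<^sub>R f y))
     \<le> (a * (N * norm (x - y) * norm h) + (L * norm (x - y)) * (M * norm h))
       + ((K * norm (x - y) * norm h) * b + (L * norm h) * (M * norm (x - y)))"
    using norm_triangle_le[OF add_mono[OF norm_triangle_le[OF add_mono[OF 1 2]] norm_triangle_le[OF add_mono[OF 3 4]]]]
    by simp
  then show "norm (p x *\<^sub>R f' x h + p' x h *\<^sub>R f x - (p y *\<^sub>R f' y h + p' y h *\<^sub>R f y))
     \<le> (a * N + 2 * L * M + K * b) * norm (x - y) * norm h"
    by (simp add: algebra_simps)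
qed

text \<open>Extension by zero does not enlarge the constants: a segment from inside the ball to its
  outside meets the shell between \<open>R'\<close> and \<open>R\<close>, where the derivative
  vanishes already, and the part of the segment up to there is shorter.\<close>

lemma C11_compact_support:
  fixes f :: "'a::euclidean_space \<Rightarrow> 'b::real_normed_vector"
  assumes C: "C11 f f' (ball 0 R) L K" and R: "0 < R'" "R' < R"
    and zero: "\<And>x. R' \<le> norm x \<Longrightarrow> f x = 0"
  shows "C11 f (\<lambda>x. if norm x < R then f' x else (\<lambda>h. 0)) UNIV L K"
proof -
  define g' where "g' x = (if norm x < R then f' x else (\<lambda>h. 0))" for x
  have der0: "(f has_derivative (\<lambda>h. 0)) (at x)" if "R' < norm x" for x
  proof -
    have "open {x :: 'a. R' < norm x}"
      by (intro open_Collect_less continuous_intros)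
    then show ?thesis
      using that zero
      by (intro has_derivative_transform_within_open[OF has_derivative_const[of 0]]) auto
  qed
  have der: "(f has_derivative g' x) (at x)" for x
    using C11D(3)[OF C] der0[of x] R by (cases "norm x < R") (auto simp: g'_def)
  have g0: "g' x = (\<lambda>h. 0)" if "R' < norm x" for x
    using has_derivative_unique[OF der der0[OF that]] by simp
  have bd: "norm (g' x h) \<le> L * norm h" for x h
    using C11D(4)[OF C] C11D(1)[OF C] by (auto simp: g'_def)
  have cross: "norm (g' x h - g' y h) \<le> K * norm (x - y) * norm h"
    if x: "norm x < R" and y: "\<not> norm y < R" for x y h
  proof -
    \<comment> \<open>The maximum keeps the prescribed norm between those of \<open>x\<close> and
      \<open>y\<close>, so that the intermediate value theorem applies also when \<open>x\<close>
      itself lies far out in the shell.\<close>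
    obtain t where t: "0 \<le> t" "t \<le> 1" "norm (x + t *\<^sub>R (y - x)) = max (norm x) ((R' + R) / 2)"
    proof -
      have "\<exists>t\<ge>0. t \<le> 1 \<and> norm (x + t *\<^sub>R (y - x)) = max (norm x) ((R' + R) / 2)"
        using x y R by (intro IVT'[of "\<lambda>t. norm (x + t *\<^sub>R (y - x))"]) (auto intro!: continuous_intros)
      then show ?thesis using that by blast
    qed
    let ?c = "x + t *\<^sub>R (y - x)"
    have "R' < (R' + R) / 2" using R by simp
    then have c: "norm ?c < R" "R' < norm ?c"
      using t x R by (auto simp: less_max_iff_disj)
    have "norm (g' x h - g' y h) = norm (f' x h - f' ?c h)"
      using x y g0[OF c(2)] g0[of y] R c by (simp add: g'_def fun_eq_iff)
    also have "\<dots> \<le> K * norm (x - ?c) * norm h"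
      using C11D(6)[OF C, of x ?c h] x c by simp
    also have "\<dots> \<le> K * norm (x - y) * norm h"
    proof -
      have "norm (x - ?c) = t * norm (x - y)"
        using t by (simp add: norm_minus_commute)
      also have "\<dots> \<le> 1 * norm (x - y)"
        using t by (intro mult_right_mono) auto
      finally show ?thesis
        using C11D(2)[OF C] by (intro mult_right_mono mult_left_mono) auto
    qed
    finally show ?thesis .
  qed
  have "norm (g' x h - g' y h) \<le> K * norm (x - y) * norm h" for x y h
  proof -
    consider "norm x < R" "norm y < R" | "norm x < R" "\<not> norm y < R"
      | "norm y < R" "\<not> norm x < R" | "\<not> norm x < R" "\<not> norm y < R" by blast
    then show ?thesis
    proof cases
      case 1
      then show ?thesis using C11D(6)[OF C, of x y h] by (simp add: g'_def)
    next
      case 2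
      then show ?thesis by (rule cross)
    next
      case 3
      then show ?thesis using cross[of y x h] by (simp add: norm_minus_commute)
    next
      case 4
      then show ?thesis using C11D(2)[OF C] by (simp add: g'_def)
    qed
  qed
  then have "C11 f g' UNIV L K"
    using C11D(1,2)[OF C] der bd by (intro C11I_convex) auto
  then show ?thesis unfolding g'_def .
qed

text \<open>A bounded sequence of derivatives has a convergent subsequence, whose limit is forced to be
  the derivative by the uniform Taylor estimate; hence no convergence of derivatives is assumed.\<close>

lemma C11_pointwise_limit:
  fixes f :: "nat \<Rightarrow> 'a::euclidean_space \<Rightarrow> 'b::euclidean_space"
  assumes C: "\<And>m. C11 (f m) (f' m) UNIV L K" and lim: "\<And>x. (\<lambda>m. f m x) \<longlonglongrightarrow> g x"
  shows "\<exists>g'. C11 g g' UNIV L K"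
proof -
  have K: "0 \<le> K" "0 \<le> L" using C11D(1,2)[OF C[of 0]] by auto
  have bl: "bounded_linear (f' m x)" for m x
    using C11D(3)[OF C UNIV_I] has_derivative_bounded_linear by blast
  have step: "\<exists>A B. (g has_derivative A) (at x) \<and> (g has_derivative B) (at y) \<and>
      (\<forall>h. norm (A h - B h) \<le> K * norm (x - y) * norm h) \<and> (\<forall>h. norm (A h) \<le> L * norm h)" for x y
  proof -
    \<comment> \<open>The derivatives at two points are paired to have one convergent subsequence
      for both; otherwise their difference could not be followed to the limit.\<close>
    define F where "F m = (Blinfun (f' m x), Blinfun (f' m y))" for m
    have ap: "blinfun_apply (Blinfun (f' m z)) h = f' m z h" for m z h
      by (simp add: bounded_linear_Blinfun_apply bl)
    have nb: "norm (Blinfun (f' m z)) \<le> L" for m z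
      using C11D(4)[OF C UNIV_I] K by (intro norm_blinfun_bound) (auto simp: ap)
    have "norm (F m) \<le> L + L" for m
      unfolding F_def by (rule order_trans[OF norm_Pair_le]) (use nb[of m x] nb[of m y] in linarith)
    then have "bounded (range F)" by (auto simp: bounded_iff)
    then obtain l r where lr: "strict_mono r" "(F \<circ> r) \<longlonglongrightarrow> l"
      using bounded_imp_convergent_subsequence by blast
    obtain A B where l: "l = (A, B)" by (cases l)
    have A: "(\<lambda>m. f' (r m) x h) \<longlonglongrightarrow> blinfun_apply A h" for h
    proof -
      have "(\<lambda>m. fst ((F \<circ> r) m)) \<longlonglongrightarrow> fst l"
        by (intro tendsto_intros lr)
      then have "(\<lambda>m. blinfun_apply (fst ((F \<circ> r) m)) h) \<longlonglongrightarrow> blinfun_apply (fst l) h"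
        by (intro tendsto_intros lr(2))
      then show ?thesis by (simp add: F_def ap l)
    qed
    have B: "(\<lambda>m. f' (r m) y h) \<longlonglongrightarrow> blinfun_apply B h" for h
    proof -
      have "(\<lambda>m. snd ((F \<circ> r) m)) \<longlonglongrightarrow> snd l"
        by (intro tendsto_intros lr)
      then have "(\<lambda>m. blinfun_apply (snd ((F \<circ> r) m)) h) \<longlonglongrightarrow> blinfun_apply (snd l) h"
        by (intro tendsto_intros lr(2))
      then show ?thesis by (simp add: F_def ap l)
    qed
    have limr: "(\<lambda>m. f (r m) z) \<longlonglongrightarrow> g z" for z
      using LIMSEQ_subseq_LIMSEQ[OF lim lr(1)] by (simp add: o_def)
    have der: "(g has_derivative blinfun_apply D) (at z)"
      if D: "\<And>h. (\<lambda>m. f' (r m) z h) \<longlonglongrightarrow> blinfun_apply D h" for D z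
    proof -
      have est: "norm (g w - g z - blinfun_apply D (w - z)) \<le> K * (norm (w - z))\<^sup>2" for w
      proof (rule LIMSEQ_le_const2)
        show "(\<lambda>m. norm (f (r m) w - f (r m) z - f' (r m) z (w - z)))
          \<longlonglongrightarrow> norm (g w - g z - blinfun_apply D (w - z))"
          by (intro tendsto_intros limr D)
        show "\<exists>N. \<forall>n\<ge>N. norm (f (r n) w - f (r n) z - f' (r n) z (w - z)) \<le> K * (norm (w - z))\<^sup>2"
          using C11_taylor[OF C] by auto
      qed
      show ?thesis
        unfolding has_derivative_at_alt
      proof (intro conjI allI impI)
        show "bounded_linear (blinfun_apply D)" by (rule blinfun.bounded_linear_right)
        fix e :: real assume e: "e > 0"
        show "\<exists>d>0. \<forall>w. norm (w - z) < d \<longrightarrow> norm (g w - g z - blinfun_apply D (w - z)) \<le> e * norm (w - z)"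
        proof (intro exI[of _ "e / (K + 1)"] conjI allI impI)
          show "0 < e / (K + 1)" using e K by simp
          fix w assume w: "norm (w - z) < e / (K + 1)"
          have "K * norm (w - z) \<le> (K + 1) * (e / (K + 1))"
            using w K e by (intro mult_mono) auto
          then have "K * norm (w - z) \<le> e" using K by simp
          then have "K * (norm (w - z))\<^sup>2 \<le> e * norm (w - z)"
            unfolding power2_eq_square mult.assoc[symmetric] by (intro mult_right_mono) auto
          then show "norm (g w - g z - blinfun_apply D (w - z)) \<le> e * norm (w - z)"
            using est[of w] by linarith
        qed
      qed
    qed
    show ?thesis
    proof (intro exI conjI allI)
      show "(g has_derivative blinfun_apply A) (at x)" by (rule der[OF A])
      show "(g has_derivative blinfun_apply B) (at y)" by (rule der[OF B])
      fix h
      show "norm (blinfun_apply A h - blinfun_apply B h) \<le> K * norm (x - y) * norm h"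
      proof (rule LIMSEQ_le_const2)
        show "(\<lambda>m. norm (f' (r m) x h - f' (r m) y h)) \<longlonglongrightarrow> norm (blinfun_apply A h - blinfun_apply B h)"
          by (intro tendsto_intros A B)
        show "\<exists>N. \<forall>n\<ge>N. norm (f' (r n) x h - f' (r n) y h) \<le> K * norm (x - y) * norm h"
          using C11D(6)[OF C] by auto
      qed
      show "norm (blinfun_apply A h) \<le> L * norm h"
      proof (rule LIMSEQ_le_const2)
        show "(\<lambda>m. norm (f' (r m) x h)) \<longlonglongrightarrow> norm (blinfun_apply A h)"
          by (intro tendsto_intros A)
        show "\<exists>N. \<forall>n\<ge>N. norm (f' (r n) x h) \<le> L * norm h"
          using C11D(4)[OF C] by auto
      qed
    qed
  qed
  have "C11 g (\<lambda>x. frechet_derivative g (at x)) UNIV L K"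
  proof (rule C11I_convex)
    fix x y h
    obtain A B where AB: "(g has_derivative A) (at x)" "(g has_derivative B) (at y)"
      "norm (A h - B h) \<le> K * norm (x - y) * norm h" "norm (A h) \<le> L * norm h"
      using step[of x y] by blast
    have eq: "frechet_derivative g (at x) = A" "frechet_derivative g (at y) = B"
      using AB frechet_derivative_at by metis+
    show "(g has_derivative frechet_derivative g (at x)) (at x)"
      "norm (frechet_derivative g (at x) h) \<le> L * norm h"
      "norm (frechet_derivative g (at x) h - frechet_derivative g (at y) h) \<le> K * norm (x - y) * norm h"
      unfolding eq using AB by auto
  qed (use K in auto)
  then show ?thesis by blast
qed

subsection \<open>Continuously differentiable maps\<close>

lemma Ck_on_1I:
  assumes "\<And>x. x \<in> S \<Longrightarrow> (f has_derivative f' x) (at x)"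
    and "\<And>v. continuous_on S (\<lambda>x. f' x v)"
  shows "Ck_on 1 f S"
proof -
  have eq: "frechet_derivative f (at x) = f' x" if "x \<in> S" for x
    using frechet_derivative_at[OF assms(1)[OF that]] by simp
  have "continuous_on S (\<lambda>x. frechet_derivative f (at x) v)" for v
    using assms(2)[of v] by (rule continuous_on_eq) (simp add: eq)
  then show ?thesis
    using assms(1) by (auto simp: One_nat_def differentiable_def simp del: One_nat_def[symmetric])
qed

lemma Ck_on_1D:
  assumes "Ck_on 1 f S"
  shows "\<And>x. x \<in> S \<Longrightarrow> (f has_derivative frechet_derivative f (at x)) (at x)"
    and "\<And>v. continuous_on S (\<lambda>x. frechet_derivative f (at x) v)"
  using assms by (auto simp: One_nat_def frechet_derivative_works[symmetric])

lemma Ck_on_2D: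
  assumes "Ck_on 2 f S"
  shows "\<And>x. x \<in> S \<Longrightarrow> (f has_derivative frechet_derivative f (at x)) (at x)"
    and "\<And>v. Ck_on 1 (\<lambda>x. frechet_derivative f (at x) v) S"
  using assms by (auto simp: numeral_2_eq_2 frechet_derivative_works[symmetric])

lemma Ck_on_subset: "Ck_on k f S \<Longrightarrow> T \<subseteq> S \<Longrightarrow> Ck_on k f T"
  by (induction k arbitrary: f) (auto intro: continuous_on_subset)

lemma has_derivative_imp_continuous_on:
  assumes "\<And>x. x \<in> S \<Longrightarrow> (f has_derivative f' x) (at x)"
  shows "continuous_on S f"
  using assms has_derivative_continuous continuous_at_imp_continuous_on by blast

lemma Ck_on_2_imp_1: "Ck_on 2 f S \<Longrightarrow> Ck_on 1 f S"
  using has_derivative_imp_continuous_on[OF Ck_on_1D(1)[OF Ck_on_2D(2)]]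
  by (intro Ck_on_1I[OF Ck_on_2D(1)])

lemma linear_euclidean_representation:
  fixes D :: "'a::euclidean_space \<Rightarrow> 'b::real_vector"
  assumes "linear D"
  shows "D v = (\<Sum>b\<in>Basis. (v \<bullet> b) *\<^sub>R D b)"
proof -
  have "D v = D (\<Sum>b\<in>Basis. (v \<bullet> b) *\<^sub>R b)"
    by (simp add: euclidean_representation)
  also have "\<dots> = (\<Sum>b\<in>Basis. (v \<bullet> b) *\<^sub>R D b)"
    using assms by (simp add: linear_sum linear_scale)
  finally show ?thesis .
qed

lemma Ck_on_1_compose:
  fixes f :: "'a::euclidean_space \<Rightarrow> 'b::euclidean_space" and g :: "'b \<Rightarrow> 'c::real_normed_vector"
  assumes f: "Ck_on 1 f S" and g: "Ck_on 1 g T" and sub: "f ` S \<subseteq> T"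
  shows "Ck_on 1 (\<lambda>x. g (f x)) S"
proof (rule Ck_on_1I)
  let ?f' = "\<lambda>x. frechet_derivative f (at x)" and ?g' = "\<lambda>x. frechet_derivative g (at x)"
  have fS: "f x \<in> T" if "x \<in> S" for x using sub that by blast
  show "((\<lambda>x. g (f x)) has_derivative (\<lambda>h. ?g' (f x) (?f' x h))) (at x)" if "x \<in> S" for x
    using has_derivative_compose[OF Ck_on_1D(1)[OF f that] Ck_on_1D(1)[OF g fS[OF that]]] .
  fix v
  have cf: "continuous_on S f"
    by (rule has_derivative_imp_continuous_on[OF Ck_on_1D(1)[OF f]])
  \<comment> \<open>Continuity of the derivative is known for a fixed direction. The direction
    \<open>?f' x v\<close> moves with \<open>x\<close>, so it is expanded in the basis.\<close>
  have "continuous_on S (\<lambda>x. \<Sum>b\<in>Basis. (?f' x v \<bullet> b) *\<^sub>R ?g' (f x) b)"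
    by (intro continuous_intros Ck_on_1D(2)[OF f] continuous_on_compose2[OF Ck_on_1D(2)[OF g] cf sub])
  then show "continuous_on S (\<lambda>x. ?g' (f x) (?f' x v))"
  proof (rule continuous_on_eq)
    fix x assume "x \<in> S"
    have "linear (?g' (f x))"
      by (rule has_derivative_linear[OF Ck_on_1D(1)[OF g fS[OF \<open>x \<in> S\<close>]]])
    then show "(\<Sum>b\<in>Basis. (?f' x v \<bullet> b) *\<^sub>R ?g' (f x) b) = ?g' (f x) (?f' x v)"
      by (rule linear_euclidean_representation[symmetric])
  qed
qed

lemma linear_norm_le_basis:
  fixes D :: "'a::euclidean_space \<Rightarrow> 'b::real_normed_vector"
  assumes "linear D" and "\<And>b. b \<in> Basis \<Longrightarrow> norm (D b) \<le> M"
  shows "norm (D v) \<le> (real DIM('a) * M) * norm v"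
proof -
  have "norm (D v) \<le> (\<Sum>b\<in>Basis. norm ((v \<bullet> b) *\<^sub>R D b))"
    by (subst linear_euclidean_representation[OF assms(1)]) (rule norm_sum)
  also have "\<dots> \<le> (\<Sum>b\<in>(Basis :: 'a set). norm v * M)"
    unfolding norm_scaleR
    using assms(2) by (intro sum_mono mult_mono) (auto simp: Basis_le_norm)
  finally show ?thesis by (simp add: mult.commute mult.left_commute)
qed

lemma Ck_on_1_bounded_derivative:
  fixes f :: "'a::euclidean_space \<Rightarrow> 'b::real_normed_vector"
  assumes f: "Ck_on 1 f S" and C: "compact C" "C \<subseteq> S"
  shows "\<exists>L\<ge>0. \<forall>x\<in>C. \<forall>h. norm (frechet_derivative f (at x) h) \<le> L * norm h"
proof -
  let ?f' = "\<lambda>x. frechet_derivative f (at x)"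
  have "\<forall>b\<in>(Basis :: 'a set). \<exists>M. \<forall>x\<in>C. norm (?f' x b) \<le> M"
  proof
    fix b :: 'a
    have "continuous_on C (\<lambda>x. ?f' x b)"
      using Ck_on_1D(2)[OF f] continuous_on_subset C by blast
    then have "bounded ((\<lambda>x. ?f' x b) ` C)"
      using C compact_continuous_image compact_imp_bounded by blast
    then show "\<exists>M. \<forall>x\<in>C. norm (?f' x b) \<le> M"
      by (auto simp: bounded_iff)
  qed
  then obtain M where M: "\<And>b x. b \<in> Basis \<Longrightarrow> x \<in> C \<Longrightarrow> norm (?f' x b) \<le> M b"
    by metis
  define N where "N = (\<Sum>b\<in>(Basis :: 'a set). \<bar>M b\<bar>)"
  have N: "norm (?f' x b) \<le> N" if "b \<in> Basis" "x \<in> C" for x b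
    using M[OF that] member_le_sum[of b Basis "\<lambda>b. \<bar>M b\<bar>"] that(1) by (auto simp: N_def)
  have "N \<ge> 0" by (auto simp: N_def sum_nonneg)
  moreover have "norm (?f' x h) \<le> (real DIM('a) * N) * norm h" if "x \<in> C" for x h
    using that C N has_derivative_linear[OF Ck_on_1D(1)[OF f]] by (intro linear_norm_le_basis) auto
  ultimately show ?thesis by (intro exI[of _ "real DIM('a) * N"]) auto
qed

lemma Ck_on_1_lipschitz:
  fixes f :: "'a::euclidean_space \<Rightarrow> 'b::real_normed_vector"
  assumes f: "Ck_on 1 f S" and C: "compact C" "convex C" "C \<subseteq> S"
  shows "\<exists>L\<ge>0. \<forall>x\<in>C. \<forall>y\<in>C. norm (f x - f y) \<le> L * norm (x - y)"
proof -
  obtain L where L: "L \<ge> 0" "\<And>x h. x \<in> C \<Longrightarrow> norm (frechet_derivative f (at x) h) \<le> L * norm h"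
    using Ck_on_1_bounded_derivative[OF f C(1,3)] by blast
  have "norm (f x - f y) \<le> L * norm (x - y)" if "x \<in> C" "y \<in> C" for x y
    by (rule derivative_bound_lipschitz[OF C(2) _ L(2) L(1) that]) (use Ck_on_1D(1)[OF f] C in auto)
  then show ?thesis using L by blast
qed

text \<open>The directional derivatives along basis vectors are \<open>C\<^sup>1\<close>, hence
  Lipschitz on the compact convex set; linearity turns these finitely many constants into one for
  all directions.\<close>

lemma Ck_on_2_imp_C11:
  fixes f :: "'a::euclidean_space \<Rightarrow> 'b::real_normed_vector"
  assumes f: "Ck_on 2 f S" and C: "compact C" "convex C" "C \<subseteq> S"
  shows "\<exists>L K. C11 f (\<lambda>x. frechet_derivative f (at x)) C L K"
proof -
  let ?f' = "\<lambda>x. frechet_derivative f (at x)"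
  obtain L where L: "L \<ge> 0" "\<And>x h. x \<in> C \<Longrightarrow> norm (?f' x h) \<le> L * norm h"
    using Ck_on_1_bounded_derivative[OF Ck_on_2_imp_1[OF f] C(1,3)] by blast
  have "\<forall>b\<in>(Basis :: 'a set). \<exists>M\<ge>0. \<forall>x\<in>C. \<forall>y\<in>C. norm (?f' x b - ?f' y b) \<le> M * norm (x - y)"
    using Ck_on_1_lipschitz[OF Ck_on_2D(2)[OF f] C] by simp
  then obtain M where M: "\<And>b. b \<in> Basis \<Longrightarrow> M b \<ge> 0"
    "\<And>b x y. b \<in> Basis \<Longrightarrow> x \<in> C \<Longrightarrow> y \<in> C \<Longrightarrow> norm (?f' x b - ?f' y b) \<le> M b * norm (x - y)"
    by metis
  define N where "N = (\<Sum>b\<in>(Basis :: 'a set). M b)"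
  have MN: "M b \<le> N" if "b \<in> Basis" for b
    using member_le_sum[of b Basis M] M(1) that by (auto simp: N_def)
  have N: "N \<ge> 0" using M(1) by (auto simp: N_def sum_nonneg)
  have lin: "linear (?f' x)" if "x \<in> C" for x
    using has_derivative_linear[OF Ck_on_2D(1)[OF f]] C that by auto
  have "C11 f ?f' C L (real DIM('a) * N)"
  proof (rule C11I_convex[OF C(2) L(1)])
    show "0 \<le> real DIM('a) * N" using N by simp
    show "(f has_derivative ?f' x) (at x)" if "x \<in> C" for x
      using Ck_on_2D(1)[OF f] C that by auto
    show "norm (?f' x h - ?f' y h) \<le> real DIM('a) * N * norm (x - y) * norm h"
      if "x \<in> C" "y \<in> C" for x y h
    proof -
      have "norm (?f' x h - ?f' y h) \<le> (real DIM('a) * (N * norm (x - y))) * norm h"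
      proof (rule linear_norm_le_basis)
        show "linear (\<lambda>h. ?f' x h - ?f' y h)"
          using lin that by (intro linear_compose_sub) auto
        show "norm (?f' x b - ?f' y b) \<le> N * norm (x - y)" if "b \<in> Basis" for b
          using M(2)[OF that \<open>x \<in> C\<close> \<open>y \<in> C\<close>] mult_right_mono[OF MN[OF that] norm_ge_zero[of "x - y"]]
          by linarith
      qed
      then show ?thesis by (simp add: mult.assoc)
    qed
  qed (use L in auto)
  then show ?thesis by blast
qed

subsection \<open>Inverting perturbations of the identity\<close>

locale near_identity =
  fixes p :: "'a::euclidean_space \<Rightarrow> 'a" and p' :: "'a \<Rightarrow> 'a \<Rightarrow> 'a"
  assumes der: "\<And>x. (p has_derivative p' x) (at x)"
    and small: "\<And>x h. norm (p' x h) \<le> 1/2 * norm h"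
begin

definition F :: "'a \<Rightarrow> 'a" where "F x = x + p x"

lemma lip: "norm (p x - p y) \<le> 1/2 * norm (x - y)"
  by (rule derivative_bound_lipschitz[of UNIV]) (use der small in auto)

lemma F_lower: "norm (x - y) \<le> 2 * norm (F x - F y)"
proof -
  have "F x - F y = (x - y) + (p x - p y)" by (simp add: F_def)
  then have "norm (x - y) \<le> norm (F x - F y) + norm (p x - p y)"
    using norm_triangle_ineq4[of "F x - F y" "p x - p y"] by simp
  then show ?thesis using lip[of x y] by linarith
qed

lemma F_surj: "\<exists>x. F x = y"
proof -
  have "\<exists>!x. y - p x = x"
  proof (rule banach_fix_type[of "1/2"])
    show "\<forall>x z. dist (y - p x) (y - p z) \<le> 1/2 * dist x z"
      using lip by (auto simp: dist_norm norm_minus_commute)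
  qed auto
  then obtain x where "y - p x = x" by blast
  then have "F x = y" by (simp add: F_def algebra_simps)
  then show ?thesis by blast
qed

lemma bij: "bij F"
  unfolding bij_def
proof
  show "inj F"
  proof (rule injI)
    fix x y assume "F x = F y"
    then show "x = y" using F_lower[of x y] by simp
  qed
  show "surj F" using F_surj by (metis surj_def)
qed

definition G :: "'a \<Rightarrow> 'a" where "G = inv F"

lemma FG [simp]: "F (G y) = y" and GF [simp]: "G (F x) = x"
  using bij by (auto simp: G_def bij_is_surj surj_f_inv_f bij_is_inj)

lemma G_lip: "norm (G x - G y) \<le> 2 * norm (x - y)"
  using F_lower[of "G x" "G y"] by simp

definition A :: "'a \<Rightarrow> 'a \<Rightarrow> 'a" where "A x h = h + p' x h"

lemma F_der: "(F has_derivative A x) (at x)"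
  unfolding F_def[abs_def] A_def[abs_def] by (auto intro!: derivative_eq_intros der)

lemma A_linear: "linear (A x)"
  using F_der has_derivative_linear by blast

lemma A_lower: "norm h \<le> 2 * norm (A x h)"
proof -
  have "norm h \<le> norm (A x h) + norm (p' x h)"
    using norm_triangle_ineq4[of "A x h" "p' x h"] by (simp add: A_def)
  then show ?thesis using small[of x h] by linarith
qed

lemma A_bij: "bij (A x)"
proof -
  have "inj (A x)"
    unfolding linear_injective_0[OF A_linear] using A_lower by (metis mult_zero_right norm_le_zero_iff norm_zero)
  then show ?thesis
    using linear_injective_imp_surjective[OF A_linear] by (simp add: bij_def)
qed

definition G' :: "'a \<Rightarrow> 'a \<Rightarrow> 'a" where "G' y = inv (A (G y))"

lemma AG' [simp]: "A (G y) (G' y k) = k" and G'A [simp]: "G' y (A (G y) k) = k"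
  using A_bij by (auto simp: G'_def bij_is_surj surj_f_inv_f bij_is_inj)

lemma G'_bound: "norm (G' y k) \<le> 2 * norm k"
  using A_lower[of "G' y k" "G y"] by simp

lemma G'_linear: "linear (G' y)"
proof (rule linearI)
  fix a b :: 'a and r :: real
  have "A (G y) (G' y a + G' y b) = a + b"
    by (simp add: linear_add[OF A_linear])
  then show "G' y (a + b) = G' y a + G' y b" by (metis G'A)
  have "A (G y) (r *\<^sub>R G' y a) = r *\<^sub>R a"
    by (simp add: linear_scale[OF A_linear])
  then show "G' y (r *\<^sub>R a) = r *\<^sub>R G' y a" by (metis G'A)
qed

lemma G_cont: "continuous_on UNIV G"
  by (rule lipschitz_on_continuous_on[of 2], rule lipschitz_onI) (auto simp: dist_norm G_lip)

lemma G_der: "(G has_derivative G' y) (at y)"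
proof (rule has_derivative_inverse_basic)
  show "(F has_derivative A (G y)) (at (G y))" by (rule F_der)
  show "bounded_linear (G' y)" using G'_linear linear_conv_bounded_linear by blast
  show "G' y \<circ> A (G y) = id" by auto
  show "continuous (at y) G" using G_cont continuous_on_eq_continuous_at by blast
  show "open (UNIV :: 'a set)" "y \<in> UNIV" "\<And>z. z \<in> UNIV \<Longrightarrow> F (G z) = z" by auto
qed

text \<open>Apply \<open>A (G x)\<close>, which is bounded below, to the difference: what remains is
  the change of \<open>p'\<close> at one fixed vector. Lipschitz and merely continuous derivatives
  of the inverse both follow from this.\<close>

lemma G'_diff: "norm (G' x k - G' y k) \<le> 2 * norm (p' (G x) (G' y k) - p' (G y) (G' y k))"
proof -
  have "A (G x) (G' x k - G' y k) = A (G y) (G' y k) - A (G x) (G' y k)"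
    by (simp add: linear_diff[OF A_linear])
  also have "\<dots> = p' (G y) (G' y k) - p' (G x) (G' y k)"
    unfolding A_def by simp
  finally show ?thesis
    using A_lower[of "G' x k - G' y k" "G x"] by (simp add: norm_minus_commute)
qed

lemma C11_inverse:
  assumes "C11 p p' UNIV L K"
  shows "C11 G G' UNIV 2 (8 * K)"
proof (rule C11I_convex)
  show "norm (G' x h - G' y h) \<le> 8 * K * norm (x - y) * norm h" for x y h
  proof -
    have "norm (G' x h - G' y h) \<le> 2 * (K * norm (G x - G y) * norm (G' y h))"
      using G'_diff[of x h y] C11D(6)[OF assms, of "G x" "G y" "G' y h"] by simp
    also have "\<dots> \<le> 2 * (K * (2 * norm (x - y)) * (2 * norm h))"
      using G_lip G'_bound C11D(2)[OF assms] by (intro mult_left_mono mult_mono) auto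
    finally show ?thesis by simp
  qed
qed (use C11D(2)[OF assms] G_der G'_bound in auto)

lemma C1_inverse:
  assumes cont: "\<And>v. continuous_on UNIV (\<lambda>x. p' x v)"
  shows "Ck_on 1 G UNIV"
proof (rule Ck_on_1I)
  show "(G has_derivative G' x) (at x)" for x by (rule G_der)
  fix v
  show "continuous_on UNIV (\<lambda>x. G' x v)"
    unfolding continuous_on_def
  proof
    fix y
    let ?w = "G' y v"
    have "continuous_on UNIV (\<lambda>x. p' (G x) ?w)"
      using continuous_on_compose2[OF cont G_cont] by simp
    then have "((\<lambda>x. p' (G x) ?w) \<longlongrightarrow> p' (G y) ?w) (at y)"
      by (simp add: continuous_on_def)
    then have *: "((\<lambda>x. 2 * norm (p' (G x) ?w - p' (G y) ?w)) \<longlongrightarrow> 2 * norm (p' (G y) ?w - p' (G y) ?w)) (at y)"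
      by (intro tendsto_intros)
    have "((\<lambda>x. G' x v - G' y v) \<longlongrightarrow> 0) (at y)"
      by (rule Lim_null_comparison[OF _ *[simplified]]) (auto intro: eventuallyI G'_diff)
    then show "((\<lambda>x. G' x v) \<longlongrightarrow> G' y v) (at y)"
      using Lim_null by blast
  qed
qed

end

subsection \<open>A cut-off function varying on a logarithmic scale\<close>

text \<open>The cubic Hermite step, falling from 1 to 0. Its derivative is Lipschitz, and this is
  all that \<open>C11\<close> asks of a cut-off.\<close>

definition smoothstep :: "real \<Rightarrow> real" where
  "smoothstep t = (let u = max 0 (min 1 t) in 1 - 3 * u\<^sup>2 + 2 * u ^ 3)"

definition smoothstep' :: "real \<Rightarrow> real" where
  "smoothstep' t = (let u = max 0 (min 1 t) in - 6 * (u * (1 - u)))"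

lemma smoothstep'_out: "t \<le> 0 \<or> 1 \<le> t \<Longrightarrow> smoothstep' t = 0"
  by (auto simp: smoothstep'_def)

lemma smoothstep_le_0: "t \<le> 0 \<Longrightarrow> smoothstep t = 1"
  and smoothstep_ge_1: "1 \<le> t \<Longrightarrow> smoothstep t = 0"
  by (auto simp: smoothstep_def)

lemma smoothstep'_bounds:
  "\<bar>smoothstep' t\<bar> \<le> 2" "\<bar>smoothstep' t\<bar> \<le> 6 * \<bar>t\<bar>" "smoothstep' t \<le> 0"
  "\<bar>smoothstep' s - smoothstep' t\<bar> \<le> 6 * \<bar>s - t\<bar>"
proof -
  define u v where "u = max 0 (min 1 t)" and "v = max 0 (min 1 s)"
  have u: "0 \<le> u" "u \<le> 1" "u \<le> \<bar>t\<bar>" and v: "0 \<le> v" "v \<le> 1" and uv: "\<bar>v - u\<bar> \<le> \<bar>s - t\<bar>"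
    by (auto simp: u_def v_def)
  have eq: "smoothstep' t = - 6 * (u * (1 - u))" "smoothstep' s = - 6 * (v * (1 - v))"
    by (simp_all add: smoothstep'_def u_def v_def Let_def)
  have nn: "0 \<le> u * (1 - u)" using u by simp
  have "0 \<le> (1 - 2 * u)\<^sup>2" by simp
  then have "u * (1 - u) \<le> 1/4" by (simp add: power2_eq_square algebra_simps)
  then show "\<bar>smoothstep' t\<bar> \<le> 2" "smoothstep' t \<le> 0" using nn unfolding eq by linarith+
  have "u * (1 - u) \<le> u" using u by (simp add: algebra_simps)
  then show "\<bar>smoothstep' t\<bar> \<le> 6 * \<bar>t\<bar>" using nn u unfolding eq by linarith
  have "v * (1 - v) - u * (1 - u) = (v - u) * (1 - u - v)" by algebra
  then have "\<bar>v * (1 - v) - u * (1 - u)\<bar> = \<bar>v - u\<bar> * \<bar>1 - u - v\<bar>" by (simp add: abs_mult)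
  also have "\<dots> \<le> \<bar>v - u\<bar> * 1" using u v by (intro mult_left_mono) auto
  finally have "\<bar>v * (1 - v) - u * (1 - u)\<bar> \<le> \<bar>s - t\<bar>" using uv by simp
  moreover have "\<bar>- 6 * a - - 6 * b\<bar> \<le> 6 * d" if "\<bar>a - b\<bar> \<le> d" for a b d :: real
    using that by linarith
  ultimately show "\<bar>smoothstep' s - smoothstep' t\<bar> \<le> 6 * \<bar>s - t\<bar>"
    unfolding eq by blast
qed

lemma smoothstep_der: "(smoothstep has_real_derivative smoothstep' t) (at t)"
proof -
  have poly: "((\<lambda>t. 1 - 3 * t\<^sup>2 + 2 * t ^ 3) has_real_derivative - 6 * (t * (1 - t))) (at t within A)" for t :: real and A
    by (auto intro!: derivative_eq_intros simp: field_simps power2_eq_square)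
  have c1: "(smoothstep has_real_derivative smoothstep' t) (at t within {..0})" if "t \<le> 0" for t
  proof (rule has_field_derivative_transform_within[OF _ zero_less_one])
    show "((\<lambda>t. 1) has_real_derivative smoothstep' t) (at t within {..0})"
      using that by (simp add: smoothstep'_out)
  qed (use that in \<open>auto simp: smoothstep_def\<close>)
  have c2: "(smoothstep has_real_derivative smoothstep' t) (at t within {0..1})" if "0 \<le> t" "t \<le> 1" for t
  proof (rule has_field_derivative_transform_within[OF _ zero_less_one])
    show "((\<lambda>t. 1 - 3 * t\<^sup>2 + 2 * t ^ 3) has_real_derivative smoothstep' t) (at t within {0..1})"
      using poly[of t] that by (simp add: smoothstep'_def)
  qed (use that in \<open>auto simp: smoothstep_def\<close>)
  have c3: "(smoothstep has_real_derivative smoothstep' t) (at t within {1..})" if "1 \<le> t" for t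
  proof (rule has_field_derivative_transform_within[OF _ zero_less_one])
    show "((\<lambda>t. 0) has_real_derivative smoothstep' t) (at t within {1..})"
      using that by (simp add: smoothstep'_out)
  qed (use that in \<open>auto simp: smoothstep_def\<close>)
  have union: "(smoothstep has_real_derivative D) (at t within A \<union> B)"
    if "(smoothstep has_real_derivative D) (at t within A)"
      "(smoothstep has_real_derivative D) (at t within B)" for A B D
    using that unfolding has_field_derivative_iff by (subst at_within_union) (rule filterlim_sup)
  consider "t < 0" | "t = 0" | "0 < t" "t < 1" | "t = 1" | "1 < t" by linarith
  then show ?thesis
  proof cases
    case 1
    then show ?thesis using c1[of t] at_within_open_subset[of t "{..<0}" "{..0}"] by force
  next
    case 2
    then have "at t within ({..0} \<union> {0..1}) = at t"
      by (intro at_within_open_subset[of t "{..<1}"]) auto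
    then show ?thesis using union[OF c1 c2] 2 by simp
  next
    case 3
    then show ?thesis using c2[of t] at_within_open_subset[of t "{0<..<1}" "{0..1}"] by force
  next
    case 4
    then have "at t within ({0..1} \<union> {1..}) = at t"
      by (intro at_within_open_subset[of t "{0<..}"]) auto
    then show ?thesis using union[OF c2 c3] 4 by simp
  next
    case 5
    then show ?thesis using c3[of t] at_within_open_subset[of t "{1<..}" "{1..}"] by force
  qed
qed

lemma smoothstep_lipschitz: "\<bar>smoothstep s - smoothstep t\<bar> \<le> 2 * \<bar>s - t\<bar>"
proof -
  have "norm (smoothstep s - smoothstep t) \<le> 2 * norm (s - t)"
  proof (rule derivative_bound_lipschitz[of UNIV])
    show "(smoothstep has_derivative (\<lambda>h. smoothstep' u * h)) (at u)" for u
      using smoothstep_der[of u] by (simp add: has_field_derivative_def)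
    show "norm (smoothstep' u * h) \<le> 2 * norm h" for u h
      using smoothstep'_bounds(1)[of u] by (simp add: abs_mult mult_right_mono)
  qed auto
  then show ?thesis by simp
qed

lemma smoothstep_range: "0 \<le> smoothstep t" "smoothstep t \<le> 1"
proof -
  have mono: "smoothstep b \<le> smoothstep a" if "a \<le> b" for a b
    by (rule DERIV_nonpos_imp_nonincreasing[OF that])
      (intro exI conjI, rule smoothstep_der, rule smoothstep'_bounds(3))
  show "smoothstep t \<le> 1" using mono[of "min 0 t" t] smoothstep_le_0[of "min 0 t"] by simp
  show "0 \<le> smoothstep t" using mono[of t "max 1 t"] smoothstep_ge_1[of "max 1 t"] by simp
qed

text \<open>In \<open>ln (norm x / norm y) \<le> norm x / norm y - 1\<close> the factor
  \<open>norm y\<close> cancels the denominator. The bound is the same on all scales, which is the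
  point of taking a logarithm.\<close>

lemma ln_norm_diff:
  fixes x y :: "'a::real_inner"
  assumes "y \<noteq> 0" "norm y \<le> norm x"
  shows "\<bar>ln (x \<bullet> x) - ln (y \<bullet> y)\<bar> * norm y \<le> 2 * norm (x - y)"
proof -
  have x: "norm x > 0" and y: "norm y > 0" using assms by auto
  have "ln (x \<bullet> x) - ln (y \<bullet> y) = 2 * ln (norm x / norm y)"
    using x y by (simp add: power2_norm_eq_inner[symmetric] ln_realpow ln_div)
  moreover have "0 \<le> ln (norm x / norm y)"
    using x y assms by (intro ln_ge_zero) auto
  moreover have "ln (norm x / norm y) \<le> norm x / norm y - 1"
    using x y by (intro ln_le_minus_one) auto
  ultimately have "\<bar>ln (x \<bullet> x) - ln (y \<bullet> y)\<bar> * norm y \<le> 2 * (norm x / norm y - 1) * norm y"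
    using y by (intro mult_right_mono) auto
  also have "\<dots> = 2 * (norm x - norm y)" using y by (simp add: field_simps)
  also have "\<dots> \<le> 2 * norm (x - y)" using norm_triangle_ineq2[of x y] by simp
  finally show ?thesis .
qed

text \<open>Inversion in the unit sphere multiplies the distance of two points by
  \<open>1 / (norm x * norm y)\<close>. Twice the inverted point
  \<open>x /\<^sub>R (x \<bullet> x)\<close> is the gradient of
  \<open>ln (x \<bullet> x)\<close>.\<close>

lemma inversion_diff:
  fixes x y :: "'a::real_inner"
  assumes "1 \<le> norm x" "1 \<le> norm y"
  shows "norm (x /\<^sub>R (x \<bullet> x) - y /\<^sub>R (y \<bullet> y)) \<le> norm (x - y)"
proof -
  have x: "x \<bullet> x \<noteq> 0" and y: "y \<bullet> y \<noteq> 0" using assms by auto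
  have "(norm (x /\<^sub>R (x \<bullet> x) - y /\<^sub>R (y \<bullet> y)))\<^sup>2 = (norm (x - y))\<^sup>2 / ((x \<bullet> x) * (y \<bullet> y))"
    using x y by (simp add: power2_norm_eq_inner inner_diff_left inner_diff_right inner_commute field_simps)
  also have "\<dots> \<le> (norm (x - y))\<^sup>2 / 1"
  proof (rule divide_left_mono)
    have "1 \<le> x \<bullet> x" "1 \<le> y \<bullet> y"
      using assms by (auto simp: power2_norm_eq_inner[symmetric] one_le_power)
    then show "1 \<le> x \<bullet> x * (y \<bullet> y)" "0 < x \<bullet> x * (y \<bullet> y) * 1"
      using mult_mono[of 1 "x \<bullet> x" 1 "y \<bullet> y"] by auto
  qed simp
  finally show ?thesis by (simp add: power2_le_iff_abs_le)
qed

text \<open>Multiplied by such a cut-off a linear vector field, which is not small, still grows by little more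
  than its own rates; for a cut-off at a single scale this fails.\<close>

lemma log_cutoff:
  assumes "0 < \<epsilon>"
  shows "\<exists>\<theta> :: 'a::euclidean_space \<Rightarrow> real. \<exists>\<theta>' R L K. R > 1 \<and> C11 \<theta> \<theta>' UNIV L K \<and>
    (\<forall>x. 0 \<le> \<theta> x \<and> \<theta> x \<le> 1) \<and> (\<forall>x. norm x \<le> 1 \<longrightarrow> \<theta> x = 1) \<and> (\<forall>x. R \<le> norm x \<longrightarrow> \<theta> x = 0) \<and>
    (\<forall>x y. norm y \<le> norm x \<longrightarrow> \<bar>\<theta> x - \<theta> y\<bar> * norm y \<le> \<epsilon> * norm (x - y))"
proof -
  \<comment> \<open>One factor 2 is the Lipschitz constant of \<open>smoothstep\<close>, the other
    one comes from \<open>ln (x \<bullet> x) = 2 * ln (norm x)\<close>.\<close>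
  define \<eta> where "\<eta> = \<epsilon> / 4"
  have \<eta>: "\<eta> > 0" using assms by (simp add: \<eta>_def)
  define t where "t x = \<eta> * ln (x \<bullet> x)" for x :: 'a
  define k where "k x = x /\<^sub>R (x \<bullet> x)" for x :: 'a
  define \<theta> where "\<theta> x = smoothstep (t x)" for x :: 'a
  define \<theta>' where "\<theta>' x h = smoothstep' (t x) * (2 * \<eta> * (k x \<bullet> h))" for x h :: 'a
  \<comment> \<open>From this radius on \<open>t x \<ge> 1\<close>. A small logarithmic slope costs
    an exponentially large support, which is harmless because the cut-off is rescaled wherever it is
    used.\<close>
  define R where "R = exp (1 / \<eta>)"
  have t_le: "t x \<le> 0" if "norm x \<le> 1" for x :: 'a
  proof (cases "x = 0")
    case False
    then have "ln (x \<bullet> x) \<le> 0"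
      using that by (simp add: power2_norm_eq_inner[symmetric] power_le_one)
    then show ?thesis using \<eta> by (simp add: t_def mult_nonneg_nonpos)
  qed (simp add: t_def)
  have one: "\<theta> x = 1" if "norm x \<le> 1" for x
    using t_le[OF that] by (simp add: \<theta>_def smoothstep_le_0)
  have zero: "\<theta> x = 0" if "R \<le> norm x" for x
  proof -
    have "0 < R" by (simp add: R_def)
    then have n: "0 < norm x" using that by linarith
    have "1 / \<eta> \<le> ln (norm x)"
      using that n by (simp add: R_def ln_ge_iff)
    also have "\<dots> \<le> ln (x \<bullet> x)"
    proof -
      have "1 \<le> R" using \<eta> by (simp add: R_def)
      then have "1 \<le> norm x" using that by linarith
      then have "norm x \<le> x \<bullet> x"
        using mult_right_mono[of 1 "norm x" "norm x"]
        by (simp add: power2_norm_eq_inner[symmetric] power2_eq_square)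
      then show ?thesis using n by simp
    qed
    finally have "1 \<le> t x" using \<eta> by (simp add: t_def field_simps)
    then show ?thesis by (simp add: \<theta>_def smoothstep_ge_1)
  qed
  have log: "\<bar>\<theta> x - \<theta> y\<bar> * norm y \<le> \<epsilon> * norm (x - y)" if "norm y \<le> norm x" for x y
  proof (cases "y = 0")
    case False
    have "\<bar>\<theta> x - \<theta> y\<bar> \<le> 2 * \<bar>t x - t y\<bar>"
      unfolding \<theta>_def by (rule smoothstep_lipschitz)
    also have "\<dots> = 2 * \<eta> * \<bar>ln (x \<bullet> x) - ln (y \<bullet> y)\<bar>"
      using \<eta> by (simp add: t_def abs_mult right_diff_distrib[symmetric])
    finally have "\<bar>\<theta> x - \<theta> y\<bar> * norm y \<le> 2 * \<eta> * (\<bar>ln (x \<bullet> x) - ln (y \<bullet> y)\<bar> * norm y)"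
      by (metis mult.assoc mult_right_mono norm_ge_zero)
    also have "\<dots> \<le> 2 * \<eta> * (2 * norm (x - y))"
      using ln_norm_diff[OF False that] \<eta> by (intro mult_left_mono) auto
    finally show ?thesis by (simp add: \<eta>_def)
  qed (use assms in simp)
  have kn: "norm (k x) \<le> 1" if "1 \<le> norm x" for x
  proof -
    have eq: "norm (k x) = 1 / norm x"
      by (simp add: k_def power2_norm_eq_inner[symmetric] power2_eq_square divide_simps)
    show ?thesis unfolding eq using that by (auto simp: divide_le_eq)
  qed
  have zero': "\<theta>' x h = 0" if "norm x \<le> 1" for x h
    using t_le[OF that] by (simp add: \<theta>'_def smoothstep'_out)
  have der: "(\<theta> has_derivative \<theta>' x) (at x)" for x
  proof (cases "norm x < 1")
    case True
    have "(\<theta> has_derivative (\<lambda>h. 0)) (at x)"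
    proof (rule has_derivative_transform_within_open[of "\<lambda>x. 1" _ _ _ "ball 0 1"])
      show "1 = \<theta> y" if "y \<in> ball 0 1" for y using one[of y] that by simp
    qed (use True in auto)
    moreover have "\<theta>' x = (\<lambda>h. 0)" using zero' True by (simp add: fun_eq_iff)
    ultimately show ?thesis by simp
  next
    case False
    then have x: "x \<bullet> x > 0" by auto
    have "((\<lambda>x. \<eta> * ln (x \<bullet> x)) has_derivative (\<lambda>h. 2 * \<eta> * (k x \<bullet> h))) (at x)"
      using x by (auto intro!: derivative_eq_intros simp: k_def inner_commute fun_eq_iff field_simps)
    moreover have "(smoothstep has_derivative (*) (smoothstep' (t x))) (at (\<eta> * ln (x \<bullet> x)))"
      using smoothstep_der[of "t x"] by (simp add: has_field_derivative_def t_def)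
    ultimately have "((\<lambda>x. smoothstep (\<eta> * ln (x \<bullet> x))) has_derivative
        (\<lambda>h. smoothstep' (t x) * (2 * \<eta> * (k x \<bullet> h)))) (at x)"
      by (rule has_derivative_compose)
    then show ?thesis unfolding \<theta>_def t_def \<theta>'_def[abs_def] .
  qed
  have bd: "norm (\<theta>' x h) \<le> 4 * \<eta> * norm h" for x h
  proof (cases "norm x \<le> 1")
    case False
    have "\<bar>k x \<bullet> h\<bar> \<le> 1 * norm h"
      using Cauchy_Schwarz_ineq2[of "k x" h] mult_right_mono[OF kn[of x] norm_ge_zero[of h]] False by linarith
    then have "\<bar>smoothstep' (t x)\<bar> * \<bar>2 * \<eta> * (k x \<bullet> h)\<bar> \<le> 2 * (2 * \<eta> * (1 * norm h))"
      using smoothstep'_bounds(1) \<eta> by (intro mult_mono) (auto simp: abs_mult)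
    then show ?thesis by (simp add: \<theta>'_def abs_mult)
  qed (use zero' \<eta> in auto)
  define K where "K = 24 * \<eta>\<^sup>2 + 4 * \<eta>"
  have tdiff: "\<bar>t x - t y\<bar> \<le> 2 * \<eta> * norm (x - y)" if "1 \<le> norm x" "1 \<le> norm y" for x y
  proof -
    have *: "\<bar>ln (x \<bullet> x) - ln (y \<bullet> y)\<bar> \<le> 2 * norm (x - y)" if "1 \<le> norm y" "norm y \<le> norm x" for x y :: 'a
    proof -
      have "\<bar>ln (x \<bullet> x) - ln (y \<bullet> y)\<bar> * 1 \<le> \<bar>ln (x \<bullet> x) - ln (y \<bullet> y)\<bar> * norm y"
        using that by (intro mult_left_mono) auto
      also have "\<dots> \<le> 2 * norm (x - y)" using that by (intro ln_norm_diff) auto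
      finally show ?thesis by simp
    qed
    have "\<bar>ln (x \<bullet> x) - ln (y \<bullet> y)\<bar> \<le> 2 * norm (x - y)"
      using *[of y x] *[of x y] that by (cases "norm y \<le> norm x") (auto simp: norm_minus_commute abs_minus_commute)
    then show ?thesis
      using \<eta> by (simp add: t_def abs_mult right_diff_distrib[symmetric])
  qed
  have c1: "norm (\<theta>' x h - \<theta>' y h) \<le> K * norm (x - y) * norm h" if "1 \<le> norm x" "1 \<le> norm y" for x y h
  proof -
    have 1: "\<bar>smoothstep' (t x) - smoothstep' (t y)\<bar> * \<bar>k x \<bullet> h\<bar> \<le> (6 * (2 * \<eta> * norm (x - y))) * (1 * norm h)"
    proof (rule mult_mono)
      show "\<bar>smoothstep' (t x) - smoothstep' (t y)\<bar> \<le> 6 * (2 * \<eta> * norm (x - y))"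
        by (rule order_trans[OF smoothstep'_bounds(4) mult_left_mono[OF tdiff[OF that]]]) simp
      show "\<bar>k x \<bullet> h\<bar> \<le> 1 * norm h"
        using Cauchy_Schwarz_ineq2[of "k x" h] mult_right_mono[OF kn[OF that(1)] norm_ge_zero[of h]] by linarith
    qed (use \<eta> in auto)
    have 2: "\<bar>smoothstep' (t y)\<bar> * \<bar>(k x - k y) \<bullet> h\<bar> \<le> 2 * (norm (x - y) * norm h)"
    proof (rule mult_mono)
      have "norm (k x - k y) \<le> norm (x - y)"
        unfolding k_def by (rule inversion_diff[OF that])
      then show "\<bar>(k x - k y) \<bullet> h\<bar> \<le> norm (x - y) * norm h"
        using Cauchy_Schwarz_ineq2[of "k x - k y" h] mult_right_mono[OF _ norm_ge_zero[of h]] order_trans by blast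
    qed (use smoothstep'_bounds(1) in auto)
    have "\<theta>' x h - \<theta>' y h = 2 * \<eta> * ((smoothstep' (t x) - smoothstep' (t y)) * (k x \<bullet> h)
        + smoothstep' (t y) * ((k x - k y) \<bullet> h))"
      by (simp add: \<theta>'_def inner_diff_left algebra_simps)
    then have "norm (\<theta>' x h - \<theta>' y h) = 2 * \<eta> * \<bar>(smoothstep' (t x) - smoothstep' (t y)) * (k x \<bullet> h)
        + smoothstep' (t y) * ((k x - k y) \<bullet> h)\<bar>"
      using \<eta> by (simp add: abs_mult)
    also have "\<dots> \<le> 2 * \<eta> * ((6 * (2 * \<eta> * norm (x - y))) * (1 * norm h) + 2 * (norm (x - y) * norm h))"
      using 1 2 \<eta> by (intro mult_left_mono order_trans[OF abs_triangle_ineq] add_mono) (auto simp: abs_mult)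
    also have "\<dots> = K * norm (x - y) * norm h"
      by (simp add: K_def power2_eq_square algebra_simps)
    finally show ?thesis .
  qed
  \<comment> \<open>Across the unit sphere the two pieces of \<open>\<theta>'\<close> fit together
    because \<open>smoothstep'\<close> vanishes at 0 at a linear rate, while \<open>t y\<close> is
    bounded by the distance of \<open>y\<close> to the unit ball.\<close>
  have c2: "norm (\<theta>' x h - \<theta>' y h) \<le> K * norm (x - y) * norm h" if "norm x \<le> 1" "1 \<le> norm y" for x y h
  proof -
    have "y \<noteq> 0" using that by auto
    have "t y = 2 * \<eta> * ln (norm y)"
      using \<open>y \<noteq> 0\<close> by (simp add: t_def power2_norm_eq_inner[symmetric] ln_realpow)
    moreover have "0 \<le> ln (norm y)" "ln (norm y) \<le> norm y - 1"
      using that \<open>y \<noteq> 0\<close> by (auto intro: ln_le_minus_one)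
    moreover have "norm y - 1 \<le> norm (x - y)"
      using that norm_triangle_ineq2[of y x] by (simp add: norm_minus_commute)
    ultimately have "\<bar>t y\<bar> \<le> 2 * \<eta> * norm (x - y)"
      using \<eta> by auto
    then have 1: "\<bar>smoothstep' (t y)\<bar> \<le> 6 * (2 * \<eta> * norm (x - y))"
      by (rule order_trans[OF smoothstep'_bounds(2) mult_left_mono]) simp
    have 2: "\<bar>k y \<bullet> h\<bar> \<le> 1 * norm h"
      using Cauchy_Schwarz_ineq2[of "k y" h] mult_right_mono[OF kn[OF that(2)] norm_ge_zero[of h]] by linarith
    have "norm (\<theta>' x h - \<theta>' y h) = norm (\<theta>' y h)"
      using zero'[OF that(1), of h] by simp
    also have "\<dots> = \<bar>smoothstep' (t y)\<bar> * (2 * \<eta> * \<bar>k y \<bullet> h\<bar>)"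
      using \<eta> by (simp add: \<theta>'_def abs_mult)
    also have "\<dots> \<le> (6 * (2 * \<eta> * norm (x - y))) * (2 * \<eta> * (1 * norm h))"
      using 1 2 \<eta> by (intro mult_mono mult_left_mono) auto
    also have "\<dots> = (24 * \<eta>\<^sup>2) * norm (x - y) * norm h"
      by (simp add: power2_eq_square)
    also have "\<dots> \<le> K * norm (x - y) * norm h"
      using \<eta> by (intro mult_right_mono) (auto simp: K_def)
    finally show ?thesis .
  qed
  have lip: "norm (\<theta>' x h - \<theta>' y h) \<le> K * norm (x - y) * norm h" for x y h
  proof -
    consider "1 \<le> norm x" "1 \<le> norm y" | "norm x \<le> 1" "1 \<le> norm y"
      | "norm y \<le> 1" "1 \<le> norm x" | "norm x \<le> 1" "norm y \<le> 1" by linarith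
    then show ?thesis
    proof cases
      case 3
      then show ?thesis using c2[of y x h] by (simp add: norm_minus_commute abs_minus_commute)
    next
      case 4
      then show ?thesis using zero' \<eta> by (simp add: K_def)
    qed (use c1 c2 in auto)
  qed
  have "C11 \<theta> \<theta>' UNIV (4 * \<eta>) K"
    using \<eta> der bd lip by (intro C11I_convex) (auto simp: K_def)
  moreover have "R > 1" using \<eta> by (simp add: R_def)
  moreover have "\<forall>x. 0 \<le> \<theta> x \<and> \<theta> x \<le> 1" by (simp add: \<theta>_def smoothstep_range)
  ultimately show ?thesis using one zero log by blast
qed

subsection \<open>Flows of Lipschitz vector fields\<close>

text \<open>The function \<open>exp (- a * u) * \<phi> u\<close> has a nonpositive derivative
  between \<open>s\<close> and \<open>t\<close>. Neither \<open>a\<close> nor \<open>\<phi>\<close>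
  has a prescribed sign, so decay is covered as well as growth.\<close>

lemma gronwall:
  fixes \<phi> :: "real \<Rightarrow> real"
  assumes T: "is_interval T" and der: "\<And>t. t \<in> T \<Longrightarrow> (\<phi> has_real_derivative \<phi>' t) (at t within T)"
    and st: "s \<in> T" "t \<in> T" "s \<le> t" and le: "\<And>u. s \<le> u \<Longrightarrow> u \<le> t \<Longrightarrow> \<phi>' u \<le> a * \<phi> u"
  shows "\<phi> t \<le> exp (a * (t - s)) * \<phi> s"
proof (cases "s = t")
  case False
  then have "s < t" using st by simp
  have sub: "{s..t} \<subseteq> T"
    using mem_is_interval_1_I[OF T st(1,2)] by auto
  define \<psi> where "\<psi> u = exp (- a * u) * \<phi> u" for u
  have d: "(\<psi> has_real_derivative exp (- a * u) * (\<phi>' u - a * \<phi> u)) (at u within {s..t})" if "s \<le> u" "u \<le> t" for u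
  proof -
    have "(\<phi> has_real_derivative \<phi>' u) (at u within {s..t})"
      by (rule DERIV_subset[OF der sub]) (use sub that in auto)
    then show ?thesis
      unfolding \<psi>_def by (auto intro!: derivative_eq_intros simp: algebra_simps)
  qed
  have "\<exists>u\<in>{s<..<t}. \<psi> t - \<psi> s = (exp (- a * u) * (\<phi>' u - a * \<phi> u)) * (t - s)"
    by (rule mvt_simple[OF \<open>s < t\<close>]) (use d in \<open>simp add: has_field_derivative_def\<close>)
  then obtain u where u: "u \<in> {s<..<t}" "\<psi> t - \<psi> s = (exp (- a * u) * (\<phi>' u - a * \<phi> u)) * (t - s)"
    by blast
  have "(exp (- a * u) * (\<phi>' u - a * \<phi> u)) * (t - s) \<le> 0"
    using le[of u] u(1) \<open>s < t\<close> by (simp add: mult_nonneg_nonpos mult_nonpos_nonneg)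
  then have "\<psi> t \<le> \<psi> s" using u by linarith
  then have "exp (a * t) * (exp (- a * t) * \<phi> t) \<le> exp (a * t) * (exp (- a * s) * \<phi> s)"
    unfolding \<psi>_def by (intro mult_left_mono) auto
  then have "(exp (a * t) * exp (- a * t)) * \<phi> t \<le> (exp (a * t) * exp (- a * s)) * \<phi> s"
    by (simp only: mult.assoc)
  moreover have "a * t + - a * s = a * (t - s)" by (simp add: right_diff_distrib)
  ultimately show ?thesis by (simp flip: exp_add)
qed simp

lemma gronwall_backward:
  fixes \<phi> :: "real \<Rightarrow> real"
  assumes T: "is_interval T" and der: "\<And>t. t \<in> T \<Longrightarrow> (\<phi> has_real_derivative \<phi>' t) (at t within T)"
    and st: "s \<in> T" "t \<in> T" "s \<le> t" and le: "\<And>u. s \<le> u \<Longrightarrow> u \<le> t \<Longrightarrow> - a * \<phi> u \<le> \<phi>' u"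
  shows "\<phi> s \<le> exp (a * (t - s)) * \<phi> t"
proof -
  have "- \<phi> t \<le> exp (- a * (t - s)) * - \<phi> s"
  proof (rule gronwall[OF T _ st, where \<phi>' = "\<lambda>u. - \<phi>' u"])
    show "- \<phi>' u \<le> - a * - \<phi> u" if "s \<le> u" "u \<le> t" for u
      using le[OF that] by simp
  qed (use der in \<open>auto intro!: derivative_eq_intros\<close>)
  then have "exp (a * (t - s)) * (exp (- a * (t - s)) * \<phi> s) \<le> exp (a * (t - s)) * \<phi> t"
    by (intro mult_left_mono) auto
  then have "(exp (a * (t - s)) * exp (- a * (t - s))) * \<phi> s \<le> exp (a * (t - s)) * \<phi> t"
    by (simp only: mult.assoc)
  then show ?thesis by (simp flip: exp_add)
qed

lemma has_vector_derivative_union: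
  assumes "(f has_vector_derivative D) (at t within A)" "(f has_vector_derivative D) (at t within B)"
  shows "(f has_vector_derivative D) (at t within A \<union> B)"
  using assms unfolding has_vector_derivative_def has_derivative_within
  by (subst at_within_union) (auto intro: filterlim_sup)

lemma exp_integral:
  assumes "0 \<le> m" "a \<noteq> (0::real)"
  shows "((\<lambda>s. exp (a * s)) has_integral (exp (a * m) - 1) / a) {0..m}"
proof -
  have "((\<lambda>s. exp (a * s)) has_integral (exp (a * m) / a - exp (a * 0) / a)) {0..m}"
    using assms
    by (intro fundamental_theorem_of_calculus)
      (auto intro!: derivative_eq_intros simp: has_real_derivative_iff_has_vector_derivative[symmetric])
  then show ?thesis by (simp add: diff_divide_distrib)
qed

lemma norm_le_add3:
  fixes x :: "'a::real_normed_vector"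
  assumes "x = (a + b) - c" "norm b \<le> B" "norm c \<le> C"
  shows "norm x \<le> norm a + B + C"
  using norm_triangle_ineq4[of "a + b" c] norm_triangle_ineq[of a b] assms(2,3)
  unfolding assms(1) by linarith

locale lipschitz_field =
  fixes F :: "'a::euclidean_space \<Rightarrow> 'a" and L :: real
  assumes L: "0 \<le> L" and lip: "norm (F x - F y) \<le> L * norm (x - y)"
begin

lemma cont: "continuous_on S F"
  by (rule lipschitz_on_continuous_on[of L], rule lipschitz_onI) (auto simp: dist_norm lip L)

text \<open>The Picard operator acts on the weighted curves \<open>e\<^sup>-\<^sup>\<kappa>\<^sup>t u(t)\<close>, where it is a
  contraction globally in time.\<close>

lemma forward_solution:
  "\<exists>u. u 0 = x \<and> (\<forall>t\<ge>0. (u has_vector_derivative F (u t)) (at t within {0..}))"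
proof -
  \<comment> \<open>Any weight above \<open>L\<close> gives the contraction constant
    \<open>L / \<kappa> < 1\<close>.\<close>
  define \<kappa> where "\<kappa> = L + 1"
  have \<kappa>: "\<kappa> > 0" "L \<le> \<kappa>" "L / \<kappa> < 1" "0 \<le> L / \<kappa>" using L by (auto simp: \<kappa>_def)
  \<comment> \<open>The curves are frozen at negative times, so that the complete space of bounded
    continuous functions on the whole line can be used for a problem on the half line.\<close>
  define m where "m t = max 0 t" for t :: real
  define I where "I v t = x + integral {0..t} (\<lambda>s. F (exp (\<kappa> * s) *\<^sub>R v s))" for v :: "real \<Rightarrow> 'a" and t
  define P where "P v t = exp (- \<kappa> * m t) *\<^sub>R I v (m t)" for v :: "real \<Rightarrow> 'a" and t
  have contF: "continuous_on S (\<lambda>s. F (exp (\<kappa> * s) *\<^sub>R apply_bcontfun v s))" for S and v :: "real \<Rightarrow>\<^sub>C 'a"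
    by (intro continuous_on_compose2[OF cont[of UNIV]] continuous_intros) auto
  have int: "(\<lambda>s. F (exp (\<kappa> * s) *\<^sub>R apply_bcontfun v s)) integrable_on {0..t}" for v :: "real \<Rightarrow>\<^sub>C 'a" and t
    by (rule integrable_continuous_real[OF contF])
  have contI: "continuous_on {0..b} (I (apply_bcontfun v))" for v :: "real \<Rightarrow>\<^sub>C 'a" and b
    unfolding I_def[abs_def] by (intro continuous_intros indefinite_integral_continuous_1 int)
  have contI': "continuous_on {0..} (I (apply_bcontfun v))" for v :: "real \<Rightarrow>\<^sub>C 'a"
  proof (rule continuous_onI)
    fix t e :: real assume te: "t \<in> {0..}" "0 < e"
    have t: "t \<in> {0..t + 1}" using te by simp
    obtain d where d: "d > 0" "\<forall>s\<in>{0..t+1}. dist s t < d \<longrightarrow> dist (I (apply_bcontfun v) s) (I (apply_bcontfun v) t) < e"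
      using contI[of "t + 1" v, unfolded continuous_on_iff, rule_format, OF t te(2)] by blast
    show "\<exists>d>0. \<forall>s\<in>{0..}. dist s t < d \<longrightarrow> dist (I (apply_bcontfun v) s) (I (apply_bcontfun v) t) \<le> e"
      by (intro exI[of _ "min d 1"]) (use d in \<open>auto simp: dist_real_def less_imp_le\<close>)
  qed
  have contP: "continuous_on UNIV (P (apply_bcontfun v))" for v :: "real \<Rightarrow>\<^sub>C 'a"
    unfolding P_def[abs_def] m_def
    by (intro continuous_intros continuous_on_compose2[OF contI']) auto
  have bP: "norm (P (apply_bcontfun v) t) \<le> norm x + (norm (F 0) + L * norm v) / \<kappa>" for v :: "real \<Rightarrow>\<^sub>C 'a" and t
  proof -
    let ?m = "m t" and ?M = "norm (F 0) + L * norm v"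
    have m: "0 \<le> ?m" by (simp add: m_def)
    have alg: "a * (b + M * (a' / k)) = a * b + M / k * (a * a')" for a b M a' k :: real
      by (simp add: algebra_simps)
    have "norm (integral {0..?m} (\<lambda>s. F (exp (\<kappa> * s) *\<^sub>R apply_bcontfun v s)))
        \<le> integral {0..?m} (\<lambda>s. ?M * exp (\<kappa> * s))"
    proof (rule integral_norm_bound_integral[OF int])
      show "(\<lambda>s. ?M * exp (\<kappa> * s)) integrable_on {0..?m}"
        by (intro integrable_continuous_real continuous_intros)
      fix s assume "s \<in> {0..?m}"
      then have e: "1 \<le> exp (\<kappa> * s)" using \<kappa> by simp
      have "norm (F (exp (\<kappa> * s) *\<^sub>R apply_bcontfun v s)) \<le> norm (F 0) + L * (exp (\<kappa> * s) * norm (apply_bcontfun v s))"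
        using norm_triangle_sub[of "F (exp (\<kappa> * s) *\<^sub>R apply_bcontfun v s)" "F 0"]
          lip[of "exp (\<kappa> * s) *\<^sub>R apply_bcontfun v s" 0] by simp
      also have "\<dots> \<le> norm (F 0) * exp (\<kappa> * s) + L * (exp (\<kappa> * s) * norm v)"
        using e L norm_bounded[of v s] mult_left_mono[OF e norm_ge_zero[of "F 0"]]
        by (intro add_mono mult_left_mono) auto
      finally show "norm (F (exp (\<kappa> * s) *\<^sub>R apply_bcontfun v s)) \<le> ?M * exp (\<kappa> * s)"
        by (simp add: algebra_simps)
    qed
    also have "\<dots> = ?M * ((exp (\<kappa> * ?m) - 1) / \<kappa>)"
      using has_integral_mult_right[OF exp_integral[OF m, of \<kappa>], of ?M] \<kappa>
      by (intro integral_unique) auto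
    also have "\<dots> \<le> ?M * (exp (\<kappa> * ?m) / \<kappa>)"
      using \<kappa> L by (intro mult_left_mono divide_right_mono) auto
    finally have b: "norm (I (apply_bcontfun v) ?m) \<le> norm x + ?M * (exp (\<kappa> * ?m) / \<kappa>)"
      unfolding I_def by (rule norm_triangle_mono[OF order_refl])
    have "exp (- \<kappa> * ?m) * norm (I (apply_bcontfun v) ?m)
        \<le> exp (- \<kappa> * ?m) * (norm x + ?M * (exp (\<kappa> * ?m) / \<kappa>))"
      using b by (intro mult_left_mono) auto
    also have "\<dots> = exp (- \<kappa> * ?m) * norm x + ?M / \<kappa> * (exp (- \<kappa> * ?m) * exp (\<kappa> * ?m))"
      by (rule alg)
    also have "\<dots> \<le> 1 * norm x + ?M / \<kappa> * 1"
      using m \<kappa> by (intro add_mono mult_right_mono) (auto simp: exp_add[symmetric])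
    finally show ?thesis by (simp add: P_def)
  qed
  define Q where "Q v = Bcontfun (P (apply_bcontfun v))" for v :: "real \<Rightarrow>\<^sub>C 'a"
  have Q: "apply_bcontfun (Q v) = P (apply_bcontfun v)" for v
    unfolding Q_def by (rule Bcontfun_inverse) (rule bcontfun_normI[OF contP bP])
  have contr: "dist (Q v) (Q w) \<le> L / \<kappa> * dist v w" for v w
  proof (rule dist_bound)
    fix t
    let ?m = "m t"
    have m: "0 \<le> ?m" by (simp add: m_def)
    have "I (apply_bcontfun v) ?m - I (apply_bcontfun w) ?m
      = integral {0..?m} (\<lambda>s. F (exp (\<kappa> * s) *\<^sub>R apply_bcontfun v s) - F (exp (\<kappa> * s) *\<^sub>R apply_bcontfun w s))"
      unfolding I_def by (simp add: integral_diff[OF int int])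
    also have "norm \<dots> \<le> integral {0..?m} (\<lambda>s. (L * dist v w) * exp (\<kappa> * s))"
    proof (rule integral_norm_bound_integral)
      show "(\<lambda>s. F (exp (\<kappa> * s) *\<^sub>R apply_bcontfun v s) - F (exp (\<kappa> * s) *\<^sub>R apply_bcontfun w s)) integrable_on {0..?m}"
        by (intro integrable_diff int)
      show "(\<lambda>s. (L * dist v w) * exp (\<kappa> * s)) integrable_on {0..?m}"
        by (intro integrable_continuous_real continuous_intros)
      fix s
      have "norm (F (exp (\<kappa> * s) *\<^sub>R apply_bcontfun v s) - F (exp (\<kappa> * s) *\<^sub>R apply_bcontfun w s))
          \<le> L * norm (exp (\<kappa> * s) *\<^sub>R (apply_bcontfun v s - apply_bcontfun w s))"
        unfolding scaleR_diff_right by (rule lip)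
      also have "\<dots> \<le> L * (exp (\<kappa> * s) * dist v w)"
        using L dist_bounded[of v s w] by (intro mult_left_mono) (auto simp: dist_norm)
      finally show "norm (F (exp (\<kappa> * s) *\<^sub>R apply_bcontfun v s) - F (exp (\<kappa> * s) *\<^sub>R apply_bcontfun w s))
          \<le> (L * dist v w) * exp (\<kappa> * s)" by (simp add: mult_ac)
    qed
    also have "\<dots> = (L * dist v w) * ((exp (\<kappa> * ?m) - 1) / \<kappa>)"
      using has_integral_mult_right[OF exp_integral[OF m, of \<kappa>], of "L * dist v w"] \<kappa>
      by (intro integral_unique) auto
    also have "\<dots> \<le> (L * dist v w) * (exp (\<kappa> * ?m) / \<kappa>)"
      using \<kappa> L by (intro mult_left_mono divide_right_mono) auto
    finally have b: "norm (I (apply_bcontfun v) ?m - I (apply_bcontfun w) ?m) \<le> (L * dist v w) * (exp (\<kappa> * ?m) / \<kappa>)" .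
    have "dist (P (apply_bcontfun v) t) (P (apply_bcontfun w) t)
        = exp (- \<kappa> * ?m) * norm (I (apply_bcontfun v) ?m - I (apply_bcontfun w) ?m)"
      by (simp add: P_def dist_norm scaleR_diff_right[symmetric])
    also have "\<dots> \<le> exp (- \<kappa> * ?m) * ((L * dist v w) * (exp (\<kappa> * ?m) / \<kappa>))"
      using b by (intro mult_left_mono) auto
    also have "\<dots> = L / \<kappa> * dist v w * (exp (- \<kappa> * ?m) * exp (\<kappa> * ?m))"
      by simp
    finally show "dist (apply_bcontfun (Q v) t) (apply_bcontfun (Q w) t) \<le> L / \<kappa> * dist v w"
      by (simp add: Q exp_add[symmetric])
  qed
  have "\<exists>!v. Q v = v"
    by (rule banach_fix_type[OF \<kappa>(4,3)]) (use contr in blast)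
  then obtain v where v: "Q v = v" by blast
  define u where "u t = exp (\<kappa> * m t) *\<^sub>R apply_bcontfun v t" for t
  have uI: "u t = I (apply_bcontfun v) t" if "0 \<le> t" for t
  proof -
    have "apply_bcontfun v t = exp (- \<kappa> * t) *\<^sub>R I (apply_bcontfun v) t"
      using that arg_cong[OF v, of "\<lambda>v. apply_bcontfun v t"] by (simp add: Q P_def m_def)
    then show ?thesis using that by (simp add: u_def m_def exp_add[symmetric])
  qed
  have der: "(u has_vector_derivative F (u t)) (at t within {0..b})" if "0 \<le> t" "t \<le> b" for t b
  proof -
    have "(I (apply_bcontfun v) has_vector_derivative F (exp (\<kappa> * t) *\<^sub>R apply_bcontfun v t)) (at t within {0..b})"
      unfolding I_def[abs_def] using that
      by (auto intro!: derivative_eq_intros integral_has_vector_derivative contF)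
    then have "(u has_vector_derivative F (exp (\<kappa> * t) *\<^sub>R apply_bcontfun v t)) (at t within {0..b})"
      by (rule has_vector_derivative_transform[rotated 2]) (use that uI in auto)
    then show ?thesis using that by (simp add: u_def m_def)
  qed
  have "(u has_vector_derivative F (u t)) (at t within {0..})" if "0 \<le> t" for t
  proof -
    have "at t within {0..} = at t within {0..t + 1}"
      by (rule at_within_nhd[of t "{..<t+1}"]) auto
    then show ?thesis using der[of t "t + 1"] that by simp
  qed
  moreover have "u 0 = x" using uI[of 0] by (simp add: I_def)
  ultimately show ?thesis by blast
qed

lemma unique:
  assumes T: "is_interval T" "0 \<in> T" "t \<in> T"
    and u: "\<And>t. t \<in> T \<Longrightarrow> (u has_vector_derivative F (u t)) (at t within T)"
    and v: "\<And>t. t \<in> T \<Longrightarrow> (v has_vector_derivative F (v t)) (at t within T)"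
    and "u 0 = v 0"
  shows "u t = v t"
proof -
  define \<phi> where "\<phi> t = (u t - v t) \<bullet> (u t - v t)" for t
  have der: "(\<phi> has_real_derivative 2 * ((u t - v t) \<bullet> (F (u t) - F (v t)))) (at t within T)" if "t \<in> T" for t
  proof -
    have "((\<lambda>t. u t - v t) has_vector_derivative F (u t) - F (v t)) (at t within T)"
      using u[OF that] v[OF that] by (rule has_vector_derivative_diff)
    from has_derivative_inner[OF this[unfolded has_vector_derivative_def] this[unfolded has_vector_derivative_def]]
    show ?thesis
      unfolding \<phi>_def has_field_derivative_def
      by (rule has_derivative_eq_rhs) (auto simp: fun_eq_iff inner_commute algebra_simps)
  qed
  have bd: "\<bar>2 * ((u t - v t) \<bullet> (F (u t) - F (v t)))\<bar> \<le> (2 * L) * \<phi> t" for t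
  proof -
    have "\<bar>(u t - v t) \<bullet> (F (u t) - F (v t))\<bar> \<le> norm (u t - v t) * (L * norm (u t - v t))"
      using Cauchy_Schwarz_ineq2 mult_left_mono[OF lip norm_ge_zero] order_trans by blast
    then have "2 * \<bar>(u t - v t) \<bullet> (F (u t) - F (v t))\<bar> \<le> 2 * (norm (u t - v t) * (L * norm (u t - v t)))"
      by simp
    also have "\<dots> = (2 * L) * \<phi> t"
      by (simp add: \<phi>_def power2_norm_eq_inner[symmetric] power2_eq_square)
    finally show ?thesis by (simp add: abs_mult)
  qed
  have z: "\<phi> 0 = 0" using assms by (simp add: \<phi>_def)
  have "\<phi> t \<le> 0"
  proof (cases "0 \<le> t")
    case True
    have "\<phi> t \<le> exp (2 * L * (t - 0)) * \<phi> 0"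
      by (rule gronwall[OF T(1) der T(2,3) True]) (use bd abs_le_D1 in blast)+
    then show ?thesis using z by simp
  next
    case False
    have "\<phi> t \<le> exp (2 * L * (0 - t)) * \<phi> 0"
    proof (rule gronwall_backward[OF T(1) der T(3,2)])
      show "- (2 * L) * \<phi> r \<le> 2 * ((u r - v r) \<bullet> (F (u r) - F (v r)))" for r
        using bd[of r] by linarith
    qed (use False in auto)
    then show ?thesis using z by simp
  qed
  moreover have "\<phi> t \<ge> 0" by (simp add: \<phi>_def)
  ultimately have "\<phi> t = 0" by simp
  then show ?thesis by (simp add: \<phi>_def)
qed

lemma reverse: "lipschitz_field (\<lambda>x. - F x) L"
  using L lip by unfold_locales (auto simp: norm_minus_commute)

definition flow :: "real \<Rightarrow> 'a \<Rightarrow> 'a" where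
  "flow t x = (SOME u. u 0 = x \<and> (\<forall>t. (u has_vector_derivative F (u t)) (at t))) t"

lemma solution_exists: "\<exists>u. u 0 = x \<and> (\<forall>t. (u has_vector_derivative F (u t)) (at t))"
proof -
  interpret rev: lipschitz_field "\<lambda>x. - F x" L by (rule reverse)
  obtain u where u: "u 0 = x" "\<And>t. t \<ge> 0 \<Longrightarrow> (u has_vector_derivative F (u t)) (at t within {0..})"
    using forward_solution by blast
  obtain v where v: "v 0 = x" "\<And>t. t \<ge> 0 \<Longrightarrow> (v has_vector_derivative - F (v t)) (at t within {0..})"
    using rev.forward_solution by blast
  define w where "w t = (if 0 \<le> t then u t else v (- t))" for t
  have w1: "(w has_vector_derivative F (w t)) (at t within {0..})" if "0 \<le> t" for t
  proof -
    have "(w has_vector_derivative F (u t)) (at t within {0..})"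
      by (rule has_vector_derivative_transform[OF _ _ u(2)[OF that]]) (use that in \<open>auto simp: w_def\<close>)
    then show ?thesis using that by (simp add: w_def)
  qed
  have w2: "(w has_vector_derivative F (w t)) (at t within {..0})" if "t \<le> 0" for t
  proof -
    have "((v \<circ> uminus) has_vector_derivative (- 1) *\<^sub>R (- F (v (- t)))) (at t within {..0})"
    proof (rule vector_diff_chain_within)
      show "(uminus has_vector_derivative - 1) (at t within {..0})"
        by (auto intro!: derivative_eq_intros)
      have "uminus ` {..0::real} = {0..}" by force
      then show "(v has_vector_derivative - F (v (- t))) (at (- t) within uminus ` {..0})"
        using v(2)[of "- t"] that by simp
    qed
    then have "((v \<circ> uminus) has_vector_derivative F (w t)) (at t within {..0})"
      using that u(1) v(1) by (cases "t = 0") (auto simp: w_def)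
    then show ?thesis
      by (rule has_vector_derivative_transform[rotated 2]) (use that u v in \<open>auto simp: w_def\<close>)
  qed
  have "(w has_vector_derivative F (w t)) (at t)" for t
  proof -
    consider "t < 0" | "t = 0" | "0 < t" by linarith
    then show ?thesis
    proof cases
      case 1
      then show ?thesis using w2[of t] at_within_open_subset[of t "{..<0}" "{..0}"] by force
    next
      case 2
      have "{0..} \<union> {..0} = (UNIV :: real set)" by auto
      then show ?thesis using has_vector_derivative_union[OF w1 w2, of t] 2 by simp
    next
      case 3
      then show ?thesis using w1[of t] at_within_open_subset[of t "{0<..}" "{0..}"] by force
    qed
  qed
  moreover have "w 0 = x" by (simp add: w_def u)
  ultimately show ?thesis by blast
qed

lemma flow_0 [simp]: "flow 0 x = x"
  and flow_der: "((\<lambda>t. flow t x) has_vector_derivative F (flow t x)) (at t)"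
proof -
  have "flow 0 x = x \<and> (\<forall>t. ((\<lambda>t. flow t x) has_vector_derivative F (flow t x)) (at t))"
    using someI_ex[OF solution_exists[of x]] unfolding flow_def .
  then show "flow 0 x = x" "((\<lambda>t. flow t x) has_vector_derivative F (flow t x)) (at t)"
    by auto
qed

lemma flow_unique:
  assumes "is_interval T" "0 \<in> T" "t \<in> T"
    and "\<And>t. t \<in> T \<Longrightarrow> (u has_vector_derivative F (u t)) (at t within T)"
  shows "u t = flow t (u 0)"
  by (rule unique[OF assms(1-4)]) (simp_all add: has_vector_derivative_at_within flow_der)

lemma flow_add: "flow (s + t) x = flow s (flow t x)"
proof -
  have der: "((\<lambda>s. flow (s + t) x) has_vector_derivative F (flow (r + t) x)) (at r)" for r
  proof -
    have "((\<lambda>t. flow t x) \<circ> (\<lambda>s. s + t) has_vector_derivative 1 *\<^sub>R F (flow (r + t) x)) (at r)"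
      by (rule vector_diff_chain_at) (auto intro!: derivative_eq_intros flow_der)
    then show ?thesis by (simp add: o_def)
  qed
  have "flow (s + t) x = flow s (flow (0 + t) x)"
    by (rule flow_unique[of UNIV s "\<lambda>s. flow (s + t) x"]) (simp_all add: der)
  then show ?thesis by simp
qed

lemma flow_minus [simp]: "flow (- t) (flow t x) = x" "flow t (flow (- t) x) = x"
  by (simp_all flip: flow_add)

lemma flow_continuous: "continuous_on S (\<lambda>t. flow t x)"
  by (rule continuous_on_vector_derivative[OF has_vector_derivative_at_within[OF flow_der]])

lemma flow_rev: "lipschitz_field.flow (\<lambda>x. - F x) t x = flow (- t) x"
proof -
  interpret rev: lipschitz_field "\<lambda>x. - F x" L by (rule reverse)
  have der: "((\<lambda>t. flow (- t) x) has_vector_derivative - F (flow (- r) x)) (at r)" for r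
  proof -
    have "((\<lambda>t. flow t x) \<circ> uminus has_vector_derivative (- 1) *\<^sub>R F (flow (- r) x)) (at r)"
      by (rule vector_diff_chain_at) (auto intro!: derivative_eq_intros flow_der)
    then show ?thesis by (simp add: o_def)
  qed
  have "flow (- t) x = rev.flow t (flow (- 0) x)"
    by (rule rev.flow_unique[of UNIV t "\<lambda>t. flow (- t) x"]) (simp_all add: der)
  then show ?thesis by simp
qed

text \<open>Consistency and stability: a step of length \<open>h\<close> errs by at most
  \<open>L * B * h\<^sup>2\<close>, where \<open>B\<close> bounds the speed along the exact
  solution, and amplifies the previous error by at most \<open>1 + h * L\<close>. With
  \<open>n * h = t\<close> the total error is of order \<open>h\<close>.\<close>

lemma euler_converges:
  assumes t: "0 \<le> t"
  shows "(\<lambda>m. ((\<lambda>y. y + (t / real (Suc m)) *\<^sub>R F y) ^^ Suc m) x) \<longlonglongrightarrow> flow t x"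
proof -
  have "compact ((\<lambda>s. F (flow s x)) ` {0..t})"
    by (intro compact_continuous_image continuous_on_compose2[OF cont[of UNIV] flow_continuous]) auto
  then obtain B where B: "\<And>s. 0 \<le> s \<Longrightarrow> s \<le> t \<Longrightarrow> norm (F (flow s x)) \<le> B" "B \<ge> 0"
  proof -
    have "bounded ((\<lambda>s. F (flow s x)) ` {0..t})"
      using \<open>compact ((\<lambda>s. F (flow s x)) ` {0..t})\<close> by (rule compact_imp_bounded)
    then obtain B where "B > 0" "\<forall>y\<in>(\<lambda>s. F (flow s x)) ` {0..t}. norm y \<le> B"
      using bounded_pos by metis
    then show ?thesis by (intro that[of B]) auto
  qed
  have step: "norm (flow (s + h) x - flow s x - h *\<^sub>R F (flow s x)) \<le> L * B * h\<^sup>2"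
    if "0 \<le> s" "0 \<le> h" "s + h \<le> t" for s h
  proof -
    have "norm (flow (s + h) x - flow s x - (s + h - s) *\<^sub>R F (flow s x)) \<le> norm (s + h - s) * (L * B * h)"
    proof (rule vector_differentiable_bound_linearization[of "{s..s+h}"])
      show "((\<lambda>t. flow t x) has_vector_derivative F (flow r x)) (at r within {s..s+h})" for r
        by (rule has_vector_derivative_at_within[OF flow_der])
      show "closed_segment s (s + h) \<subseteq> {s..s+h}" "s \<in> {s..s+h}"
        using that by (auto simp: closed_segment_eq_real_ivl)
      fix r assume r: "r \<in> {s..s+h}"
      have "norm (flow r x - flow s x) \<le> B * norm (r - s)"
      proof (rule derivative_bound_lipschitz)
        show "convex {s..s+h}" by simp
        show "((\<lambda>t. flow t x) has_derivative (\<lambda>h. h *\<^sub>R F (flow y x))) (at y)" for y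
          using flow_der[of x y] by (simp add: has_vector_derivative_def)
        show "norm (k *\<^sub>R F (flow y x)) \<le> B * norm k" if "y \<in> {s..s+h}" for y k
          using B(1)[of y] that \<open>0 \<le> s\<close> \<open>s + h \<le> t\<close>
            mult_right_mono[of "norm (F (flow y x))" B "\<bar>k\<bar>"] by (simp add: mult.commute)
      qed (use B r that in auto)
      also have "\<dots> \<le> B * h" using r B by (intro mult_left_mono) auto
      finally show "norm (F (flow r x) - F (flow s x)) \<le> L * B * h"
        using order_trans[OF lip mult_left_mono[OF _ L]] by (simp add: mult.assoc)
    qed
    then show ?thesis using that by (simp add: power2_eq_square mult_ac)
  qed
  have err: "norm (((\<lambda>y. y + h *\<^sub>R F y) ^^ n) x - flow (real n * h) x) \<le> real n * (L * B * h\<^sup>2) * (1 + h * L) ^ n"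
    if "0 \<le> h" "real n * h \<le> t" for h n
    using that
  proof (induction n)
    case (Suc n)
    let ?E = "((\<lambda>y. y + h *\<^sub>R F y) ^^ n) x" and ?f = "flow (real n * h) x"
    have le: "real n * h \<le> t" using Suc.prems by (simp add: algebra_simps)
    have IH: "norm (?E - ?f) \<le> real n * (L * B * h\<^sup>2) * (1 + h * L) ^ n"
      using Suc.IH Suc.prems le by simp
    have s: "norm (flow (real n * h + h) x - ?f - h *\<^sub>R F ?f) \<le> L * B * h\<^sup>2"
      using Suc.prems by (intro step) (auto simp: algebra_simps)
    have l: "norm (h *\<^sub>R (F ?E - F ?f)) \<le> h * L * norm (?E - ?f)"
      using mult_left_mono[OF lip Suc.prems(1), of ?E ?f] Suc.prems(1) by (simp add: mult.assoc)
    have eq: "flow (real (Suc n) * h) x = flow (real n * h + h) x" by (simp add: algebra_simps)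
    have "((\<lambda>y. y + h *\<^sub>R F y) ^^ Suc n) x - flow (real (Suc n) * h) x
        = ((?E - ?f) + h *\<^sub>R (F ?E - F ?f)) - (flow (real n * h + h) x - ?f - h *\<^sub>R F ?f)"
      unfolding eq by (simp add: algebra_simps)
    then have "norm (((\<lambda>y. y + h *\<^sub>R F y) ^^ Suc n) x - flow (real (Suc n) * h) x)
        \<le> norm (?E - ?f) + h * L * norm (?E - ?f) + L * B * h\<^sup>2"
      using l s by (rule norm_le_add3)
    also have "\<dots> = (1 + h * L) * norm (?E - ?f) + L * B * h\<^sup>2" by (simp add: algebra_simps)
    also have "\<dots> \<le> (1 + h * L) * (real n * (L * B * h\<^sup>2) * (1 + h * L) ^ n) + L * B * h\<^sup>2 * (1 + h * L) ^ Suc n"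
    proof (intro add_mono mult_left_mono IH)
      have "1 \<le> (1 + h * L) ^ Suc n" using Suc.prems(1) L by (intro one_le_power) simp
      then show "L * B * h\<^sup>2 \<le> L * B * h\<^sup>2 * (1 + h * L) ^ Suc n"
        using L B mult_left_mono[of 1 "(1 + h * L) ^ Suc n" "L * B * h\<^sup>2"] by simp
    qed (use Suc.prems(1) L in auto)
    also have "\<dots> = real (Suc n) * (L * B * h\<^sup>2) * (1 + h * L) ^ Suc n"
      by (simp add: algebra_simps)
    finally show ?case .
  qed simp
  define C where "C = t\<^sup>2 * L * B * exp (t * L)"
  have "norm (((\<lambda>y. y + (t / real (Suc m)) *\<^sub>R F y) ^^ Suc m) x - flow t x) \<le> C * inverse (real (Suc m))" for m
  proof -
    let ?h = "t / real (Suc m)"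
    have h: "0 \<le> ?h" "real (Suc m) * ?h = t" using t by auto
    have "(1 + ?h * L) ^ Suc m \<le> exp (?h * L) ^ Suc m"
      by (rule power_mono[OF exp_ge_add_one_self]) (use mult_nonneg_nonneg[OF h(1), of L] L in linarith)
    also have "\<dots> = exp (t * L)"
      using h by (simp add: exp_of_nat_mult[symmetric] del: of_nat_Suc power_Suc)
    finally have "real (Suc m) * (L * B * ?h\<^sup>2) * (1 + ?h * L) ^ Suc m \<le> real (Suc m) * (L * B * ?h\<^sup>2) * exp (t * L)"
      using L B by (intro mult_left_mono) auto
    also have "\<dots> = C * inverse (real (Suc m))"
    proof -
      have "N * (L * B * (t / N)\<^sup>2) * e = t\<^sup>2 * L * B * e * inverse N" if "N \<noteq> 0" for N e :: real
        using that by (simp add: power2_eq_square field_simps)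
      from this[of "real (Suc m)" "exp (t * L)"] show ?thesis by (simp add: C_def)
    qed
    finally show ?thesis
      using err[OF h(1), of "Suc m"] h(2) by simp
  qed
  then have "\<forall>\<^sub>F m in sequentially. norm (((\<lambda>y. y + (t / real (Suc m)) *\<^sub>R F y) ^^ Suc m) x - flow t x) \<le> C * inverse (real (Suc m))"
    by (rule always_eventually[OF allI])
  moreover have "(\<lambda>m. C * inverse (real (Suc m))) \<longlonglongrightarrow> C * 0"
    by (intro tendsto_intros LIMSEQ_inverse_real_of_nat)
  ultimately have "(\<lambda>m. ((\<lambda>y. y + (t / real (Suc m)) *\<^sub>R F y) ^^ Suc m) x - flow t x) \<longlonglongrightarrow> 0"
    by (simp add: Lim_null_comparison)
  then show ?thesis by (rule LIM_zero_cancel)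
qed

end

text \<open>The Euler approximations of the time-\<open>t\<close> map have derivatives with uniformly bounded
  Lipschitz constants, which makes the variational equation unnecessary.\<close>

lemma C11_euler_power:
  fixes F :: "'a::real_normed_vector \<Rightarrow> 'a"
  assumes F: "C11 F F' UNIV L K" and h: "0 \<le> h"
  shows "\<exists>f'. C11 ((\<lambda>y. y + h *\<^sub>R F y) ^^ n) f' UNIV ((1 + h * L) ^ n) (real n * (h * K) * (1 + h * L) ^ (2 * n))"
proof (induction n)
  case 0
  have "C11 (\<lambda>x :: 'a. x) (\<lambda>x h. h) UNIV 1 0"
    using C11_bounded_linear[OF bounded_linear_ident, of 1 UNIV] by simp
  then show ?case by (auto simp: id_def)
next
  case (Suc n)
  note C = C11D(1,2)[OF F]
  have id: "C11 (\<lambda>x :: 'a. x) (\<lambda>x h. h) UNIV 1 0"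
    using C11_bounded_linear[OF bounded_linear_ident, of 1 UNIV] by simp
  have sc: "C11 (\<lambda>y :: 'a. h *\<^sub>R y) (\<lambda>_ y. h *\<^sub>R y) UNIV h 0"
    using h by (intro C11_bounded_linear bounded_linear_scaleR_right) auto
  have hF: "C11 (\<lambda>y. h *\<^sub>R F y) (\<lambda>y k. h *\<^sub>R F' y k) UNIV (h * L) (h * K)"
    using C11_compose[OF F sc] by simp
  have E: "C11 (\<lambda>y. y + h *\<^sub>R F y) (\<lambda>y k. k + h *\<^sub>R F' y k) UNIV (1 + h * L) (h * K)"
    using C11_add[OF id hF] by simp
  obtain f' where f: "C11 ((\<lambda>y. y + h *\<^sub>R F y) ^^ n) f' UNIV ((1 + h * L) ^ n) (real n * (h * K) * (1 + h * L) ^ (2 * n))"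
    using Suc by blast
  let ?a = "1 + h * L"
  have a: "1 \<le> ?a" using h C by simp
  have b: "0 \<le> h * K" using h C by simp
  have "?a * (real n * (h * K) * ?a ^ (2 * n)) + h * K * (?a ^ n)\<^sup>2 \<le> real (Suc n) * (h * K) * ?a ^ (2 * Suc n)"
  proof -
    have p: "?a ^ (2 * n) * ?a \<le> ?a ^ (2 * Suc n)" "?a ^ (2 * n) \<le> ?a ^ (2 * Suc n)"
    proof -
      have "?a ^ (2 * n) * ?a = ?a ^ Suc (2 * n)" by (simp only: power_Suc mult.commute)
      then show "?a ^ (2 * n) * ?a \<le> ?a ^ (2 * Suc n)"
        by (simp only:) (rule power_increasing[OF _ a], simp)
      show "?a ^ (2 * n) \<le> ?a ^ (2 * Suc n)"
        by (rule power_increasing[OF _ a]) simp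
    qed
    have "?a * (real n * (h * K) * ?a ^ (2 * n)) + h * K * (?a ^ n)\<^sup>2
      = real n * (h * K) * (?a ^ (2 * n) * ?a) + h * K * ?a ^ (2 * n)"
      unfolding power_even_eq by (simp only: mult_ac)
    also have "\<dots> \<le> real n * (h * K) * ?a ^ (2 * Suc n) + h * K * ?a ^ (2 * Suc n)"
      using p b by (intro add_mono mult_left_mono) auto
    also have "\<dots> = real (Suc n) * (h * K) * ?a ^ (2 * Suc n)"
      by (simp only: of_nat_Suc distrib_right mult_1_left add.commute)
    finally show ?thesis .
  qed
  then have "C11 (\<lambda>x. (\<lambda>y. y + h *\<^sub>R F y) (((\<lambda>y. y + h *\<^sub>R F y) ^^ n) x))
      (\<lambda>x k. f' x k + h *\<^sub>R F' (((\<lambda>y. y + h *\<^sub>R F y) ^^ n) x) (f' x k)) UNIV (?a ^ Suc n) (real (Suc n) * (h * K) * ?a ^ (2 * Suc n))"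
    by (intro C11_mono[OF C11_compose[OF f E]]) simp_all
  then show ?case
    unfolding funpow.simps(2) comp_def by blast
qed

text \<open>For \<open>n * h = t\<close> the bound \<open>(1 + h * M) ^ n \<le> exp (t * M)\<close>
  makes the constants of the Euler maps independent of the number of steps, so they survive in the
  pointwise limit.\<close>

lemma (in lipschitz_field) flow_C11_nonneg:
  assumes F: "C11 F F' UNIV M K" and t: "0 \<le> t"
  shows "\<exists>f' L' K'. C11 (flow t) f' UNIV L' K'"
proof -
  note C = C11D(1,2)[OF F]
  define f where "f m = (\<lambda>y. y + (t / real (Suc m)) *\<^sub>R F y) ^^ Suc m" for m
  have "\<exists>f'. C11 (f m) f' UNIV (exp (t * M)) (t * K * exp (2 * (t * M)))" for m
  proof -
    let ?h = "t / real (Suc m)"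
    have h: "0 \<le> ?h" "real (Suc m) * ?h = t" using t by auto
    obtain f' where f': "C11 (f m) f' UNIV ((1 + ?h * M) ^ Suc m) (real (Suc m) * (?h * K) * (1 + ?h * M) ^ (2 * Suc m))"
      unfolding f_def using C11_euler_power[OF F h(1)] by blast
    have e: "(1 + ?h * M) ^ Suc m \<le> exp (t * M)"
    proof -
      have "(1 + ?h * M) ^ Suc m \<le> exp (?h * M) ^ Suc m"
      by (rule power_mono[OF exp_ge_add_one_self]) (use mult_nonneg_nonneg[OF h(1), of M] C(1) in linarith)
      also have "\<dots> = exp (t * M)"
        using h by (simp add: exp_of_nat_mult[symmetric] del: of_nat_Suc power_Suc)
      finally show ?thesis .
    qed
    have "(1 + ?h * M) ^ (2 * Suc m) = ((1 + ?h * M) ^ Suc m)\<^sup>2"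
      by (rule power_even_eq)
    also have "\<dots> \<le> (exp (t * M))\<^sup>2" 
      by (rule power_mono[OF e zero_le_power]) (use mult_nonneg_nonneg[OF h(1), of M] C(1) in linarith)
    also have "\<dots> = exp (2 * (t * M))" by (simp add: exp_double)
    finally have "(t * K) * (1 + ?h * M) ^ (2 * Suc m) \<le> t * K * exp (2 * (t * M))"
      using t C by (intro mult_left_mono) auto
    moreover have "real (Suc m) * (?h * K) = t * K" by simp
    ultimately show ?thesis using C11_mono[OF f' e] by auto
  qed
  then obtain f' where f': "\<And>m. C11 (f m) (f' m) UNIV (exp (t * M)) (t * K * exp (2 * (t * M)))"
    by metis
  have "(\<lambda>m. f m x) \<longlonglongrightarrow> flow t x" for x
    unfolding f_def by (rule euler_converges[OF t])
  from C11_pointwise_limit[OF f' this] show ?thesis by blast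
qed

lemma (in lipschitz_field) flow_C11:
  assumes F: "C11 F F' UNIV M K"
  shows "\<exists>f' L' K'. C11 (flow t) f' UNIV L' K'"
proof (cases "0 \<le> t")
  case True
  then show ?thesis using flow_C11_nonneg[OF F] by blast
next
  case False
  interpret rev: lipschitz_field "\<lambda>x. - F x" L by (rule reverse)
  have "C11 (\<lambda>y :: 'a. - y) (\<lambda>_ y. - y) UNIV 1 0"
    by (intro C11_bounded_linear bounded_linear_minus bounded_linear_ident) auto
  from C11_compose[OF F this] have C: "C11 (\<lambda>x. - F x) (\<lambda>x k. - F' x k) UNIV M K" by simp
  have "rev.flow (- t) = flow t"
    by (simp add: flow_rev fun_eq_iff)
  moreover have "\<exists>f' L' K'. C11 (rev.flow (- t)) f' UNIV L' K'"
    by (rule rev.flow_C11_nonneg[OF C]) (use False in simp)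
  ultimately show ?thesis by simp
qed

subsection \<open>Asymptotic phase\<close>

lemma quadratic_form_derivative:
  fixes B :: "'a::real_normed_vector \<Rightarrow> 'a \<Rightarrow> real"
  assumes B: "bounded_bilinear B" "\<And>u v. B u v = B v u"
    and u: "(u has_vector_derivative u') (at t within S)"
  shows "((\<lambda>t. B (u t) (u t)) has_real_derivative 2 * B (u t) u') (at t within S)"
proof -
  have "((\<lambda>t. B (u t) (u t)) has_vector_derivative B (u t) u' + B u' (u t)) (at t within S)"
    by (rule bounded_bilinear.has_vector_derivative[OF B(1) u u])
  then show ?thesis
    using B(2)[of u' "u t"] by (simp add: has_real_derivative_iff_has_vector_derivative)
qed

lemma form_growth:
  fixes B :: "'a::real_normed_vector \<Rightarrow> 'a \<Rightarrow> real" and u :: "real \<Rightarrow> 'a"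
  assumes B: "bounded_bilinear B" "\<And>u v. B u v = B v u"
    and u: "\<And>t. (u has_vector_derivative u' t) (at t)"
  shows "0 \<le> t \<Longrightarrow> (\<And>s. 0 \<le> s \<Longrightarrow> B (u s) (u' s) \<le> r * B (u s) (u s)) \<Longrightarrow>
      B (u t) (u t) \<le> exp (2 * r * t) * B (u 0) (u 0)"
    and "t \<le> 0 \<Longrightarrow> (\<And>s. s \<le> 0 \<Longrightarrow> - r * B (u s) (u s) \<le> B (u s) (u' s)) \<Longrightarrow>
      B (u t) (u t) \<le> exp (2 * r * \<bar>t\<bar>) * B (u 0) (u 0)"
proof -
  have d: "((\<lambda>t. B (u t) (u t)) has_real_derivative 2 * B (u t) (u' t)) (at t within UNIV)" for t
    by (rule quadratic_form_derivative[OF B u])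
  show "B (u t) (u t) \<le> exp (2 * r * t) * B (u 0) (u 0)"
    if "0 \<le> t" "\<And>s. 0 \<le> s \<Longrightarrow> B (u s) (u' s) \<le> r * B (u s) (u s)"
  proof -
    have "B (u t) (u t) \<le> exp ((2 * r) * (t - 0)) * B (u 0) (u 0)"
      by (rule gronwall[OF is_interval_univ d UNIV_I UNIV_I that(1)]) (use that(2) in simp)
    then show ?thesis by simp
  qed
  show "B (u t) (u t) \<le> exp (2 * r * \<bar>t\<bar>) * B (u 0) (u 0)"
    if "t \<le> 0" "\<And>s. s \<le> 0 \<Longrightarrow> - r * B (u s) (u s) \<le> B (u s) (u' s)"
  proof -
    have "B (u t) (u t) \<le> exp ((2 * r) * (0 - t)) * B (u 0) (u 0)"
    proof (rule gronwall_backward[OF is_interval_univ d UNIV_I UNIV_I that(1)])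
      show "- (2 * r) * B (u s) (u s) \<le> 2 * B (u s) (u' s)" if "s \<le> 0" for s
        using \<open>\<And>s. s \<le> 0 \<Longrightarrow> - r * B (u s) (u s) \<le> B (u s) (u' s)\<close>[OF that] by linarith
    qed
    then show ?thesis using that(1) by simp
  qed
qed

text \<open>The Lipschitz constants \<open>a\<^sub>n\<close> of the derivatives obey
  \<open>a\<^sub>n\<^sub>+\<^sub>1 = \<mu> * a\<^sub>n + K * \<mu> ^ (2 * n)\<close>, and the factor
  \<open>K / (\<mu> * (\<mu> - 1))\<close> is chosen so that \<open>\<mu> ^ (2 * n)\<close> times it
  solves this recursion exactly. The uncontrolled \<open>K\<close> stays outside the exponential
  rate.\<close>

lemma C11_power:
  fixes f :: "'a::real_normed_vector \<Rightarrow> 'a"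
  assumes f: "C11 f f' UNIV \<mu> K" and \<mu>: "1 < \<mu>"
  shows "\<exists>h. C11 (f ^^ n) h UNIV (\<mu> ^ n) (K / (\<mu> * (\<mu> - 1)) * \<mu> ^ (2 * n))"
proof (induction n)
  case 0
  have id: "C11 (f ^^ 0) (\<lambda>x h. h) UNIV 1 0"
    unfolding funpow.simps id_def using C11_bounded_linear[OF bounded_linear_ident, of 1 UNIV] by simp
  have "0 \<le> K / (\<mu> * (\<mu> - 1)) * \<mu> ^ (2 * 0)"
    using C11D(2)[OF f] \<mu> by simp
  then have "C11 (f ^^ 0) (\<lambda>x h. h) UNIV (\<mu> ^ 0) (K / (\<mu> * (\<mu> - 1)) * \<mu> ^ (2 * 0))"
    by (rule C11_mono[OF id, rotated]) simp
  then show ?case by blast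
next
  case (Suc n)
  let ?K = "K / (\<mu> * (\<mu> - 1))"
  obtain h where h: "C11 (f ^^ n) h UNIV (\<mu> ^ n) (?K * \<mu> ^ (2 * n))"
    using Suc by blast
  have K: "K = ?K * (\<mu> * (\<mu> - 1))" using \<mu> by simp
  have "\<mu> * (k * m) + (k * (\<mu> * (\<mu> - 1))) * m = k * (\<mu> * \<mu> * m)" for k m
    by (simp add: algebra_simps)
  from this[of ?K "\<mu> ^ (2 * n)", folded K]
  have "\<mu> * (?K * \<mu> ^ (2 * n)) + K * (\<mu> ^ n)\<^sup>2 = ?K * \<mu> ^ (2 * Suc n)"
    by (simp add: power_even_eq[symmetric] mult.assoc)
  then have "C11 (\<lambda>x. f ((f ^^ n) x)) (\<lambda>x k. f' ((f ^^ n) x) (h x k)) UNIV (\<mu> ^ Suc n) (?K * \<mu> ^ (2 * Suc n))"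
    using C11_compose[OF h f] by simp
  then show ?case unfolding funpow.simps(2) comp_def by blast
qed

text \<open>Landau's inequality; it upgrades the fast convergence of the approximations of the asymptotic
  phase to convergence of their derivatives, whose Lipschitz constants grow only slowly.\<close>

lemma C11_interpolation:
  assumes q: "C11 q q' UNIV L K" and t: "0 < t" and A: "\<And>y. norm (y - x) \<le> t \<Longrightarrow> norm (q y) \<le> A"
  shows "norm (q' x h) \<le> (2 * A / t + K * t) * norm h"
proof (cases "h = 0")
  case True
  then show ?thesis using C11_linear[OF q, of x] by (simp add: linear_0)
next
  case False
  define k where "k = (t / norm h) *\<^sub>R h"
  have k: "norm k = t" using False t by (simp add: k_def)
  have "norm (q (x + k) - q x - q' x (x + k - x)) \<le> K * (norm (x + k - x))\<^sup>2"
    by (rule C11_taylor[OF q]) auto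
  then have "norm (q (x + k) - q x - q' x k) \<le> K * t\<^sup>2" using k by simp
  moreover have "norm (q (x + k)) \<le> A" "norm (q x) \<le> A" using A t k by auto
  moreover have "norm (q' x k) \<le> norm (q (x + k) - q x - q' x k) + norm (q (x + k)) + norm (q x)"
    using norm_triangle_ineq4[of "q (x + k) - q x" "q (x + k) - q x - q' x k"]
      norm_triangle_ineq4[of "q (x + k)" "q x"] by simp
  ultimately have "norm (q' x k) \<le> 2 * A + K * t\<^sup>2" by linarith
  moreover have "norm (q' x k) = t / norm h * norm (q' x h)"
    unfolding k_def using t by (simp add: linear_scale[OF C11_linear[OF q UNIV_I]])
  ultimately have "t * norm (q' x h) \<le> (2 * A + K * t\<^sup>2) * norm h"
    using False by (simp add: field_simps)
  moreover have "(2 * A + K * t\<^sup>2) * norm h = t * ((2 * A / t + K * t) * norm h)"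
    using t by (simp add: field_simps power2_eq_square)
  ultimately show ?thesis using t by (simp only: mult_le_cancel_left_pos)
qed

lemma geometric_tail:
  fixes a :: "nat \<Rightarrow> 'a::banach"
  assumes a: "\<And>i. norm (a i) \<le> M * \<theta> ^ i" and \<theta>: "0 \<le> \<theta>" "\<theta> < 1"
  shows "summable a" and "norm ((\<Sum>i<n. a i) - suminf a) \<le> M * \<theta> ^ n / (1 - \<theta>)"
proof -
  have g: "summable (\<lambda>i. M * \<theta> ^ i)"
    using \<theta> by (intro summable_mult summable_geometric) auto
  show s: "summable a"
    by (rule summable_comparison_test'[OF g]) (use a in auto)
  have sn: "summable (\<lambda>i. norm (a (i + n)))"
    by (rule summable_comparison_test'[OF summable_ignore_initial_segment[OF g, of n]]) (use a in auto)
  have "norm ((\<Sum>i<n. a i) - suminf a) = norm (\<Sum>i. a (i + n))"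
    using suminf_minus_initial_segment[OF s, of n] by (simp add: norm_minus_commute)
  also have "\<dots> \<le> (\<Sum>i. norm (a (i + n)))" by (rule summable_norm[OF sn])
  also have "\<dots> \<le> (\<Sum>i. (M * \<theta> ^ n) * \<theta> ^ i)"
  proof (rule suminf_le[OF _ sn])
    show "norm (a (i + n)) \<le> (M * \<theta> ^ n) * \<theta> ^ i" for i
      using a[of "i + n"] by (simp add: power_add mult_ac)
    show "summable (\<lambda>i. (M * \<theta> ^ n) * \<theta> ^ i)"
      using \<theta> by (intro summable_mult summable_geometric) auto
  qed
  also have "\<dots> = (M * \<theta> ^ n) * (1 / (1 - \<theta>))"
    using \<theta> suminf_geometric[of \<theta>] by (subst suminf_mult) (auto intro: summable_geometric)
  finally show "norm ((\<Sum>i<n. a i) - suminf a) \<le> M * \<theta> ^ n / (1 - \<theta>)" by simp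
qed

text \<open>Differentiability is asked of the flow and not of \<open>H\<close>, and without
  uniformity in the time, since the maps of two fixed times are iterated. \<open>P\<close> projects
  along the stable directions, \<epsilon> is the slow rate and \<open>c\<close> the fast one;
  \<open>17 * \<epsilon> < c\<close> is the condition \<open>\<theta> < 1\<close> below. The points
  of \<open>Z\<close> are equilibria, over which the centre component of the field vanishes on a
  ball of fixed radius.\<close>

locale center_stable_flow =
  fixes \<psi> :: "real \<Rightarrow> 'a::euclidean_space \<Rightarrow> 'a" and H P :: "'a \<Rightarrow> 'a"
    and B :: "'a \<Rightarrow> 'a \<Rightarrow> real" and a b \<epsilon> c L \<rho> :: real and Z :: "'a set"
  assumes P_linear: "linear P" and P_idem [simp]: "P (P x) = P x" and P_norm: "norm (P x) \<le> norm x"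
    and flow_0 [simp]: "\<psi> 0 x = x" and flow_add: "\<psi> (s + t) x = \<psi> s (\<psi> t x)"
    and flow_der: "((\<lambda>t. \<psi> t x) has_vector_derivative H (\<psi> t x)) (at t)"
    and flow_C11: "\<exists>f' L K. C11 (\<psi> t) f' UNIV L K"
    and B_bilinear: "bounded_bilinear B" and B_sym: "B x y = B y x"
    and a_pos: "0 < a" and B_lower: "a * (norm x)\<^sup>2 \<le> B x x" and B_upper: "B x x \<le> b * (norm x)\<^sup>2"
    and H_lip: "norm (H x - H y) \<le> L * norm (x - y)"
    and H_center: "P (H (P x)) = H (P x)"
    and growth: "B (x - y) (H x - H y) \<le> \<epsilon> * B (x - y) (x - y)"
    and center_growth: "- \<epsilon> * B (P x - P y) (P x - P y) \<le> B (P x - P y) (H (P x) - H (P y))"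
    and decay: "B (x - P x) (H x - P (H x)) \<le> - c * B (x - P x) (x - P x)"
    and eps: "0 < \<epsilon>" "17 * \<epsilon> < c"
    and \<rho>: "0 < \<rho>" and Z_center: "y \<in> Z \<Longrightarrow> P y = y"
    and Z_equilibrium: "y \<in> Z \<Longrightarrow> P x = 0 \<Longrightarrow> norm x < \<rho> \<Longrightarrow> P (H (x + y)) = 0"
begin

section \<open>Growth and decay along the flow, invariance of the centre, straight fibres\<close>

lemma P_bl: "bounded_linear P"
  using P_linear linear_conv_bounded_linear by blast

lemma P_diff: "P (x - y) = P x - P y" and P_add: "P (x + y) = P x + P y"
  using P_linear by (simp_all add: linear_diff linear_add)

lemma Q_norm: "norm (x - P x) \<le> 2 * norm x"
  using norm_triangle_ineq4[of x "P x"] P_norm[of x] by linarith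

lemma PQ [simp]: "P (x - P x) = 0"
  by (simp add: P_diff)

lemma ab: "a \<le> b" if "x \<noteq> 0" for x :: 'a
  using order_trans[OF B_lower B_upper, of x] that by (simp add: mult_le_cancel_right)

text \<open>The distortion between the norm and the form \<open>B\<close>. The maximum with 1 gives
  \<open>1 \<le> k\<close> directly, without a case distinction for a space of dimension
  zero.\<close>

definition k :: real where "k = sqrt (max 1 (b / a))"

lemma k1: "1 \<le> k"
  by (simp add: k_def)

lemma norm_from_form:
  assumes "B u u \<le> (exp r)\<^sup>2 * B v v"
  shows "norm u \<le> k * exp r * norm v"
proof -
  have "a * (norm u)\<^sup>2 \<le> (exp r)\<^sup>2 * (b * (norm v)\<^sup>2)"
    using order_trans[OF B_lower order_trans[OF assms mult_left_mono[OF B_upper]]] by simp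
  then have "(norm u)\<^sup>2 \<le> (exp r)\<^sup>2 * ((b / a) * (norm v)\<^sup>2)"
    using a_pos by (simp add: field_simps)
  also have "\<dots> \<le> (exp r)\<^sup>2 * (k\<^sup>2 * (norm v)\<^sup>2)"
    by (intro mult_left_mono mult_right_mono) (auto simp: k_def)
  also have "\<dots> = (k * exp r * norm v)\<^sup>2" by (simp add: power_mult_distrib)
  finally show ?thesis
    by (rule power2_le_imp_le) (use k1 in simp)
qed

lemma exp_2: "exp (2 * r * t) = (exp (r * t))\<^sup>2" for r t :: real
  by (metis exp_double mult.assoc)

lemma flow_expansion:
  assumes "0 \<le> t"
  shows "norm (\<psi> t x - \<psi> t y) \<le> k * exp (\<epsilon> * t) * norm (x - y)"
proof -
  have "B (\<psi> t x - \<psi> t y) (\<psi> t x - \<psi> t y) \<le> exp (2 * \<epsilon> * t) * B (\<psi> 0 x - \<psi> 0 y) (\<psi> 0 x - \<psi> 0 y)"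
    by (rule form_growth(1)[where u = "\<lambda>t. \<psi> t x - \<psi> t y", OF B_bilinear B_sym _ assms growth])
      (intro has_vector_derivative_diff flow_der)
  then show ?thesis unfolding exp_2 by (intro norm_from_form) simp
qed

lemma Q_der: "((\<lambda>t. \<psi> t x - P (\<psi> t x)) has_vector_derivative H (\<psi> t x) - P (H (\<psi> t x))) (at t)"
  by (intro has_vector_derivative_diff flow_der bounded_linear.has_vector_derivative[OF P_bl])

lemma Q_decay:
  assumes "0 \<le> t"
  shows "norm (\<psi> t x - P (\<psi> t x)) \<le> k * exp (- c * t) * norm (x - P x)"
proof -
  have "B (\<psi> t x - P (\<psi> t x)) (\<psi> t x - P (\<psi> t x)) \<le> exp (2 * (- c) * t) * B (\<psi> 0 x - P (\<psi> 0 x)) (\<psi> 0 x - P (\<psi> 0 x))"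
    by (rule form_growth(1)[where u = "\<lambda>t. \<psi> t x - P (\<psi> t x)", OF B_bilinear B_sym Q_der assms decay])
  then show ?thesis unfolding exp_2 by (intro norm_from_form) simp
qed

text \<open>Gronwall's inequality in the shape of a uniqueness statement; it is applied to
  components of orbits that have to vanish identically.\<close>

lemma zero_derivative_bound:
  fixes u :: "real \<Rightarrow> 'a"
  assumes u: "\<And>t. (u has_vector_derivative u' t) (at t)" and "u 0 = 0"
    and bd: "\<And>t. 0 \<le> t \<Longrightarrow> norm (u' t) \<le> M * norm (u t)" and t: "0 \<le> t"
  shows "u t = 0"
proof -
  have "u t \<bullet> u t \<le> exp (2 * M * t) * (u 0 \<bullet> u 0)"
  proof (rule form_growth(1)[OF bounded_bilinear_inner inner_commute u t])
    fix s :: real assume "0 \<le> s"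
    have "u s \<bullet> u' s \<le> norm (u s) * norm (u' s)" by (rule norm_cauchy_schwarz)
    also have "\<dots> \<le> norm (u s) * (M * norm (u s))" by (intro mult_left_mono bd \<open>0 \<le> s\<close>) auto
    finally show "u s \<bullet> u' s \<le> M * (u s \<bullet> u s)"
      by (simp add: power2_norm_eq_inner[symmetric] power2_eq_square mult_ac)
  qed
  then have "u t \<bullet> u t = 0" using assms(2) inner_ge_zero[of "u t"] by simp
  then show ?thesis by simp
qed

lemma QH_bound: "norm (H x - P (H x)) \<le> 2 * L * norm (x - P x)"
proof -
  have eq: "H x - P (H x) = (H x - H (P x)) - P (H x - H (P x))"
    by (simp add: P_diff H_center)
  have "norm (H x - P (H x)) \<le> 2 * norm (H x - H (P x))"
    by (subst eq) (rule Q_norm)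
  also have "\<dots> \<le> 2 * (L * norm (x - P x))" by (intro mult_left_mono H_lip) auto
  finally show ?thesis by simp
qed

text \<open>On the centre the stable component of \<open>H\<close> is zero, so off it this component
  is bounded by the distance to the centre (\<open>QH_bound\<close>). Along an orbit starting on the
  centre the distance satisfies a linear differential inequality with initial value 0, in both
  directions of time.\<close>

lemma center_invariant [simp]: "P (\<psi> t (P x)) = \<psi> t (P x)"
proof -
  have "\<psi> t (P x) - P (\<psi> t (P x)) = 0"
  proof (cases "0 \<le> t")
    case True
    show ?thesis
      by (rule zero_derivative_bound[where u = "\<lambda>t. \<psi> t (P x) - P (\<psi> t (P x))", OF Q_der _ QH_bound True]) simp
  next
    case False
    define u where "u s = \<psi> (- s) (P x) - P (\<psi> (- s) (P x))" for s
    have "(u has_vector_derivative - (H (\<psi> (- s) (P x)) - P (H (\<psi> (- s) (P x))))) (at s)" for s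
    proof -
      have "((\<lambda>t. \<psi> t (P x) - P (\<psi> t (P x))) \<circ> uminus has_vector_derivative
          (- 1) *\<^sub>R (H (\<psi> (- s) (P x)) - P (H (\<psi> (- s) (P x))))) (at s)"
        by (rule vector_diff_chain_at[OF _ Q_der]) (auto intro!: derivative_eq_intros)
      then show ?thesis by (simp add: o_def u_def[abs_def])
    qed
    moreover have "u 0 = 0" by (simp add: u_def)
    moreover have "norm (- (H (\<psi> (- s) (P x)) - P (H (\<psi> (- s) (P x))))) \<le> 2 * L * norm (u s)" for s
      unfolding norm_minus_cancel u_def by (rule QH_bound)
    ultimately have "u (- t) = 0"
      by (rule zero_derivative_bound) (use False in auto)
    then show ?thesis by (simp add: u_def)
  qed
  then show ?thesis by simp
qed

text \<open>Within the centre the slow rate holds backward as well as forward. The backward half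
  makes the pull-back along the centre flow affordable; off the centre the backward flow is not
  controlled.\<close>

lemma center_expansion: "norm (\<psi> t (P x) - \<psi> t (P y)) \<le> k * exp (\<epsilon> * \<bar>t\<bar>) * norm (P x - P y)"
proof (cases "0 \<le> t")
  case True
  then show ?thesis using flow_expansion[OF True, of "P x" "P y"] by simp
next
  case False
  have g: "- \<epsilon> * B (\<psi> s (P x) - \<psi> s (P y)) (\<psi> s (P x) - \<psi> s (P y))
      \<le> B (\<psi> s (P x) - \<psi> s (P y)) (H (\<psi> s (P x)) - H (\<psi> s (P y)))" for s
    using center_growth[of "\<psi> s (P x)" "\<psi> s (P y)"] by simp
  have "B (\<psi> t (P x) - \<psi> t (P y)) (\<psi> t (P x) - \<psi> t (P y))
      \<le> exp (2 * \<epsilon> * \<bar>t\<bar>) * B (\<psi> 0 (P x) - \<psi> 0 (P y)) (\<psi> 0 (P x) - \<psi> 0 (P y))"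
    by (rule form_growth(2)[where u = "\<lambda>t. \<psi> t (P x) - \<psi> t (P y)", OF B_bilinear B_sym _ _ g])
      (use False in \<open>auto intro!: has_vector_derivative_diff flow_der\<close>)
  then show ?thesis unfolding exp_2 by (intro norm_from_form) simp
qed

lemma flow_inverse [simp]: "\<psi> (- t) (\<psi> t x) = x" "\<psi> t (\<psi> (- t) x) = x"
  by (simp_all flip: flow_add)

lemma P_zero [simp]: "P 0 = 0"
  using P_linear by (rule linear_0)

text \<open>Let \<open>u\<close> be the deviation of the centre component from \<open>y\<close>. By
  decay the stable component stays shorter than \<rho>, so the centre component of \<open>H\<close>
  vanishes at this stable component plus \<open>y\<close>. That point differs from the orbit by
  \<open>u\<close>; hence the derivative of \<open>u\<close> is at most \<open>L * norm u\<close>,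
  and \<open>u\<close> starts at 0.\<close>

lemma Z_fibre:
  assumes y: "y \<in> Z" and x: "P x = 0" "k * norm x < \<rho>" and t: "0 \<le> t"
  shows "P (\<psi> t (x + y)) = y"
proof -
  define u where "u t = P (\<psi> t (x + y)) - y" for t
  have Py: "P y = y" by (rule Z_center[OF y])
  have "u t = 0"
  proof (rule zero_derivative_bound[OF _ _ _ t])
    show "(u has_vector_derivative P (H (\<psi> s (x + y)))) (at s)" for s
      unfolding u_def[abs_def]
      by (auto intro!: derivative_eq_intros bounded_linear.has_vector_derivative[OF P_bl] flow_der)
    show "u 0 = 0" using x Py by (simp add: u_def P_add)
    fix s :: real assume s: "0 \<le> s"
    define v where "v = \<psi> s (x + y) - P (\<psi> s (x + y))"
    have "norm v \<le> k * exp (- c * s) * norm x"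
      using Q_decay[OF s, of "x + y"] x Py by (simp add: v_def P_add)
    also have "\<dots> \<le> k * 1 * norm x"
      using k1 eps s by (intro mult_right_mono mult_left_mono) auto
    finally have v: "norm v < \<rho>" using x by simp
    have "P (H (v + y)) = 0"
      by (rule Z_equilibrium[OF y _ v]) (simp add: v_def)
    then have "P (H (\<psi> s (x + y))) = P (H (\<psi> s (x + y)) - H (v + y))"
      by (simp add: P_diff)
    then have "norm (P (H (\<psi> s (x + y)))) \<le> norm (H (\<psi> s (x + y)) - H (v + y))"
      using P_norm by simp
    also have "\<dots> \<le> L * norm (\<psi> s (x + y) - (v + y))" by (rule H_lip)
    also have "\<psi> s (x + y) - (v + y) = u s" by (simp add: v_def u_def)
    finally show "norm (P (H (\<psi> s (x + y)))) \<le> L * norm (u s)" .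
  qed
  then show ?thesis by (simp add: u_def)
qed

lemma Z_fixed:
  assumes y: "y \<in> Z"
  shows "\<psi> t y = y"
proof -
  have pos: "\<psi> t y = y" if "0 \<le> t" for t
    using Z_fibre[OF y _ _ that, of 0] center_invariant[of t y] Z_center[OF y] \<rho> by simp
  show ?thesis
  proof (cases "0 \<le> t")
    case False
    then have "\<psi> t (\<psi> (- t) y) = \<psi> t y" using pos[of "- t"] by simp
    then show ?thesis by simp
  qed (rule pos)
qed

section \<open>The time-\<open>T\<close> maps and their rates\<close>

definition T :: real where "T = max 1 (ln k / \<epsilon>)"
definition \<mu> :: real where "\<mu> = exp (2 * \<epsilon> * T)"
definition \<beta> :: real where "\<beta> = exp (- (c - \<epsilon>) * T)"
text \<open>The ratio of the geometric series that bounds the derivatives of the increments: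
  \<open>\<mu> ^ (4 * n)\<close> is the growth of their Lipschitz constants and
  \<open>sqrt \<beta> ^ n\<close> the step width of the interpolation.\<close>

definition \<theta> :: real where "\<theta> = \<mu> ^ 4 * sqrt \<beta>"

text \<open>The time is so long that the distortion \<open>k\<close> is worth no more than one
  further factor \<open>exp (\<epsilon> * T)\<close>. Measured in the plain norm, the
  time-\<open>T\<close> map therefore expands by at most \<mu>, with doubled exponent, and contracts
  the stable component by \<beta>, with exponent reduced by \<epsilon>.\<close>

lemma T: "0 < T" "k \<le> exp (\<epsilon> * T)"
proof -
  show "0 < T" by (simp add: T_def)
  have "ln k / \<epsilon> \<le> T" by (simp add: T_def)
  then have "ln k \<le> \<epsilon> * T" using eps by (simp add: field_simps)
  then have "exp (ln k) \<le> exp (\<epsilon> * T)" by simp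
  then show "k \<le> exp (\<epsilon> * T)" using k1 by simp
qed

lemma \<mu>1: "1 < \<mu>"
  using T eps by (simp add: \<mu>_def)

lemma \<beta>: "0 < \<beta>" "\<beta> < 1"
  using T eps mult_neg_pos[of "\<epsilon> - c" T] by (auto simp: \<beta>_def)

text \<open>The exponent is negative exactly for \<open>17 * \<epsilon> < c\<close>.\<close>

lemma \<theta>_exp: "\<theta> = exp ((8 * \<epsilon> - (c - \<epsilon>) / 2) * T)"
proof -
  have "\<mu> ^ 4 = exp (8 * \<epsilon> * T)"
    unfolding \<mu>_def by (simp add: exp_of_nat_mult[symmetric] mult_ac)
  moreover have "(8 * \<epsilon> - (c - \<epsilon>) / 2) * T = 8 * \<epsilon> * T + - (c - \<epsilon>) / 2 * T"
    by (simp add: field_simps)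
  moreover have "sqrt \<beta> = exp (- (c - \<epsilon>) / 2 * T)"
    by (rule real_sqrt_unique) (auto simp: \<beta>_def exp_double[symmetric])
  ultimately show ?thesis
    unfolding \<theta>_def by (simp only: exp_add)
qed

lemma \<theta>: "0 < \<theta>" "\<theta> < 1"
  using T eps by (auto simp: \<theta>_exp mult_neg_pos)

lemma small_rates: "\<mu> * \<beta> \<le> \<theta> * sqrt \<beta>" "\<mu>\<^sup>2 * \<beta> \<le> \<theta>" "\<mu> ^ 4 * sqrt \<beta> = \<theta>"
proof -
  have s: "0 < sqrt \<beta>" "sqrt \<beta> \<le> 1" "\<beta> = sqrt \<beta> * sqrt \<beta>" using \<beta> by auto
  have "\<mu> ^ 1 \<le> \<mu> ^ 4" "\<mu>\<^sup>2 \<le> \<mu> ^ 4" using \<mu>1 by (intro power_increasing; simp)+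
  then have m: "\<mu> \<le> \<mu> ^ 4" "\<mu>\<^sup>2 \<le> \<mu> ^ 4" by simp_all
  have "\<mu> * \<beta> \<le> \<mu> ^ 4 * \<beta>" using m \<beta> by (intro mult_right_mono) auto
  also have "\<dots> = \<theta> * sqrt \<beta>" by (subst s(3)) (simp add: \<theta>_def)
  finally show "\<mu> * \<beta> \<le> \<theta> * sqrt \<beta>" .
  have "\<beta> \<le> sqrt \<beta>" using mult_left_mono[OF s(2), of "sqrt \<beta>"] s by simp
  then show "\<mu>\<^sup>2 * \<beta> \<le> \<theta>" unfolding \<theta>_def using m \<mu>1 \<beta> by (intro mult_mono) auto
  show "\<mu> ^ 4 * sqrt \<beta> = \<theta>" by (simp add: \<theta>_def)
qed

definition f :: "'a \<Rightarrow> 'a" where "f = \<psi> T"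
text \<open>The backward flow is preceded by \<open>P\<close> because its Lipschitz bound holds on
  the centre; in this form it is a map of the whole space with constant \<mu>.\<close>

definition g :: "'a \<Rightarrow> 'a" where "g x = P (\<psi> (- T) (P x))"

lemma k_\<mu>: "k * exp (\<epsilon> * T) \<le> \<mu>"
proof -
  have "k * exp (\<epsilon> * T) \<le> exp (\<epsilon> * T) * exp (\<epsilon> * T)"
    using T by (intro mult_right_mono) auto
  also have "\<dots> = \<mu>" by (simp add: \<mu>_def exp_add[symmetric])
  finally show ?thesis .
qed

lemma f_lip: "norm (f x - f y) \<le> \<mu> * norm (x - y)"
  unfolding f_def using flow_expansion[of T x y] T mult_right_mono[OF k_\<mu> norm_ge_zero[of "x - y"]]
  by linarith

lemma g_lip: "norm (g x - g y) \<le> \<mu> * norm (x - y)"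
proof -
  have "norm (g x - g y) \<le> norm (\<psi> (- T) (P x) - \<psi> (- T) (P y))" by (simp add: g_def)
  also have "\<dots> \<le> k * exp (\<epsilon> * T) * norm (P x - P y)"
    using center_expansion[of "- T" x y] T by simp
  also have "\<dots> \<le> \<mu> * norm (x - y)"
    using k_\<mu> \<mu>1 P_norm[of "x - y"] by (intro mult_mono) (auto simp: P_diff)
  finally show ?thesis .
qed

lemma Q_f: "norm (f x - P (f x)) \<le> \<beta> * norm (x - P x)"
proof -
  have "k * exp (- c * T) \<le> exp (\<epsilon> * T) * exp (- c * T)"
    using T by (intro mult_right_mono) auto
  also have "\<dots> = \<beta>" by (simp add: \<beta>_def exp_add[symmetric] algebra_simps)
  finally show ?thesis
    unfolding f_def using Q_decay[of T x] T mult_right_mono[OF _ norm_ge_zero[of "x - P x"]]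
    by (meson less_imp_le order_trans)
qed

lemma P_C11: "C11 P (\<lambda>x. P) S 1 0"
  by (rule C11_bounded_linear[OF P_bl]) (use P_norm in auto)

lemma fg_C11: "\<exists>f' g' K. C11 f f' UNIV \<mu> K \<and> C11 g g' UNIV \<mu> K"
proof -
  obtain f' Lf Kf where f': "C11 f f' UNIV Lf Kf"
    using flow_C11 unfolding f_def by blast
  obtain h' Lh Kh where h': "C11 (\<psi> (- T)) h' UNIV Lh Kh"
    using flow_C11 by blast
  have "C11 (\<lambda>x. \<psi> (- T) (P x)) (\<lambda>x k. h' (P x) (P k)) UNIV Lh Kh"
    using C11_compose[OF P_C11 h', of UNIV] by simp
  from C11_compose[OF this P_C11, of UNIV]
  have g': "C11 g (\<lambda>x k. P (h' (P x) (P k))) UNIV Lh Kh"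
    unfolding g_def[abs_def] by simp
  have "C11 f f' UNIV \<mu> (max Kf Kh)"
    by (rule C11_mono[OF C11I_lipschitz[OF open_UNIV _ C11D(2)[OF f'] C11D(3)[OF f'] f_lip C11D(6)[OF f']]])
      (use \<mu>1 in auto)
  moreover have "C11 g (\<lambda>x k. P (h' (P x) (P k))) UNIV \<mu> (max Kf Kh)"
    by (rule C11_mono[OF C11I_lipschitz[OF open_UNIV _ C11D(2)[OF g'] C11D(3)[OF g'] g_lip C11D(6)[OF g']]])
      (use \<mu>1 in auto)
  ultimately show ?thesis by blast
qed

section \<open>Approximations of the phase and their increments\<close>

definition \<pi>n :: "nat \<Rightarrow> 'a \<Rightarrow> 'a" where "\<pi>n n x = (g ^^ n) (P ((f ^^ n) x))"
definition q :: "nat \<Rightarrow> 'a \<Rightarrow> 'a" where "q n x = \<pi>n (Suc n) x - \<pi>n n x"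

lemma f_power: "(f ^^ n) x = \<psi> (real n * T) x"
  by (induction n) (auto simp: f_def flow_add[symmetric] algebra_simps)

lemma g_power: "(g ^^ n) (P x) = \<psi> (- (real n * T)) (P x)"
proof (induction n)
  case (Suc n)
  have "(g ^^ Suc n) (P x) = g (\<psi> (- (real n * T)) (P x))" using Suc by simp
  also have "\<dots> = P (\<psi> (- T) (P (\<psi> (- (real n * T)) (P x))))" by (simp add: g_def)
  also have "\<dots> = \<psi> (- T + - (real n * T)) (P x)"
  proof -
    have "P (\<psi> (- T + - (real n * T)) (P x)) = \<psi> (- T + - (real n * T)) (P x)" by (rule center_invariant)
    then show ?thesis unfolding flow_add center_invariant .
  qed
  finally show ?case by (simp add: algebra_simps)
qed simp

lemma power_lip:
  fixes h :: "'a \<Rightarrow> 'a"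
  assumes "\<And>x y. norm (h x - h y) \<le> \<mu> * norm (x - y)"
  shows "norm ((h ^^ n) x - (h ^^ n) y) \<le> \<mu> ^ n * norm (x - y)"
proof (induction n)
  case (Suc n)
  have "norm ((h ^^ Suc n) x - (h ^^ Suc n) y) \<le> \<mu> * norm ((h ^^ n) x - (h ^^ n) y)"
    using assms by simp
  also have "\<dots> \<le> \<mu> * (\<mu> ^ n * norm (x - y))" using Suc \<mu>1 by (intro mult_left_mono) auto
  finally show ?case by (simp add: mult_ac)
qed simp

lemma Q_f_power: "norm ((f ^^ n) x - P ((f ^^ n) x)) \<le> \<beta> ^ n * norm (x - P x)"
proof (induction n)
  case (Suc n)
  have "norm ((f ^^ Suc n) x - P ((f ^^ Suc n) x)) \<le> \<beta> * norm ((f ^^ n) x - P ((f ^^ n) x))"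
    using Q_f by simp
  also have "\<dots> \<le> \<beta> * (\<beta> ^ n * norm (x - P x))" using Suc \<beta> by (intro mult_left_mono) auto
  finally show ?case by (simp add: mult_ac)
qed simp

text \<open>Two consecutive approximations share the factor \<open>g ^^ n\<close>; removing it costs
  \<open>\<mu> ^ n\<close> and leaves one step \<open>g \<circ> P \<circ> f\<close> compared with
  \<open>P\<close>, at the point \<open>(f ^^ n) x\<close>, which is close to the centre.\<close>

lemma q_bound: "norm (q n x) \<le> \<mu> ^ n * norm (g (P (f ((f ^^ n) x))) - P ((f ^^ n) x))"
  unfolding q_def \<pi>n_def funpow_Suc_right comp_def funpow_swap1[symmetric]
  using power_lip[of g n "g (P (f ((f ^^ n) x)))" "P ((f ^^ n) x)", OF g_lip]
  by (simp add: funpow_swap1)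

lemma gPf_center: "g (P (f (P x))) = P x"
  by (simp add: g_def f_def)

lemma gPf_near: "norm (g (P (f x)) - P x) \<le> (\<mu>\<^sup>2 + 1) * norm (x - P x)"
proof -
  have "norm (g (P (f x)) - P x) = norm (g (P (f x)) - g (P (f (P x))))" by (simp add: gPf_center)
  also have "\<dots> \<le> \<mu> * norm (P (f x) - P (f (P x)))" by (rule g_lip)
  also have "\<dots> \<le> \<mu> * norm (f x - f (P x))"
    using P_norm[of "f x - f (P x)"] \<mu>1 by (intro mult_left_mono) (auto simp: P_diff)
  also have "\<dots> \<le> \<mu> * (\<mu> * norm (x - P x))" using f_lip \<mu>1 by (intro mult_left_mono) auto
  also have "\<dots> \<le> (\<mu>\<^sup>2 + 1) * norm (x - P x)" by (simp add: power2_eq_square algebra_simps)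
  finally show ?thesis .
qed

lemma q_small: "norm (q n x) \<le> (\<mu>\<^sup>2 + 1) * (\<mu> * \<beta>) ^ n * norm (x - P x)"
proof -
  have "norm (g (P (f ((f ^^ n) x))) - P ((f ^^ n) x)) \<le> (\<mu>\<^sup>2 + 1) * (\<beta> ^ n * norm (x - P x))"
    by (rule order_trans[OF gPf_near mult_left_mono[OF Q_f_power]]) simp
  then have "\<mu> ^ n * norm (g (P (f ((f ^^ n) x))) - P ((f ^^ n) x)) \<le> \<mu> ^ n * ((\<mu>\<^sup>2 + 1) * (\<beta> ^ n * norm (x - P x)))"
    using \<mu>1 by (intro mult_left_mono) auto
  then show ?thesis
    using order_trans[OF q_bound] by (simp add: power_mult_distrib mult_ac)
qed

text \<open>The derivative of \<open>g ^^ n\<close> has a Lipschitz constant of order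
  \<open>\<mu> ^ (2 * n)\<close>, and the chain rule multiplies it by the square of the Lipschitz
  constant \<open>\<mu> ^ n\<close> of the inner map. This gives the fourth power of \<mu>.\<close>

lemma q_C11: "\<exists>K\<ge>0. \<forall>n. \<exists>q' L. C11 (q n) q' UNIV L (K * (\<mu> ^ 4) ^ n)"
proof -
  obtain f' g' K where fg: "C11 f f' UNIV \<mu> K" "C11 g g' UNIV \<mu> K"
    using fg_C11 by blast
  define K0 where "K0 = K / (\<mu> * (\<mu> - 1))"
  have K0: "0 \<le> K0" using C11D(2)[OF fg(1)] \<mu>1 by (simp add: K0_def)
  have pin: "\<exists>h. C11 (\<pi>n n) h UNIV (\<mu> ^ n * \<mu> ^ n) (2 * K0 * (\<mu> ^ 4) ^ n)" for n
  proof -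
    obtain fn where fn: "C11 (f ^^ n) fn UNIV (\<mu> ^ n) (K0 * \<mu> ^ (2 * n))"
      using C11_power[OF fg(1) \<mu>1] unfolding K0_def by blast
    obtain gn where gn: "C11 (g ^^ n) gn UNIV (\<mu> ^ n) (K0 * \<mu> ^ (2 * n))"
      using C11_power[OF fg(2) \<mu>1] unfolding K0_def by blast
    have "C11 (\<lambda>x. P ((f ^^ n) x)) (\<lambda>x k. P (fn x k)) UNIV (\<mu> ^ n) (K0 * \<mu> ^ (2 * n))"
      using C11_compose[OF fn P_C11, of UNIV] by simp
    from C11_compose[OF this gn, of]
    have c: "C11 (\<pi>n n) (\<lambda>x k. gn (P ((f ^^ n) x)) (P (fn x k))) UNIV (\<mu> ^ n * \<mu> ^ n)
        (\<mu> ^ n * (K0 * \<mu> ^ (2 * n)) + K0 * \<mu> ^ (2 * n) * (\<mu> ^ n)\<^sup>2)"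
      unfolding \<pi>n_def[abs_def] by simp
    have "\<mu> ^ n * \<mu> ^ (2 * n) \<le> \<mu> ^ (4 * n)" "\<mu> ^ (2 * n) * (\<mu> ^ n)\<^sup>2 = \<mu> ^ (4 * n)"
      using \<mu>1 by (simp_all add: power_add[symmetric] power_mult[symmetric] mult.commute[of n] power_increasing)
    moreover have "(\<mu> ^ 4) ^ n = \<mu> ^ (4 * n)" by (simp add: power_mult)
    moreover have "\<mu> ^ n * (K0 * \<mu> ^ (2 * n)) = K0 * (\<mu> ^ n * \<mu> ^ (2 * n))"
      "K0 * \<mu> ^ (2 * n) * (\<mu> ^ n)\<^sup>2 = K0 * (\<mu> ^ (2 * n) * (\<mu> ^ n)\<^sup>2)"
      "2 * K0 * \<mu> ^ (4 * n) = K0 * \<mu> ^ (4 * n) + K0 * \<mu> ^ (4 * n)"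
      by (simp_all add: mult_ac)
    ultimately have "\<mu> ^ n * (K0 * \<mu> ^ (2 * n)) + K0 * \<mu> ^ (2 * n) * (\<mu> ^ n)\<^sup>2 \<le> 2 * K0 * (\<mu> ^ 4) ^ n"
      using K0 by (simp only:) (intro add_right_mono mult_left_mono)
    then show ?thesis using C11_mono[OF c order_refl] by blast
  qed
  have "\<exists>q' L. C11 (q n) q' UNIV L ((4 * K0 * \<mu> ^ 4) * (\<mu> ^ 4) ^ n)" for n
  proof -
    obtain h1 where h1: "C11 (\<pi>n (Suc n)) h1 UNIV (\<mu> ^ Suc n * \<mu> ^ Suc n) (2 * K0 * (\<mu> ^ 4) ^ Suc n)"
      using pin by blast
    obtain h2 where h2: "C11 (\<pi>n n) h2 UNIV (\<mu> ^ n * \<mu> ^ n) (2 * K0 * (\<mu> ^ 4) ^ n)"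
      using pin by blast
    have m: "C11 (\<lambda>y :: 'a. - y) (\<lambda>_ y. - y) UNIV 1 0"
      by (intro C11_bounded_linear bounded_linear_minus bounded_linear_ident) auto
    have "(\<mu> ^ 4) ^ n \<le> (\<mu> ^ 4) ^ Suc n"
      using \<mu>1 by (intro power_increasing) (auto intro: one_le_power)
    then have "2 * K0 * (\<mu> ^ 4) ^ Suc n + 2 * K0 * (\<mu> ^ 4) ^ n \<le> 2 * K0 * (\<mu> ^ 4) ^ Suc n + 2 * K0 * (\<mu> ^ 4) ^ Suc n"
      using K0 by (intro add_left_mono mult_left_mono) auto
    then have le: "2 * K0 * (\<mu> ^ 4) ^ Suc n + 2 * K0 * (\<mu> ^ 4) ^ n \<le> (4 * K0 * \<mu> ^ 4) * (\<mu> ^ 4) ^ n"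
      by (simp add: mult_ac)
    from C11_add[OF h1 C11_compose[OF h2 m]]
    have "C11 (q n) (\<lambda>x k. h1 x k + - h2 x k) UNIV (\<mu> ^ Suc n * \<mu> ^ Suc n + \<mu> ^ n * \<mu> ^ n)
        (2 * K0 * (\<mu> ^ 4) ^ Suc n + 2 * K0 * (\<mu> ^ 4) ^ n)"
      by (simp add: q_def[abs_def])
    from C11_mono[OF this order_refl le] show ?thesis by blast
  qed
  moreover have "0 \<le> 4 * K0 * \<mu> ^ 4" using K0 \<mu>1 by simp
  ultimately show ?thesis by blast
qed

section \<open>The asymptotic phase as a limit\<close>

definition \<pi> :: "'a \<Rightarrow> 'a" where "\<pi> x = P x + (\<Sum>n. q n x)"

lemma \<mu>\<beta>_le: "0 \<le> \<mu> * \<beta>" "\<mu> * \<beta> \<le> \<theta>" "\<mu> * \<beta> < 1"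
proof -
  show "0 \<le> \<mu> * \<beta>" using \<mu>1 \<beta> by simp
  have "\<theta> * sqrt \<beta> \<le> \<theta> * 1" using \<theta> \<beta> by (intro mult_left_mono) auto
  then show "\<mu> * \<beta> \<le> \<theta>" "\<mu> * \<beta> < 1" using small_rates(1) \<theta> by linarith+
qed

lemma q_summable: "summable (\<lambda>n. q n x)"
proof (rule geometric_tail(1))
  show "norm (q n x) \<le> ((\<mu>\<^sup>2 + 1) * norm (x - P x)) * (\<mu> * \<beta>) ^ n" for n
    using q_small[of n x] by (simp add: mult_ac)
qed (use \<mu>\<beta>_le in auto)

lemma \<pi>n_sum: "\<pi>n n x = P x + (\<Sum>i<n. q i x)"
  by (induction n) (auto simp: \<pi>n_def q_def)

lemma \<pi>n_lim: "(\<lambda>n. \<pi>n n x) \<longlonglongrightarrow> \<pi> x"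
  unfolding \<pi>n_sum \<pi>_def by (intro tendsto_intros summable_LIMSEQ q_summable)

text \<open>The Lipschitz constants of the derivatives of the increments grow with \<open>n\<close>,
  so they do not pass to the sum. Interpolated with the small size of the increments they give a
  summable bound for the derivatives themselves, locally uniformly, and therefore a
  \<open>C\<^sup>1\<close> limit.\<close>

lemma \<pi>_C1: "\<exists>\<pi>'. (\<forall>x. (\<pi> has_derivative \<pi>' x) (at x)) \<and> (\<forall>v. continuous_on UNIV (\<lambda>x. \<pi>' x v))"
proof -
  obtain K where K: "K \<ge> 0" "\<And>n. \<exists>q' L. C11 (q n) q' UNIV L (K * (\<mu> ^ 4) ^ n)"
    using q_C11 by blast
  then obtain q' Lq where q': "\<And>n. C11 (q n) (q' n) UNIV (Lq n) (K * (\<mu> ^ 4) ^ n)"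
    by metis
  define M where "M R = 4 * (\<mu>\<^sup>2 + 1) * (R + 1) + K" for R :: real
  have bd: "norm (q' n x h) \<le> (M R * norm h) * \<theta> ^ n" if "norm x \<le> R" for n x h R
  proof -
    \<comment> \<open>This width balances the two terms: the increment is of size
      \<open>\<theta> ^ n * t\<close>, so that division by \<open>t\<close> leaves
      \<open>\<theta> ^ n\<close>, and \<open>(\<mu> ^ 4) ^ n * t\<close> is
      \<open>\<theta> ^ n\<close> as well.\<close>
    define t where "t = sqrt \<beta> ^ n"
    have t: "0 < t" "t \<le> 1" using \<beta> by (auto simp: t_def power_le_one)
    have R: "0 \<le> R" using that norm_ge_zero order_trans by blast
    let ?A = "(\<mu>\<^sup>2 + 1) * (\<theta> ^ n * t) * (2 * (R + 1))"
    have A: "norm (q n y) \<le> ?A" if y: "norm (y - x) \<le> t" for y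
    proof -
      have "norm y \<le> R + 1" using y t \<open>norm x \<le> R\<close> norm_triangle_sub[of y x] by linarith
      then have "norm (y - P y) \<le> 2 * (R + 1)" by (intro order_trans[OF Q_norm]) simp
      moreover have "(\<mu> * \<beta>) ^ n \<le> \<theta> ^ n * t"
        using power_mono[OF small_rates(1) \<mu>\<beta>_le(1), of n] by (simp add: t_def power_mult_distrib)
      ultimately have "(\<mu>\<^sup>2 + 1) * (\<mu> * \<beta>) ^ n * norm (y - P y) \<le> ?A"
        using \<mu>\<beta>_le t \<theta> by (intro mult_mono) auto
      then show ?thesis using q_small[of n y] by linarith
    qed
    have "norm (q' n x h) \<le> (2 * ?A / t + (K * (\<mu> ^ 4) ^ n) * t) * norm h"
      by (rule C11_interpolation[OF q' t(1) A])
    moreover have "2 * ?A / t = 4 * (\<mu>\<^sup>2 + 1) * (R + 1) * \<theta> ^ n"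
      using t by (simp add: field_simps)
    moreover have "(K * (\<mu> ^ 4) ^ n) * t = K * \<theta> ^ n"
      by (simp add: t_def \<theta>_def power_mult_distrib)
    ultimately have "norm (q' n x h) \<le> (4 * (\<mu>\<^sup>2 + 1) * (R + 1) * \<theta> ^ n + K * \<theta> ^ n) * norm h"
      by (simp only:)
    then show ?thesis by (simp add: M_def algebra_simps)
  qed
  define S' where "S' x h = (\<Sum>n. q' n x h)" for x h
  have M0: "0 \<le> M R" if "0 \<le> R" for R using K that by (simp add: M_def)
  have der: "((\<lambda>x. \<Sum>n. q n x) has_derivative S' x) (at x)" for x
  proof -
    \<comment> \<open>The bound \<open>M R\<close> grows with the distance to the origin; hence the
      series is differentiated on balls.\<close>
    define R where "R = norm x + 1"
    have R: "0 \<le> R" "x \<in> ball 0 R" by (auto simp: R_def add_nonneg_pos)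
    have "\<exists>s. \<forall>x\<in>ball 0 R. (\<lambda>n. q n x) sums s x \<and> (s has_derivative S' x) (at x within ball 0 R)"
    proof (rule has_derivative_series)
      show "(q n has_derivative q' n y) (at y within ball 0 R)" for n y
        by (rule has_derivative_at_withinI[OF C11D(3)[OF q' UNIV_I]])
      show "x \<in> ball 0 R" by (rule R)
      show "(\<lambda>n. q n x) sums (\<Sum>n. q n x)" by (rule summable_sums[OF q_summable])
      fix e :: real assume e: "e > 0"
      have "(\<lambda>n. M R * \<theta> ^ n / (1 - \<theta>)) \<longlonglongrightarrow> M R * 0 / (1 - \<theta>)"
        using \<theta> by (intro tendsto_intros LIMSEQ_realpow_zero) auto
      then have "\<forall>\<^sub>F n in sequentially. M R * \<theta> ^ n / (1 - \<theta>) < e"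
        using e by (intro order_tendstoD(2)[of _ 0]) auto
      then show "\<forall>\<^sub>F n in sequentially. \<forall>y\<in>ball 0 R. \<forall>h. norm ((\<Sum>i<n. q' i y h) - S' y h) \<le> e * norm h"
      proof (rule eventually_mono, intro ballI allI)
        fix n and y h :: 'a assume n: "M R * \<theta> ^ n / (1 - \<theta>) < e" and y: "y \<in> ball 0 R"
        have "norm ((\<Sum>i<n. q' i y h) - S' y h) \<le> (M R * norm h) * \<theta> ^ n / (1 - \<theta>)"
          unfolding S'_def by (rule geometric_tail(2)) (use bd[of y R] y \<theta> in auto)
        also have "\<dots> = (M R * \<theta> ^ n / (1 - \<theta>)) * norm h" by simp
        also have "\<dots> \<le> e * norm h" using n by (intro mult_right_mono) auto
        finally show "norm ((\<Sum>i<n. q' i y h) - S' y h) \<le> e * norm h" .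
      qed
    qed simp
    then obtain s where s: "\<And>y. y \<in> ball 0 R \<Longrightarrow> (\<lambda>n. q n y) sums s y"
      "(s has_derivative S' x) (at x within ball 0 R)"
      using R by blast
    have "(s has_derivative S' x) (at x)"
      using s(2) at_within_open[OF R(2) open_ball] by simp
    then show ?thesis
    proof (rule has_derivative_transform_within_open[OF _ open_ball R(2)])
      show "s y = (\<Sum>n. q n y)" if "y \<in> ball 0 R" for y
        using sums_unique[OF s(1)[OF that]] .
    qed
  qed
  have cont: "continuous_on UNIV (\<lambda>x. S' x v)" for v
    unfolding continuous_on_eq_continuous_at[OF open_UNIV]
  proof
    fix x :: 'a
    define R where "R = norm x + 1"
    have R: "x \<in> ball 0 R" by (auto simp: R_def add_nonneg_pos)
    have ul: "uniform_limit (ball 0 R) (\<lambda>n x. \<Sum>i<n. q' i x v) (\<lambda>x. \<Sum>i. q' i x v) sequentially"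
      by (rule Weierstrass_m_test[of _ _ "\<lambda>n. (M R * norm v) * \<theta> ^ n"])
        (use bd[of _ R] \<theta> in \<open>auto intro!: summable_mult summable_geometric\<close>)
    have cs: "continuous_on (ball 0 R) (\<lambda>x. \<Sum>i<n. q' i x v)" for n
    proof (intro continuous_on_sum)
      fix i
      show "continuous_on (ball 0 R) (\<lambda>x. q' i x v)"
        by (rule lipschitz_on_continuous_on[of "K * (\<mu> ^ 4) ^ i * norm v"], rule lipschitz_onI)
          (use C11D(6)[OF q', of _ _ i v] K \<mu>1 in \<open>auto simp: dist_norm mult_ac\<close>)
    qed
    have "continuous_on (ball 0 R) (\<lambda>x. S' x v)"
      unfolding S'_def
      by (rule uniform_limit_theorem[OF always_eventually[OF allI[OF cs]] ul trivial_limit_sequentially])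
    then show "isCont (\<lambda>x. S' x v) x"
      using R continuous_on_eq_continuous_at[OF open_ball] by blast
  qed
  show ?thesis
  proof (intro exI conjI allI)
    show "(\<pi> has_derivative (\<lambda>h. P h + S' x h)) (at x)" for x
      unfolding \<pi>_def[abs_def]
      by (intro has_derivative_add der bounded_linear_imp_has_derivative P_bl)
    show "continuous_on UNIV (\<lambda>x. P v + S' x v)" for v
      by (intro continuous_intros cont)
  qed
qed

lemma \<pi>_center [simp]: "\<pi> (P x) = P x"
proof -
  have "q n (P x) = 0" for n
    using q_small[of n "P x"] by simp
  then show ?thesis by (simp add: \<pi>_def)
qed

lemma P_\<pi> [simp]: "P (\<pi> x) = \<pi> x"
proof -
  have "P (\<pi>n n x) = \<pi>n n x" for n
    by (simp add: \<pi>n_def g_power)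
  then have "(\<lambda>n. \<pi>n n x) \<longlonglongrightarrow> P (\<pi> x)"
    using bounded_linear.tendsto[OF P_bl \<pi>n_lim[of x]] by simp
  then show ?thesis using \<pi>n_lim LIMSEQ_unique by blast
qed

lemma flow_continuous: "continuous_on S (\<psi> t)"
proof -
  obtain f' L K where "C11 (\<psi> t) f' UNIV L K" using flow_C11 by blast
  from has_derivative_imp_continuous_on[OF C11D(3)[OF this]] show ?thesis
    using continuous_on_subset by blast
qed

text \<open>For the approximations the two sides differ in whether the stable component of
  \<open>z = (f ^^ n) x\<close> is dropped before or after the time \<open>t\<close>. This component
  is of order \<open>\<beta> ^ n\<close>, the pull-back costs \<open>\<mu> ^ n\<close>, and
  \<open>\<mu> * \<beta> < 1\<close>. The Lipschitz constant of \<open>\<psi> t\<close> is a fixed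
  factor.\<close>

lemma \<pi>_flow: "\<pi> (\<psi> t x) = \<psi> t (\<pi> x)"
proof -
  obtain f' L' K where C: "C11 (\<psi> t) f' UNIV L' K" using flow_C11 by blast
  define M where "M = L' * norm (x - P x)"
  have bd: "norm (\<pi>n n (\<psi> t x) - \<psi> t (\<pi>n n x)) \<le> M * (\<mu> * \<beta>) ^ n" for n
  proof -
    define z where "z = (f ^^ n) x"
    have "\<psi> t (\<pi>n n x) = \<psi> (- (real n * T)) (\<psi> t (P z))"
      by (simp add: \<pi>n_def g_power z_def flow_add[symmetric] add.commute)
    also have "\<dots> = (g ^^ n) (P (\<psi> t (P z)))"
      by (simp add: g_power del: center_invariant) simp
    finally have 1: "\<psi> t (\<pi>n n x) = (g ^^ n) (P (\<psi> t (P z)))" .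
    have 2: "\<pi>n n (\<psi> t x) = (g ^^ n) (P (\<psi> t z))"
      by (simp add: \<pi>n_def z_def f_power flow_add[symmetric] add.commute)
    have "norm (\<pi>n n (\<psi> t x) - \<psi> t (\<pi>n n x)) \<le> \<mu> ^ n * norm (P (\<psi> t z) - P (\<psi> t (P z)))"
      unfolding 1 2 by (rule power_lip[OF g_lip])
    also have "\<dots> \<le> \<mu> ^ n * norm (\<psi> t z - \<psi> t (P z))"
      using P_norm[of "\<psi> t z - \<psi> t (P z)"] \<mu>1 by (intro mult_left_mono) (auto simp: P_diff)
    also have "\<dots> \<le> \<mu> ^ n * (L' * norm (z - P z))"
      using C11D(5)[OF C] \<mu>1 by (intro mult_left_mono) auto
    also have "\<dots> \<le> \<mu> ^ n * (L' * (\<beta> ^ n * norm (x - P x)))"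
      using Q_f_power[of n x] C11D(1)[OF C] \<mu>1 by (intro mult_left_mono) (auto simp: z_def)
    also have "\<dots> = M * (\<mu> * \<beta>) ^ n" by (simp add: M_def power_mult_distrib)
    finally show ?thesis .
  qed
  have "(\<lambda>n. \<psi> t (\<pi>n n x)) \<longlonglongrightarrow> \<psi> t (\<pi> x)"
    by (rule continuous_on_tendsto_compose[OF flow_continuous[of UNIV] \<pi>n_lim]) auto
  then have "(\<lambda>n. \<pi>n n (\<psi> t x) - \<psi> t (\<pi>n n x)) \<longlonglongrightarrow> \<pi> (\<psi> t x) - \<psi> t (\<pi> x)"
    by (intro tendsto_diff \<pi>n_lim)
  moreover have "(\<lambda>n. \<pi>n n (\<psi> t x) - \<psi> t (\<pi>n n x)) \<longlonglongrightarrow> 0"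
  proof (rule Lim_null_comparison[OF always_eventually[OF allI[OF bd]]])
    have "(\<lambda>n. M * (\<mu> * \<beta>) ^ n) \<longlonglongrightarrow> M * 0"
      using \<mu>\<beta>_le by (intro tendsto_intros LIMSEQ_realpow_zero) auto
    then show "(\<lambda>n. M * (\<mu> * \<beta>) ^ n) \<longlonglongrightarrow> 0" by simp
  qed
  ultimately show ?thesis using LIMSEQ_unique by force
qed

text \<open>Near a fibre over an equilibrium in \<open>Z\<close> the correction vanishes both on the fibre and on the
  centre manifold, so it is bilinear in the distances to the two.\<close>

lemma \<pi>_estimate:
  "\<exists>C\<ge>0. \<forall>x y. y \<in> Z \<longrightarrow> k * norm (x - P x) < \<rho> \<longrightarrow> norm (\<pi> x - P x) \<le> C * norm (x - P x) * norm (P x - y)"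
proof -
  obtain q' L1 K where C: "C11 (q 0) q' UNIV L1 (K * (\<mu> ^ 4) ^ 0)" and K: "K \<ge> 0"
    using q_C11 by blast
  have q0: "q 0 x = g (P (f x)) - P x" for x by (simp add: q_def \<pi>n_def)
  have "norm (\<pi> x - P x) \<le> (K / (1 - \<theta>)) * norm (x - P x) * norm (P x - y)"
    if y: "y \<in> Z" and x: "k * norm (x - P x) < \<rho>" for x y
  proof -
    have "norm (q n x) \<le> (K * norm (x - P x) * norm (P x - y)) * \<theta> ^ n" for n
    proof -
      define z where "z = (f ^^ n) x"
      have Qz: "norm (z - P z) \<le> \<beta> ^ n * norm (x - P x)" unfolding z_def by (rule Q_f_power)
      also have "\<dots> \<le> 1 * norm (x - P x)" using \<beta> by (intro mult_right_mono) (auto simp: power_le_one)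
      finally have "k * norm (z - P z) \<le> k * norm (x - P x)"
        using k1 by (intro mult_left_mono) auto
      then have kz: "k * norm (z - P z) < \<rho>" using x by linarith
      \<comment> \<open>Comparison with the point over \<open>y\<close> that has the same stable
        component as \<open>x\<close>: its fibre is straight, so the distance from
        \<open>P z\<close> to \<open>y\<close> grows by at most \<mu> per step.\<close>
      have "P ((f ^^ n) (x - P x + y)) = y"
        unfolding f_power using T by (intro Z_fibre[OF y PQ x]) auto
      then have "norm (P z - y) = norm (P ((f ^^ n) x - (f ^^ n) (x - P x + y)))"
        by (simp add: z_def P_diff)
      also have "\<dots> \<le> norm ((f ^^ n) x - (f ^^ n) (x - P x + y))" by (rule P_norm)
      also have "\<dots> \<le> \<mu> ^ n * norm (x - (x - P x + y))" by (rule power_lip[OF f_lip])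
      finally have Pz: "norm (P z - y) \<le> \<mu> ^ n * norm (P x - y)" by simp
      have gy: "g y = y" using Z_fixed[OF y, of "- T"] Z_center[OF y] by (simp add: g_def)
      have z1: "q 0 (z - P z + y) = 0"
        using Z_fibre[OF y PQ kz, of T] T Z_center[OF y] gy unfolding q0 f_def by (simp add: P_add)
      have z2: "q 0 y = 0"
        using Z_fixed[OF y, of T] Z_center[OF y] gy unfolding q0 f_def by simp
      have z3: "q 0 (P z) = 0" unfolding q0 by (simp add: gPf_center)
      \<comment> \<open>A second difference over a parallelogram with corners \<open>z\<close>,
        \<open>P z\<close>, the point of the fibre over \<open>y\<close>, and \<open>y\<close>. The
        map \<open>q 0\<close> vanishes at the last three of them.\<close>
      have "norm (q 0 (z - P z + P z) - q 0 (P z) - q 0 (z - P z + y) + q 0 y)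
          \<le> (K * (\<mu> ^ 4) ^ 0) * norm (z - P z) * norm (P z - y)"
        by (rule C11_mixed_difference[OF C])
      then have "norm (q 0 z) \<le> K * norm (z - P z) * norm (P z - y)"
        using z1 z2 z3 by simp
      also have "\<dots> \<le> K * (\<beta> ^ n * norm (x - P x)) * (\<mu> ^ n * norm (P x - y))"
        using Qz Pz K \<beta> \<mu>1 by (intro mult_mono mult_left_mono) auto
      finally have "\<mu> ^ n * norm (q 0 z) \<le> \<mu> ^ n * (K * (\<beta> ^ n * norm (x - P x)) * (\<mu> ^ n * norm (P x - y)))"
        using \<mu>1 by (intro mult_left_mono) auto
      also have "\<dots> = (K * norm (x - P x) * norm (P x - y)) * (\<mu>\<^sup>2 * \<beta>) ^ n"
        by (simp add: power_mult_distrib power_mult[symmetric] power2_eq_square mult_ac)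
      also have "\<dots> \<le> (K * norm (x - P x) * norm (P x - y)) * \<theta> ^ n"
        using small_rates(2) K \<beta> by (intro mult_left_mono power_mono) auto
      finally show ?thesis using q_bound[of n x] unfolding z_def q0 by linarith
    qed
    from geometric_tail(2)[OF this, of 0] \<theta> show ?thesis
      by (simp add: \<pi>_def)
  qed
  moreover have "0 \<le> K / (1 - \<theta>)" using K \<theta> by simp
  ultimately show ?thesis by blast
qed

end

subsection \<open>Extending the equation to the whole space\<close>

lemma C11_scaled_cutoff:
  fixes \<theta> :: "'a::euclidean_space \<Rightarrow> real"
  assumes \<theta>: "C11 \<theta> \<theta>' UNIV L K" and s: "0 < s"
  shows "C11 (\<lambda>x. \<theta> (x /\<^sub>R s)) (\<lambda>x h. \<theta>' (x /\<^sub>R s) (h /\<^sub>R s)) UNIV (L / s) (K / s\<^sup>2)"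
proof -
  have "C11 (\<lambda>x :: 'a. x /\<^sub>R s) (\<lambda>_ x. x /\<^sub>R s) UNIV (1 / s) 0"
    using s by (intro C11_bounded_linear bounded_linear_scaleR_right) (auto simp: divide_simps)
  from C11_compose[OF this \<theta>] show ?thesis by (simp add: power_divide)
qed

text \<open>Since \<open>p\<close> vanishes to second order, on a ball of radius proportional to
  \<open>s\<close> it is of size \<open>s\<^sup>2\<close> and its derivative of size
  \<open>s\<close>. This compensates the factors \<open>1 / s\<close> and
  \<open>1 / s\<^sup>2\<close> of the scaled cut-off: the derivative of the product is of order
  \<open>s\<close>, and the Lipschitz constant of the derivative stays bounded as \<open>s\<close>
  decreases.\<close>

lemma C11_local_extension:
  fixes p :: "'a::euclidean_space \<Rightarrow> 'b::euclidean_space" and \<theta> :: "'a \<Rightarrow> real"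
  assumes p: "C11 p p' (ball 0 R0) L K" and p0: "p 0 = 0" "p' 0 = (\<lambda>h. 0)"
    and \<theta>: "C11 \<theta> \<theta>' UNIV L\<theta> K\<theta>" "\<And>x. 0 \<le> \<theta> x \<and> \<theta> x \<le> 1" "\<And>x. R \<le> norm x \<Longrightarrow> \<theta> x = 0" and R: "1 < R"
  shows "\<exists>K'>0. \<forall>s. 0 < s \<longrightarrow> 2 * s * R \<le> R0 \<longrightarrow>
    (\<exists>q'. C11 (\<lambda>x. \<theta> (x /\<^sub>R s) *\<^sub>R p x) q' UNIV (K' * s) K')"
proof -
  note C = C11D[OF p] and C\<theta> = C11D[OF \<theta>(1)]
  define K' where "K' = 1 + K * (2 * R) + L\<theta> * (K * (2 * R)\<^sup>2) + (K + 2 * L\<theta> * (K * (2 * R)) + K\<theta> * (K * (2 * R)\<^sup>2))"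
  have K': "0 < K'" using C C\<theta> R by (auto simp: K'_def intro!: add_pos_nonneg)
  have "\<exists>q'. C11 (\<lambda>x. \<theta> (x /\<^sub>R s) *\<^sub>R p x) q' UNIV (K' * s) K'" if s: "0 < s" "2 * s * R \<le> R0" for s
  proof -
    define r where "r = 2 * s * R"
    have r: "0 < r" "r \<le> R0" using s R by (auto simp: r_def)
    have p'b: "norm (p' x h) \<le> (K * r) * norm h" if "x \<in> ball 0 r" for x h
    proof -
      have "norm (p' x h) \<le> K * norm x * norm h"
        using C(6)[of x 0 h] that r p0 by simp
      also have "\<dots> \<le> (K * r) * norm h"
        using that C(2) by (intro mult_right_mono mult_left_mono) auto
      finally show ?thesis .
    qed
    have pr: "C11 p p' (ball 0 r) (K * r) K"
      using C(2,3) C(6) p'b r by (intro C11I_convex) auto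
    have pb: "norm (p x) \<le> K * r\<^sup>2" if "x \<in> ball 0 r" for x
    proof -
      have "norm (p x) \<le> (K * r) * norm x"
        using C11D(5)[OF pr that, of 0] r p0 by simp
      also have "\<dots> \<le> (K * r) * r" using that C(2) r by (intro mult_left_mono) auto
      finally show ?thesis by (simp add: power2_eq_square)
    qed
    have "C11 (\<lambda>x. \<theta> (x /\<^sub>R s) *\<^sub>R p x)
        (\<lambda>x h. \<theta> (x /\<^sub>R s) *\<^sub>R p' x h + \<theta>' (x /\<^sub>R s) (h /\<^sub>R s) *\<^sub>R p x) (ball 0 r)
        (1 * (K * r) + L\<theta> / s * (K * r\<^sup>2)) (1 * K + 2 * (L\<theta> / s) * (K * r) + K\<theta> / s\<^sup>2 * (K * r\<^sup>2))"
      by (rule C11_scaleR[OF C11_subset[OF C11_scaled_cutoff[OF \<theta>(1) s(1)]] pr])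
        (use \<theta>(2) pb C(2) r in auto)
    moreover have "1 * (K * r) + L\<theta> / s * (K * r\<^sup>2) \<le> K' * s"
    proof -
      have "1 * (K * r) + L\<theta> / s * (K * r\<^sup>2) = (K * (2 * R) + L\<theta> * (K * (2 * R)\<^sup>2)) * s"
        using s by (simp add: r_def power2_eq_square field_simps)
      also have "\<dots> \<le> K' * s"
        using s C C\<theta> R by (intro mult_right_mono) (auto simp: K'_def)
      finally show ?thesis .
    qed
    moreover have "1 * K + 2 * (L\<theta> / s) * (K * r) + K\<theta> / s\<^sup>2 * (K * r\<^sup>2) \<le> K'"
    proof -
      have "1 * K + 2 * (L\<theta> / s) * (K * r) + K\<theta> / s\<^sup>2 * (K * r\<^sup>2)
        = K + 2 * L\<theta> * (K * (2 * R)) + K\<theta> * (K * (2 * R)\<^sup>2)"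
        using s by (simp add: r_def power2_eq_square field_simps)
      also have "\<dots> \<le> K'" using C C\<theta> R by (auto simp: K'_def)
      finally show ?thesis .
    qed
    ultimately have c: "C11 (\<lambda>x. \<theta> (x /\<^sub>R s) *\<^sub>R p x)
        (\<lambda>x h. \<theta> (x /\<^sub>R s) *\<^sub>R p' x h + \<theta>' (x /\<^sub>R s) (h /\<^sub>R s) *\<^sub>R p x) (ball 0 r) (K' * s) K'"
      by (rule C11_mono)
    have z: "\<theta> (x /\<^sub>R s) *\<^sub>R p x = 0" if "s * R \<le> norm x" for x
      using that s \<theta>(3)[of "x /\<^sub>R s"] by (simp add: field_simps)
    have "0 < s * R" "s * R < r" using s R by (auto simp: r_def)
    from C11_compact_support[OF c this z] show ?thesis by blast
  qed
  then show ?thesis using K' by blast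
qed

lemma Ck_diffeo_derivative_iso:
  fixes \<Phi> :: "'a::euclidean_space \<Rightarrow> 'a"
  assumes \<Phi>: "Ck_diffeo k \<Phi> A A'" and k: "1 \<le> k" and x: "x \<in> A"
  shows "\<exists>D'. linear D' \<and> (\<forall>v. D' (frechet_derivative \<Phi> (at x) v) = v) \<and> (\<forall>v. frechet_derivative \<Phi> (at x) (D' v) = v)
    \<and> (inv_into A \<Phi> has_derivative D') (at (\<Phi> x))"
proof -
  obtain m where m: "k = Suc m" using k by (cases k) auto
  have o: "open A" "open A'" "bij_betw \<Phi> A A'" and d: "Ck_on k \<Phi> A" "Ck_on k (inv_into A \<Phi>) A'"
    using \<Phi> by (auto simp: Ck_diffeo_def)
  have \<Phi>x: "\<Phi> x \<in> A'" using o(3) x by (auto simp: bij_betw_def)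
  let ?D = "frechet_derivative \<Phi> (at x)" and ?D' = "frechet_derivative (inv_into A \<Phi>) (at (\<Phi> x))"
  have D: "(\<Phi> has_derivative ?D) (at x)"
    using d(1) x unfolding m by (simp add: frechet_derivative_works[symmetric])
  have D': "(inv_into A \<Phi> has_derivative ?D') (at (\<Phi> x))"
    using d(2) \<Phi>x unfolding m by (simp add: frechet_derivative_works[symmetric])
  have "((\<lambda>y. inv_into A \<Phi> (\<Phi> y)) has_derivative (\<lambda>v. ?D' (?D v))) (at x)"
    using has_derivative_compose[OF D D'] .
  moreover have "((\<lambda>y. inv_into A \<Phi> (\<Phi> y)) has_derivative (\<lambda>v. v)) (at x)"
  proof (rule has_derivative_transform_within_open[OF has_derivative_ident o(1) x])
    show "y = inv_into A \<Phi> (\<Phi> y)" if "y \<in> A" for y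
      using that o(3) by (simp add: bij_betw_def)
  qed
  ultimately have inv: "?D' (?D v) = v" for v
    using has_derivative_unique fun_cong by metis
  have lin: "linear ?D" "linear ?D'"
    using has_derivative_linear[OF D] has_derivative_linear[OF D'] by auto
  have "?D' \<circ> ?D = id" using inv by auto
  then have "?D \<circ> ?D' = id" using linear_inverse_left[OF lin] by blast
  then have "?D (?D' v) = v" for v by (metis comp_apply id_apply)
  then show ?thesis using lin inv D' by blast
qed

text \<open>\<open>q\<close> extends the nonlinear part of the change of coordinates, and
  \<open>N\<close> the field before the derivative of that change is applied to it. By
  \<open>N_est\<close> a difference of \<open>N\<close> is, up to \<open>e\<close>, a convex
  combination of the linearization and of \<open>- c (x - P x)\<close>. Both have admissible rates
  on centre and stable directions, hence so do their combinations; a cut-off to zero would lose the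
  decay. The assumption \<open>small\<close> bounds what the push-forward by \<open>id + q\<close>
  adds. The resulting rates are \<open>2 * \<epsilon>\<close> and \<open>c - \<epsilon>\<close>, and
  \<open>17 * (2 * \<epsilon>) < c - \<epsilon>\<close> is
  \<open>35 * \<epsilon> < c\<close>.\<close>

locale extended_field = near_identity q q'
  for q :: "'a::euclidean_space \<Rightarrow> 'a" and q' :: "'a \<Rightarrow> 'a \<Rightarrow> 'a" +
  fixes N P \<A> :: "'a \<Rightarrow> 'a" and N' :: "'a \<Rightarrow> 'a \<Rightarrow> 'a" and B :: "'a \<Rightarrow> 'a \<Rightarrow> real"
    and \<theta> :: "'a \<Rightarrow> real" and a b c e \<epsilon> d K1 K2 LN KN :: real
  assumes q_C11: "C11 q q' UNIV K1 K2" and q'_zero: "\<And>W k. d < norm W \<Longrightarrow> q' W k = 0"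
    and q_0: "q 0 = 0" and d: "0 < d"
    and N_C11: "C11 N N' UNIV LN KN" and N_0: "N 0 = 0"
    and \<theta>: "0 \<le> \<theta> x" "\<theta> x \<le> 1"
    and N_est: "norm y \<le> norm x \<Longrightarrow>
      norm (N x - N y - (\<theta> x *\<^sub>R \<A> (x - y) - (c * (1 - \<theta> x)) *\<^sub>R ((x - y) - P (x - y)))) \<le> e * norm (x - y)"
    and small: "K1 * LN + 4 * K2 * d * LN \<le> e"
    and P_lin: "linear P" and P_idem: "P (P x) = P x" and P_norm: "norm (P x) \<le> norm x"
    and A_lin: "linear \<A>" and AP: "P (\<A> x) = \<A> (P x)"
    and B_bilinear: "bounded_bilinear B" and B_sym: "B x y = B y x" and a_pos: "0 < a"
    and B_lower: "a * (norm x)\<^sup>2 \<le> B x x" and B_bound: "\<bar>B x y\<bar> \<le> b * norm x * norm y" and b_pos: "0 < b"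
    and B_cross: "B (P x) (y - P y) = 0"
    and Bc: "\<bar>B (P x) (\<A> (P x))\<bar> \<le> \<epsilon> * B (P x) (P x)"
    and Bs: "B (x - P x) (\<A> (x - P x)) \<le> - c * B (x - P x) (x - P x)"
    and c_pos: "0 < c" and eps: "0 < \<epsilon>" "35 * \<epsilon> < c" and e: "0 \<le> e" "2 * e * b \<le> a * \<epsilon>"
begin

text \<open>The push-forward by \<open>F\<close> of the field \<open>\<lambda>W. N (F W)\<close>. It
  contains \<open>q'\<close>, which is Lipschitz, so no derivative of \<open>H\<close> is
  available.\<close>

definition H :: "'a \<Rightarrow> 'a" where "H x = N x + q' (G x) (N x)"

lemma H_A: "H x = A (G x) (N x)"
  by (simp add: H_def A_def)

text \<open>Besides a term with the small factor \<open>q'\<close>, there is the change of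
  \<open>q'\<close> applied to \<open>N y\<close>, a vector that is large far out. If the shorter
  point \<open>y\<close> lies outside radius \<open>2 * d\<close>, both preimages are where
  \<open>q'\<close> vanishes; otherwise \<open>norm (N y)\<close> is at most
  \<open>LN * (2 * d)\<close>.\<close>

lemma H_near_N: "norm (H x - H y - (N x - N y)) \<le> e * norm (x - y)" if "norm y \<le> norm x"
proof -
  have lin: "linear (q' W)" for W by (rule C11_linear[OF q_C11 UNIV_I])
  note C = C11D(1,2)[OF q_C11]
  have 1: "norm (q' (G x) (N x - N y)) \<le> K1 * (LN * norm (x - y))"
    by (rule order_trans[OF C11D(4)[OF q_C11 UNIV_I] mult_left_mono[OF C11D(5)[OF N_C11] C(1)]]) auto
  have 2: "norm (q' (G x) (N y) - q' (G y) (N y)) \<le> 4 * K2 * d * LN * norm (x - y)"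
  proof (cases "norm y \<le> 2 * d")
    case True
    have "norm (N y) \<le> LN * norm y" using C11D(5)[OF N_C11, of y 0] N_0 by simp
    also have "\<dots> \<le> LN * (2 * d)" using True C11D(1)[OF N_C11] by (intro mult_left_mono) auto
    finally have Ny: "norm (N y) \<le> LN * (2 * d)" .
    have "norm (q' (G x) (N y) - q' (G y) (N y)) \<le> K2 * norm (G x - G y) * norm (N y)"
      by (rule C11D(6)[OF q_C11]) auto
    also have "\<dots> \<le> K2 * (2 * norm (x - y)) * (LN * (2 * d))"
      using Ny G_lip[of x y] C by (intro mult_mono mult_left_mono) auto
    finally show ?thesis by (simp add: mult_ac)
  next
    case False
    have far: "q' (G z) k = 0" if "2 * d < norm z" for z k
    proof (rule q'_zero)
      have eq: "G z + q (G z) = z" using FG[of z] by (simp add: F_def)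
      have "norm z \<le> norm (G z) + norm (q (G z))"
        using norm_triangle_ineq[of "G z" "q (G z)"] unfolding eq .
      moreover have "norm (q (G z)) \<le> 1/2 * norm (G z)"
        using lip[of "G z" 0] by (simp add: q_0)
      ultimately show "d < norm (G z)" using that d by linarith
    qed
    show ?thesis using far[of x] far[of y] False \<open>norm y \<le> norm x\<close> C C11D(1)[OF N_C11] d by simp
  qed
  have "H x - H y - (N x - N y) = q' (G x) (N x - N y) + (q' (G x) (N y) - q' (G y) (N y))"
    unfolding H_def using lin by (simp add: linear_diff)
  then have "norm (H x - H y - (N x - N y)) \<le> K1 * (LN * norm (x - y)) + 4 * K2 * d * LN * norm (x - y)"
    using norm_triangle_mono[OF 1 2] by simp
  also have "\<dots> = (K1 * LN + 4 * K2 * d * LN) * norm (x - y)" by (simp add: algebra_simps)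
  also have "\<dots> \<le> e * norm (x - y)" by (intro mult_right_mono small) auto
  finally show ?thesis .
qed

text \<open>The estimate of \<open>N\<close> is tied to the longer of the two points. The comparison
  term is odd in \<open>x - y\<close>, so exchanging the points costs a sign. The value of
  \<open>t\<close> is forgotten, since the form estimates hold for every \<open>t\<close> between 0
  and 1.\<close>

lemma H_est: "\<exists>t\<ge>0. t \<le> 1 \<and>
  norm (H x - H y - (t *\<^sub>R \<A> (x - y) - (c * (1 - t)) *\<^sub>R ((x - y) - P (x - y)))) \<le> 2 * e * norm (x - y)"
proof -
  have *: "\<exists>t\<ge>0. t \<le> 1 \<and>
    norm (H x - H y - (t *\<^sub>R \<A> (x - y) - (c * (1 - t)) *\<^sub>R ((x - y) - P (x - y)))) \<le> 2 * e * norm (x - y)"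
    if "norm y \<le> norm x" for x y
  proof (intro exI conjI)
    define D where "D = \<theta> x *\<^sub>R \<A> (x - y) - (c * (1 - \<theta> x)) *\<^sub>R ((x - y) - P (x - y))"
    have eq: "H x - H y - D = (H x - H y - (N x - N y)) + (N x - N y - D)" by simp
    have "norm (H x - H y - D) \<le> e * norm (x - y) + e * norm (x - y)"
      unfolding eq using N_est[OF that] by (intro norm_triangle_mono[OF H_near_N[OF that]]) (simp add: D_def)
    then show "norm (H x - H y - (\<theta> x *\<^sub>R \<A> (x - y) - (c * (1 - \<theta> x)) *\<^sub>R ((x - y) - P (x - y))))
        \<le> 2 * e * norm (x - y)"
      unfolding D_def by simp
  qed (rule \<theta>)+
  show ?thesis
  proof (cases "norm y \<le> norm x")
    case True
    then show ?thesis by (rule *)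
  next
    case False
    then obtain t where t: "0 \<le> t" "t \<le> 1"
      "norm (H y - H x - (t *\<^sub>R \<A> (y - x) - (c * (1 - t)) *\<^sub>R ((y - x) - P (y - x)))) \<le> 2 * e * norm (y - x)"
      using *[of x y] by auto
    have eq: "H x - H y - (t *\<^sub>R \<A> (x - y) - (c * (1 - t)) *\<^sub>R ((x - y) - P (x - y)))
      = - (H y - H x - (t *\<^sub>R \<A> (y - x) - (c * (1 - t)) *\<^sub>R ((y - x) - P (y - x))))"
      by (simp add: linear_diff[OF A_lin] linear_diff[OF P_lin] algebra_simps)
    have "norm (H x - H y - (t *\<^sub>R \<A> (x - y) - (c * (1 - t)) *\<^sub>R ((x - y) - P (x - y)))) \<le> 2 * e * norm (x - y)"
      unfolding eq norm_minus_cancel norm_minus_commute[of x y] by (rule t(3))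
    then show ?thesis using t(1,2) by blast
  qed
qed

lemma H_lipschitz: "\<exists>L\<ge>0. \<forall>x y. norm (H x - H y) \<le> L * norm (x - y)"
proof -
  have *: "norm (H x - H y) \<le> (LN + e) * norm (x - y)" if "norm y \<le> norm x" for x y
  proof -
    have "H x - H y = (N x - N y) + (H x - H y - (N x - N y))" by simp
    then have "norm (H x - H y) \<le> LN * norm (x - y) + e * norm (x - y)"
      using norm_triangle_mono[OF C11D(5)[OF N_C11 UNIV_I UNIV_I] H_near_N[OF that]] by metis
    then show ?thesis by (simp add: algebra_simps)
  qed
  have "norm (H x - H y) \<le> (LN + e) * norm (x - y)" for x y
  proof (cases "norm y \<le> norm x")
    case True
    then show ?thesis by (rule *)
  next
    case False
    then have "norm (H y - H x) \<le> (LN + e) * norm (y - x)" by (intro *) simp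
    then show ?thesis unfolding norm_minus_commute[of "H x"] norm_minus_commute[of x] .
  qed
  then show ?thesis using C11D(1)[OF N_C11] e by (intro exI[of _ "LN + e"]) auto
qed

lemma B_pos: "0 \<le> B x x"
  using order_trans[OF _ B_lower, of 0 x] a_pos by simp

lemma B_err: "\<bar>B x w\<bar> \<le> \<epsilon> * B x x" if "norm w \<le> 2 * e * norm x"
proof -
  have "\<bar>B x w\<bar> \<le> b * norm x * (2 * e * norm x)"
    by (rule order_trans[OF B_bound mult_left_mono[OF that]]) (use b_pos in simp)
  also have "\<dots> = (2 * e * b) * (norm x)\<^sup>2" by (simp add: power2_eq_square)
  also have "\<dots> \<le> (a * \<epsilon>) * (norm x)\<^sup>2" using e by (intro mult_right_mono) auto
  also have "\<dots> = \<epsilon> * (a * (norm x)\<^sup>2)" by simp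
  also have "\<dots> \<le> \<epsilon> * B x x" using eps by (intro mult_left_mono B_lower) auto
  finally show ?thesis .
qed

interpretation B: bounded_bilinear B by (rule B_bilinear)

lemma B_cross': "B (y - P y) (P x) = 0"
  using B_cross B_sym by metis

lemma P_diff: "P (x - y) = P x - P y"
  using P_lin by (rule linear_diff)

lemma PQ: "P (x - P x) = 0" by (simp add: P_diff P_idem)

lemma Pythagoras: "B x x = B (P x) (P x) + B (x - P x) (x - P x)"
proof -
  have "B x x = B (P x + (x - P x)) (P x + (x - P x))" by simp
  also have "\<dots> = B (P x) (P x) + B (x - P x) (x - P x)"
    unfolding B.add_left B.add_right by (simp only: B_cross B_cross')
  finally show ?thesis .
qed

lemma A_form: "B x (\<A> x) = B (P x) (\<A> (P x)) + B (x - P x) (\<A> (x - P x))"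
proof -
  have 1: "\<A> (P x) = P (\<A> x)" by (simp add: AP)
  have 2: "\<A> (x - P x) = \<A> x - P (\<A> x)" using A_lin by (simp add: linear_diff AP)
  have "B x (\<A> x) = B (P x + (x - P x)) (P (\<A> x) + (\<A> x - P (\<A> x)))" by simp
  also have "\<dots> = B (P x) (P (\<A> x)) + B (x - P x) (\<A> x - P (\<A> x))"
    unfolding B.add_left B.add_right by (simp only: B_cross B_cross')
  finally show ?thesis unfolding 1 2 .
qed

lemma Q_form: "B x (x - P x) = B (x - P x) (x - P x)" "B (x - P x) x = B (x - P x) (x - P x)"
proof -
  have "B x (x - P x) = B (P x + (x - P x)) (x - P x)" by simp
  also have "\<dots> = B (x - P x) (x - P x)" unfolding B.add_left by (simp only: B_cross)
  finally show "B x (x - P x) = B (x - P x) (x - P x)" .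
  then show "B (x - P x) x = B (x - P x) (x - P x)" using B_sym by metis
qed

lemma form_split:
  assumes t: "0 \<le> t" "t \<le> 1" and w: "w = H x - H y - (t *\<^sub>R \<A> (x - y) - (c * (1 - t)) *\<^sub>R ((x - y) - P (x - y)))"
  shows "B z (H x - H y) = t * B z (\<A> (x - y)) - c * (1 - t) * B z ((x - y) - P (x - y)) + B z w"
proof -
  have "H x - H y = (t *\<^sub>R \<A> (x - y) - (c * (1 - t)) *\<^sub>R ((x - y) - P (x - y))) + w"
    by (simp add: w)
  then show ?thesis by (simp add: B.add_right B.diff_right B.scaleR_right)
qed

text \<open>The form splits along \<open>P\<close>. The linearization contributes at most \<epsilon>
  on the centre and nothing positive on the stable part, the term with \<open>c\<close> has a
  favourable sign, and the second \<epsilon> pays for the error.\<close>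

lemma growth: "B (x - y) (H x - H y) \<le> (2 * \<epsilon>) * B (x - y) (x - y)"
proof -
  let ?d = "x - y"
  obtain t where t: "0 \<le> t" "t \<le> 1"
    "norm (H x - H y - (t *\<^sub>R \<A> (x - y) - (c * (1 - t)) *\<^sub>R ((x - y) - P (x - y)))) \<le> 2 * e * norm (x - y)"
    using H_est by blast
  define w where "w = H x - H y - (t *\<^sub>R \<A> (x - y) - (c * (1 - t)) *\<^sub>R ((x - y) - P (x - y)))"
  have eq: "B ?d (H x - H y) = t * B ?d (\<A> ?d) - c * (1 - t) * B ?d (?d - P ?d) + B ?d w"
    by (rule form_split[OF t(1,2) w_def])
  have "B ?d (\<A> ?d) \<le> \<epsilon> * B (P ?d) (P ?d) + 0"
    unfolding A_form[of ?d]
  proof (rule add_mono)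
    show "B (P ?d) (\<A> (P ?d)) \<le> \<epsilon> * B (P ?d) (P ?d)" using Bc[of ?d] by linarith
    have "0 \<le> c * B (?d - P ?d) (?d - P ?d)" using c_pos B_pos by simp
    then show "B (?d - P ?d) (\<A> (?d - P ?d)) \<le> 0" using Bs[of ?d] by linarith
  qed
  also have "\<dots> \<le> \<epsilon> * B ?d ?d"
    using Pythagoras[of ?d] B_pos[of "?d - P ?d"] eps by simp
  finally have "t * B ?d (\<A> ?d) \<le> t * (\<epsilon> * B ?d ?d)" using t by (intro mult_left_mono)
  also have "\<dots> \<le> 1 * (\<epsilon> * B ?d ?d)" using t eps B_pos by (intro mult_right_mono) auto
  finally have 1: "t * B ?d (\<A> ?d) \<le> \<epsilon> * B ?d ?d" by simp
  have 2: "0 \<le> c * (1 - t) * B ?d (?d - P ?d)"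
    unfolding Q_form using c_pos t B_pos by simp
  have 3: "\<bar>B ?d w\<bar> \<le> \<epsilon> * B ?d ?d" using B_err t(3) by (simp add: w_def)
  show ?thesis unfolding eq using 1 2 3 by linarith
qed

lemma center_growth: "- (2 * \<epsilon>) * B (P x - P y) (P x - P y) \<le> B (P x - P y) (H (P x) - H (P y))"
proof -
  let ?d = "P x - P y"
  have Pd: "P ?d = ?d" by (simp add: P_diff P_idem)
  obtain t where t: "0 \<le> t" "t \<le> 1"
    "norm (H (P x) - H (P y) - (t *\<^sub>R \<A> ?d - (c * (1 - t)) *\<^sub>R (?d - P ?d))) \<le> 2 * e * norm ?d"
    using H_est by blast
  define w where "w = H (P x) - H (P y) - (t *\<^sub>R \<A> ?d - (c * (1 - t)) *\<^sub>R (?d - P ?d))"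
  have eq: "B ?d (H (P x) - H (P y)) = t * B ?d (\<A> ?d) - c * (1 - t) * B ?d (?d - P ?d) + B ?d w"
    by (rule form_split[OF t(1,2) w_def])
  have z: "B ?d (?d - P ?d) = 0" unfolding Pd by (simp add: B.zero_right)
  have "- (\<epsilon> * B ?d ?d) \<le> B ?d (\<A> ?d)" using Bc[of ?d] unfolding Pd by linarith
  then have "t * - (\<epsilon> * B ?d ?d) \<le> t * B ?d (\<A> ?d)" using t by (intro mult_left_mono)
  moreover have "t * (\<epsilon> * B ?d ?d) \<le> 1 * (\<epsilon> * B ?d ?d)" using t eps B_pos by (intro mult_right_mono) auto
  ultimately have 1: "- (\<epsilon> * B ?d ?d) \<le> t * B ?d (\<A> ?d)" by simp
  have 3: "\<bar>B ?d w\<bar> \<le> \<epsilon> * B ?d ?d" using B_err t(3) by (simp add: w_def)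
  show ?thesis unfolding eq z using 1 3 by simp
qed

text \<open>Compare \<open>x\<close> with \<open>P x\<close>, where the stable component of
  \<open>H\<close> vanishes. Their difference is purely stable, and there the linearization and
  \<open>- c (x - P x)\<close> both decay at rate \<open>c\<close>, so the interpolation parameter
  drops out.\<close>

lemma decay:
  assumes "P (H (P x)) = H (P x)"
  shows "B (x - P x) (H x - P (H x)) \<le> - (c - \<epsilon>) * B (x - P x) (x - P x)"
proof -
  let ?d = "x - P x"
  have Qd: "?d - P ?d = ?d" by (simp add: PQ)
  obtain t where t: "0 \<le> t" "t \<le> 1"
    "norm (H x - H (P x) - (t *\<^sub>R \<A> ?d - (c * (1 - t)) *\<^sub>R (?d - P ?d))) \<le> 2 * e * norm ?d"
    using H_est by blast
  define w where "w = H x - H (P x) - (t *\<^sub>R \<A> ?d - (c * (1 - t)) *\<^sub>R (?d - P ?d))"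
  have eq: "B ?d (H x - H (P x)) = t * B ?d (\<A> ?d) - c * (1 - t) * B ?d (?d - P ?d) + B ?d w"
    by (rule form_split[OF t(1,2) w_def])
  have "H x - P (H x) = (H x - H (P x)) - P (H x - H (P x))"
    by (simp add: P_diff assms)
  then have "B ?d (H x - P (H x)) = B ?d ((H x - H (P x)) - P (H x - H (P x)))"
    by (rule arg_cong)
  also have "\<dots> = B ?d (H x - H (P x))"
    unfolding B.diff_right[of _ _ "P (H x - H (P x))"] by (simp only: B_cross')
  finally have eq': "B ?d (H x - P (H x)) = B ?d (H x - H (P x))" .
  have "t * B ?d (\<A> ?d) \<le> t * (- c * B ?d ?d)" using Bs[of x] t by (intro mult_left_mono) auto
  moreover have "B ?d (?d - P ?d) = B ?d ?d" unfolding Qd ..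
  ultimately have "t * B ?d (\<A> ?d) - c * (1 - t) * B ?d (?d - P ?d) \<le> - c * B ?d ?d"
    by (simp add: algebra_simps)
  moreover have "\<bar>B ?d w\<bar> \<le> \<epsilon> * B ?d ?d" using B_err t(3) by (simp add: w_def)
  ultimately show ?thesis unfolding eq' eq by (simp add: algebra_simps)
qed

text \<open>\<open>F\<close> conjugates the flow of the \<open>C11\<close> field
  \<open>\<lambda>W. N (F W)\<close> to that of \<open>H\<close>. In this way the flow has a
  Lipschitz derivative although \<open>H\<close> is merely known to be Lipschitz.\<close>

lemma H_flow_C11:
  assumes "lipschitz_field H L"
  shows "\<exists>f' L' K'. C11 (lipschitz_field.flow H t) f' UNIV L' K'"
proof -
  interpret X: lipschitz_field H L by (rule assms)
  have idC: "C11 (\<lambda>x :: 'a. x) (\<lambda>x h. h) UNIV 1 0"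
    using C11_bounded_linear[OF bounded_linear_ident, of 1 UNIV] by simp
  have FC: "C11 F (\<lambda>x h. h + q' x h) UNIV (1 + K1) (0 + K2)"
    unfolding F_def[abs_def] by (rule C11_add[OF idC q_C11])
  have GC: "C11 G G' UNIV 2 (8 * K2)" by (rule C11_inverse[OF q_C11])
  obtain V' LV KV where V: "C11 (\<lambda>W. N (F W)) V' UNIV LV KV"
    using C11_compose[OF FC N_C11] by auto
  interpret W: lipschitz_field "\<lambda>W. N (F W)" LV
    using C11D(1,5)[OF V] by unfold_locales auto
  have flow: "X.flow t x = F (W.flow t (G x))" for t x
  proof -
    have "((\<lambda>t. F (W.flow t (G x))) has_vector_derivative H (F (W.flow s (G x)))) (at s)" for s
    proof -
      have "((\<lambda>t. F (W.flow t (G x))) has_derivative (\<lambda>h. A (W.flow s (G x)) (h *\<^sub>R N (F (W.flow s (G x)))))) (at s)"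
        by (rule has_derivative_compose[OF W.flow_der[unfolded has_vector_derivative_def] F_der])
      then show ?thesis
        unfolding has_vector_derivative_def H_A GF by (simp add: linear_scale[OF A_linear])
    qed
    then have "F (W.flow t (G x)) = X.flow t (F (W.flow 0 (G x)))"
      by (intro X.flow_unique[of UNIV t "\<lambda>t. F (W.flow t (G x))"]) auto
    then show ?thesis by simp
  qed
  obtain w' Lw Kw where w: "C11 (W.flow t) w' UNIV Lw Kw"
    using W.flow_C11[OF V] by blast
  have "C11 (\<lambda>x. W.flow t (G x)) (\<lambda>x k. w' (G x) (G' x k)) UNIV (Lw * 2) (Lw * (8 * K2) + Kw * 2\<^sup>2)"
    by (rule C11_compose[OF GC w]) simp
  from C11_compose[OF this FC] show ?thesis
    unfolding flow[abs_def] by auto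
qed

theorem center_stable:
  assumes center: "\<And>x. P (H (P x)) = H (P x)" and \<rho>: "0 < \<rho>"
    and Z: "\<And>y. y \<in> Z \<Longrightarrow> P y = y"
    and eq: "\<And>x y. y \<in> Z \<Longrightarrow> P x = 0 \<Longrightarrow> norm x < \<rho> \<Longrightarrow> P (H (x + y)) = 0"
  shows "\<exists>L. lipschitz_field H L \<and> center_stable_flow (lipschitz_field.flow H) H P B a b (2 * \<epsilon>) (c - \<epsilon>) L \<rho> Z"
proof -
  obtain L where L: "L \<ge> 0" "\<And>x y. norm (H x - H y) \<le> L * norm (x - y)"
    using H_lipschitz by blast
  have lf: "lipschitz_field H L" using L by unfold_locales auto
  interpret X: lipschitz_field H L by (rule lf)
  have "center_stable_flow X.flow H P B a b (2 * \<epsilon>) (c - \<epsilon>) L \<rho> Z"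
  proof (rule center_stable_flow.intro)
    show "B x x \<le> b * (norm x)\<^sup>2" for x
      using B_bound[of x x] by (simp add: power2_eq_square mult.assoc)
    show "\<exists>f' L K. C11 (X.flow t) f' UNIV L K" for t by (rule H_flow_C11[OF lf])
    show "B (x - P x) (H x - P (H x)) \<le> - (c - \<epsilon>) * B (x - P x) (x - P x)" for x
      by (rule decay[OF center])
  qed (use P_lin P_idem P_norm X.flow_add X.flow_der B_bilinear B_sym a_pos B_lower L(2) center growth
      center_growth eps \<rho> Z eq in \<open>simp_all\<close>)
  then show ?thesis using lf by blast
qed

end

text \<open>The constants depend on each other in this order: the error \<open>e\<close> allowed by
  the form, the slope \<open>e1\<close> of the logarithmic cut-off, the scale \<open>s\<close> on
  which the nonlinear part of the coordinates is kept, the radius \<open>r2\<close> on which the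
  field is nearly linear, the scale \<sigma> of the cut-off of the field. Within
  \<open>\<sigma> = 2 * \<rho>\<close> of the origin nothing has been changed.\<close>

lemma near_identity_extension:
  fixes p G1 P \<A> :: "'a::euclidean_space \<Rightarrow> 'a" and p' G1' :: "'a \<Rightarrow> 'a \<Rightarrow> 'a" and B :: "'a \<Rightarrow> 'a \<Rightarrow> real"
  assumes R0: "0 < R0" and p: "C11 p p' (ball 0 R0) Lp Kp" "p 0 = 0" "p' 0 = (\<lambda>h. 0)"
    and G1: "C11 G1 G1' (ball 0 R0) LG KG" "G1 0 = 0" "\<And>k. G1' 0 k = \<A> k"
    and P: "linear P" "\<And>x. P (P x) = P x" "\<And>x. norm (P x) \<le> norm x"
    and A: "linear \<A>" "\<And>x. P (\<A> x) = \<A> (P x)"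
    and B: "bounded_bilinear B" "\<And>x y. B x y = B y x" "0 < a" "\<And>x. a * (norm x)\<^sup>2 \<le> B x x"
      "\<And>x y. B (P x) (y - P y) = 0"
    and Bc: "\<And>x. \<bar>B (P x) (\<A> (P x))\<bar> \<le> \<epsilon> * B (P x) (P x)"
    and Bs: "\<And>x. B (x - P x) (\<A> (x - P x)) \<le> - c * B (x - P x) (x - P x)"
    and center: "\<And>W. norm W < R0 \<Longrightarrow> P (W + p W) = W + p W \<Longrightarrow>
      P (G1 W + p' W (G1 W)) = G1 W + p' W (G1 W)"
    and Z: "\<And>W. norm W < R0 \<Longrightarrow> P (W + p W) \<in> Z \<Longrightarrow> P (G1 W + p' W (G1 W)) = 0"
    and \<epsilon>: "0 < \<epsilon>" "35 * \<epsilon> < c"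
  shows "\<exists>H L b \<rho>. lipschitz_field H L \<and> 0 < \<rho> \<and> H 0 = 0 \<and>
    (\<forall>X. norm X < 2 * \<rho> \<longrightarrow> (\<exists>W. norm W < R0 \<and> X = W + p W \<and> H X = G1 W + p' W (G1 W))) \<and>
    (\<exists>C. \<forall>X. norm (H (P X)) \<le> C) \<and>
    center_stable_flow (lipschitz_field.flow H) H P B a b (2 * \<epsilon>) (c - \<epsilon>) L \<rho> {y \<in> Z. P y = y \<and> norm y < \<rho>}"
proof -
  have c: "0 < c" using \<epsilon> by simp
  obtain b where b: "0 < b" "\<And>x y. norm (B x y) \<le> norm x * norm y * b"
    using bounded_bilinear.pos_bounded[OF B(1)] by auto
  have Bb: "\<bar>B x y\<bar> \<le> b * norm x * norm y" for x y using b(2)[of x y] by (simp add: mult_ac)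
  have blA: "bounded_linear \<A>" and blP: "bounded_linear P"
    using A(1) P(1) linear_conv_bounded_linear by auto
  obtain nA where nA: "0 \<le> nA" "\<And>v. norm (\<A> v) \<le> nA * norm v"
    using bounded_linear.nonneg_bounded[OF blA] by (metis mult.commute)
  have PD: "P (x - y) = P x - P y" for x y using P(1) by (rule linear_diff)
  have Qn: "norm (x - P x) \<le> 2 * norm x" for x
    using norm_triangle_ineq4[of x "P x"] P(3)[of x] by linarith
  have LG: "0 \<le> LG" "0 \<le> KG" using C11D(1,2)[OF G1(1)] by auto
  \<comment> \<open>An error of \<open>2 * e\<close> in the norm then costs at most \<epsilon> in
    the form.\<close>
  define e where "e = a * \<epsilon> / (2 * b)"
  have e: "0 < e" "2 * e * b \<le> a * \<epsilon>" using b B(3) \<epsilon> by (auto simp: e_def)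
  \<comment> \<open>\<open>2 * LG + 2 * c\<close> will bound the quotient of
    \<open>norm (\<beta> y)\<close> and \<open>norm y\<close>, by which the variation of the cut-off
    is multiplied.\<close>
  define e1 where "e1 = e / (2 * (2 * LG + 2 * c + 1))"
  have e1: "0 < e1" "e1 * (2 * LG + 2 * c) \<le> e / 2"
  proof -
    have k: "0 < 2 * LG + 2 * c + 1" using LG c by simp
    then show "0 < e1" using e by (simp add: e1_def)
    have "e1 * (2 * LG + 2 * c) \<le> e1 * (2 * LG + 2 * c + 1)"
      using \<open>0 < e1\<close> by (intro mult_left_mono) auto
    also have "\<dots> = e / 2"
    proof -
      have "e / (2 * K) * K = e / 2" if "0 < K" for K using that by simp
      from this[OF k] show ?thesis by (simp only: e1_def)
    qed
    finally show "e1 * (2 * LG + 2 * c) \<le> e / 2" .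
  qed
  obtain \<theta>0 :: "'a \<Rightarrow> real" and \<theta>0' R L\<theta> K\<theta> where R: "1 < R" and \<theta>0: "C11 \<theta>0 \<theta>0' UNIV L\<theta> K\<theta>"
    and \<theta>0r: "\<forall>x. 0 \<le> \<theta>0 x \<and> \<theta>0 x \<le> 1" "\<forall>x. norm x \<le> 1 \<longrightarrow> \<theta>0 x = 1" "\<forall>x. R \<le> norm x \<longrightarrow> \<theta>0 x = 0"
    and \<theta>0l: "\<forall>x y. norm y \<le> norm x \<longrightarrow> \<bar>\<theta>0 x - \<theta>0 y\<bar> * norm y \<le> e1 * norm (x - y)"
    using log_cutoff[OF e1(1), where 'a = 'a] by (elim exE conjE) (rule that)
  \<comment> \<open>The Lipschitz constant of \<open>N\<close>. It is fixed before \<open>s\<close>,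
    although \<open>N\<close> is built with the help of \<open>s\<close>.\<close>
  define LN where "LN = nA + 2 * c + e"
  have LN: "0 < LN" using nA c e by (simp add: LN_def)
  obtain K' where K': "0 < K'" and ext: "\<forall>s. 0 < s \<longrightarrow> 2 * s * R \<le> R0 \<longrightarrow>
      (\<exists>q'. C11 (\<lambda>x. \<theta>0 (x /\<^sub>R s) *\<^sub>R p x) q' UNIV (K' * s) K')"
    using C11_local_extension[OF p \<theta>0 _ _ R] \<theta>0r by auto
  \<comment> \<open>The three terms keep the support inside the ball of radius \<open>R0\<close>,
    the derivative of \<open>q\<close> below 1/2, and the contribution of the push-forward below
    \<open>e\<close>.\<close>
  define s where "s = min (R0 / (2 * R)) (min (1 / (2 * K')) (e / (K' * LN * (1 + 4 * R))))"
  have s: "0 < s" "2 * s * R \<le> R0" "K' * s \<le> 1/2" "K' * s * LN + 4 * K' * (s * R) * LN \<le> e"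
  proof -
    have k: "0 < K' * LN * (1 + 4 * R)" using K' LN R by simp
    show "0 < s" using R0 R K' e k by (simp add: s_def)
    have "s \<le> R0 / (2 * R)" "s \<le> 1 / (2 * K')" "s \<le> e / (K' * LN * (1 + 4 * R))" by (auto simp: s_def)
    then show "2 * s * R \<le> R0" "K' * s \<le> 1/2" using R K' by (auto simp: field_simps)
    have "s * (K' * LN * (1 + 4 * R)) \<le> e"
      using \<open>s \<le> e / (K' * LN * (1 + 4 * R))\<close> k by (simp add: pos_le_divide_eq)
    then show "K' * s * LN + 4 * K' * (s * R) * LN \<le> e" by (simp add: algebra_simps)
  qed
  have "s * 1 \<le> s * (2 * R)" using s R by (intro mult_left_mono) auto
  then have sR0: "s \<le> R0" using s(2) by simp
  define q where "q W = \<theta>0 (W /\<^sub>R s) *\<^sub>R p W" for W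
  obtain q' where q': "C11 q q' UNIV (K' * s) K'"
    using ext s unfolding q_def[abs_def] by blast
  interpret ni: near_identity q q'
  proof
    show "(q has_derivative q' x) (at x)" for x by (rule C11D(3)[OF q' UNIV_I])
    show "norm (q' x h) \<le> 1/2 * norm h" for x h
      by (rule order_trans[OF C11D(4)[OF q' UNIV_I] mult_right_mono[OF s(3)]]) simp
  qed
  have q_p: "q W = p W" if "norm W \<le> s" for W
    using \<theta>0r(2) that s by (simp add: q_def field_simps)
  have q_0: "q 0 = 0" using p(2) by (simp add: q_def)
  have q_out: "q W = 0" if "s * R \<le> norm W" for W
    using \<theta>0r(3) that s by (simp add: q_def field_simps)
  have q'_p: "q' W = p' W" if "norm W < s" for W
  proof (rule has_derivative_unique[OF C11D(3)[OF q' UNIV_I]])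
    show "(q has_derivative p' W) (at W)"
    proof (rule has_derivative_transform_within_open[OF C11D(3)[OF p(1)] open_ball[of 0 s]])
      show "p x = q x" if "x \<in> ball 0 s" for x using that q_p[of x] by simp
    qed (use that sR0 in auto)
  qed
  have q'_out: "q' W k = 0" if "s * R < norm W" for W k
  proof -
    have "(q has_derivative (\<lambda>h. 0)) (at W)"
    proof (rule has_derivative_transform_within_open[OF has_derivative_const])
      show "open {W :: 'a. s * R < norm W}" by (intro open_Collect_less continuous_intros)
      show "0 = q x" if "x \<in> {W. s * R < norm W}" for x using that q_out[of x] by simp
    qed (use that in auto)
    then show ?thesis using has_derivative_unique[OF C11D(3)[OF q' UNIV_I]] by metis
  qed
  have G0: "ni.G 0 = 0" using ni.GF[of 0] q_0 by (simp add: ni.F_def)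
  have Gn: "norm (ni.G X) \<le> 2 * norm X" for X using ni.G_lip[of X 0] G0 by simp
  define \<alpha> where "\<alpha> X = G1 (ni.G X)" for X
  define \<alpha>' where "\<alpha>' X k = G1' (ni.G X) (ni.G' X k)" for X k
  have "C11 (\<lambda>X. G1 (ni.G X)) (\<lambda>X k. G1' (ni.G X) (ni.G' X k)) (ball 0 (s / 2)) (LG * 2) (LG * (8 * K') + KG * 2\<^sup>2)"
  proof (rule C11_compose[OF C11_subset[OF ni.C11_inverse[OF q']] G1(1)])
    show "ni.G ` ball 0 (s / 2) \<subseteq> ball 0 R0"
      using Gn sR0 by (force intro: le_less_trans)
  qed simp
  then obtain K\<alpha> where \<alpha>C: "C11 \<alpha> \<alpha>' (ball 0 (s / 2)) (LG * 2) K\<alpha>"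
    unfolding \<alpha>_def[abs_def] \<alpha>'_def[abs_def] by blast
  have \<alpha>0: "\<alpha> 0 = 0" by (simp add: \<alpha>_def G0 G1(2))
  have \<alpha>'0: "\<alpha>' 0 k = \<A> k" for k
  proof -
    have "ni.A (ni.G 0) k = k" using q'_p[of 0] s p(3) by (simp add: ni.A_def G0)
    then have "ni.G' 0 k = k" using ni.G'A[of 0 k] by simp
    then show ?thesis by (simp add: \<alpha>'_def G0 G1(3))
  qed
  have K\<alpha>: "0 \<le> K\<alpha>" by (rule C11D(2)[OF \<alpha>C])
  define r2 where "r2 = min (s / 2) (e / (2 * (K\<alpha> + 1)))"
  have r2: "0 < r2" "r2 \<le> s / 2" "K\<alpha> * r2 \<le> e / 2"
  proof -
    show "0 < r2" using s e K\<alpha> by (auto simp: r2_def)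
    show "r2 \<le> s / 2" unfolding r2_def by (rule min.cobounded1)
    have "K\<alpha> * r2 \<le> (K\<alpha> + 1) * (e / (2 * (K\<alpha> + 1)))"
      using K\<alpha> \<open>0 < r2\<close> by (intro mult_mono) (auto simp: r2_def)
    also have "\<dots> = e / 2"
    proof -
      have "x * (e / (2 * x)) = e / 2" if "0 < x" for x using that by simp
      from this[of "K\<alpha> + 1"] show ?thesis using K\<alpha> by simp
    qed
    finally show "K\<alpha> * r2 \<le> e / 2" .
  qed
  have \<alpha>lin: "norm (\<alpha> x - \<alpha> y - \<A> (x - y)) \<le> e / 2 * norm (x - y)" if "norm x < r2" "norm y < r2" for x y
  proof (rule derivative_near_linear[of "ball 0 r2", OF convex_ball _ blA])
    show "(\<alpha> has_derivative \<alpha>' z) (at z)" if "z \<in> ball 0 r2" for z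
      using that r2 by (intro C11D(3)[OF \<alpha>C]) auto
    show "norm (\<alpha>' z k - \<A> k) \<le> e / 2 * norm k" if "z \<in> ball 0 r2" for z k
    proof -
      have "norm (\<alpha>' z k - \<alpha>' 0 k) \<le> K\<alpha> * norm (z - 0) * norm k"
        using that r2 s by (intro C11D(6)[OF \<alpha>C]) auto
      also have "\<dots> \<le> K\<alpha> * r2 * norm k"
        using that K\<alpha> by (intro mult_right_mono mult_left_mono) auto
      also have "\<dots> \<le> e / 2 * norm k" by (intro mult_right_mono r2) auto
      finally show ?thesis by (simp add: \<alpha>'0)
    qed
  qed (use that e in auto)
  have \<alpha>bd: "norm (\<alpha> x) \<le> 2 * LG * norm x" if "norm x < r2" for x
    using C11D(5)[OF \<alpha>C, of x 0] that r2 s \<alpha>0 by simp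
  \<comment> \<open>The scaled cut-off vanishes from radius \<open>r2 / 2\<close> on, strictly
    inside the ball on which \<open>\<alpha>\<close> is close to its linear part.\<close>
  define \<sigma> where "\<sigma> = r2 / (2 * R)"
  have \<sigma>: "0 < \<sigma>" "\<sigma> * R = r2 / 2" "\<sigma> \<le> r2 / 2" using r2 R by (auto simp: \<sigma>_def field_simps)
  define \<theta> where "\<theta> X = \<theta>0 (X /\<^sub>R \<sigma>)" for X
  have \<theta>r: "0 \<le> \<theta> X" "\<theta> X \<le> 1" for X using \<theta>0r(1) by (auto simp: \<theta>_def)
  have \<theta>1: "\<theta> X = 1" if "norm X \<le> \<sigma>" for X
    using \<theta>0r(2) that \<sigma>(1) by (simp add: \<theta>_def field_simps)
  have \<theta>0': "\<theta> X = 0" if "r2 / 2 \<le> norm X" for X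
    using \<theta>0r(3) that \<sigma>(1) unfolding \<sigma>(2)[symmetric] by (simp add: \<theta>_def field_simps)
  have \<theta>l: "\<bar>\<theta> x - \<theta> y\<bar> * norm y \<le> e1 * norm (x - y)" if "norm y \<le> norm x" for x y
  proof -
    have "\<bar>\<theta> x - \<theta> y\<bar> * norm (y /\<^sub>R \<sigma>) \<le> e1 * norm (x /\<^sub>R \<sigma> - y /\<^sub>R \<sigma>)"
      unfolding \<theta>_def
    proof (rule \<theta>0l[rule_format])
      show "norm (y /\<^sub>R \<sigma>) \<le> norm (x /\<^sub>R \<sigma>)" using that \<sigma>(1) by (simp add: mult_left_mono)
    qed
    then have "(\<bar>\<theta> x - \<theta> y\<bar> * norm y) / \<sigma> \<le> (e1 * norm (x - y)) / \<sigma>"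
      using \<sigma>(1) by (simp add: scaleR_diff_right[symmetric] divide_inverse mult_ac)
    then show ?thesis using \<sigma>(1) by (simp add: divide_le_cancel)
  qed
  \<comment> \<open>Adding \<open>c (X - P X)\<close> inside the cut-off and subtracting it outside
    leaves a single product with \<theta>, hence one term to estimate when \<theta> varies.\<close>
  define \<beta> where "\<beta> X = \<alpha> X + c *\<^sub>R (X - P X)" for X
  define N where "N X = \<theta> X *\<^sub>R \<beta> X + (- c) *\<^sub>R (X - P X)" for X
  have N_alt: "N X = \<theta> X *\<^sub>R \<alpha> X - (c * (1 - \<theta> X)) *\<^sub>R (X - P X)" for X
    by (simp add: N_def \<beta>_def algebra_simps)
  have N0: "N 0 = 0" by (simp add: N_alt \<alpha>0 linear_0[OF P(1)])
  have N_est: "norm (N x - N y - (\<theta> x *\<^sub>R \<A> (x - y) - (c * (1 - \<theta> x)) *\<^sub>R ((x - y) - P (x - y)))) \<le> e * norm (x - y)"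
    if yx: "norm y \<le> norm x" for x y
  proof -
    have 1: "norm (\<theta> x *\<^sub>R (\<alpha> x - \<alpha> y - \<A> (x - y))) \<le> e / 2 * norm (x - y)"
    proof (cases "norm x < r2")
      case True
      then have "norm (\<alpha> x - \<alpha> y - \<A> (x - y)) \<le> e / 2 * norm (x - y)" using yx by (intro \<alpha>lin) auto
      moreover have "\<theta> x * norm (\<alpha> x - \<alpha> y - \<A> (x - y)) \<le> 1 * norm (\<alpha> x - \<alpha> y - \<A> (x - y))"
        by (intro mult_right_mono \<theta>r) auto
      ultimately show ?thesis using \<theta>r(1)[of x] by simp
    next
      case False
      then show ?thesis using \<theta>0'[of x] r2 e by simp
    qed
    have 2: "norm ((\<theta> x - \<theta> y) *\<^sub>R \<beta> y) \<le> e / 2 * norm (x - y)"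
    proof (cases "norm y < r2")
      case True
      have "norm (\<beta> y) \<le> 2 * LG * norm y + c * (2 * norm y)"
        unfolding \<beta>_def using \<alpha>bd[OF True] Qn[of y] c by (intro norm_triangle_mono) auto
      then have "\<bar>\<theta> x - \<theta> y\<bar> * norm (\<beta> y) \<le> \<bar>\<theta> x - \<theta> y\<bar> * (2 * LG * norm y + c * (2 * norm y))"
        by (intro mult_left_mono) auto
      also have "\<dots> = (\<bar>\<theta> x - \<theta> y\<bar> * norm y) * (2 * LG + 2 * c)" by (simp add: algebra_simps)
      also have "\<dots> \<le> (e1 * norm (x - y)) * (2 * LG + 2 * c)"
        using LG c by (intro mult_right_mono \<theta>l[OF yx]) auto
      also have "\<dots> = (e1 * (2 * LG + 2 * c)) * norm (x - y)" by simp
      also have "\<dots> \<le> e / 2 * norm (x - y)" by (intro mult_right_mono e1) auto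
      finally show ?thesis by simp
    next
      case False
      then show ?thesis using \<theta>0'[of x] \<theta>0'[of y] yx r2 e by simp
    qed
    have "N x - N y - (\<theta> x *\<^sub>R \<A> (x - y) - (c * (1 - \<theta> x)) *\<^sub>R ((x - y) - P (x - y)))
        = \<theta> x *\<^sub>R (\<alpha> x - \<alpha> y - \<A> (x - y)) + (\<theta> x - \<theta> y) *\<^sub>R \<beta> y"
      unfolding N_def \<beta>_def PD by (simp add: algebra_simps)
    then show ?thesis using norm_triangle_mono[OF 1 2] by simp
  qed
  have N_lip: "norm (N x - N y) \<le> LN * norm (x - y)" for x y
  proof -
    have *: "norm (N x - N y) \<le> LN * norm (x - y)" if "norm y \<le> norm x" for x y
    proof -
      let ?D = "\<theta> x *\<^sub>R \<A> (x - y) - (c * (1 - \<theta> x)) *\<^sub>R ((x - y) - P (x - y))"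
      have "norm (\<theta> x *\<^sub>R \<A> (x - y)) \<le> 1 * (nA * norm (x - y))"
        unfolding norm_scaleR using \<theta>r[of x] nA by (intro mult_mono) auto
      moreover have "norm ((c * (1 - \<theta> x)) *\<^sub>R ((x - y) - P (x - y))) \<le> (c * 1) * (2 * norm (x - y))"
        unfolding norm_scaleR using \<theta>r[of x] c Qn by (intro mult_mono) (auto simp: abs_mult mult_le_cancel_left)
      ultimately have "norm ?D \<le> 1 * (nA * norm (x - y)) + (c * 1) * (2 * norm (x - y))"
        by (rule order_trans[OF norm_triangle_ineq4 add_mono])
      moreover have "norm (N x - N y) \<le> norm (N x - N y - ?D) + norm ?D"
        using norm_triangle_ineq[of "N x - N y - ?D" ?D] by simp
      ultimately show ?thesis using N_est[OF that] by (simp add: LN_def algebra_simps)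
    qed
    show ?thesis
    proof (cases "norm y \<le> norm x")
      case True
      then show ?thesis by (rule *)
    next
      case False
      then have "norm (N y - N x) \<le> LN * norm (y - x)" by (intro *) simp
      then show ?thesis unfolding norm_minus_commute[of "N x"] norm_minus_commute[of x] .
    qed
  qed
  have "\<exists>N' LN0 KN. C11 N N' UNIV LN0 KN"
  proof -
    have "bounded_linear (\<lambda>X. c *\<^sub>R (X - P X))" "bounded_linear (\<lambda>X. (- c) *\<^sub>R (X - P X))"
      using blP by (intro bounded_linear_const_scaleR bounded_linear_sub bounded_linear_ident; simp)+
    then obtain l1 l2 where l: "C11 (\<lambda>X. c *\<^sub>R (X - P X)) (\<lambda>x X. c *\<^sub>R (X - P X)) UNIV l1 0"
      "C11 (\<lambda>X. (- c) *\<^sub>R (X - P X)) (\<lambda>x X. (- c) *\<^sub>R (X - P X)) UNIV l2 0"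
      using C11_bounded_linear_ex by blast
    have "C11 \<alpha> \<alpha>' (ball 0 r2) (LG * 2) K\<alpha>" using r2 by (intro C11_subset[OF \<alpha>C]) auto
    from C11_add[OF this C11_subset[OF l(1)]]
    have \<beta>C: "C11 \<beta> (\<lambda>x h. \<alpha>' x h + c *\<^sub>R (h - P h)) (ball 0 r2) (LG * 2 + l1) (K\<alpha> + 0)"
      unfolding \<beta>_def[abs_def] by simp
    have "\<beta> 0 = 0" by (simp add: \<beta>_def \<alpha>0 linear_0[OF P(1)])
    then have \<beta>b: "norm (\<beta> x) \<le> (LG * 2 + l1) * r2" if "x \<in> ball 0 r2" for x
      using order_trans[OF C11D(5)[OF \<beta>C that, of 0] mult_left_mono[of "norm (x - 0)" r2]]
        that r2 C11D(1)[OF \<beta>C] by simp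
    have "C11 (\<lambda>X. \<theta> X *\<^sub>R \<beta> X) (\<lambda>x h. \<theta> x *\<^sub>R (\<alpha>' x h + c *\<^sub>R (h - P h)) + \<theta>0' (x /\<^sub>R \<sigma>) (h /\<^sub>R \<sigma>) *\<^sub>R \<beta> x)
        (ball 0 r2) (1 * (LG * 2 + l1) + (L\<theta> / \<sigma>) * ((LG * 2 + l1) * r2))
        (1 * (K\<alpha> + 0) + 2 * (L\<theta> / \<sigma>) * (LG * 2 + l1) + (K\<theta> / \<sigma>\<^sup>2) * ((LG * 2 + l1) * r2))"
      unfolding \<theta>_def
      by (rule C11_scaleR[OF C11_subset[OF C11_scaled_cutoff[OF \<theta>0 \<sigma>(1)]] \<beta>C _ \<beta>b])
        (use \<theta>0r(1) r2 C11D(1)[OF \<beta>C] in auto)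
    moreover have "0 < r2 / 2" "r2 / 2 < r2" using r2 by auto
    moreover have "\<theta> x *\<^sub>R \<beta> x = 0" if "r2 / 2 \<le> norm x" for x using \<theta>0'[OF that] by simp
    ultimately have "\<exists>f' L K. C11 (\<lambda>X. \<theta> X *\<^sub>R \<beta> X) f' UNIV L K"
      by (meson C11_compact_support)
    then obtain f' L K where "C11 (\<lambda>X. \<theta> X *\<^sub>R \<beta> X) f' UNIV L K" by blast
    from C11_add[OF this l(2)] show ?thesis unfolding N_def[abs_def] by blast
  qed
  then obtain N' LN0 KN where N'0: "C11 N N' UNIV LN0 KN" by blast
  have N': "C11 N N' UNIV LN KN"
    using LN C11D(2,3,6)[OF N'0] N_lip by (intro C11I_lipschitz) auto
  interpret extended_field q q' N P \<A> N' B \<theta> a b c e \<epsilon> "s * R" "K' * s" K' LN KN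
  proof (intro extended_field.intro extended_field_axioms.intro)
    show "q' W k = 0" if "s * R < norm W" for W k by (rule q'_out[OF that])
    show "0 < s * R" using s(1) R by simp
    show "norm (N x - N y - (\<theta> x *\<^sub>R \<A> (x - y) - (c * (1 - \<theta> x)) *\<^sub>R ((x - y) - P (x - y)))) \<le> e * norm (x - y)"
      if "norm y \<le> norm x" for x y by (rule N_est[OF that])
    show "0 \<le> e" using e(1) by simp
  qed (rule ni.near_identity_axioms q' q_0 N' N0 \<theta>r s(4) P A B Bb b(1) Bc Bs c \<epsilon> e(2))+
  \<comment> \<open>Half of \<sigma>, because the points \<open>x + y\<close> of a fibre, with both
    summands shorter than \<rho>, must lie where the field is unchanged.\<close>
  define \<rho> where "\<rho> = \<sigma> / 2"
  have \<rho>: "0 < \<rho>" "2 * \<rho> = \<sigma>" using \<sigma> by (auto simp: \<rho>_def)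
  have Gs: "norm (ni.G X) < s" if "norm X < r2" for X using Gn[of X] that r2 by linarith
  have near: "norm (ni.G X) < R0 \<and> X = ni.G X + p (ni.G X)
      \<and> q' (ni.G X) (\<alpha> X) = p' (ni.G X) (G1 (ni.G X))" if "norm X < r2" for X
    using Gs[OF that] sR0 ni.FG[of X] q_p[of "ni.G X"] q'_p[of "ni.G X"] by (simp add: ni.F_def \<alpha>_def)
  have near0: "\<exists>W. norm W < R0 \<and> X = W + p W \<and> H X = G1 W + p' W (G1 W)" if "norm X < 2 * \<rho>" for X
  proof (intro exI conjI)
    have X: "norm X < r2" "norm X \<le> \<sigma>" using that \<rho> \<sigma> r2 by auto
    show "norm (ni.G X) < R0" "X = ni.G X + p (ni.G X)" using near[OF X(1)] by auto
    show "H X = G1 (ni.G X) + p' (ni.G X) (G1 (ni.G X))"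
      using near[OF X(1)] \<theta>1[OF X(2)] by (simp add: H_def N_alt \<alpha>_def)
  qed
  have lq: "linear (q' W)" for W by (rule C11_linear[OF q' UNIV_I])
  have H_far: "H (P X) = 0" if "r2 \<le> norm (P X)" for X
  proof -
    have "N (P X) = 0" using \<theta>0'[of "P X"] that r2 P(2) by (simp add: N_alt)
    then show ?thesis by (simp add: H_def linear_0[OF lq])
  qed
  have cent: "P (H (P X)) = H (P X)" for X
  proof (cases "norm (P X) < r2")
    case True
    define W where "W = ni.G (P X)"
    have W: "norm W < R0" "P X = W + p W" "q' W (\<alpha> (P X)) = p' W (G1 W)"
      using near[OF True] by (auto simp: W_def)
    have H: "H (P X) = \<theta> (P X) *\<^sub>R (G1 W + p' W (G1 W))"
      using W(3) by (simp add: H_def N_alt P(2) linear_scale[OF lq] W_def[symmetric] scaleR_add_right)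
        (simp add: \<alpha>_def W_def)
    have "P (W + p W) = W + p W" unfolding W(2)[symmetric] by (rule P(2))
    then show ?thesis
      unfolding H using center[OF W(1)] by (simp add: linear_scale[OF P(1)])
  next
    case False
    then show ?thesis using H_far[of X] by (simp add: linear_0[OF P(1)])
  qed
  have H0: "H 0 = 0" by (simp add: H_def N0 linear_0[OF lq])
  have "\<exists>L. lipschitz_field H L \<and> center_stable_flow (lipschitz_field.flow H) H P B a b (2 * \<epsilon>) (c - \<epsilon>) L \<rho>
      {y \<in> Z. P y = y \<and> norm y < \<rho>}"
  proof (rule center_stable[OF cent \<rho>(1)])
    fix x y assume y: "y \<in> {y \<in> Z. P y = y \<and> norm y < \<rho>}" and x: "P x = 0" "norm x < \<rho>"
    have "norm (x + y) < 2 * \<rho>" using norm_triangle_ineq[of x y] x y by simp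
    then obtain W where W: "norm W < R0" "x + y = W + p W" "H (x + y) = G1 W + p' W (G1 W)"
      using near0 by blast
    have "P (W + p W) = y" unfolding W(2)[symmetric] using x y linear_add[OF P(1), of x y] by simp
    then show "P (H (x + y)) = 0" unfolding W(3) using y by (intro Z[OF W(1)]) simp
  qed auto
  then obtain L where L: "lipschitz_field H L"
    "center_stable_flow (lipschitz_field.flow H) H P B a b (2 * \<epsilon>) (c - \<epsilon>) L \<rho> {y \<in> Z. P y = y \<and> norm y < \<rho>}"
    by blast
  have "norm (H (P X)) \<le> L * r2" for X
  proof (cases "norm (P X) < r2")
    case True
    have "norm (H (P X)) \<le> L * norm (P X)"
      using lipschitz_field.lip[OF L(1), of "P X" 0] H0 by simp
    also have "\<dots> \<le> L * r2" using True lipschitz_field.L[OF L(1)] by (intro mult_left_mono) auto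
    finally show ?thesis .
  next
    case False
    then show ?thesis using H_far[of X] lipschitz_field.L[OF L(1)] r2 by simp
  qed
  then show ?thesis using L \<rho> near0 H0 by blast
qed

text \<open>In the linear coordinate \<open>W = \<Phi>'(0) U\<close> the equation has the
  \<open>C\<^sup>2\<close> field \<open>G1\<close>, and \<open>\<Phi>\<close> becomes
  \<open>W + p W\<close> with \<open>p\<close> vanishing to second order. So the coordinates of
  \<open>\<Phi>\<close> differ from linear ones by a change near the identity.\<close>

lemma extension_exists:
  fixes \<Phi> G P A :: "'a::euclidean_space \<Rightarrow> 'a" and B :: "'a \<Rightarrow> 'a \<Rightarrow> real" and r \<epsilon> c a :: real
  defines "h \<equiv> coord_field \<Phi> (ball 0 r) G"
  assumes r: "0 < r" and \<Phi>0: "\<Phi> 0 = 0" and \<Phi>: "Ck_diffeo 2 \<Phi> (ball 0 r) (\<Phi> ` ball 0 r)"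
    and G: "Ck_on 2 G UNIV" "G 0 = 0"
    and P: "linear P" "\<And>x. P (P x) = P x" "\<And>x. norm (P x) \<le> norm x"
    and A: "linear A" "\<And>u. A (frechet_derivative \<Phi> (at 0) u) = frechet_derivative \<Phi> (at 0) (frechet_derivative G (at 0) u)"
    and AP: "\<And>x. P (A x) = A (P x)"
    and B: "bounded_bilinear B" "\<And>x y. B x y = B y x" "0 < a" "\<And>x. a * (norm x)\<^sup>2 \<le> B x x"
      "\<And>x y. B (P x) (y - P y) = 0"
    and Bc: "\<And>x. \<bar>B (P x) (A (P x))\<bar> \<le> \<epsilon> * B (P x) (P x)"
    and Bs: "\<And>x. B (x - P x) (A (x - P x)) \<le> - c * B (x - P x) (x - P x)"
    and center: "\<And>X. X \<in> \<Phi> ` ball 0 r \<Longrightarrow> P X = X \<Longrightarrow> P (h X) = h X"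
    and Z: "\<And>X. X \<in> \<Phi> ` ball 0 r \<Longrightarrow> P X \<in> Z \<Longrightarrow> P (h X) = 0"
    and \<epsilon>: "0 < \<epsilon>" "35 * \<epsilon> < c"
  shows "\<exists>H L b \<rho>. lipschitz_field H L \<and> 0 < \<rho> \<and> H 0 = 0 \<and>
    (\<forall>X. norm X < 2 * \<rho> \<longrightarrow> X \<in> \<Phi> ` ball 0 r \<and> H X = h X) \<and> (\<exists>C. \<forall>X. norm (H (P X)) \<le> C) \<and>
    center_stable_flow (lipschitz_field.flow H) H P B a b (2 * \<epsilon>) (c - \<epsilon>) L \<rho> {y \<in> Z. P y = y \<and> norm y < \<rho>}"
proof -
  let ?D = "ball 0 r :: 'a set" and ?L = "frechet_derivative \<Phi> (at 0)"
  have k12: "(1::nat) \<le> 2" by simp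
  have bij: "bij_betw \<Phi> ?D (\<Phi> ` ?D)" and \<Phi>C2: "Ck_on 2 \<Phi> ?D"
    using \<Phi> by (auto simp: Ck_diffeo_def)
  have inj: "inj_on \<Phi> ?D" using bij by (simp add: bij_betw_def)
  obtain L1 where L1: "linear L1" "\<And>v. L1 (?L v) = v" "\<And>v. ?L (L1 v) = v"
    using Ck_diffeo_derivative_iso[OF \<Phi> k12, of 0] r by auto
  have linL: "linear ?L"
    using has_derivative_linear[OF Ck_on_2D(1)[OF \<Phi>C2]] r by simp
  have blL: "bounded_linear ?L" "bounded_linear L1" 
    using linL L1(1) linear_conv_bounded_linear by auto
  obtain nL where nL: "C11 ?L (\<lambda>x. ?L) UNIV nL 0" using C11_bounded_linear_ex[OF blL(1)] by blast
  obtain n1 where n1: "C11 L1 (\<lambda>x. L1) UNIV n1 0" using C11_bounded_linear_ex[OF blL(2)] by blast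
  \<comment> \<open>Keeps \<open>L1 W\<close> in the closed ball of radius \<open>r / 2\<close>, a
    compact part of the domain, where \<open>\<Phi>\<close> has uniform constants.\<close>
  define R0 where "R0 = r / (2 * (n1 + 1))"
  have n1': "0 \<le> n1" using C11D(1)[OF n1] .
  have R0: "0 < R0" using r n1' by (simp add: R0_def)
  have L1R0: "L1 ` ball 0 R0 \<subseteq> cball 0 (r / 2)"
  proof
    fix y assume "y \<in> L1 ` ball 0 R0"
    then obtain x where x: "y = L1 x" "norm x < R0" by auto
    have "norm y \<le> n1 * norm x" using C11D(4)[OF n1, of x x] x by simp
    also have "\<dots> \<le> (n1 + 1) * R0" using x n1' by (intro mult_mono) auto
    also have "\<dots> = r / 2"
    proof -
      have "x * (r / (2 * x)) = r / 2" if "0 < x" for x using that by simp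
      from this[of "n1 + 1"] show ?thesis using n1' by (simp add: R0_def)
    qed
    finally show "y \<in> cball 0 (r / 2)" by simp
  qed
  have cb: "cball 0 (r / 2) \<subseteq> ?D" using r by auto
  obtain L\<Phi> K\<Phi> where C\<Phi>: "C11 \<Phi> (\<lambda>x. frechet_derivative \<Phi> (at x)) (cball 0 (r / 2)) L\<Phi> K\<Phi>"
    using Ck_on_2_imp_C11[OF \<Phi>C2 compact_cball convex_cball cb] by blast
  define p where "p W = \<Phi> (L1 W) + - W" for W
  define p' where "p' W k = frechet_derivative \<Phi> (at (L1 W)) (L1 k) + - k" for W k
  have mid: "C11 (\<lambda>y :: 'a. - y) (\<lambda>_ y. - y) S 1 0" for S
    by (intro C11_bounded_linear bounded_linear_minus bounded_linear_ident) auto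
  have "C11 (\<lambda>W. \<Phi> (L1 W)) (\<lambda>W k. frechet_derivative \<Phi> (at (L1 W)) (L1 k)) (ball 0 R0) (L\<Phi> * n1) (L\<Phi> * 0 + K\<Phi> * n1\<^sup>2)"
    by (rule C11_compose[OF C11_subset[OF n1] C\<Phi> L1R0]) simp
  from C11_add[OF this mid[of "ball 0 R0"]]
  obtain Lp Kp where Cp: "C11 p p' (ball 0 R0) Lp Kp"
    unfolding p_def[abs_def] p'_def[abs_def] by blast
  have p0: "p 0 = 0" "p' 0 = (\<lambda>h. 0)"
    using L1 \<Phi>0 by (auto simp: p_def p'_def linear_0)
  obtain LG0 KG0 where CG0: "C11 G (\<lambda>x. frechet_derivative G (at x)) (cball 0 r) LG0 KG0"
    using Ck_on_2_imp_C11[OF G(1) compact_cball convex_cball subset_UNIV] by blast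
  have L1R0': "L1 ` ball 0 R0 \<subseteq> cball 0 r" using L1R0 cb by force
  define G1 where "G1 W = ?L (G (L1 W))" for W
  define G1' where "G1' W k = ?L (frechet_derivative G (at (L1 W)) (L1 k))" for W k
  have "C11 (\<lambda>W. G (L1 W)) (\<lambda>W k. frechet_derivative G (at (L1 W)) (L1 k)) (ball 0 R0) (LG0 * n1) (LG0 * 0 + KG0 * n1\<^sup>2)"
    by (rule C11_compose[OF C11_subset[OF n1] CG0 L1R0']) simp
  from C11_compose[OF this nL] obtain LG KG where CG: "C11 G1 G1' (ball 0 R0) LG KG"
    unfolding G1_def[abs_def] G1'_def[abs_def] by auto
  have G10: "G1 0 = 0" using L1 G linL by (simp add: G1_def linear_0)
  have G1'0: "G1' 0 k = A k" for k
    using A(2)[of "L1 k"] L1 by (simp add: G1'_def linear_0)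
  have key: "L1 W \<in> ?D" "\<Phi> (L1 W) = W + p W" "h (W + p W) = G1 W + p' W (G1 W)" if W: "norm W < R0" for W
  proof -
    have "W \<in> ball 0 R0" using W by simp
    then show U: "L1 W \<in> ?D" using L1R0 cb by blast
    show X: "\<Phi> (L1 W) = W + p W" by (simp add: p_def)
    have "inv_into ?D \<Phi> (W + p W) = L1 W"
      using inv_into_f_f[OF inj U] by (simp add: X)
    then show "h (W + p W) = G1 W + p' W (G1 W)"
      by (simp add: h_def coord_field_def p'_def G1_def L1)
  qed
  have "\<exists>H L b \<rho>. lipschitz_field H L \<and> 0 < \<rho> \<and> H 0 = 0 \<and>
    (\<forall>X. norm X < 2 * \<rho> \<longrightarrow> (\<exists>W. norm W < R0 \<and> X = W + p W \<and> H X = G1 W + p' W (G1 W))) \<and>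
    (\<exists>C. \<forall>X. norm (H (P X)) \<le> C) \<and>
    center_stable_flow (lipschitz_field.flow H) H P B a b (2 * \<epsilon>) (c - \<epsilon>) L \<rho> {y \<in> Z. P y = y \<and> norm y < \<rho>}"
  proof (rule near_identity_extension[OF R0 Cp p0 CG G10 G1'0 P A(1) AP B Bc Bs _ _ \<epsilon>])
    fix W :: 'a assume W: "norm W < R0"
    have im: "W + p W \<in> \<Phi> ` ?D" using key[OF W] by (metis imageI)
    show "P (G1 W + p' W (G1 W)) = G1 W + p' W (G1 W)" if "P (W + p W) = W + p W"
      using center[OF im that] unfolding key(3)[OF W] .
    show "P (G1 W + p' W (G1 W)) = 0" if "P (W + p W) \<in> Z"
      using Z[OF im that] unfolding key(3)[OF W] .
  qed
  then obtain H L b \<rho> where H: "lipschitz_field H L" "0 < \<rho>" "H 0 = 0"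
    "\<forall>X. norm X < 2 * \<rho> \<longrightarrow> (\<exists>W. norm W < R0 \<and> X = W + p W \<and> H X = G1 W + p' W (G1 W))"
    "\<exists>C. \<forall>X. norm (H (P X)) \<le> C"
    "center_stable_flow (lipschitz_field.flow H) H P B a b (2 * \<epsilon>) (c - \<epsilon>) L \<rho> {y \<in> Z. P y = y \<and> norm y < \<rho>}"
    by (elim exE conjE) (rule that; (assumption | blast))
  have "X \<in> \<Phi> ` ?D \<and> H X = h X" if X: "norm X < 2 * \<rho>" for X
  proof -
    obtain W where W: "norm W < R0" "X = W + p W" "H X = G1 W + p' W (G1 W)"
      using H(4) X by blast
    have "W + p W \<in> \<Phi> ` ?D" using key[OF W(1)] by (metis imageI)
    then show ?thesis using W key(3)[OF W(1)] by simp
  qed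
  then show ?thesis using H by blast
qed

subsection \<open>The linearization in the given coordinates\<close>

lemma block_linear: "linear (block J)"
  by (rule linearI) (auto simp: block_def vec_eq_iff)

lemma block_idem [simp]: "block J (block J x) = block J x"
  by (auto simp: block_def vec_eq_iff)

lemma block_norm: "norm (block J x) \<le> norm x"
  unfolding norm_vec_def block_def by (intro L2_set_mono) auto

lemma block_bl: "bounded_linear (block J)"
  using block_linear linear_conv_bounded_linear by blast

lemma block_compl: "Jm \<inter> Jc = {} \<Longrightarrow> Jm \<union> Jc = UNIV \<Longrightarrow> block Jm x = x - block Jc x"
  by (auto simp: block_def vec_eq_iff)

lemma block_diff: "block J (x - y) = block J x - block J y"
  using block_linear by (rule linear_diff)

lemma block_0 [simp]: "block J 0 = 0"
  by (simp add: block_def vec_eq_iff)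

locale setting =
  fixes G :: "real^'n \<Rightarrow> real^'n"
    and \<Phi> \<Psi> \<Theta> :: "real^'n \<Rightarrow> real^'n"
    and Jm Jz Ju Jc :: "'n set"
    and Am Ac :: "real^'n \<Rightarrow> real^'n^'n"
    and S0 \<Omega> Stan Vm :: "(real^'n) set"
    and r c :: real and d :: nat
  assumes G_regular: "Ck_on 2 G UNIV"
    and G_zero: "G 0 = 0"
    and r_pos: "r > 0"
    and coords: "coordinate_change r Jm Jz Ju \<Phi> \<Psi>"
    and Jc_eq: "Jc = Jz \<union> Ju"
    and \<Theta>_eq: "\<Theta> = \<Psi> \<circ> \<Phi>"
    and \<Omega>_eq: "\<Omega> = \<Theta> ` ball 0 r"
    and form: "split_form Jm Jc \<Omega> (coord_field \<Theta> (ball 0 r) G) Am Ac"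
    and Z0: "\<And>X. X \<in> \<Omega> \<Longrightarrow> block Jz X = 0 \<Longrightarrow> block Jc (coord_field \<Theta> (ball 0 r) G X) = 0"
    and c_pos: "c > 0"
    and c_gap: "\<And>\<mu>. block_eigenvalue Jm (Am 0) \<mu> \<Longrightarrow> Re \<mu> < - c"
    and S0_manifold: "C1_submanifold d S0"
    and S0_origin: "0 \<in> S0"
    and S0_center: "S0 \<subseteq> center_manifold Jm \<Omega>"
    and S0_invariant: "locally_invariant (coord_field \<Theta> (ball 0 r) G) \<Omega> S0"
    and Stan_eq: "Stan = tangent_space_at S0 0"
    and Vm_eq: "Vm = {X. block Jc X = 0}"
begin

abbreviation "D \<equiv> ball 0 r :: (real^'n) set"
abbreviation "E \<equiv> \<Phi> ` D"
abbreviation "h \<equiv> coord_field \<Phi> D G"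
abbreviation "g \<equiv> coord_field \<Theta> D G"
abbreviation "P \<equiv> block Jc"
abbreviation "\<Psi>' X \<equiv> frechet_derivative \<Psi> (at X)"
abbreviation "\<Phi>' U \<equiv> frechet_derivative \<Phi> (at U)"

lemma split: "Jm \<inter> Jc = {}" "Jm \<union> Jc = UNIV" "Jz \<subseteq> Jc"
  using coords by (auto simp: coordinate_change_def Jc_eq)

lemma Q_block: "block Jm x = x - P x"
  by (rule block_compl[OF split(1,2)])

lemma PQ0 [simp]: "P (block Jm x) = 0" "block Jm (P x) = 0"
  by (simp_all add: Q_block block_diff)

lemma \<Phi>D: "\<Phi> 0 = 0" "Ck_diffeo 2 \<Phi> D E" and \<Psi>D: "\<Psi> 0 = 0" "Ck_diffeo 1 \<Psi> E (\<Psi> ` E)"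
  and \<Psi>m: "\<And>X. X \<in> E \<Longrightarrow> block Jm (\<Psi> X) = block Jm X"
  and \<Psi>c: "\<And>X X'. X \<in> E \<Longrightarrow> X' \<in> E \<Longrightarrow> P X = P X' \<Longrightarrow> P (\<Psi> X) = P (\<Psi> X')"
  using coords unfolding coordinate_change_def Jc_eq[symmetric] by blast+

lemma \<Omega>_E: "\<Omega> = \<Psi> ` E"
  by (simp add: \<Omega>_eq \<Theta>_eq image_comp)

lemma opens: "open E" "open \<Omega>"
  using \<Phi>D \<Psi>D by (auto simp: Ck_diffeo_def \<Omega>_E)

lemma zeros: "0 \<in> D" "0 \<in> E" "0 \<in> \<Omega>"
proof -
  show "0 \<in> D" using r_pos by simp
  then show "0 \<in> E" using \<Phi>D(1) by (metis imageI)
  then show "0 \<in> \<Omega>" using \<Psi>D(1) unfolding \<Omega>_E by (metis imageI)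
qed

lemma injs: "inj_on \<Phi> D" "inj_on \<Psi> E" "inj_on \<Theta> D"
proof -
  show 1: "inj_on \<Phi> D" and 2: "inj_on \<Psi> E"
    using \<Phi>D \<Psi>D by (auto simp: Ck_diffeo_def bij_betw_def)
  show "inj_on \<Theta> D" unfolding \<Theta>_eq using 1 2 by (rule comp_inj_on)
qed

lemma \<Phi>_der: "U \<in> D \<Longrightarrow> (\<Phi> has_derivative \<Phi>' U) (at U)"
  using \<Phi>D(2) unfolding Ck_diffeo_def by (elim conjE) (rule Ck_on_2D(1))

lemma \<Psi>_der: "X \<in> E \<Longrightarrow> (\<Psi> has_derivative \<Psi>' X) (at X)"
  using \<Psi>D(2) unfolding Ck_diffeo_def by (elim conjE) (rule Ck_on_1D(1))

lemma \<Theta>_der: "U \<in> D \<Longrightarrow> (\<Theta> has_derivative (\<lambda>v. \<Psi>' (\<Phi> U) (\<Phi>' U v))) (at U)"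
  unfolding \<Theta>_eq comp_def by (rule has_derivative_compose[OF \<Phi>_der \<Psi>_der]) auto

lemma \<Theta>_frechet: "U \<in> D \<Longrightarrow> frechet_derivative \<Theta> (at U) = (\<lambda>v. \<Psi>' (\<Phi> U) (\<Phi>' U v))"
  using frechet_derivative_at[OF \<Theta>_der] by simp

lemma fields: 
  assumes "U \<in> D"
  shows "coord_field \<Phi> D F (\<Phi> U) = \<Phi>' U (F U)"
    and "coord_field \<Theta> D F (\<Psi> (\<Phi> U)) = \<Psi>' (\<Phi> U) (\<Phi>' U (F U))"
proof -
  show "coord_field \<Phi> D F (\<Phi> U) = \<Phi>' U (F U)"
    using assms injs(1) by (simp add: coord_field_def)
  have "\<Psi> (\<Phi> U) = \<Theta> U" by (simp add: \<Theta>_eq)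
  then show "coord_field \<Theta> D F (\<Psi> (\<Phi> U)) = \<Psi>' (\<Phi> U) (\<Phi>' U (F U))"
    using assms injs(3) by (simp add: coord_field_def \<Theta>_frechet)
qed

lemma field_\<Psi>: "X \<in> E \<Longrightarrow> coord_field \<Theta> D F (\<Psi> X) = \<Psi>' X (coord_field \<Phi> D F X)"
  using fields by auto

lemma \<Psi>'_linear: "X \<in> E \<Longrightarrow> linear (\<Psi>' X)"
  using has_derivative_linear[OF \<Psi>_der] .

lemma derivative_block:
  assumes X: "X \<in> E" and K: "\<And>Y. Y \<in> E \<Longrightarrow> block J (\<Psi> Y) = block J' Y"
  shows "block J (\<Psi>' X v) = block J' v"
proof -
  have "((\<lambda>Y. block J (\<Psi> Y)) has_derivative (\<lambda>v. block J (\<Psi>' X v))) (at X)"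
    by (rule bounded_linear.has_derivative[OF block_bl \<Psi>_der[OF X]])
  moreover have "((\<lambda>Y. block J (\<Psi> Y)) has_derivative block J') (at X)"
    by (rule has_derivative_transform_within_open[OF bounded_linear_imp_has_derivative[OF block_bl] opens(1) X])
      (simp add: K)
  ultimately show ?thesis using has_derivative_unique by metis
qed

lemma \<Psi>'_m: "X \<in> E \<Longrightarrow> block Jm (\<Psi>' X v) = block Jm v"
  by (rule derivative_block[OF _ \<Psi>m])

text \<open>Differentiate along the line \<open>X + t *\<^sub>R v\<close>: its points share their
  centre block, so the centre block of \<open>\<Psi>\<close> is constant along it.\<close>

lemma \<Psi>'_c:
  assumes X: "X \<in> E" and v: "P v = 0"
  shows "P (\<Psi>' X v) = 0"
proof -
  have "((\<lambda>t. X + t *\<^sub>R v) has_derivative (\<lambda>t. t *\<^sub>R v)) (at 0)"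
    by (auto intro!: derivative_eq_intros)
  moreover have "(\<Psi> has_derivative \<Psi>' X) (at (X + 0 *\<^sub>R v))" using \<Psi>_der[OF X] by simp
  ultimately have "((\<lambda>t. \<Psi> (X + t *\<^sub>R v)) has_derivative (\<lambda>t. \<Psi>' X (t *\<^sub>R v))) (at 0)"
    by (rule has_derivative_compose)
  then have 1: "((\<lambda>t. P (\<Psi> (X + t *\<^sub>R v))) has_derivative (\<lambda>t. P (\<Psi>' X (t *\<^sub>R v)))) (at 0)"
    by (rule bounded_linear.has_derivative[OF block_bl])
  have op: "open ((\<lambda>t. X + t *\<^sub>R v) -` E)"
    by (rule open_vimage[OF opens(1)]) (intro continuous_intros)
  have "((\<lambda>t. P (\<Psi> (X + t *\<^sub>R v))) has_derivative (\<lambda>t. 0)) (at 0)"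
  proof (rule has_derivative_transform_within_open[OF has_derivative_const op])
    show "P (\<Psi> X) = P (\<Psi> (X + t *\<^sub>R v))" if "t \<in> (\<lambda>t. X + t *\<^sub>R v) -` E" for t
      using that X v by (intro \<Psi>c) (auto simp: linear_add[OF block_linear] linear_scale[OF block_linear])
  qed (use X in auto)
  then have "(\<lambda>t. P (\<Psi>' X (t *\<^sub>R v))) = (\<lambda>t. 0)"
    using has_derivative_unique[OF 1] by simp
  then show ?thesis by (auto dest: fun_cong[of _ _ 1])
qed

lemma \<Psi>'_iso: "X \<in> E \<Longrightarrow> \<exists>R. linear R \<and> (\<forall>v. R (\<Psi>' X v) = v) \<and> (\<forall>v. \<Psi>' X (R v) = v)"
  using Ck_diffeo_derivative_iso[OF \<Psi>D(2), of X] by auto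

lemma \<Psi>'_inj0: "X \<in> E \<Longrightarrow> \<Psi>' X v = 0 \<Longrightarrow> v = 0"
  using \<Psi>'_iso[of X] \<Psi>'_linear[of X] by (metis linear_0)

text \<open>The derivative of \<open>\<Psi>\<close> respects both blocks and is injective, so it is
  injective on the centre block.\<close>

lemma P_from_\<Psi>':
  assumes X: "X \<in> E" and "P (\<Psi>' X v) = 0"
  shows "P v = 0"
proof -
  have eq: "\<Psi>' X v = \<Psi>' X (block Jm v) + \<Psi>' X (P v)"
    using linear_add[OF \<Psi>'_linear[OF X], of "block Jm v" "P v"] by (simp add: Q_block)
  have "P (\<Psi>' X (P v)) = 0"
    using assms(2) \<Psi>'_c[OF X PQ0(1)] unfolding eq by (simp add: linear_add[OF block_linear])
  moreover have "block Jm (\<Psi>' X (P v)) = 0" using \<Psi>'_m[OF X, of "P v"] by simp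
  ultimately have "\<Psi>' X (P v) = 0" by (simp add: Q_block)
  then show ?thesis by (rule \<Psi>'_inj0[OF X])
qed

lemma center_h:
  assumes X: "X \<in> E" and "P X = X"
  shows "P (h X) = h X"
proof -
  have m: "block Jm X = 0" using assms(2) by (simp add: Q_block)
  have "\<Psi> X \<in> \<Omega>" using X by (simp add: \<Omega>_E)
  then have "block Jm (g (\<Psi> X)) = block Jm (Am (\<Psi> X) *v block Jm (\<Psi> X))"
    using form by (simp add: split_form_def)
  also have "\<dots> = 0" using \<Psi>m[OF X] m by (simp add: matrix_vector_mult_0_right)
  finally have "block Jm (h X) = 0" using \<Psi>'_m[OF X, of "h X"] field_\<Psi>[OF X, of G] by simp
  then show ?thesis by (simp add: Q_block)
qed

text \<open>The manifold \<open>Z\<^sub>0\<close> in the coordinates of \<open>\<Phi>\<close>, where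
  it is curved and of class \<open>C\<^sup>1\<close>.\<close>

definition "Zset = {y \<in> E. block Jz (\<Psi> y) = 0}"

lemma block_sub: "J \<subseteq> J' \<Longrightarrow> block J (block J' x) = block J x"
  by (auto simp: block_def vec_eq_iff)

lemma Z_h:
  assumes X: "X \<in> E" and "P X \<in> Zset"
  shows "P (h X) = 0"
proof -
  have y: "P X \<in> E" "block Jz (\<Psi> (P X)) = 0" using assms(2) by (auto simp: Zset_def)
  have "P (\<Psi> X) = P (\<Psi> (P X))" by (rule \<Psi>c[OF X y(1)]) simp
  then have "block Jz (\<Psi> X) = 0" using y(2) block_sub[OF split(3)] by metis
  moreover have "\<Psi> X \<in> \<Omega>" using X by (simp add: \<Omega>_E)
  ultimately have "P (g (\<Psi> X)) = 0" using Z0 by blast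
  then show ?thesis unfolding field_\<Psi>[OF X] by (rule P_from_\<Psi>'[OF X])
qed

end

text \<open>At a zero of the first factor, continuity of the second one is enough for a product
  rule. The coefficients of the split form and the derivative of \<open>\<Theta>\<close> are
  continuous and no better.\<close>

lemma vanishing_product_derivative:
  fixes m :: "real \<Rightarrow> 'b::real_normed_vector"
  assumes f: "(f has_real_derivative f') (at 0)" "f 0 = 0" and m: "(m \<longlongrightarrow> m 0) (at 0)"
  shows "((\<lambda>t. f t *\<^sub>R m t) has_vector_derivative f' *\<^sub>R m 0) (at 0)"
proof -
  have f0: "((\<lambda>t. f t / t) \<longlongrightarrow> f') (at 0)"
    using f by (simp add: has_field_derivative_iff)
  have "((\<lambda>t. norm ((f t / t) *\<^sub>R m t - f' *\<^sub>R m 0)) \<longlongrightarrow> norm (f' *\<^sub>R m 0 - f' *\<^sub>R m 0)) (at 0)"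
    by (intro tendsto_intros f0 m)
  then have "((\<lambda>t. norm ((f t / t) *\<^sub>R m t - f' *\<^sub>R m 0)) \<longlongrightarrow> 0) (at 0)" by simp
  moreover have "\<forall>\<^sub>F t in at 0. norm ((f t / t) *\<^sub>R m t - f' *\<^sub>R m 0) =
      norm (f (0 + t) *\<^sub>R m (0 + t) - f 0 *\<^sub>R m 0 - t *\<^sub>R f' *\<^sub>R m 0) / norm t"
  proof (rule eventually_mono[OF eventually_neq_at_within[of 0]])
    fix t :: real assume t: "t \<noteq> 0"
    have "f t *\<^sub>R m t - t *\<^sub>R f' *\<^sub>R m 0 = t *\<^sub>R ((f t / t) *\<^sub>R m t - f' *\<^sub>R m 0)"
      using t by (simp add: scaleR_diff_right)
    then show "norm ((f t / t) *\<^sub>R m t - f' *\<^sub>R m 0) =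
        norm (f (0 + t) *\<^sub>R m (0 + t) - f 0 *\<^sub>R m 0 - t *\<^sub>R f' *\<^sub>R m 0) / norm t"
      using t f(2) by simp
  qed
  ultimately have "(\<lambda>t. norm (f (0 + t) *\<^sub>R m (0 + t) - f 0 *\<^sub>R m 0 - t *\<^sub>R f' *\<^sub>R m 0) / norm t) \<midarrow>0\<rightarrow> 0"
    by (rule Lim_transform_eventually)
  then show ?thesis
    unfolding has_vector_derivative_def has_derivative_at
    by (intro conjI bounded_linear_scaleR_left)
qed

lemma vanishing_linear_derivative:
  fixes w :: "real \<Rightarrow> 'a::euclidean_space" and M :: "real \<Rightarrow> 'a \<Rightarrow> 'b::real_normed_vector"
  assumes w: "(w has_vector_derivative w') (at 0)" "w 0 = 0" and M: "\<And>v. ((\<lambda>t. M t v) \<longlongrightarrow> M 0 v) (at 0)"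
    and lin: "linear (M 0)" "\<forall>\<^sub>F t in nhds 0. linear (M t)"
  shows "((\<lambda>t. M t (w t)) has_vector_derivative M 0 w') (at 0)"
proof -
  have "((\<lambda>t. (w t \<bullet> b) *\<^sub>R M t b) has_vector_derivative (w' \<bullet> b) *\<^sub>R M 0 b) (at 0)" for b
    by (rule vanishing_product_derivative[OF _ _ M])
      (use w in \<open>auto simp: has_real_derivative_iff_has_vector_derivative intro!: derivative_eq_intros
        bounded_linear.has_vector_derivative[OF bounded_linear_inner_left]\<close>)
  then have "((\<lambda>t. \<Sum>b\<in>Basis. (w t \<bullet> b) *\<^sub>R M t b) has_vector_derivative (\<Sum>b\<in>Basis. (w' \<bullet> b) *\<^sub>R M 0 b)) (at 0)"
    by (intro has_vector_derivative_sum)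
  then have d: "((\<lambda>t. \<Sum>b\<in>Basis. (w t \<bullet> b) *\<^sub>R M t b) has_vector_derivative M 0 w') (at 0)"
    using linear_euclidean_representation[OF lin(1), of w'] by simp
  obtain T where T: "open T" "0 \<in> T" "\<And>t. t \<in> T \<Longrightarrow> linear (M t)"
    using lin(2) unfolding eventually_nhds by blast
  show ?thesis
    by (rule has_vector_derivative_transform_within_open[OF d T(1,2)])
      (rule linear_euclidean_representation[OF T(3), symmetric])
qed

section \<open>The linearization at the origin and a form adapted to it\<close>

context setting
begin

lemma curve_facts:
  fixes u :: "real^'n"
  defines "Y \<equiv> \<lambda>t. \<Psi> (\<Phi> (t *\<^sub>R u))"
  shows "\<exists>T. open T \<and> 0 \<in> T \<and> (\<forall>t\<in>T. t *\<^sub>R u \<in> D)"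
    and "((\<lambda>t. \<Phi> (t *\<^sub>R u)) has_vector_derivative \<Phi>' 0 u) (at 0)"
    and "(Y has_vector_derivative \<Psi>' 0 (\<Phi>' 0 u)) (at 0)"
    and "((\<lambda>t. G (t *\<^sub>R u)) has_vector_derivative frechet_derivative G (at 0) u) (at 0)"
proof -
  have "open ((\<lambda>t. t *\<^sub>R u) -` D)" by (rule open_vimage[OF open_ball]) (intro continuous_intros)
  then show "\<exists>T. open T \<and> 0 \<in> T \<and> (\<forall>t\<in>T. t *\<^sub>R u \<in> D)"
    using r_pos by (intro exI[of _ "(\<lambda>t. t *\<^sub>R u) -` D"]) auto
  have tu: "((\<lambda>t. t *\<^sub>R u) has_derivative (\<lambda>t. t *\<^sub>R u)) (at 0)"
    by (auto intro!: derivative_eq_intros)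
  have *: "((\<lambda>t. F (t *\<^sub>R u)) has_vector_derivative F' u) (at 0)" if F: "(F has_derivative F') (at 0)" for F F' :: "real^'n \<Rightarrow> real^'n"
  proof -
    have "(F has_derivative F') (at (0 *\<^sub>R u))" using F by simp
    from has_derivative_compose[OF tu this] show ?thesis
      using has_derivative_linear[OF F] by (simp add: has_vector_derivative_def linear_scale)
  qed
  show "((\<lambda>t. \<Phi> (t *\<^sub>R u)) has_vector_derivative \<Phi>' 0 u) (at 0)" by (rule *[OF \<Phi>_der[OF zeros(1)]])
  show "(Y has_vector_derivative \<Psi>' 0 (\<Phi>' 0 u)) (at 0)"
    unfolding Y_def using *[OF \<Theta>_der[OF zeros(1)]] \<Phi>D(1) by (simp add: \<Theta>_eq)
  show "((\<lambda>t. G (t *\<^sub>R u)) has_vector_derivative frechet_derivative G (at 0) u) (at 0)"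
    by (rule *[OF Ck_on_2D(1)[OF G_regular UNIV_I]])
qed

text \<open>Along the curve the field is the derivative of \<open>\<Theta>\<close> at
  \<open>t *\<^sub>R u\<close>, applied to \<open>G (t *\<^sub>R u)\<close>. Since \<open>G\<close>
  vanishes at the origin, the product is differentiable there although its first factor is merely
  continuous.\<close>

lemma field_derivative:
  "((\<lambda>t. g (\<Psi> (\<Phi> (t *\<^sub>R u)))) has_vector_derivative \<Psi>' 0 (\<Phi>' 0 (frechet_derivative G (at 0) u))) (at 0)"
proof -
  obtain T where T: "open T" "0 \<in> T" "\<And>t. t \<in> T \<Longrightarrow> t *\<^sub>R u \<in> D" using curve_facts(1)[of u] by blast
  define M where "M t v = \<Psi>' (\<Phi> (t *\<^sub>R u)) (\<Phi>' (t *\<^sub>R u) v)" for t v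
  have C1: "Ck_on 1 \<Theta> D"
    unfolding \<Theta>_eq comp_def
    by (rule Ck_on_1_compose[of \<Phi> D \<Psi> E])
      (use \<Phi>D(2) \<Psi>D(2) Ck_on_2_imp_1 in \<open>auto simp: Ck_diffeo_def simp del: Ck_on.simps\<close>)
  have lin: "linear (M t)" if "t \<in> T" for t
    unfolding M_def using has_derivative_linear[OF \<Theta>_der[OF T(3)[OF that]]] .
  have "((\<lambda>t. M t (G (t *\<^sub>R u))) has_vector_derivative M 0 (frechet_derivative G (at 0) u)) (at 0)"
  proof (rule vanishing_linear_derivative[OF curve_facts(4), where M=M])
    show "G (0 *\<^sub>R u) = 0" using G_zero by simp
    show "linear (M 0)" by (rule lin[OF T(2)])
    show "\<forall>\<^sub>F t in nhds 0. linear (M t)" using T lin unfolding eventually_nhds by blast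
    fix v
    have "continuous_on T (\<lambda>t. frechet_derivative \<Theta> (at (t *\<^sub>R u)) v)"
      by (rule continuous_on_compose2[OF Ck_on_1D(2)[OF C1]]) (use T in \<open>auto intro!: continuous_intros\<close>)
    then have "continuous_on T (\<lambda>t. M t v)"
      by (rule continuous_on_eq) (simp only: M_def \<Theta>_frechet[OF T(3)])
    then have "isCont (\<lambda>t. M t v) 0" using T continuous_on_eq_continuous_at by blast
    then show "((\<lambda>t. M t v) \<longlongrightarrow> M 0 v) (at 0)" by (simp add: isCont_def)
  qed
  then have "((\<lambda>t. g (\<Psi> (\<Phi> (t *\<^sub>R u)))) has_vector_derivative M 0 (frechet_derivative G (at 0) u)) (at 0)"
    by (rule has_vector_derivative_transform_within_open[OF _ T(1,2)]) (simp add: M_def fields(2)[OF T(3)])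
  then show ?thesis by (simp add: M_def \<Phi>D(1))
qed

text \<open>Both sides of the split form are differentiated along one curve; on the right the
  coefficient survives through its value at the origin.\<close>

lemma split_derivative:
  assumes C: "continuous_on \<Omega> C" and eq: "\<And>X. X \<in> \<Omega> \<Longrightarrow> block J (g X) = block J (C X *v block J X)"
  shows "block J (\<Psi>' 0 (\<Phi>' 0 (frechet_derivative G (at 0) u))) = block J (C 0 *v block J (\<Psi>' 0 (\<Phi>' 0 u)))"
proof -
  define Y where "Y t = \<Psi> (\<Phi> (t *\<^sub>R u))" for t
  obtain T where T: "open T" "0 \<in> T" "\<And>t. t \<in> T \<Longrightarrow> t *\<^sub>R u \<in> D" using curve_facts(1)[of u] by blast
  have Y\<Omega>: "Y t \<in> \<Omega>" if "t \<in> T" for t using T(3)[OF that] by (simp add: Y_def \<Omega>_E)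
  have Y0: "Y 0 = 0" by (simp add: Y_def \<Phi>D \<Psi>D)
  define M where "M t v = block J (C (Y t) *v v)" for t v
  have lin: "linear (M t)" for t
    unfolding M_def by (rule linearI)
      (auto simp: matrix_vector_right_distrib linear_add[OF block_linear] linear_scale[OF block_linear] matrix_vector_mult_scaleR)
  have Yd: "(Y has_vector_derivative \<Psi>' 0 (\<Phi>' 0 u)) (at 0)" unfolding Y_def by (rule curve_facts(3))
  have 1: "((\<lambda>t. M t (block J (Y t))) has_vector_derivative M 0 (block J (\<Psi>' 0 (\<Phi>' 0 u)))) (at 0)"
  proof (rule vanishing_linear_derivative[where M=M])
    show "((\<lambda>t. block J (Y t)) has_vector_derivative block J (\<Psi>' 0 (\<Phi>' 0 u))) (at 0)"
      by (rule bounded_linear.has_vector_derivative[OF block_bl Yd])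
    show "block J (Y 0) = 0" by (simp add: Y0)
    show "linear (M 0)" by (rule lin)
    show "\<forall>\<^sub>F t in nhds 0. linear (M t)" using lin by simp
    fix v
    have "isCont Y 0" using Yd has_vector_derivative_continuous by blast
    then have Yl: "(Y \<longlongrightarrow> 0) (at 0)" by (simp add: isCont_def Y0)
    have "isCont C 0" using C continuous_on_eq_continuous_at[OF opens(2)] zeros(3) by blast
    then have "((\<lambda>t. C (Y t)) \<longlongrightarrow> C 0) (at 0)" by (rule isCont_tendsto_compose[OF _ Yl])
    then have "((\<lambda>t. C (Y t) *v v) \<longlongrightarrow> C 0 *v v) (at 0)"
      unfolding matrix_vector_mult_def by (intro tendsto_intros)
    then show "((\<lambda>t. M t v) \<longlongrightarrow> M 0 v) (at 0)"
      unfolding M_def Y0 by (rule bounded_linear.tendsto[OF block_bl])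
  qed
  have 2: "((\<lambda>t. block J (g (Y t))) has_vector_derivative block J (\<Psi>' 0 (\<Phi>' 0 (frechet_derivative G (at 0) u)))) (at 0)"
    unfolding Y_def by (rule bounded_linear.has_vector_derivative[OF block_bl field_derivative])
  have "((\<lambda>t. block J (g (Y t))) has_vector_derivative M 0 (block J (\<Psi>' 0 (\<Phi>' 0 u)))) (at 0)"
    by (rule has_vector_derivative_transform_within_open[OF 1 T(1,2)]) (simp add: M_def eq[OF Y\<Omega>])
  then show ?thesis
    using vector_derivative_unique_at[OF 2] by (simp add: M_def Y0)
qed

text \<open>The matrices of the split form belong to the final coordinates, the operator
  \<open>A\<close> to those of \<open>\<Phi>\<close>. The derivative of \<open>\<Psi>\<close> does
  not change the stable block, and on the centre block it conjugates \<open>A\<close> to the block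
  of \<open>Ac 0\<close>.\<close>

lemma linear_part:
  "\<exists>A. linear A \<and> (\<forall>u. A (\<Phi>' 0 u) = \<Phi>' 0 (frechet_derivative G (at 0) u)) \<and>
    (\<forall>v. block Jm (A v) = block Jm (Am 0 *v block Jm v)) \<and>
    (\<forall>v. P (\<Psi>' 0 (A v)) = P (Ac 0 *v P (\<Psi>' 0 v))) \<and> (\<forall>v. P (A v) = A (P v))"
proof -
  obtain L1 where L1: "linear L1" "\<And>v. L1 (\<Phi>' 0 v) = v" "\<And>v. \<Phi>' 0 (L1 v) = v"
    using Ck_diffeo_derivative_iso[OF \<Phi>D(2), of 0] zeros(1) by auto
  define A where "A v = \<Phi>' 0 (frechet_derivative G (at 0) (L1 v))" for v
  have lin: "linear A"
    unfolding A_def[abs_def]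
    using linear_compose[OF linear_compose[OF L1(1) has_derivative_linear[OF Ck_on_2D(1)[OF G_regular UNIV_I]]]
        has_derivative_linear[OF \<Phi>_der[OF zeros(1)]]] by (simp add: comp_def)
  note sf = form[unfolded split_form_def]
  have m: "block Jm (A v) = block Jm (Am 0 *v block Jm v)" for v
  proof -
    have "block Jm (\<Psi>' 0 (A v)) = block Jm (Am 0 *v block Jm (\<Psi>' 0 (\<Phi>' 0 (L1 v))))"
      unfolding A_def using sf by (intro split_derivative) auto
    then show ?thesis by (simp add: \<Psi>'_m[OF zeros(2)] L1)
  qed
  have c: "P (\<Psi>' 0 (A v)) = P (Ac 0 *v P (\<Psi>' 0 v))" for v
  proof -
    have "P (\<Psi>' 0 (A v)) = P (Ac 0 *v P (\<Psi>' 0 (\<Phi>' 0 (L1 v))))"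
      unfolding A_def using sf by (intro split_derivative) auto
    then show ?thesis by (simp add: L1)
  qed
  have AP: "P (A v) = A (P v)" for v
  proof -
    have "block Jm (A (P v)) = 0" using m[of "P v"] by (simp add: matrix_vector_mult_0_right)
    then have 1: "P (A (P v)) = A (P v)" by (simp add: Q_block)
    have "P (\<Psi>' 0 (A (block Jm v))) = 0"
      using c[of "block Jm v"] \<Psi>'_c[OF zeros(2) PQ0(1), of v] by (simp add: matrix_vector_mult_0_right)
    then have "P (A (block Jm v)) = 0" by (rule P_from_\<Psi>'[OF zeros(2)])
    moreover have "A v = A (block Jm v) + A (P v)" using linear_add[OF lin, of "block Jm v" "P v"] by (simp add: Q_block)
    ultimately show ?thesis using 1 by (simp add: linear_add[OF block_linear])
  qed
  have "A (\<Phi>' 0 u) = \<Phi>' 0 (frechet_derivative G (at 0) u)" for u by (simp add: A_def L1)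
  then show ?thesis using lin m c AP by blast
qed

text \<open>The sum of a form for each block, the one of the centre being transported by
  \<open>\<Psi>' 0\<close>, under which \<open>A\<close> becomes \<open>Ac 0\<close>. Centre and
  stable directions are thereby orthogonal for \<open>B\<close>, and the size of
  \<open>\<Psi>' 0\<close> affects the constant \<open>a\<close> but not the rates.\<close>

lemma adapted:
  assumes e: "0 < e"
  shows "\<exists>A B a. linear A \<and> (\<forall>u. A (\<Phi>' 0 u) = \<Phi>' 0 (frechet_derivative G (at 0) u)) \<and> (\<forall>v. P (A v) = A (P v)) \<and>
    bounded_bilinear B \<and> (\<forall>x y. B x y = B y x) \<and> 0 < (a :: real) \<and> (\<forall>x. a * (norm x)\<^sup>2 \<le> B x x) \<and>
    (\<forall>x y. B (P x) (y - P y) = 0) \<and> (\<forall>x. \<bar>B (P x) (A (P x))\<bar> \<le> e * B (P x) (P x)) \<and>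
    (\<forall>x. B (x - P x) (A (x - P x)) \<le> - (c - e) * B (x - P x) (x - P x))"
proof -
  obtain A where A: "linear A" "\<forall>u. A (\<Phi>' 0 u) = \<Phi>' 0 (frechet_derivative G (at 0) u)"
    "\<And>v. block Jm (A v) = block Jm (Am 0 *v block Jm v)"
    "\<And>v. P (\<Psi>' 0 (A v)) = P (Ac 0 *v P (\<Psi>' 0 v))" "\<And>v. P (A v) = A (P v)"
    using linear_part by blast
  obtain Bm :: "real^'n \<Rightarrow> real^'n \<Rightarrow> real" where Bm1: "bounded_bilinear Bm \<and> (\<forall>u v. Bm u v = Bm v u) \<and> (\<forall>u. 0 \<le> Bm u u) \<and>
    (\<forall>x. block Jm x = x \<longrightarrow> (norm x)\<^sup>2 \<le> Bm x x) \<and> (\<forall>hi. (\<forall>\<mu>. block_eigenvalue Jm (Am 0) \<mu> \<longrightarrow> Re \<mu> \<le> hi) \<longrightarrow>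
       (\<forall>x. block Jm x = x \<longrightarrow> Bm (block Jm (Am 0 *v x)) x \<le> (hi + e) * Bm x x))"
    using adapted_form[OF e, of Jm "Am 0"] by metis
  then have Bm: "bounded_bilinear Bm" "\<And>u v. Bm u v = Bm v u" "\<And>x. block Jm x = x \<Longrightarrow> (norm x)\<^sup>2 \<le> Bm x x"
    and Bmd: "\<And>hi x. (\<And>\<mu>. block_eigenvalue Jm (Am 0) \<mu> \<Longrightarrow> Re \<mu> \<le> hi) \<Longrightarrow> block Jm x = x \<Longrightarrow>
       Bm (block Jm (Am 0 *v x)) x \<le> (hi + e) * Bm x x" by blast+
  obtain Bc :: "real^'n \<Rightarrow> real^'n \<Rightarrow> real" where Bc1: "bounded_bilinear Bc \<and> (\<forall>u v. Bc u v = Bc v u) \<and> (\<forall>u. 0 \<le> Bc u u) \<and>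
    (\<forall>x. P x = x \<longrightarrow> (norm x)\<^sup>2 \<le> Bc x x) \<and> (\<forall>hi. (\<forall>\<mu>. block_eigenvalue Jc (Ac 0) \<mu> \<longrightarrow> Re \<mu> \<le> hi) \<longrightarrow>
       (\<forall>x. P x = x \<longrightarrow> Bc (P (Ac 0 *v x)) x \<le> (hi + e) * Bc x x)) \<and>
    (\<forall>lo. (\<forall>\<mu>. block_eigenvalue Jc (Ac 0) \<mu> \<longrightarrow> lo \<le> Re \<mu>) \<longrightarrow>
       (\<forall>x. P x = x \<longrightarrow> (lo - e) * Bc x x \<le> Bc (P (Ac 0 *v x)) x))"
    using adapted_form[OF e, of Jc "Ac 0"] by metis
  then have Bc: "bounded_bilinear Bc" "\<And>u v. Bc u v = Bc v u" "\<And>x. P x = x \<Longrightarrow> (norm x)\<^sup>2 \<le> Bc x x"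
    and Bcu: "\<And>hi x. (\<And>\<mu>. block_eigenvalue Jc (Ac 0) \<mu> \<Longrightarrow> Re \<mu> \<le> hi) \<Longrightarrow> P x = x \<Longrightarrow>
       Bc (P (Ac 0 *v x)) x \<le> (hi + e) * Bc x x"
    and Bcl: "\<And>lo x. (\<And>\<mu>. block_eigenvalue Jc (Ac 0) \<mu> \<Longrightarrow> lo \<le> Re \<mu>) \<Longrightarrow> P x = x \<Longrightarrow>
       (lo - e) * Bc x x \<le> Bc (P (Ac 0 *v x)) x" by blast+
  define S where "S x = \<Psi>' 0 (P x)" for x
  have Slin: "linear S" unfolding S_def[abs_def]
    using linear_compose[OF block_linear \<Psi>'_linear[OF zeros(2)]] by (simp add: comp_def)
  have Sbl: "bounded_linear S" using Slin linear_conv_bounded_linear by blast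
  have PS: "P (S x) = S x" for x
    using \<Psi>'_m[OF zeros(2), of "P x"] by (simp add: S_def Q_block)
  have S0: "S (x - P x) = 0" "S (P x) = S x" for x
    by (simp_all add: S_def block_diff linear_0[OF \<Psi>'_linear[OF zeros(2)]])
  obtain R nR where R: "linear R" "\<And>v. R (\<Psi>' 0 v) = v" "nR > 0" "\<And>v. norm (R v) \<le> norm v * nR"
    using \<Psi>'_iso[OF zeros(2)] linear_bounded_pos by (metis mult.commute)
  define B where "B x y = Bm (block Jm x) (block Jm y) + Bc (S x) (S y)" for x y
  have B_eq: "B x y = Bm (x - P x) (y - P y) + Bc (S x) (S y)" for x y by (simp add: B_def Q_block)
  interpret m: bounded_bilinear Bm by (rule Bm(1))
  interpret c: bounded_bilinear Bc by (rule Bc(1))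
  have "bilinear B"
    unfolding bilinear_def B_def
    by (auto intro!: linearI simp: m.add_left m.add_right c.add_left c.add_right m.scaleR_left m.scaleR_right
        c.scaleR_left c.scaleR_right linear_add[OF Slin] linear_scale[OF Slin] algebra_simps
        linear_add[OF block_linear] linear_scale[OF block_linear])
  then have B1: "bounded_bilinear B" using bilinear_conv_bounded_bilinear by blast
  have B2: "B x y = B y x" for x y unfolding B_eq using Bm(2) Bc(2) by metis
  \<comment> \<open>The 1/2 comes from estimating the square of a sum by twice the sum of the
    squares; \<open>nR\<close> bounds the inverse of \<open>\<Psi>' 0\<close>, which compares
    \<open>P x\<close> with \<open>S x\<close>.\<close>
  define a where "a = min 1 (1 / nR\<^sup>2) / 2"
  have a: "0 < a" using R by (simp add: a_def)
  have B3: "a * (norm x)\<^sup>2 \<le> B x x" for x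
  proof -
    have 1: "(norm (x - P x))\<^sup>2 \<le> Bm (x - P x) (x - P x)"
      by (rule Bm(3)) (simp add: Q_block block_diff)
    have "norm (P x) \<le> norm (S x) * nR" using R(2)[of "P x"] R(4)[of "S x"] by (simp add: S_def)
    then have "(norm (P x))\<^sup>2 \<le> (norm (S x) * nR)\<^sup>2" by (intro power_mono) auto
    then have "1 / nR\<^sup>2 * (norm (P x))\<^sup>2 \<le> (norm (S x))\<^sup>2"
      using R(3) by (simp add: power_mult_distrib pos_divide_le_eq)
    also have "\<dots> \<le> Bc (S x) (S x)" by (rule Bc(3)[OF PS])
    finally have 2: "1 / nR\<^sup>2 * (norm (P x))\<^sup>2 \<le> Bc (S x) (S x)" .
    have "norm x \<le> norm (x - P x) + norm (P x)" using norm_triangle_ineq[of "x - P x" "P x"] by simp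
    then have "(norm x)\<^sup>2 \<le> (norm (x - P x) + norm (P x))\<^sup>2" by (intro power_mono) auto
    also have "\<dots> \<le> 2 * ((norm (x - P x))\<^sup>2 + (norm (P x))\<^sup>2)"
      using zero_le_power2[of "norm (x - P x) - norm (P x)"] by (simp add: power2_eq_square algebra_simps)
    finally have "a * (norm x)\<^sup>2 \<le> a * (2 * ((norm (x - P x))\<^sup>2 + (norm (P x))\<^sup>2))"
      using a by (intro mult_left_mono) auto
    also have "\<dots> = min 1 (1 / nR\<^sup>2) * (norm (x - P x))\<^sup>2 + min 1 (1 / nR\<^sup>2) * (norm (P x))\<^sup>2"
      by (simp add: a_def algebra_simps)
    also have "\<dots> \<le> 1 * (norm (x - P x))\<^sup>2 + 1 / nR\<^sup>2 * (norm (P x))\<^sup>2"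
      by (intro add_mono mult_right_mono) auto
    also have "\<dots> \<le> B x x" unfolding B_eq using 1 2 by linarith
    finally show ?thesis .
  qed
  have B4: "B (P x) (y - P y) = 0" for x y
    unfolding B_eq S0 by (simp add: m.zero_left c.zero_right)
  have B5: "\<bar>B (P x) (A (P x))\<bar> \<le> e * B (P x) (P x)" for x
  proof -
    have SA: "S (A (P x)) = P (Ac 0 *v S x)"
    proof -
      have "\<Psi>' 0 (P (A (P x))) = P (\<Psi>' 0 (P (A (P x))))" using PS[of "A (P x)"] by (simp add: S_def)
      also have "P (A (P x)) = A (P x)" by (simp add: A(5))
      finally have "S (A (P x)) = P (\<Psi>' 0 (A (P x)))" by (simp add: S_def A(5))
      also have "\<dots> = P (Ac 0 *v P (\<Psi>' 0 (P x)))" by (rule A(4))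
      finally show ?thesis using PS[of x] by (simp add: S_def)
    qed
    have "B (P x) (A (P x)) = Bc (P (Ac 0 *v S x)) (S x)"
      unfolding B_eq SA S0 by (simp add: m.zero_left Bc(2))
    moreover have "B (P x) (P x) = Bc (S x) (S x)"
      unfolding B_eq S0 by (simp add: m.zero_left)
    moreover have "Bc (P (Ac 0 *v S x)) (S x) \<le> (0 + e) * Bc (S x) (S x)"
      by (rule Bcu[OF _ PS]) (use form in \<open>simp add: split_form_def\<close>)
    moreover have "Bc (P (Ac 0 *v S x)) (S x) \<ge> (0 - e) * Bc (S x) (S x)"
      by (rule Bcl[OF _ PS]) (use form in \<open>simp add: split_form_def\<close>)
    ultimately show ?thesis by (simp add: abs_le_iff)
  qed
  have B6: "B (x - P x) (A (x - P x)) \<le> - (c - e) * B (x - P x) (x - P x)" for x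
  proof -
    let ?x = "x - P x"
    have Qx: "block Jm ?x = ?x" "P ?x = 0" by (simp_all add: Q_block block_diff)
    have "P (A ?x) = 0" using A(5)[of ?x] Qx(2) linear_0[OF A(1)] by simp
    then have "A ?x - P (A ?x) = block Jm (Am 0 *v ?x)" using A(3)[of ?x] Qx by (simp add: Q_block)
    then have "B ?x (A ?x) = Bm (block Jm (Am 0 *v ?x)) ?x"
      unfolding B_eq S0 Qx(2) by (simp add: c.zero_left Bm(2))
    moreover have "B ?x ?x = Bm ?x ?x" unfolding B_eq S0 Qx(2) by (simp add: c.zero_left)
    moreover have "Bm (block Jm (Am 0 *v ?x)) ?x \<le> (- c + e) * Bm ?x ?x"
      by (rule Bmd[OF less_imp_le[OF c_gap] Qx(1)])
    ultimately show ?thesis by (simp add: algebra_simps)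
  qed
  show ?thesis
    by (intro exI[of _ A] exI[of _ B] exI[of _ a] conjI allI) (rule A B1 B2 a B3 B4 B5 B6 A(2)[rule_format])+
qed

end

text \<open>The field \<open>H\<close> extends the one in the coordinates given by \<open>\<Phi>\<close> from a ball of fixed radius. The
  cut-off \<open>\<phi>\<close> of the theorem cannot serve for this purpose: its gradient is not controlled, so it may
  destroy the spectral gap.\<close>

locale phase = setting G \<Phi> \<Psi> \<Theta> Jm Jz Ju Jc Am Ac S0 \<Omega> Stan Vm r c d + cs: center_stable_flow "lipschitz_field.flow H" H "block Jc" B a b \<epsilon> c' L \<rho>
    "{y \<in> setting.Zset \<Phi> \<Psi> Jz r. block Jc y = y \<and> norm y < \<rho>}"
  for G \<Phi> \<Psi> \<Theta> :: "real^'n \<Rightarrow> real^'n" and Jm Jz Ju Jc :: "'n set" and Am Ac :: "real^'n \<Rightarrow> real^'n^'n"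
    and S0 \<Omega> Stan Vm :: "(real^'n) set" and r c :: real and d :: nat
    and H :: "real^'n \<Rightarrow> real^'n" and B a b \<epsilon> c' L \<rho> +
  assumes rates: "\<epsilon> = 2 * (c / 1000)" "c' = (c - c / 1000) - c / 1000"
    and H_lipschitz: "lipschitz_field H L"
    and H_near: "\<And>X. norm X < 2 * \<rho> \<Longrightarrow> X \<in> \<Phi> ` ball 0 r \<and> H X = coord_field \<Phi> (ball 0 r) G X"
    and H_bounded: "\<exists>C. \<forall>X. norm (H (block Jc X)) \<le> C"

lemma (in setting) phase_exists:
  "\<exists>H B a b \<epsilon> c' L \<rho>. phase G \<Phi> \<Psi> \<Theta> Jm Jz Ju Jc Am Ac S0 \<Omega> Stan Vm r c d H B a b \<epsilon> c' L \<rho>"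
proof -
  \<comment> \<open>A fraction of \<open>c\<close> small enough for the gap condition; it also
    leaves room for the final rate \<open>c / 4\<close>.\<close>
  have e: "0 < c / 1000" "35 * (c / 1000) < c - c / 1000" using c_pos by auto
  obtain A B a where AB: "linear A \<and> (\<forall>u. A (\<Phi>' 0 u) = \<Phi>' 0 (frechet_derivative G (at 0) u)) \<and> (\<forall>v. P (A v) = A (P v)) \<and>
    bounded_bilinear B \<and> (\<forall>x y. B x y = B y x) \<and> 0 < (a :: real) \<and> (\<forall>x. a * (norm x)\<^sup>2 \<le> B x x) \<and>
    (\<forall>x y. B (P x) (y - P y) = 0) \<and> (\<forall>x. \<bar>B (P x) (A (P x))\<bar> \<le> c / 1000 * B (P x) (P x)) \<and>
    (\<forall>x. B (x - P x) (A (x - P x)) \<le> - (c - c / 1000) * B (x - P x) (x - P x))"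
    using adapted[OF e(1)] by (elim exE) (rule that)
  have A: "linear A" "\<And>u. A (\<Phi>' 0 u) = \<Phi>' 0 (frechet_derivative G (at 0) u)" "\<And>v. P (A v) = A (P v)"
    and B: "bounded_bilinear B" "\<And>x y. B x y = B y x" "0 < a" "\<And>x. a * (norm x)\<^sup>2 \<le> B x x"
      "\<And>x y. B (P x) (y - P y) = 0" "\<And>x. \<bar>B (P x) (A (P x))\<bar> \<le> c / 1000 * B (P x) (P x)"
      "\<And>x. B (x - P x) (A (x - P x)) \<le> - (c - c / 1000) * B (x - P x) (x - P x)"
    using AB by auto
  have "\<exists>H L b \<rho>. lipschitz_field H L \<and> 0 < \<rho> \<and> H 0 = 0 \<and>
    (\<forall>X. norm X < 2 * \<rho> \<longrightarrow> X \<in> E \<and> H X = h X) \<and> (\<exists>C. \<forall>X. norm (H (P X)) \<le> C) \<and>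
    center_stable_flow (lipschitz_field.flow H) H P B a b (2 * (c / 1000)) ((c - c / 1000) - c / 1000) L \<rho> {y \<in> Zset. P y = y \<and> norm y < \<rho>}"
  proof (rule extension_exists[OF r_pos \<Phi>D G_regular G_zero block_linear block_idem block_norm A(1,2,3) B _ _ e])
    show "P (h X) = h X" if "X \<in> E" "P X = X" for X by (rule center_h[OF that])
    show "P (h X) = 0" if "X \<in> E" "P X \<in> Zset" for X by (rule Z_h[OF that])
  qed
  then obtain H L b \<rho> where "lipschitz_field H L \<and> 0 < \<rho> \<and> H 0 = 0 \<and>
    (\<forall>X. norm X < 2 * \<rho> \<longrightarrow> X \<in> E \<and> H X = h X) \<and> (\<exists>C. \<forall>X. norm (H (P X)) \<le> C) \<and>
    center_stable_flow (lipschitz_field.flow H) H P B a b (2 * (c / 1000)) ((c - c / 1000) - c / 1000) L \<rho> {y \<in> Zset. P y = y \<and> norm y < \<rho>}"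
    by (elim exE) (rule that)
  then have "phase G \<Phi> \<Psi> \<Theta> Jm Jz Ju Jc Am Ac S0 \<Omega> Stan Vm r c d H B a b (2 * (c / 1000)) ((c - c / 1000) - c / 1000) L \<rho>"
    by (intro phase.intro phase_axioms.intro setting_axioms) auto
  then show ?thesis by blast
qed

subsection \<open>Submanifolds through the origin\<close>

lemma Ck_on_1_cong:
  assumes "open S" and f: "Ck_on 1 f S" and eq: "\<And>x. x \<in> S \<Longrightarrow> f x = g x"
  shows "Ck_on 1 g S"
proof (rule Ck_on_1I)
  show "(g has_derivative frechet_derivative f (at x)) (at x)" if "x \<in> S" for x
    by (rule has_derivative_transform_within_open[OF Ck_on_1D(1)[OF f that] assms(1) that]) (rule eq)
  show "continuous_on S (\<lambda>x. frechet_derivative f (at x) v)" for v by (rule Ck_on_1D(2)[OF f])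
qed

lemma Ck_on_1_linear: "bounded_linear f \<Longrightarrow> Ck_on 1 f S"
  by (rule Ck_on_1I[where f' = "\<lambda>_. f"]) (auto intro: bounded_linear_imp_has_derivative)

lemma eventually_nhds_image:
  fixes f :: "'a::t2_space \<Rightarrow> 'b::topological_space"
  assumes "isCont f x" "open U" "f x \<in> U"
  shows "\<forall>\<^sub>F y in nhds x. f y \<in> U"
  using topological_tendstoD[of f "f x" "nhds x" U] assms tendsto_at_iff_tendsto_nhds[of f x]
  by (simp add: isCont_def)

lemma C1_small_derivative:
  fixes p :: "'a::euclidean_space \<Rightarrow> 'b::real_normed_vector"
  assumes S: "open S" "0 \<in> S" and p: "\<And>x. x \<in> S \<Longrightarrow> (p has_derivative p' x) (at x)"
    and cont: "\<And>v. continuous_on S (\<lambda>x. p' x v)" and 0: "\<And>v. p' 0 v = 0" and \<eta>: "0 < \<eta>"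
  shows "\<exists>r>0. ball 0 r \<subseteq> S \<and> (\<forall>x\<in>ball 0 r. \<forall>h. norm (p' x h) \<le> \<eta> * norm h) \<and>
    (\<forall>x\<in>ball 0 r. \<forall>y\<in>ball 0 r. norm (p x - p y) \<le> \<eta> * norm (x - y))"
proof -
  define e where "e = \<eta> / real DIM('a)"
  have e: "0 < e" using \<eta> by (simp add: e_def)
  have "\<forall>\<^sub>F x in nhds 0. \<forall>b\<in>(Basis :: 'a set). p' x b \<in> ball 0 e"
  proof (rule eventually_ball_finite[OF finite_Basis], rule ballI, rule eventually_nhds_image)
    show "isCont (\<lambda>x. p' x b) 0" for b
      using cont S continuous_on_eq_continuous_at by blast
  qed (use e 0 in auto)
  moreover have "\<forall>\<^sub>F x in nhds 0. x \<in> S" using S eventually_nhds by blast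
  ultimately have "\<forall>\<^sub>F x in nhds 0. x \<in> S \<and> (\<forall>b\<in>(Basis :: 'a set). p' x b \<in> ball 0 e)"
    by (simp add: eventually_conj_iff)
  then obtain r where r: "0 < r" "\<And>x. dist x 0 < r \<Longrightarrow> x \<in> S \<and> (\<forall>b\<in>(Basis :: 'a set). p' x b \<in> ball 0 e)"
    unfolding eventually_nhds_metric by blast
  have rS: "x \<in> S" if "x \<in> ball 0 r" for x using r(2)[of x] that by simp
  have b: "norm (p' x h) \<le> \<eta> * norm h" if "x \<in> ball 0 r" for x h
  proof -
    have "norm (p' x h) \<le> (real DIM('a) * e) * norm h"
      by (rule linear_norm_le_basis[OF has_derivative_linear[OF p[OF rS[OF that]]]])
        (use r(2)[of x] that in \<open>auto intro: less_imp_le\<close>)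
    then show ?thesis by (simp add: e_def)
  qed
  have "norm (p x - p y) \<le> \<eta> * norm (x - y)" if "x \<in> ball 0 r" "y \<in> ball 0 r" for x y
    by (rule derivative_bound_lipschitz[OF convex_ball p[OF rS] b _ that]) (use \<eta> in auto)
  then show ?thesis using r(1) rS b by blast
qed

text \<open>Without a Lipschitz bound the smallness of \<open>p'\<close> near the origin comes from
  its continuity, so a radius is found before the cut-off is scaled to it. The values of
  \<open>q\<close> are multiples of those of \<open>p\<close>; they stay in every linear subspace
  that contains the latter.\<close>

lemma C1_local_extension:
  fixes p :: "'a::euclidean_space \<Rightarrow> 'a"
  assumes S: "open S" "0 \<in> S" and p: "\<And>x. x \<in> S \<Longrightarrow> (p has_derivative p' x) (at x)"
    and cont: "\<And>v. continuous_on S (\<lambda>x. p' x v)" and 0: "p 0 = 0" "\<And>v. p' 0 v = 0"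
  obtains s q q' where "0 < s" "near_identity q q'" "\<And>v. continuous_on UNIV (\<lambda>x. q' x v)" "ball 0 s \<subseteq> S"
    "\<And>v. q' 0 v = 0" "\<And>x. x \<in> ball 0 s \<Longrightarrow> q x = p x" "\<And>x. \<exists>a. q x = a *\<^sub>R p x"
proof -
  obtain \<theta> :: "'a \<Rightarrow> real" and \<theta>' R L K where \<theta>1: "R > 1 \<and> C11 \<theta> \<theta>' UNIV L K \<and> (\<forall>x. 0 \<le> \<theta> x \<and> \<theta> x \<le> 1) \<and> (\<forall>x. norm x \<le> 1 \<longrightarrow> \<theta> x = 1) \<and>
    (\<forall>x. R \<le> norm x \<longrightarrow> \<theta> x = 0) \<and> (\<forall>x y. norm y \<le> norm x \<longrightarrow> \<bar>\<theta> x - \<theta> y\<bar> * norm y \<le> 1 * norm (x - y))"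
    using log_cutoff[OF zero_less_one, where ?'a = 'a] by (elim exE) (rule that)
  have \<theta>: "R > 1" "C11 \<theta> \<theta>' UNIV L K" "\<And>x. 0 \<le> \<theta> x \<and> \<theta> x \<le> 1"
    "\<And>x. norm x \<le> 1 \<Longrightarrow> \<theta> x = 1" "\<And>x. R \<le> norm x \<Longrightarrow> \<theta> x = 0" using \<theta>1 by auto
  note C\<theta> = C11D[OF \<theta>(2)]
  \<comment> \<open>On the support \<open>norm (p x) \<le> \<eta> * (s * R)\<close>, which
    compensates the slope \<open>L / s\<close> of the scaled cut-off; the derivative of the product
    is at most \<open>\<eta> * L * R + \<eta> = 1/2\<close>.\<close>
  define \<eta> where "\<eta> = 1 / (2 * (1 + L * R))"
  have LR: "0 \<le> L * R" using C\<theta>(1) \<theta>(1) by simp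
  have \<eta>: "0 < \<eta>" "\<eta> * L * R + \<eta> = 1/2"
  proof -
    show "0 < \<eta>" using LR by (simp add: \<eta>_def)
    have "\<eta> * (1 + L * R) = 1/2" using LR by (simp add: \<eta>_def)
    then show "\<eta> * L * R + \<eta> = 1/2" by (simp add: algebra_simps)
  qed
  obtain r where r: "0 < r" "ball 0 r \<subseteq> S" "\<And>x h. x \<in> ball 0 r \<Longrightarrow> norm (p' x h) \<le> \<eta> * norm h"
    "\<And>x y. x \<in> ball 0 r \<Longrightarrow> y \<in> ball 0 r \<Longrightarrow> norm (p x - p y) \<le> \<eta> * norm (x - y)"
    using C1_small_derivative[OF S p cont 0(2) \<eta>(1)] by blast
  define s where "s = r / (2 * R)"
  have s: "0 < s" "s * R < r" "s < r"
  proof -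
    show s0: "0 < s" and sr: "s * R < r" using r \<theta>(1) by (auto simp: s_def)
    show "s < r" using s0 sr \<theta>(1) by (smt (verit) mult_less_cancel_left2)
  qed
  define t where "t x = \<theta> (x /\<^sub>R s)" for x
  define t' where "t' x h = \<theta>' (x /\<^sub>R s) (h /\<^sub>R s)" for x h
  have t: "C11 t t' UNIV (L / s) (K / s\<^sup>2)"
    unfolding t_def[abs_def] t'_def[abs_def] by (rule C11_scaled_cutoff[OF \<theta>(2) s(1)])
  note Ct = C11D[OF t]
  have tder: "(t has_derivative t' x) (at x)" for x using Ct(3)[of x] by simp
  have tcont: "continuous_on UNIV (\<lambda>x. t' x v)" for v
    proof (rule lipschitz_on_continuous_on, rule lipschitz_onI)
    show "dist (t' x v) (t' y v) \<le> (K / s\<^sup>2 * norm v) * dist x y" for x y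
      using Ct(6)[of x y v] by (simp add: dist_norm ac_simps)
    show "0 \<le> K / s\<^sup>2 * norm v" using Ct(2) by (rule mult_nonneg_nonneg) simp
  qed
  have out: "t x = 0" if "s * R \<le> norm x" for x
    unfolding t_def by (rule \<theta>(5)) (use that s in \<open>simp add: divide_simps ac_simps\<close>)
  have oo: "open {x :: 'a. s * R < norm x}" by (intro open_Collect_less continuous_intros)
  have out': "t' x h = 0" if "s * R < norm x" for x h
  proof -
    have "(t has_derivative (\<lambda>h. 0)) (at x)"
      by (rule has_derivative_transform_within_open[OF has_derivative_const oo]) (use that out in auto)
    then show ?thesis using has_derivative_unique[OF tder] by metis
  qed
  define q where "q x = t x *\<^sub>R p x" for x
  define q' where "q' x h = (if norm x < r then t' x h *\<^sub>R p x + t x *\<^sub>R p' x h else 0)" for x h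
  have q'0: "q' x h = 0" if "s * R < norm x" for x h using out[of x] out'[of x] that by (simp add: q'_def)
  have qder: "(q has_derivative q' x) (at x)" for x
  proof (cases "norm x < r")
    case True
    then have x: "x \<in> S" using r(2) by auto
    have "(q has_derivative (\<lambda>h. t x *\<^sub>R p' x h + t' x h *\<^sub>R p x)) (at x)"
      unfolding q_def[abs_def] by (rule has_derivative_scaleR[OF tder p[OF x]])
    moreover have "q' x = (\<lambda>h. t x *\<^sub>R p' x h + t' x h *\<^sub>R p x)" using True by (auto simp: q'_def)
    ultimately show ?thesis by simp
  next
    case False
    then have x: "s * R < norm x" using s by simp
    have "(q has_derivative (\<lambda>h. 0)) (at x)"
      by (rule has_derivative_transform_within_open[OF has_derivative_const oo]) (use x out in \<open>auto simp: q_def\<close>)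
    moreover have "q' x = (\<lambda>h. 0)" using q'0[OF x] by auto
    ultimately show ?thesis by simp
  qed
  have qcont: "continuous_on UNIV (\<lambda>x. q' x v)" for v
  proof -
    have pc: "continuous_on (ball 0 r) p"
      by (rule has_derivative_imp_continuous_on[OF p]) (use r in auto)
    have "continuous_on (ball 0 r) (\<lambda>x. t' x v *\<^sub>R p x + t x *\<^sub>R p' x v)"
      by (intro continuous_intros pc continuous_on_subset[OF tcont] continuous_on_subset[OF cont r(2)]
          has_derivative_imp_continuous_on[OF tder]) auto
    then have 1: "continuous_on (ball 0 r) (\<lambda>x. q' x v)" by (rule continuous_on_eq) (simp add: q'_def)
    have 2: "continuous_on {x. s * R < norm x} (\<lambda>x. q' x v)"
      using continuous_on_const[of _ 0] by (rule continuous_on_eq) (simp add: q'0)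
    have "continuous_on (ball 0 r \<union> {x. s * R < norm x}) (\<lambda>x. q' x v)"
      by (rule continuous_on_open_Un[OF open_ball oo 1 2])
    moreover have "ball 0 r \<union> {x :: 'a. s * R < norm x} = UNIV" using s by auto
    ultimately show ?thesis by simp
  qed
  have small: "norm (q' x h) \<le> 1/2 * norm h" for x h
  proof (cases "s * R < norm x")
    case False
    then have x: "norm x \<le> s * R" "x \<in> ball 0 r" using s by auto
    have px: "norm (p x) \<le> \<eta> * (s * R)"
      using order_trans[OF r(4)[OF x(2), of 0] mult_left_mono[of "norm (x - 0)" "s * R" \<eta>]] r(1) x \<eta> 0 by simp
    have "norm (q' x h) \<le> norm (t' x h) * norm (p x) + norm (t x) * norm (p' x h)"
      using norm_triangle_ineq[of "t' x h *\<^sub>R p x" "t x *\<^sub>R p' x h"] x by (simp add: q'_def)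
    also have "\<dots> \<le> (L / s * norm h) * (\<eta> * (s * R)) + 1 * (\<eta> * norm h)"
    proof (intro add_mono mult_mono)
      show "norm (t' x h) \<le> L / s * norm h" using Ct(4)[of x h] by simp
      show "0 \<le> L / s * norm h" using Ct(1) by (rule mult_nonneg_nonneg) simp
    qed (use px \<theta>(3)[of "x /\<^sub>R s"] r(3)[OF x(2)] in \<open>auto simp: t_def\<close>)
    also have "\<dots> = (\<eta> * L * R + \<eta>) * norm h" using s by (simp add: field_simps)
    finally show ?thesis unfolding \<eta>(2) .
  qed (simp add: q'0)
  have eq: "q x = p x" if "x \<in> ball 0 s" for x
    using \<theta>(4)[of "x /\<^sub>R s"] that s by (simp add: q_def t_def divide_simps)
  have ni: "near_identity q q'" by (rule near_identity.intro[OF qder small])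
  have q'00: "q' 0 v = 0" for v using 0 by (simp add: q'_def)
  have sS: "ball 0 s \<subseteq> S" using r(2) s(3) by auto
  have qp: "\<exists>a. q x = a *\<^sub>R p x" for x by (auto simp: q_def)
  show thesis by (rule that[OF s(1) ni qcont sS q'00 eq qp])
qed

lemma orthogonal_projection:
  fixes W :: "'a::euclidean_space set"
  assumes "subspace W"
  shows "\<exists>N. linear N \<and> (\<forall>x. N x = 0 \<longleftrightarrow> x \<in> W) \<and> (\<forall>x. \<forall>w\<in>W. orthogonal (N x) w) \<and> (\<forall>x. N (N x) = N x)"
proof -
  obtain B where B: "B \<subseteq> W" "pairwise orthogonal B" "span B = W" "independent B"
    using orthonormal_basis_subspace[OF assms] by metis
  define N where "N a = a - (\<Sum>b\<in>B. (b \<bullet> a / (b \<bullet> b)) *\<^sub>R b)" for a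
  have lin: "linear N"
    unfolding N_def by (intro linearI)
      (auto simp: inner_add_right add_divide_distrib scaleR_add_left sum.distrib scaleR_diff_right scaleR_sum_right)
  have orth: "orthogonal (N a) w" if "w \<in> W" for a w
    using Gram_Schmidt_step[OF B(2), of w a] that B(3) by (simp add: N_def orthogonal_commute)
  have diff: "a - N a \<in> W" for a
    unfolding B(3)[symmetric] N_def by (simp add: span_sum span_scale span_base)
  have iff: "N x = 0 \<longleftrightarrow> x \<in> W" for x
  proof
    show "x \<in> W" if "N x = 0" using diff[of x] that by simp
    assume x: "x \<in> W"
    have "x - (x - N x) \<in> W" by (rule subspace_diff[OF assms x diff])
    then have "N x \<in> W" by simp
    then show "N x = 0" using orth[of "N x" x] by (simp add: orthogonal_def)
  qed
  have "N (N x) = N x" for x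
    using iff[of "x - N x"] diff[of x] linear_diff[OF lin, of x "N x"] by simp
  then show ?thesis using lin orth iff by (intro exI[of _ N] conjI allI ballI)
qed

lemma chart_member:
  assumes "Ck_diffeo k h A B" "h ` (S \<inter> A) = B \<inter> T" "x \<in> A"
  shows "x \<in> S \<longleftrightarrow> h x \<in> T"
proof -
  have h: "bij_betw h A B" using assms(1) by (simp add: Ck_diffeo_def)
  have "h x \<in> B" using h assms(3) by (auto simp: bij_betw_def)
  then have "h x \<in> T \<longleftrightarrow> h x \<in> h ` (S \<inter> A)" using assms(2) by auto
  also have "\<dots> \<longleftrightarrow> x \<in> S \<inter> A"
    by (rule inj_on_image_mem_iff[OF bij_betw_imp_inj_on[OF h] assms(3)]) auto
  finally show ?thesis using assms(3) by auto
qed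

lemma inverse_chart_derivative:
  fixes h :: "'a::euclidean_space \<Rightarrow> 'a"
  assumes h: "Ck_diffeo 1 h A B" and 0: "0 \<in> A" "h 0 = 0" and der: "(h has_derivative (\<lambda>v. v)) (at 0)"
  shows "inv_into A h 0 = 0" "0 \<in> B" "(inv_into A h has_derivative (\<lambda>v. v)) (at 0)"
proof -
  have b: "bij_betw h A B" "open A" and g: "Ck_on 1 (inv_into A h) B" using h by (auto simp: Ck_diffeo_def)
  have inj: "inj_on h A" using b by (simp add: bij_betw_def)
  show 00: "inv_into A h 0 = 0" using inv_into_f_f[OF inj 0(1)] 0(2) by simp
  show B: "0 \<in> B" using b 0 unfolding bij_betw_def by (metis imageI)
  let ?g' = "frechet_derivative (inv_into A h) (at 0)"
  have g': "(inv_into A h has_derivative ?g') (at 0)" by (rule Ck_on_1D(1)[OF g B])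
  have "(inv_into A h has_derivative ?g') (at (h 0))" using g' 0(2) by simp
  from has_derivative_compose[OF der this]
  have "((\<lambda>x. inv_into A h (h x)) has_derivative ?g') (at 0)" .
  moreover have "((\<lambda>x. inv_into A h (h x)) has_derivative (\<lambda>v. v)) (at 0)"
    by (rule has_derivative_transform_within_open[OF has_derivative_ident b(2) 0(1)]) (simp add: inj)
  ultimately have "?g' = (\<lambda>v. v)" by (rule has_derivative_unique)
  then show "(inv_into A h has_derivative (\<lambda>v. v)) (at 0)" using g' by simp
qed

text \<open>As the derivative of \<open>h\<close> is the identity, a curve and its image have the
  same velocity. The image runs in \<open>T\<close>, and so its velocity is orthogonal to everything
  orthogonal to \<open>T\<close>. Conversely straight lines in \<open>T\<close> are pulled
  back.\<close>

lemma tangent_space_chart: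
  fixes h :: "'a::euclidean_space \<Rightarrow> 'a"
  assumes h: "Ck_diffeo 1 h A B" and 0: "0 \<in> A" "h 0 = 0" and der: "(h has_derivative (\<lambda>v. v)) (at 0)"
    and T: "subspace T" "h ` (S \<inter> A) = B \<inter> T"
  shows "tangent_space_at S 0 = T"
proof
  note inv = inverse_chart_derivative[OF h 0 der]
  have op: "open A" "open B" using h by (auto simp: Ck_diffeo_def)
  show "tangent_space_at S 0 \<subseteq> T"
  proof
    fix v assume "v \<in> tangent_space_at S 0"
    then obtain \<gamma> where \<gamma>: "\<gamma> 0 = 0" "\<forall>\<^sub>F t in nhds (0::real). \<gamma> t \<in> S" "(\<gamma> has_vector_derivative v) (at 0)"
      unfolding tangent_space_at_def by blast
    have "isCont \<gamma> 0" using \<gamma>(3) has_vector_derivative_continuous by blast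
    then have "\<forall>\<^sub>F t in nhds 0. \<gamma> t \<in> A" by (rule eventually_nhds_image) (use op 0 \<gamma> in auto)
    with \<gamma>(2) have "\<forall>\<^sub>F t in nhds 0. h (\<gamma> t) \<in> T"
      by eventually_elim (use chart_member[OF h T(2)] in blast)
    then obtain V where V: "open V" "0 \<in> V" "\<And>t. t \<in> V \<Longrightarrow> h (\<gamma> t) \<in> T"
      unfolding eventually_nhds by blast
    have "(h has_derivative (\<lambda>v. v)) (at (\<gamma> 0))" using der \<gamma>(1) by simp
    from has_derivative_compose[OF \<gamma>(3)[unfolded has_vector_derivative_def] this]
    have w: "((\<lambda>t. h (\<gamma> t)) has_derivative (\<lambda>t. t *\<^sub>R v)) (at 0)" .
    have "orthogonal n v" if n: "n \<in> orthogonal_comp T" for n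
    proof -
      have 1: "((\<lambda>t. n \<bullet> h (\<gamma> t)) has_derivative (\<lambda>t. n \<bullet> (t *\<^sub>R v))) (at 0)"
        by (rule bounded_linear.has_derivative[OF bounded_linear_inner_right w])
      have "((\<lambda>t. n \<bullet> h (\<gamma> t)) has_derivative (\<lambda>t. 0)) (at 0)"
      proof (rule has_derivative_transform_within_open[OF has_derivative_const V(1,2)])
        show "0 = n \<bullet> h (\<gamma> t)" if "t \<in> V" for t
          using n V(3)[OF that] by (auto simp: orthogonal_comp_def orthogonal_def inner_commute)
      qed
      from has_derivative_unique[OF 1 this] have "n \<bullet> (1 *\<^sub>R v) = 0" by metis
      then show ?thesis by (simp add: orthogonal_def)
    qed
    then have "v \<in> orthogonal_comp (orthogonal_comp T)" by (simp add: orthogonal_comp_def)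
    then show "v \<in> T" using orthogonal_comp_self[OF T(1)] by simp
  qed
  show "T \<subseteq> tangent_space_at S 0"
  proof
    fix v assume v: "v \<in> T"
    define \<gamma> where "\<gamma> t = inv_into A h (t *\<^sub>R v)" for t
    have "isCont (\<lambda>t. t *\<^sub>R v) 0" by (intro continuous_intros)
    then have "\<forall>\<^sub>F t in nhds 0. t *\<^sub>R v \<in> B" by (rule eventually_nhds_image) (use op inv in auto)
    then have ev: "\<forall>\<^sub>F t in nhds 0. \<gamma> t \<in> S"
    proof eventually_elim
      case (elim t)
      then have "t *\<^sub>R v \<in> h ` (S \<inter> A)" using T v subspace_scale by blast
      then obtain x where x: "x \<in> S" "x \<in> A" "t *\<^sub>R v = h x" by blast
      have "inj_on h A" using h by (simp add: Ck_diffeo_def bij_betw_def)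
      then have "\<gamma> t = x" unfolding \<gamma>_def x(3) using x(2) by (rule inv_into_f_f)
      then show ?case using x by simp
    qed
    have tv: "((\<lambda>t. t *\<^sub>R v) has_derivative (\<lambda>t. t *\<^sub>R v)) (at 0)" by (auto intro!: derivative_eq_intros)
    have "(inv_into A h has_derivative (\<lambda>v. v)) (at (0 *\<^sub>R v))" using inv(3) by simp
    from has_derivative_compose[OF tv this] have "(\<gamma> has_vector_derivative v) (at 0)"
      unfolding has_vector_derivative_def \<gamma>_def .
    then show "v \<in> tangent_space_at S 0" unfolding tangent_space_at_def using ev inv(1)
      by (intro CollectI exI[of _ \<gamma>]) (simp add: \<gamma>_def)
  qed
qed

text \<open>A chart followed by the inverse of its derivative at the origin is tangent to the
  identity, and its flat piece is then the tangent space itself.\<close>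

lemma normalized_chart:
  fixes S :: "'a::euclidean_space set"
  assumes S: "C1_submanifold d S" "0 \<in> S"
  shows "\<exists>A B h. 0 \<in> A \<and> Ck_diffeo 1 h A B \<and> h 0 = 0 \<and> (h has_derivative (\<lambda>v. v)) (at 0) \<and>
    subspace (tangent_space_at S 0) \<and> h ` (S \<inter> A) = B \<inter> tangent_space_at S 0"
proof -
  obtain A B0 h0 L0 where c: "0 \<in> A" "Ck_diffeo 1 h0 A B0" "subspace L0" "h0 ` (S \<inter> A) = B0 \<inter> L0"
    using bspec[OF S(1)[unfolded C1_submanifold_def] S(2)] by (elim exE conjE) (rule that)
  let ?D = "frechet_derivative h0 (at 0)"
  have k11: "(1::nat) \<le> 1" by simp
  obtain R where R: "linear R" "\<And>v. R (?D v) = v" "\<And>v. ?D (R v) = v"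
    using Ck_diffeo_derivative_iso[OF c(2) k11 c(1)] by blast
  have h0: "bij_betw h0 A B0" "open A" "open B0" "Ck_on 1 h0 A" "Ck_on 1 (inv_into A h0) B0"
    using c(2) by (auto simp: Ck_diffeo_def)
  have D: "(h0 has_derivative ?D) (at 0)" by (rule Ck_on_1D(1)[OF h0(4) c(1)])
  have bl: "bounded_linear R" "bounded_linear ?D"
    using R(1) has_derivative_bounded_linear[OF D] linear_conv_bounded_linear by auto
  have linD: "linear ?D" using has_derivative_linear[OF D] .
  define h where "h y = R (h0 y - h0 0)" for y
  define g where "g z = h0 0 + ?D z" for z
  define B where "B = g -` B0"
  define T where "T = R ` L0"
  have gh: "g (h y) = h0 y" for y by (simp add: g_def h_def R)
  have hg: "R (g z - h0 0) = z" for z by (simp add: g_def R)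
  have inj0: "inj_on h0 A" and im0: "h0 ` A = B0" using h0(1) by (auto simp: bij_betw_def)
  have inj: "inj_on h A" by (rule inj_onI) (metis gh inj0 inj_onD)
  have im: "h ` A = B"
  proof
    show "h ` A \<subseteq> B" using im0 by (auto simp: B_def gh)
    show "B \<subseteq> h ` A"
    proof
      fix z assume "z \<in> B"
      then obtain y where "y \<in> A" "g z = h0 y" using im0 by (auto simp: B_def)
      then show "z \<in> h ` A" using hg[of z] by (auto simp: h_def)
    qed
  qed
  have gC: "Ck_on 1 g V" for V
    unfolding g_def[abs_def]
    by (rule Ck_on_1I[where f' = "\<lambda>_ v. 0 + ?D v"])
      (auto intro: has_derivative_add[OF has_derivative_const bounded_linear_imp_has_derivative[OF bl(2)]]
        simp del: add_0_left)
  have oB: "open B" unfolding B_def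
    by (rule open_vimage[OF h0(3)]) (unfold g_def[abs_def], intro continuous_intros linear_continuous_on bl)
  have hder: "(h has_derivative (\<lambda>v. R (frechet_derivative h0 (at y) v))) (at y)" if "y \<in> A" for y
    unfolding h_def[abs_def]
    by (rule bounded_linear.has_derivative[OF bl(1)]) (auto intro!: derivative_eq_intros Ck_on_1D(1)[OF h0(4) that])
  have "Ck_on 1 h A"
    by (rule Ck_on_1I[OF hder]) (auto intro!: bounded_linear.continuous_on[OF bl(1)] Ck_on_1D(2)[OF h0(4)])
  moreover have "Ck_on 1 (inv_into A h) B"
  proof (rule Ck_on_1_cong[OF oB Ck_on_1_compose[OF gC h0(5)]])
    show "g ` B \<subseteq> B0" by (auto simp: B_def)
    fix z assume "z \<in> B"
    then obtain y where y: "y \<in> A" "z = h y" using im by blast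
    show "inv_into A h0 (g z) = inv_into A h z"
      unfolding y(2) gh inv_into_f_f[OF inj y(1)] by (rule inv_into_f_f[OF inj0 y(1)])
  qed
  ultimately have diffeo: "Ck_diffeo 1 h A B" using h0(2) oB inj im by (simp add: Ck_diffeo_def bij_betw_def)
  have h00: "h 0 = 0" using R(1) by (simp add: h_def linear_0)
  have der: "(h has_derivative (\<lambda>v. v)) (at 0)" using hder[OF c(1)] by (simp add: R)
  have l0: "h0 0 \<in> L0" using c S(2) by blast
  have T: "subspace T" unfolding T_def using R(1) c(3) by (rule linear_subspace_image)
  have iff: "h y \<in> T \<longleftrightarrow> h0 y \<in> L0" for y
  proof
    assume "h0 y \<in> L0"
    then show "h y \<in> T" unfolding T_def h_def using subspace_diff[OF c(3) _ l0] by blast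
  next
    assume "h y \<in> T"
    then obtain l where l: "l \<in> L0" "R (h0 y - h0 0) = R l" by (auto simp: T_def h_def)
    then have "h0 y - h0 0 = l" using R(3) by metis
    then have "h0 y = h0 0 + l" by (simp add: algebra_simps)
    then show "h0 y \<in> L0" using subspace_add[OF c(3) l0 l(1)] by simp
  qed
  have "h ` (S \<inter> A) = B \<inter> T"
  proof
    show "h ` (S \<inter> A) \<subseteq> B \<inter> T" using chart_member[OF c(2,4)] im iff by auto
    show "B \<inter> T \<subseteq> h ` (S \<inter> A)" unfolding im[symmetric] using chart_member[OF c(2,4)] iff by auto
  qed
  moreover from this have "tangent_space_at S 0 = T" by (rule tangent_space_chart[OF diffeo c(1) h00 der T])
  ultimately show ?thesis using c(1) diffeo h00 der T
    by (intro exI[of _ A] exI[of _ B] exI[of _ h] conjI) auto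
qed

section \<open>A local equation for \<open>S0\<close> within the centre\<close>

context setting
begin

lemma Stan: "subspace Stan" "v \<in> Stan \<Longrightarrow> P v = v"
proof -
  show "subspace Stan" using normalized_chart[OF S0_manifold S0_origin] by (auto simp: Stan_eq)
  assume "v \<in> Stan"
  then obtain \<gamma> where \<gamma>: "\<gamma> 0 = 0" "\<forall>\<^sub>F t in nhds (0::real). \<gamma> t \<in> S0" "(\<gamma> has_vector_derivative v) (at 0)"
    unfolding tangent_space_at_def Stan_eq by blast
  obtain V where V: "open V" "0 \<in> V" "\<And>t. t \<in> V \<Longrightarrow> \<gamma> t \<in> S0"
    using \<gamma>(2) unfolding eventually_nhds by blast
  have 1: "((\<lambda>t. block Jm (\<gamma> t)) has_vector_derivative block Jm v) (at 0)"
    by (rule bounded_linear.has_vector_derivative[OF block_bl \<gamma>(3)])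
  have "((\<lambda>t. block Jm (\<gamma> t)) has_vector_derivative 0) (at 0)"
  proof (rule has_vector_derivative_transform_within_open[OF has_vector_derivative_const V(1,2)])
    show "0 = block Jm (\<gamma> t)" if "t \<in> V" for t
      using subsetD[OF S0_center V(3)[OF that]] by (simp add: center_manifold_def)
  qed
  then have "block Jm v = 0" by (rule vector_derivative_unique_at[OF 1])
  then show "P v = v" by (simp add: Q_block)
qed

lemma Vm: "subspace Vm" "v \<in> Vm \<longleftrightarrow> P v = 0"
  unfolding Vm_eq subspace_def by (simp_all add: linear_add[OF block_linear] linear_scale[OF block_linear])

lemma W_iff: "y \<in> {s + x | s x. s \<in> Stan \<and> x \<in> Vm} \<longleftrightarrow> P y \<in> Stan"
proof
  assume "y \<in> {s + x | s x. s \<in> Stan \<and> x \<in> Vm}"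
  then show "P y \<in> Stan" using Stan(2) Vm(2) by (auto simp: linear_add[OF block_linear])
next
  assume "P y \<in> Stan"
  moreover have "y - P y \<in> Vm" by (simp add: Vm(2) block_diff)
  ultimately show "y \<in> {s + x | s x. s \<in> Stan \<and> x \<in> Vm}"
    by (intro CollectI exI[of _ "P y"] exI[of _ "y - P y"]) simp
qed

text \<open>\<open>\<kappa> = N \<circ> h\<close> for a normalized chart \<open>h\<close>. The chart
  need not preserve the centre, so \<open>\<kappa> y = 0\<close> says no more than
  \<open>P (h y) \<in> Stan\<close>. This vector equals \<open>h z\<close> for some \<open>z\<close>
  in \<open>S0\<close>, and \<open>z = y\<close> because the map \<open>P (h y) + block Jm y\<close>
  has the identity as its derivative at the origin and is injective near it.\<close>

lemma S0_equation:
  assumes N: "linear N" "\<And>x. N x = 0 \<longleftrightarrow> P x \<in> Stan"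
  shows "\<exists>\<kappa> R. 0 < R \<and> Ck_on 1 \<kappa> (ball 0 R) \<and> (\<kappa> has_derivative N) (at 0) \<and> range \<kappa> \<subseteq> range N \<and>
    (\<forall>y\<in>ball 0 R. P y = y \<longrightarrow> (y \<in> S0 \<longleftrightarrow> \<kappa> y = 0))"
proof -
  obtain A B h where c: "0 \<in> A" "Ck_diffeo 1 h A B" "h 0 = 0" "(h has_derivative (\<lambda>v. v)) (at 0)"
    "h ` (S0 \<inter> A) = B \<inter> Stan"
    using normalized_chart[OF S0_manifold S0_origin] by (auto simp: Stan_eq)
  have d: "open A" "open B" "bij_betw h A B" "Ck_on 1 h A" "Ck_on 1 (inv_into A h) B"
    using c(2) by (auto simp: Ck_diffeo_def)
  note inv = inverse_chart_derivative[OF c(2,1,3,4)]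
  have Nbl: "bounded_linear N" using N(1) linear_conv_bounded_linear by blast
  define q where "q y = P (h y) + block Jm y - y" for y
  define q' where "q' y v = P (frechet_derivative h (at y) v) + block Jm v - v" for y v
  have h'0: "frechet_derivative h (at 0) = (\<lambda>v. v)" using frechet_derivative_at[OF c(4)] by simp
  have qder: "(q has_derivative q' y) (at y)" if "y \<in> A" for y
    unfolding q_def[abs_def] q'_def[abs_def]
    by (intro has_derivative_diff has_derivative_add bounded_linear.has_derivative[OF block_bl]
        Ck_on_1D(1)[OF d(4) that] has_derivative_ident)
  have q'c: "continuous_on A (\<lambda>y. q' y v)" for v
    unfolding q'_def by (intro continuous_intros bounded_linear.continuous_on[OF block_bl] Ck_on_1D(2)[OF d(4)])
  have q'0: "q' 0 v = 0" for v by (simp add: q'_def h'0 Q_block)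
  obtain R1 where R1: "0 < R1" "ball 0 R1 \<subseteq> A"
    "\<And>x y. x \<in> ball 0 R1 \<Longrightarrow> y \<in> ball 0 R1 \<Longrightarrow> norm (q x - q y) \<le> 1/2 * norm (x - y)"
    using C1_small_derivative[OF d(1) c(1) qder q'c q'0, of "1/2"] by auto
  have inj: "x = y" if "x \<in> ball 0 R1" "y \<in> ball 0 R1" "P (h x) + block Jm x = P (h y) + block Jm y" for x y
  proof -
    have "q x - q y = y - x" using that(3) by (simp add: q_def)
    then have "norm (x - y) \<le> 1/2 * norm (x - y)" using R1(3)[OF that(1,2)] by (simp add: norm_minus_commute)
    then show ?thesis by simp
  qed
  have hc: "isCont (\<lambda>y. P (h y)) 0"
    using bounded_linear.isCont[OF block_bl has_derivative_continuous[OF c(4)]] .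
  have gc: "isCont (inv_into A h) (P (h 0))"
    using has_derivative_continuous[OF inv(3)] by (simp add: c(3))
  have "\<forall>\<^sub>F y in nhds 0. P (h y) \<in> B" by (rule eventually_nhds_image[OF hc d(2)]) (simp add: c(3) inv(2))
  moreover have "\<forall>\<^sub>F y in nhds 0. inv_into A h (P (h y)) \<in> ball 0 R1"
    by (rule eventually_nhds_image[OF isCont_o2[OF hc gc] open_ball]) (simp add: c(3) inv(1) R1(1))
  ultimately have "\<forall>\<^sub>F y in nhds 0. P (h y) \<in> B \<and> inv_into A h (P (h y)) \<in> ball 0 R1"
    by (simp add: eventually_conj_iff)
  then obtain R2 where R2: "0 < R2" "\<And>y. dist y 0 < R2 \<Longrightarrow> P (h y) \<in> B \<and> inv_into A h (P (h y)) \<in> ball 0 R1"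
    unfolding eventually_nhds_metric by blast
  define R where "R = min R1 R2"
  have R: "0 < R" "ball 0 R \<subseteq> A" using R1(1,2) R2(1) by (auto simp: R_def)
  have "y \<in> S0 \<longleftrightarrow> N (h y) = 0" if y: "y \<in> ball 0 R" "P y = y" for y
  proof
    have yA: "y \<in> A" using y R by blast
    show "N (h y) = 0" if "y \<in> S0"
    proof -
      have "h y \<in> Stan" using chart_member[OF c(2,5) yA] that by simp
      then show ?thesis using N(2) Stan(2) by simp
    qed
    assume "N (h y) = 0"
    then have t: "P (h y) \<in> Stan" using N(2) by simp
    have tB: "P (h y) \<in> B" and zR: "inv_into A h (P (h y)) \<in> ball 0 R1" using R2(2)[of y] y by (auto simp: R_def)
    then have "P (h y) \<in> h ` (S0 \<inter> A)" using t c(5) by blast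
    then obtain z where z: "z \<in> S0" "z \<in> A" "P (h y) = h z" by blast
    have ih: "inj_on h A" using d(3) by (simp add: bij_betw_def)
    have zR1: "z \<in> ball 0 R1" using zR inv_into_f_f[OF ih z(2)] unfolding z(3) by simp
    have yR1: "y \<in> ball 0 R1" using y(1) by (simp add: R_def)
    have zm: "block Jm z = 0" using subsetD[OF S0_center z(1)] by (simp add: center_manifold_def)
    have hz: "P (h z) = h z" using Stan(2)[OF t] unfolding z(3) .
    have ym: "block Jm y = 0" using y(2) by (simp add: Q_block)
    have "y = z" by (rule inj[OF yR1 zR1]) (simp add: zm ym hz z(3))
    then show "y \<in> S0" using z by simp
  qed
  moreover have "Ck_on 1 (\<lambda>y. N (h y)) (ball 0 R)"
    by (rule Ck_on_1_compose[OF Ck_on_subset[OF d(4) R(2)] Ck_on_1_linear[OF Nbl, of UNIV]]) simp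
  moreover have "((\<lambda>y. N (h y)) has_derivative N) (at 0)"
    using bounded_linear.has_derivative[OF Nbl c(4)] .
  ultimately show ?thesis using R(1) by (intro exI[of _ "\<lambda>y. N (h y)"] exI[of _ R] conjI ballI impI) auto
qed

lemma \<Psi>_inv: 
  "Ck_on 1 (inv_into E \<Psi>) \<Omega>" "\<And>X. X \<in> E \<Longrightarrow> inv_into E \<Psi> (\<Psi> X) = X"
  "\<And>y. y \<in> \<Omega> \<Longrightarrow> inv_into E \<Psi> y \<in> E" "\<And>y. y \<in> \<Omega> \<Longrightarrow> \<Psi> (inv_into E \<Psi> y) = y" "Ck_on 1 \<Psi> E"
  "inv_into E \<Psi> 0 = 0"
proof -
  show "Ck_on 1 (inv_into E \<Psi>) \<Omega>" "Ck_on 1 \<Psi> E" using \<Psi>D(2) by (auto simp: Ck_diffeo_def \<Omega>_E)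
  show 1: "inv_into E \<Psi> (\<Psi> X) = X" if "X \<in> E" for X using injs(2) that by (rule inv_into_f_f)
  show "inv_into E \<Psi> y \<in> E" "\<Psi> (inv_into E \<Psi> y) = y" if "y \<in> \<Omega>" for y
    using that unfolding \<Omega>_E by (auto intro: inv_into_into simp: f_inv_into_f simp del: image_image)
  show "inv_into E \<Psi> 0 = 0" using 1[OF zeros(2)] \<Psi>D(1) by simp
qed

lemma \<Psi>_inv_derivative:
  assumes X: "X \<in> E" and y: "y = \<Psi> X" and R: "(inv_into E \<Psi> has_derivative R) (at y)"
  shows "R (\<Psi>' X v) = v"
proof -
  have "(inv_into E \<Psi> has_derivative R) (at (\<Psi> X))" using R y by simp
  from has_derivative_compose[OF \<Psi>_der[OF X] this]
  have 1: "((\<lambda>x. inv_into E \<Psi> (\<Psi> x)) has_derivative (\<lambda>v. R (\<Psi>' X v))) (at X)" .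
  have "((\<lambda>x. inv_into E \<Psi> (\<Psi> x)) has_derivative (\<lambda>v. v)) (at X)"
    by (rule has_derivative_transform_within_open[OF has_derivative_ident opens(1) X]) (simp add: \<Psi>_inv(2))
  from has_derivative_unique[OF 1 this] show ?thesis by metis
qed

end

section \<open>The preimage of \<open>S0\<close> under the phase as a submanifold\<close>

context phase
begin

lemma zero_Z: "0 \<in> {y \<in> Zset. P y = y \<and> norm y < \<rho>}"
  using zeros \<Psi>D(1) cs.\<rho> by (simp add: Zset_def)

lemma \<pi>_0: "cs.\<pi> 0 = 0"
  using cs.\<pi>_center[of 0] by simp

text \<open>The origin is one of the equilibria; with \<open>y = 0\<close> the bilinear estimate of
  \<open>\<pi> - P\<close> becomes quadratic.\<close>

lemma \<pi>_derivative_0: "(cs.\<pi> has_derivative P) (at 0)"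
proof -
  obtain C where C: "C \<ge> 0" "\<And>x y. y \<in> {y \<in> Zset. P y = y \<and> norm y < \<rho>} \<Longrightarrow> cs.k * norm (x - P x) < \<rho> \<Longrightarrow>
      norm (cs.\<pi> x - P x) \<le> C * norm (x - P x) * norm (P x - y)"
    using cs.\<pi>_estimate by blast
  have k: "0 < cs.k" using cs.k1 by simp
  have "\<exists>d>0. \<forall>y. norm (y - 0) < d \<longrightarrow> norm (cs.\<pi> y - cs.\<pi> 0 - P (y - 0)) \<le> e * norm (y - 0)" if e: "0 < e" for e
  proof (intro exI conjI allI impI)
    define d where "d = min (\<rho> / (2 * cs.k)) (e / (2 * C + 1))"
    show "0 < d" using cs.\<rho> k e C(1) by (simp add: d_def)
    fix y :: "real^'n" assume "norm (y - 0) < d"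
    then have y: "norm y < \<rho> / (2 * cs.k)" "norm y \<le> e / (2 * C + 1)" by (auto simp: d_def)
    have "cs.k * norm (y - P y) \<le> cs.k * (2 * norm y)" using cs.Q_norm k by (intro mult_left_mono) auto
    also have "\<dots> < \<rho>" using y(1) k by (simp add: field_simps)
    finally have "norm (cs.\<pi> y - P y) \<le> C * norm (y - P y) * norm (P y - 0)" by (rule C(2)[OF zero_Z])
    also have "\<dots> \<le> C * (2 * norm y) * norm y"
      using cs.Q_norm[of y] block_norm[of Jc y] C(1) by (intro mult_mono) auto
    also have "\<dots> \<le> e * norm y"
    proof -
      have "(2 * C + 1) * norm y \<le> e" using y(2) C(1) by (simp add: field_simps)
      moreover have "(2 * C + 1) * norm y = 2 * C * norm y + norm y" by (simp add: algebra_simps)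
      ultimately have "2 * C * norm y \<le> e" using norm_ge_zero[of y] by linarith
      then have "2 * C * norm y * norm y \<le> e * norm y" by (rule mult_right_mono) simp
      then show ?thesis by (simp add: ac_simps)
    qed
    finally show "norm (cs.\<pi> y - cs.\<pi> 0 - P (y - 0)) \<le> e * norm (y - 0)" by (simp add: \<pi>_0)
  qed
  then show ?thesis unfolding has_derivative_at_alt using block_bl by blast
qed

lemma \<pi>_Ck: "Ck_on 1 cs.\<pi> S"
proof -
  obtain \<pi>' where "\<And>x. (cs.\<pi> has_derivative \<pi>' x) (at x)" "\<And>v. continuous_on UNIV (\<lambda>x. \<pi>' x v)"
    using cs.\<pi>_C1 by blast
  then show ?thesis by (intro Ck_on_subset[OF Ck_on_1I[of UNIV]]) auto
qed

text \<open>The manifold consists of the points whose asymptotic phase lies in \<open>S\<^sub>0\<close>.\<close>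

lemma manifold_equation:
  assumes N: "linear N" "\<And>x. N x = 0 \<longleftrightarrow> P x \<in> Stan"
  obtains k k' S where "open S" "0 \<in> S" "S \<subseteq> \<Omega>" "\<And>y. y \<in> S \<Longrightarrow> (k has_derivative k' y) (at y)"
    "\<And>v. continuous_on S (\<lambda>y. k' y v)" "k 0 = 0" "\<And>v. k' 0 v = N v" "range k \<subseteq> range N"
    "\<And>y. y \<in> S \<Longrightarrow> k y = 0 \<longleftrightarrow> \<Psi> (cs.\<pi> (inv_into E \<Psi> y)) \<in> S0"
proof -
  obtain \<kappa> R where \<kappa>: "0 < R" "Ck_on 1 \<kappa> (ball 0 R)" "(\<kappa> has_derivative N) (at 0)" "range \<kappa> \<subseteq> range N"
    "\<And>y. y \<in> ball 0 R \<Longrightarrow> P y = y \<Longrightarrow> y \<in> S0 \<longleftrightarrow> \<kappa> y = 0"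
    using S0_equation[OF N] by (elim exE conjE) (rule that; (assumption | blast))
  let ?i = "inv_into E \<Psi>"
  define S1 where "S1 = \<Omega> \<inter> (\<lambda>y. cs.\<pi> (?i y)) -` E"
  have ic: "continuous_on \<Omega> ?i" by (rule has_derivative_imp_continuous_on[OF Ck_on_1D(1)[OF \<Psi>_inv(1)]])
  have \<pi>c: "continuous_on UNIV cs.\<pi>" by (rule has_derivative_imp_continuous_on[OF Ck_on_1D(1)[OF \<pi>_Ck]])
  have \<Psi>c: "continuous_on E \<Psi>" by (rule has_derivative_imp_continuous_on[OF \<Psi>_der])
  have c1: "continuous_on \<Omega> (\<lambda>y. cs.\<pi> (?i y))" by (rule continuous_on_compose2[OF \<pi>c ic]) simp
  have S1: "open S1" unfolding S1_def by (rule continuous_open_preimage[OF c1 opens(2,1)])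
  have c2: "continuous_on S1 (\<lambda>y. \<Psi> (cs.\<pi> (?i y)))"
    by (rule continuous_on_compose2[OF \<Psi>c continuous_on_subset[OF c1]]) (auto simp: S1_def)
  define S where "S = S1 \<inter> (\<lambda>y. \<Psi> (cs.\<pi> (?i y))) -` ball 0 R"
  have S: "open S" unfolding S_def by (rule continuous_open_preimage[OF c2 S1 open_ball])
  have S0: "0 \<in> S" using zeros \<Psi>_inv(6) \<pi>_0 \<Psi>D(1) \<kappa>(1) by (simp add: S_def S1_def)
  define k where "k y = \<kappa> (\<Psi> (cs.\<pi> (?i y)))" for y
  have SO: "S \<subseteq> \<Omega>" by (auto simp: S_def S1_def)
  have C1: "Ck_on 1 (\<lambda>y. cs.\<pi> (?i y)) S" by (rule Ck_on_1_compose[OF Ck_on_subset[OF \<Psi>_inv(1) SO] \<pi>_Ck[of UNIV]]) simp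
  have C2: "Ck_on 1 (\<lambda>y. \<Psi> (cs.\<pi> (?i y))) S" by (rule Ck_on_1_compose[OF C1 \<Psi>_inv(5)]) (auto simp: S_def S1_def)
  have C3: "Ck_on 1 k S" unfolding k_def[abs_def] by (rule Ck_on_1_compose[OF C2 \<kappa>(2)]) (auto simp: S_def)
  let ?R = "frechet_derivative ?i (at 0)"
  have i': "(?i has_derivative ?R) (at 0)" by (rule Ck_on_1D(1)[OF \<Psi>_inv(1) zeros(3)])
  have "(cs.\<pi> has_derivative P) (at (?i 0))" using \<pi>_derivative_0 by (simp add: \<Psi>_inv(6))
  from has_derivative_compose[OF i' this] have 1: "((\<lambda>y. cs.\<pi> (?i y)) has_derivative (\<lambda>v. P (?R v))) (at 0)" .
  have "(\<Psi> has_derivative \<Psi>' 0) (at (cs.\<pi> (?i 0)))" using \<Psi>_der[OF zeros(2)] by (simp add: \<Psi>_inv(6) \<pi>_0)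
  from has_derivative_compose[OF 1 this] have 2: "((\<lambda>y. \<Psi> (cs.\<pi> (?i y))) has_derivative (\<lambda>v. \<Psi>' 0 (P (?R v)))) (at 0)" .
  have "(\<kappa> has_derivative N) (at (\<Psi> (cs.\<pi> (?i 0))))" using \<kappa>(3) by (simp add: \<Psi>_inv(6) \<pi>_0 \<Psi>D(1))
  from has_derivative_compose[OF 2 this] have 3: "(k has_derivative (\<lambda>v. N (\<Psi>' 0 (P (?R v))))) (at 0)"
    unfolding k_def .
  \<comment> \<open>Dropping the stable component before \<open>\<Psi>' 0\<close> is invisible to
    \<open>N\<close>: that component is mapped into the stable directions, which \<open>N\<close>
    kills.\<close>
  have "N (\<Psi>' 0 (P (?R v))) = N v" for v
  proof -
    obtain R0 where R0: "\<And>v. \<Psi>' 0 (R0 v) = v" using \<Psi>'_iso[OF zeros(2)] by blast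
    have Rv: "?R v = R0 v" using \<Psi>_inv_derivative[OF zeros(2) _ i', of "R0 v"] R0 \<Psi>D(1) by simp
    have "\<Psi>' 0 (R0 v) = \<Psi>' 0 (block Jm (R0 v)) + \<Psi>' 0 (P (R0 v))"
      using linear_add[OF \<Psi>'_linear[OF zeros(2)], of "block Jm (R0 v)" "P (R0 v)"] by (simp add: Q_block)
    moreover have "N (\<Psi>' 0 (block Jm (R0 v))) = 0"
      using N(2) \<Psi>'_c[OF zeros(2) PQ0(1), of "R0 v"] subspace_0[OF Stan(1)] by simp
    ultimately have "N (\<Psi>' 0 (R0 v)) = N (\<Psi>' 0 (P (R0 v)))" using linear_add[OF N(1)] by simp
    then show ?thesis unfolding Rv R0 by simp
  qed
  with 3 have 4: "(k has_derivative N) (at 0)" by simp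
  have k'0: "frechet_derivative k (at 0) v = N v" for v using frechet_derivative_at[OF 4] by simp
  have k0: "k 0 = 0" using \<kappa>(5)[of 0] \<kappa>(1) S0_origin by (simp add: k_def \<Psi>_inv(6) \<pi>_0 \<Psi>D(1))
  have kS: "k y = 0 \<longleftrightarrow> \<Psi> (cs.\<pi> (?i y)) \<in> S0" if y: "y \<in> S" for y
  proof -
    have e: "cs.\<pi> (?i y) \<in> E" "\<Psi> (cs.\<pi> (?i y)) \<in> ball 0 R" using y by (auto simp: S_def S1_def)
    have "block Jm (\<Psi> (cs.\<pi> (?i y))) = 0"
      using \<Psi>m[OF e(1)] cs.P_\<pi>[of "?i y"] by (simp add: Q_block)
    then have "P (\<Psi> (cs.\<pi> (?i y))) = \<Psi> (cs.\<pi> (?i y))" by (simp add: Q_block)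
    then show ?thesis using \<kappa>(5)[OF e(2)] by (simp add: k_def)
  qed
  have kr: "range k \<subseteq> range N" using \<kappa>(4) by (auto simp: k_def)
  show thesis by (rule that[OF S S0 SO Ck_on_1D[OF C3] k0 k'0 kr kS])
qed

text \<open>The defining function \<open>k\<close> has values in the range of \<open>N\<close>,
  which is orthogonal to \<open>W\<close>, and so has the extension \<open>q\<close> of
  \<open>k - N\<close>. Therefore \<open>N (F y) = k y\<close> near the origin for
  \<open>F = id + q\<close>. This map straightens the manifold to \<open>W\<close> and moves points
  orthogonally to \<open>W\<close>: it is a chart, and its inverse minus the identity is the map of
  which the manifold is the graph. The neighbourhood \<open>V\<close> is left open because it will
  be the image of a ball of radius \<delta>.\<close>

lemma invariant_manifold_exists:
  defines "W \<equiv> {s + x | s x. s \<in> Stan \<and> x \<in> Vm}"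
  shows "\<exists>S. open S \<and> 0 \<in> S \<and> S \<subseteq> \<Omega> \<and> (\<forall>V. open V \<longrightarrow> 0 \<in> V \<longrightarrow> V \<subseteq> S \<longrightarrow>
    (\<exists>M. M = {y \<in> V. \<Psi> (cs.\<pi> (inv_into E \<Psi> y)) \<in> S0} \<and>
      C1_submanifold (dim W) M \<and> C1_parameterized_by M W V \<and> tangent_space_at M 0 = W))"
proof -
  have W: "y \<in> W \<longleftrightarrow> P y \<in> Stan" for y unfolding W_def by (rule W_iff)
  have sW: "subspace W"
    using Stan(1) by (auto simp: subspace_def W linear_add[OF block_linear] linear_scale[OF block_linear])
  obtain N where N: "linear N" "\<And>x. N x = 0 \<longleftrightarrow> x \<in> W" "\<And>x w. w \<in> W \<Longrightarrow> orthogonal (N x) w" "\<And>x. N (N x) = N x"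
    using orthogonal_projection[OF sW] by blast
  have NP: "N x = 0 \<longleftrightarrow> P x \<in> Stan" for x using N(2) W by simp
  have Nbl: "bounded_linear N" using N(1) linear_conv_bounded_linear by blast
  obtain k k' S where S: "open S" "0 \<in> S" "S \<subseteq> \<Omega>" and k: "\<And>y. y \<in> S \<Longrightarrow> (k has_derivative k' y) (at y)"
    "\<And>v. continuous_on S (\<lambda>y. k' y v)" "k 0 = 0" "\<And>v. k' 0 v = N v" "range k \<subseteq> range N"
    "\<And>y. y \<in> S \<Longrightarrow> k y = 0 \<longleftrightarrow> \<Psi> (cs.\<pi> (inv_into E \<Psi> y)) \<in> S0"
    by (rule manifold_equation[OF N(1) NP]) (rule that; assumption)
  define p where "p y = k y - N y" for y
  define p' where "p' y v = k' y v - N v" for y v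
  have pder: "(p has_derivative p' y) (at y)" if "y \<in> S" for y
    unfolding p_def[abs_def] p'_def[abs_def]
    by (intro has_derivative_diff k(1)[OF that] bounded_linear_imp_has_derivative[OF Nbl])
  have pc: "continuous_on S (\<lambda>y. p' y v)" for v unfolding p'_def by (intro continuous_intros k(2))
  have p0: "p 0 = 0" "p' 0 v = 0" for v using k N(1) by (auto simp: p_def p'_def linear_0)
  have Np: "N (p y) = p y" for y
  proof -
    obtain z where "k y = N z" using k(5) by blast
    then show ?thesis by (simp add: p_def linear_diff[OF N(1)] N(4))
  qed
  obtain s q q' where q: "0 < s" "near_identity q q'" "\<And>v. continuous_on UNIV (\<lambda>x. q' x v)" "ball 0 s \<subseteq> S"
    "\<And>v. q' 0 v = 0" "\<And>x. x \<in> ball 0 s \<Longrightarrow> q x = p x" "\<And>x. \<exists>a. q x = a *\<^sub>R p x"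
    by (rule C1_local_extension[OF S(1,2) pder pc p0], assumption) (rule that; assumption)
  interpret ni: near_identity q q' by (rule q(2))
  have Nq: "N (q y) = q y" for y using q(7)[of y] Np linear_scale[OF N(1)] by auto
  have GC: "Ck_on 1 ni.G V" for V using Ck_on_subset[OF ni.C1_inverse[OF q(3)]] by simp
  have FC: "Ck_on 1 ni.F V" for V
  proof (rule Ck_on_1I[OF ni.F_der])
    show "continuous_on V (\<lambda>x. ni.A x v)" for v
      unfolding ni.A_def by (intro continuous_intros continuous_on_subset[OF q(3)]) auto
  qed
  have F0: "ni.F 0 = 0" using q(6)[of 0] q(1) p0(1) by (simp add: ni.F_def)
  have Fd0: "(ni.F has_derivative (\<lambda>v. v)) (at 0)" using ni.F_der[of 0] by (simp add: ni.A_def[abs_def] q(5))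
  have FW: "ni.F y \<in> W \<longleftrightarrow> k y = 0" if "y \<in> ball 0 s" for y
  proof -
    have "N (ni.F y) = N y + q y" by (simp add: ni.F_def linear_add[OF N(1)] Nq)
    also have "\<dots> = k y" using q(6)[OF that] by (simp add: p_def)
    finally show ?thesis using N(2) by metis
  qed
  have main: "C1_submanifold (dim W) M \<and> C1_parameterized_by M W V \<and> tangent_space_at M 0 = W"
    if V: "open V" "0 \<in> V" "V \<subseteq> ball 0 s" and M: "M = {y \<in> V. \<Psi> (cs.\<pi> (inv_into E \<Psi> y)) \<in> S0}" for V M
  proof -
    have MV: "y \<in> M \<longleftrightarrow> y \<in> V \<and> ni.F y \<in> W" for y
    proof (cases "y \<in> V")
      case True
      then have y: "y \<in> ball 0 s" using V(3) by blast
      then show ?thesis using True FW[OF y] k(6)[OF subsetD[OF q(4) y]] by (simp add: M)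
    qed (simp add: M)
    have FV: "ni.F ` V = ni.G -` V" using ni.FG ni.GF by (force simp: image_iff)
    have "open (ni.G -` V)" using V(1) ni.G_cont by (rule open_vimage)
    then have oFV: "open (ni.F ` V)" by (simp add: FV)
    have injF: "inj_on ni.F V" using ni.bij by (auto simp: bij_def intro: inj_on_subset)
    have GI: "Ck_on 1 (inv_into V ni.F) (ni.F ` V)"
    proof (rule Ck_on_1_cong[OF oFV GC])
      fix x assume "x \<in> ni.F ` V"
      then obtain y where y: "y \<in> V" "x = ni.F y" by blast
      show "ni.G x = inv_into V ni.F x" unfolding y(2) inv_into_f_f[OF injF y(1)] by simp
    qed
    have diffeo: "Ck_diffeo 1 ni.F V (ni.F ` V)"
      unfolding Ck_diffeo_def bij_betw_def by (intro conjI V(1) oFV injF refl FC GI)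
    have im: "ni.F ` (M \<inter> V) = ni.F ` V \<inter> W" using MV by auto
    have "C1_submanifold (dim W) M"
      unfolding C1_submanifold_def
      by (intro ballI exI[of _ V] exI[of _ "ni.F ` V"] exI[of _ ni.F] exI[of _ W] conjI diffeo sW im refl) (simp add: MV)
    moreover have "tangent_space_at M 0 = W" by (rule tangent_space_chart[OF diffeo V(2) F0 Fd0 sW im])
    moreover have "C1_parameterized_by M W V"
      unfolding C1_parameterized_by_def
    proof (intro exI conjI ballI)
      define g where "g v = ni.G v - v" for v
      show "Ck_on 1 g UNIV"
        unfolding g_def
        by (rule Ck_on_1I[where f' = "\<lambda>x v. frechet_derivative ni.G (at x) v - v"])
          (intro has_derivative_diff Ck_on_1D[OF GC[of UNIV]] has_derivative_ident continuous_intros UNIV_I)+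
      show "orthogonal (g v) w" if "w \<in> W" for v w
      proof -
        have "g v = - q (ni.G v)" using ni.FG[of v] by (simp add: ni.F_def g_def algebra_simps)
        also have "\<dots> = N (- q (ni.G v))" using Nq linear_neg[OF N(1)] by simp
        finally show ?thesis using N(3)[OF that] by metis
      qed
      have "{v + g v | v. v \<in> W} = {y. ni.F y \<in> W}"
      proof (intro set_eqI iffI)
        fix y assume "y \<in> {y. ni.F y \<in> W}"
        moreover have "y = ni.F y + g (ni.F y)" by (simp add: g_def)
        ultimately show "y \<in> {v + g v | v. v \<in> W}" by blast
      qed (auto simp: g_def)
      then show "M = {v + g v | v. v \<in> W} \<inter> V" using MV by auto
    qed
    ultimately show ?thesis by blast
  qed
  show ?thesis
  proof (rule exI[of _ "ball 0 s"], intro conjI allI impI open_ball)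
    show "0 \<in> ball 0 s" using q(1) by simp
    show "ball 0 s \<subseteq> \<Omega>" using q(4) S(3) by blast
    fix V :: "(real^'n) set" assume V: "open V" "0 \<in> V" "V \<subseteq> ball 0 s"
    show "\<exists>M. M = {y \<in> V. \<Psi> (cs.\<pi> (inv_into E \<Psi> y)) \<in> S0} \<and>
        C1_submanifold (dim W) M \<and> C1_parameterized_by M W V \<and> tangent_space_at M 0 = W"
      using main[OF V refl] by (intro exI conjI refl) auto
  qed
qed

end

subsection \<open>A change of time\<close>

text \<open>Two solutions which change their order meet by the intermediate value theorem, and then
  they coincide for all times.\<close>

lemma scalar_flow_mono:
  fixes m :: "real \<Rightarrow> real"
  assumes m: "lipschitz_field m K" and xy: "x \<le> y"
  shows "lipschitz_field.flow m t x \<le> lipschitz_field.flow m t y"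
proof (rule ccontr)
  interpret m: lipschitz_field m K by (rule m)
  assume not_le: "\<not> m.flow t x \<le> m.flow t y"
  define d where "d s = m.flow (s * t) y - m.flow (s * t) x" for s
  have "continuous_on {0..1} d"
    unfolding d_def
    by (intro continuous_intros continuous_on_compose2[OF m.flow_continuous[of UNIV]]) auto
  then obtain s where "d s = 0"
    using IVT2'[of d 1 0 0] not_le xy by (auto simp: d_def)
  then have "m.flow (- (s * t)) (m.flow (s * t) y) = m.flow (- (s * t)) (m.flow (s * t) x)"
    by (simp add: d_def)
  then show False using not_le by simp
qed

text \<open>The phase of an orbit on the manifold runs at full speed, whereas the cut-off field moves it with
  speed \<open>m\<close>. The supremum chooses the reparametrization \<open>\<sigma>\<close> which catches up with the true time at
  the right end of \<open>T\<close>; there the defect \<open>1 - m\<close> is smallest, and \<open>\<sigma>\<close> does not leave the interval.\<close>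

lemma time_change:
  fixes m :: "real \<Rightarrow> real"
  assumes m: "lipschitz_field m L" "\<And>s. 0 \<le> m s \<and> m s \<le> 1" and T: "is_interval T" "0 \<in> T"
    and a: "0 < a" "0 \<le> K" and dec: "\<And>s. s \<in> T \<Longrightarrow> 0 \<le> s \<Longrightarrow> 1 - m s \<le> K * exp (- a * s)"
  obtains \<sigma> where "\<And>t. (\<sigma> has_real_derivative m (\<sigma> t)) (at t)" "\<And>t. t \<in> T \<Longrightarrow> \<sigma> t \<in> closure T"
    "\<And>t. t \<in> T \<Longrightarrow> 0 \<le> t \<Longrightarrow> t \<le> \<sigma> t \<and> \<sigma> t \<le> t + K / a * exp (- a * t)"
proof -
  interpret m: lipschitz_field m L by (rule m(1))
  have der: "((\<lambda>t. m.flow t x) has_real_derivative m (m.flow t x)) (at t)" for x t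
    using m.flow_der by (simp add: has_real_derivative_iff_has_vector_derivative)
  have mono: "x \<le> y \<Longrightarrow> m.flow t x \<le> m.flow t y" for x y t by (rule scalar_flow_mono[OF m(1)])
  have speed: "m.flow s x \<le> m.flow t x \<and> m.flow t x \<le> m.flow s x + (t - s)" if "s \<le> t" for s t x
  proof
    show "m.flow s x \<le> m.flow t x"
      by (rule DERIV_nonneg_imp_nondecreasing[OF that]) (use der m(2) in blast)
    have "s - m.flow s x \<le> t - m.flow t x"
    proof (rule DERIV_nonneg_imp_nondecreasing[OF that])
      fix u
      have "((\<lambda>t. t - m.flow t x) has_real_derivative 1 - m (m.flow u x)) (at u)"
        by (intro DERIV_diff DERIV_ident der)
      then show "\<exists>y. ((\<lambda>t. t - m.flow t x) has_real_derivative y) (at u) \<and> 0 \<le> y"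
        using m(2)[of "m.flow u x"] by (intro exI[of _ "1 - m (m.flow u x)"]) simp
    qed
    then show "m.flow t x \<le> m.flow s x + (t - s)" by simp
  qed
  have inT: "s \<in> T" if "t \<in> T" "0 \<le> s" "s \<le> t" for s t
    using mem_is_interval_1_I[OF T(1,2) that(1)] that by blast
  \<comment> \<open>An upper barrier. Its speed \<open>1 - K * exp (- a * \<tau>)\<close> is at most
    that of a solution which is at or ahead of the true time; so a solution below the barrier at a
    later time \<open>t\<close> was below it before.\<close>
  define X where "X \<tau> = \<tau> + K / a * exp (- a * \<tau>)" for \<tau>
  have backward: "\<tau> \<le> m.flow (\<tau> - t) t \<and> m.flow (\<tau> - t) t \<le> t" if "\<tau> \<le> t" for \<tau> t
    using speed[of "\<tau> - t" 0 t] that by simp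
  have upper: "m.flow (\<tau> - t) t \<le> X \<tau>" if t: "t \<in> T" "0 \<le> \<tau>" "\<tau> \<le> t" for \<tau> t
  proof -
    define e where "e u = m.flow (u - t) t - X u" for u
    have "e \<tau> \<le> e t"
    proof (rule DERIV_nonneg_imp_nondecreasing[OF t(3)])
      fix u assume u: "\<tau> \<le> u" "u \<le> t"
      define w where "w = m.flow (u - t) t"
      have w: "u \<le> w" "w \<le> t" using backward[OF u(2)] by (auto simp: w_def)
      have "1 - m w \<le> K * exp (- a * w)" using w u t by (intro dec inT[OF t(1)]) auto
      also have "\<dots> \<le> K * exp (- a * u)" using w a by (intro mult_left_mono) auto
      finally have nn: "0 \<le> m w - (1 - K * exp (- a * u))" by simp
      have "((\<lambda>u. u - t) has_real_derivative 1) (at u)" by (auto intro!: derivative_eq_intros)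
      then have "((\<lambda>u. m.flow (u - t) t) has_real_derivative m w * 1) (at u)"
        unfolding w_def by (rule DERIV_chain2[where g = "\<lambda>u. u - t" and f = "\<lambda>s. m.flow s t", OF der])
      then have d1: "((\<lambda>u. m.flow (u - t) t) has_real_derivative m w) (at u)" by simp
      have d2: "(X has_real_derivative 1 - K * exp (- a * u)) (at u)"
        unfolding X_def using a by (auto intro!: derivative_eq_intros)
      show "\<exists>y. (e has_real_derivative y) (at u) \<and> 0 \<le> y"
        unfolding e_def using DERIV_diff[OF d1 d2] nn by blast
    qed
    also have "e t \<le> 0" using a by (simp add: e_def X_def)
    finally show ?thesis by (simp add: e_def)
  qed
  \<comment> \<open>The initial value of the solution that shows the true time \<open>t\<close> at
    time \<open>t\<close>. It increases with \<open>t\<close>, since solutions run at speed at most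
    1 and need a larger head start to be on time later.\<close>
  define e where "e t = m.flow (- t) t" for t
  have e1: "e t = m.flow (- \<tau>) (m.flow (\<tau> - t) t)" for \<tau> t
    using m.flow_add[of "- \<tau>" "\<tau> - t" t] by (simp add: e_def)
  have e_mono: "e s \<le> e t" if "s \<le> t" for s t
    unfolding e1[of t s] unfolding e_def[of s] using backward[OF that] by (intro mono) simp
  have key: "e t \<le> m.flow (- \<tau>) y" if t: "t \<in> T" "\<tau> \<in> T" "0 \<le> \<tau>"
    and y: "\<tau> \<le> y" "\<tau> \<le> t \<Longrightarrow> m.flow (\<tau> - t) t \<le> y" for t \<tau> y
  proof (cases "\<tau> \<le> t")
    case True
    then show ?thesis unfolding e1[of t \<tau>] using y by (intro mono) simp
  next
    case False
    then have "e t \<le> e \<tau>" by (intro e_mono) simp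
    also have "\<dots> \<le> m.flow (- \<tau>) y" unfolding e_def using y(1) by (intro mono)
    finally show ?thesis .
  qed
  define A where "A = {t \<in> T. 0 \<le> t}"
  have A: "0 \<in> A" using T(2) by (simp add: A_def)
  \<comment> \<open>The least initial value from which the solution is never late on the nonnegative
    part of \<open>T\<close>. A supremum covers intervals without a last point.\<close>
  define \<sigma>0 where "\<sigma>0 = Sup (e ` A)"
  have X0: "\<tau> \<le> X \<tau>" for \<tau> using a by (simp add: X_def)
  have keyX: "e t \<le> m.flow (- \<tau>) (X \<tau>)" if "t \<in> A" "\<tau> \<in> T" "0 \<le> \<tau>" for t \<tau>
    using that upper[of t \<tau>] X0 by (intro key) (auto simp: A_def)
  have bdd: "bdd_above (e ` A)"
    using keyX[OF _ T(2)] by (intro bdd_aboveI2[of _ _ "m.flow 0 (X 0)"]) simp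
  have \<sigma>0_ge: "e t \<le> \<sigma>0" if "t \<in> A" for t unfolding \<sigma>0_def using that bdd by (intro cSup_upper) auto
  have \<sigma>0_le: "\<sigma>0 \<le> y" if "\<And>t. t \<in> A \<Longrightarrow> e t \<le> y" for y
    unfolding \<sigma>0_def using that A by (intro cSup_least) auto
  define \<sigma> where "\<sigma> t = m.flow t \<sigma>0" for t
  have le: "\<sigma> \<tau> \<le> y" if "\<And>t. t \<in> A \<Longrightarrow> e t \<le> m.flow (- \<tau>) y" for \<tau> y
    using mono[OF \<sigma>0_le[OF that], of \<tau>] by (simp add: \<sigma>_def)
  have ge: "\<tau> \<le> \<sigma> \<tau>" if "\<tau> \<in> T" for \<tau>
  proof (cases "0 \<le> \<tau>")
    case True
    then have "e \<tau> \<le> \<sigma>0" using that by (intro \<sigma>0_ge) (simp add: A_def)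
    from mono[OF this, of \<tau>] show ?thesis by (simp add: e_def \<sigma>_def)
  next
    case False
    have "0 \<le> \<sigma>0" using \<sigma>0_ge[OF A] by (simp add: e_def)
    then show ?thesis using speed[of \<tau> 0 \<sigma>0] False by (simp add: \<sigma>_def)
  qed
  show thesis
  proof (rule that)
    show "(\<sigma> has_real_derivative m (\<sigma> t)) (at t)" for t unfolding \<sigma>_def by (rule der)
    show "t \<le> \<sigma> t \<and> \<sigma> t \<le> t + K / a * exp (- a * t)" if "t \<in> T" "0 \<le> t" for t
      using ge[OF that(1)] le[OF keyX[OF _ that]] by (simp add: X_def)
    show "\<sigma> \<tau> \<in> closure T" if \<tau>: "\<tau> \<in> T" for \<tau>
    proof (cases "\<exists>t\<in>T. \<sigma> \<tau> \<le> t")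
      case True
      then obtain t where "t \<in> T" "\<sigma> \<tau> \<le> t" by blast
      then have "\<sigma> \<tau> \<in> T" using mem_is_interval_1_I[OF T(1) \<tau>] ge[OF \<tau>] by blast
      then show ?thesis using closure_subset by blast
    next
      case False
      then have lt: "t < \<sigma> \<tau>" if "t \<in> T" for t using that by (meson not_le)
      have bT: "bdd_above T" by (rule bdd_aboveI[of _ "\<sigma> \<tau>"]) (use lt less_imp_le in blast)
      have T_le: "t \<le> Sup T" if "t \<in> T" for t using that bT by (rule cSup_upper)
      \<comment> \<open>A value beyond all of \<open>T\<close> can only be the right end point: the
        solution which is on time at a point of \<open>T\<close> does not exceed
        \<open>Sup T\<close> at earlier times, and the supremum of the initial values inherits
        this.\<close>
      have le_b: "\<sigma> s \<le> Sup T" if s: "s \<in> T" "0 \<le> s" for s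
      proof (rule le)
        show "e t \<le> m.flow (- s) (Sup T)" if "t \<in> A" for t
        proof (rule key[OF _ s T_le[OF s(1)]])
          show "t \<in> T" using that by (simp add: A_def)
          then show "m.flow (s - t) t \<le> Sup T" if "s \<le> t" using backward[OF that] T_le[of t] by linarith
        qed
      qed
      have "\<sigma> \<tau> \<le> Sup T"
      proof (cases "0 \<le> \<tau>")
        case True
        then show ?thesis by (rule le_b[OF \<tau>])
      next
        case False
        then have "\<sigma> \<tau> \<le> \<sigma> 0" using speed[of \<tau> 0 \<sigma>0] by (simp add: \<sigma>_def)
        also have "\<dots> \<le> Sup T" by (rule le_b[OF T(2)]) simp
        finally show ?thesis .
      qed
      moreover have "Sup T \<le> \<sigma> \<tau>" using \<tau> lt less_imp_le by (intro cSup_least) auto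
      ultimately have "\<sigma> \<tau> = Sup T" by simp
      then show ?thesis using closure_contains_Sup[OF _ bT] \<tau> by auto
    qed
  qed
qed

subsection \<open>Orbits in the different coordinates\<close>

context setting
begin

lemma orbit_pull:
  assumes Y: "Y \<tau> \<in> \<Omega>" "(Y has_vector_derivative coord_field \<Theta> D F (Y \<tau>)) (at \<tau> within T)"
  shows "((\<lambda>t. inv_into E \<Psi> (Y t)) has_vector_derivative coord_field \<Phi> D F (inv_into E \<Psi> (Y \<tau>))) (at \<tau> within T)"
proof -
  let ?X = "inv_into E \<Psi> (Y \<tau>)"
  let ?R = "frechet_derivative (inv_into E \<Psi>) (at (Y \<tau>))"
  have X: "?X \<in> E" "\<Psi> ?X = Y \<tau>" using \<Psi>_inv(3,4)[OF Y(1)] by auto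
  have R: "(inv_into E \<Psi> has_derivative ?R) (at (Y \<tau>))" by (rule Ck_on_1D(1)[OF \<Psi>_inv(1) Y(1)])
  from has_derivative_compose[OF Y(2)[unfolded has_vector_derivative_def] this]
  have 1: "((\<lambda>t. inv_into E \<Psi> (Y t)) has_derivative (\<lambda>t. ?R (t *\<^sub>R coord_field \<Theta> D F (Y \<tau>)))) (at \<tau> within T)" .
  have "?R (coord_field \<Theta> D F (Y \<tau>)) = coord_field \<Phi> D F ?X"
    using \<Psi>_inv_derivative[OF X(1) X(2)[symmetric] R] field_\<Psi>[OF X(1), of F] unfolding X(2) by simp
  then have "?R (t *\<^sub>R coord_field \<Theta> D F (Y \<tau>)) = t *\<^sub>R coord_field \<Phi> D F ?X" for t
    using linear_scale[OF has_derivative_linear[OF R]] by simp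
  then show ?thesis using 1 by (simp add: has_vector_derivative_def)
qed

lemma orbit_push:
  assumes X: "X \<tau> \<in> E" "(X has_vector_derivative coord_field \<Phi> D F (X \<tau>)) (at \<tau> within T)"
  shows "((\<lambda>t. \<Psi> (X t)) has_vector_derivative coord_field \<Theta> D F (\<Psi> (X \<tau>))) (at \<tau> within T)"
  using has_derivative_compose[OF X(2)[unfolded has_vector_derivative_def] \<Psi>_der[OF X(1)]]
  by (simp add: has_vector_derivative_def field_\<Psi>[OF X(1)] linear_scale[OF \<Psi>'_linear[OF X(1)]])

lemma cut_field:
  assumes "X \<in> E"
  shows "coord_field \<Phi> D (\<lambda>U. \<phi> U *\<^sub>R G U) X = \<phi> (inv_into D \<Phi> X) *\<^sub>R h X"
proof -
  obtain U where U: "U \<in> D" "X = \<Phi> U" using assms by blast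
  show ?thesis
    unfolding U(2) fields(1)[OF U(1)] inv_into_f_f[OF injs(1) U(1)]
    by (rule linear_scale[OF has_derivative_linear[OF \<Phi>_der[OF U(1)]]])
qed

text \<open>In a chart \<open>S0\<close> is the closed set \<open>Stan\<close>. The reparametrized
  time may reach an end point that does not belong to \<open>T\<close>, and the phase there is known
  to be a limit of points of \<open>S0\<close>.\<close>

lemma S0_locally_closed: "\<exists>R>0. ball 0 R \<inter> closure S0 \<subseteq> S0"
proof -
  obtain A B h where c: "0 \<in> A" "Ck_diffeo 1 h A B" "h ` (S0 \<inter> A) = B \<inter> Stan"
    using normalized_chart[OF S0_manifold S0_origin] by (auto simp: Stan_eq)
  have A: "open A" "Ck_on 1 h A" using c(2) by (auto simp: Ck_diffeo_def)
  have hc: "continuous_on A h" by (rule has_derivative_imp_continuous_on[OF Ck_on_1D(1)[OF A(2)]])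
  have op: "open (A \<inter> h -` (- Stan))"
    by (rule continuous_open_preimage[OF hc A(1)]) (use closed_subspace[OF Stan(1)] in auto)
  obtain R where R: "0 < R" "ball 0 R \<subseteq> A" using A(1) c(1) open_contains_ball by blast
  have "y \<in> S0" if "y \<in> A" "y \<in> closure S0" for y
  proof (rule ccontr)
    assume "y \<notin> S0"
    then have yU: "y \<in> A \<inter> h -` (- Stan)" using chart_member[OF c(2,3) that(1)] that(1) by auto
    have "A \<inter> h -` (- Stan) \<inter> S0 \<noteq> {}"
      using open_Int_closure_eq_empty[OF op, of S0] yU that(2) by blast
    then obtain z where "z \<in> S0" "z \<in> A \<inter> h -` (- Stan)" by blast
    then show False using chart_member[OF c(2,3), of z] by auto
  qed
  then show ?thesis using R by blast
qed

text \<open>The cut-off vanishes outside the compact image of the closed ball of radius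
  \<open>2 * \<delta>\<close>, so extension by zero is differentiable with bounded derivative. The
  constant depends on the cut-off, and through it so will the constant \<open>C\<close> of the
  decomposition.\<close>

lemma cut_off_lipschitz:
  assumes \<phi>: "cut_off \<delta> \<phi>" and \<delta>: "0 < \<delta>" "2 * \<delta> < r"
  shows "\<exists>K\<ge>0. \<forall>X X'. \<bar>(if X \<in> E then \<phi> (inv_into D \<Phi> X) else 0) - (if X' \<in> E then \<phi> (inv_into D \<Phi> X') else 0)\<bar>
    \<le> K * norm (X - X')"
proof -
  define f where "f X = (if X \<in> E then \<phi> (inv_into D \<Phi> X) else 0)" for X
  have inv: "Ck_on 1 (inv_into D \<Phi>) E"
    using \<Phi>D(2) Ck_on_2_imp_1 unfolding Ck_diffeo_def by blast
  have \<phi>1: "Ck_on 1 \<phi> UNIV" using \<phi> unfolding cut_off_def by blast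
  have C: "Ck_on 1 f E"
    by (rule Ck_on_1_cong[OF opens(1) Ck_on_1_compose[OF inv \<phi>1]]) (auto simp: f_def)
  let ?K = "\<Phi> ` cball 0 (2 * \<delta>)"
  have sub: "cball 0 (2 * \<delta>) \<subseteq> D" using \<delta> by auto
  have "continuous_on D \<Phi>" by (rule has_derivative_imp_continuous_on[OF \<Phi>_der])
  then have K: "compact ?K" "?K \<subseteq> E"
    using sub by (auto intro!: compact_continuous_image continuous_on_subset[of D])
  have out: "f X = 0" if "X \<notin> ?K" for X
  proof (cases "X \<in> E")
    case True
    then obtain U where U: "U \<in> D" "X = \<Phi> U" by blast
    then have "2 * \<delta> \<le> norm U" using that by force
    moreover have "inv_into D \<Phi> X = U" unfolding U(2) by (rule inv_into_f_f[OF injs(1) U(1)])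
    ultimately show ?thesis using \<phi> True by (simp add: f_def cut_off_def)
  qed (simp add: f_def)
  have oK: "open (- ?K)" using compact_imp_closed[OF K(1)] by auto
  obtain L where L: "L \<ge> 0" "\<And>X v. X \<in> ?K \<Longrightarrow> norm (frechet_derivative f (at X) v) \<le> L * norm v"
    using Ck_on_1_bounded_derivative[OF C K] by blast
  define f' where "f' X v = (if X \<in> ?K then frechet_derivative f (at X) v else 0)" for X v
  have "(f has_derivative f' X) (at X)" for X
  proof (cases "X \<in> ?K")
    case True
    then have "f' X = frechet_derivative f (at X)" by (auto simp: f'_def)
    then show ?thesis using Ck_on_1D(1)[OF C] True K(2) by auto
  next
    case False
    have "(f has_derivative (\<lambda>v. 0)) (at X)"
      by (rule has_derivative_transform_within_open[OF has_derivative_const oK]) (use False out in auto)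
    moreover have "f' X = (\<lambda>v. 0)" using False by (auto simp: f'_def)
    ultimately show ?thesis by simp
  qed
  moreover have "norm (f' X v) \<le> L * norm v" for X v using L by (simp add: f'_def)
  ultimately have "norm (f X - f X') \<le> L * norm (X - X')" for X X'
    using L(1) by (intro derivative_bound_lipschitz[of UNIV f f' L]) auto
  then show ?thesis using L(1) unfolding f_def real_norm_def by blast
qed

end

sublocale phase \<subseteq> lf: lipschitz_field H L
  by (rule H_lipschitz)

text \<open>All smallness conditions on one radius \<eta>. Points with
  \<open>norm X < \<eta>\<close> have phases of size at most \<open>2 * \<eta>\<close>;
  \<open>\<Psi>\<close> takes these to size at most \<open>L\<Psi> * (2 * \<eta>)\<close>, removing
  the \<zeta> component is allowed another factor 2, and \<open>LI\<close> controls the way back.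
  Every one of these points must stay where the estimate applied to it holds.\<close>

locale scales = phase G \<Phi> \<Psi> \<Theta> Jm Jz Ju Jc Am Ac S0 \<Omega> Stan Vm r c d H B a b \<epsilon> c' L \<rho>
  for G \<Phi> \<Psi> \<Theta> :: "real^'n \<Rightarrow> real^'n" and Jm Jz Ju Jc :: "'n set" and Am Ac :: "real^'n \<Rightarrow> real^'n^'n"
    and S0 \<Omega> Stan Vm :: "(real^'n) set" and r c :: real and d :: nat
    and H :: "real^'n \<Rightarrow> real^'n" and B a b \<epsilon> c' L \<rho> +
  fixes L\<Psi> LI C\<pi> \<eta> R' RS :: real
  assumes \<eta>: "0 < \<eta>" "2 * \<eta> \<le> \<rho>" "cs.k * (2 * \<eta>) < \<rho>" "C\<pi> * (2 * \<eta>) \<le> 1 / 2" "2 * (L\<Psi> * (2 * \<eta>)) < R'"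
      "L\<Psi> * (2 * \<eta>) < RS" "LI * (2 * (L\<Psi> * (2 * \<eta>))) < \<rho>"
    and L\<Psi>: "0 \<le> L\<Psi>" "\<And>X X'. norm X \<le> \<rho> \<Longrightarrow> norm X' \<le> \<rho> \<Longrightarrow> norm (\<Psi> X - \<Psi> X') \<le> L\<Psi> * norm (X - X')"
    and R': "cball 0 R' \<subseteq> \<Omega>" and LI: "0 \<le> LI"
      "\<And>y y'. norm y \<le> R' \<Longrightarrow> norm y' \<le> R' \<Longrightarrow> norm (inv_into E \<Psi> y - inv_into E \<Psi> y') \<le> LI * norm (y - y')"
    and C\<pi>: "0 \<le> C\<pi>" "\<And>x y. y \<in> {y \<in> Zset. block Jc y = y \<and> norm y < \<rho>} \<Longrightarrow> cs.k * norm (x - block Jc x) < \<rho> \<Longrightarrow>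
      norm (cs.\<pi> x - block Jc x) \<le> C\<pi> * norm (x - block Jc x) * norm (block Jc x - y)"
    and RS: "ball 0 RS \<inter> closure S0 \<subseteq> S0"

lemma small_multiple: "0 < b \<Longrightarrow> \<forall>\<^sub>F \<eta> in at_right (0::real). a * \<eta> < b"
  using order_tendstoD(2)[of "\<lambda>\<eta>. a * \<eta>" 0 "at_right 0" b] tendsto_mult_right_zero[OF tendsto_ident_at, of a]
  by simp

lemma (in phase) scales_exist:
  "\<exists>L\<Psi> LI C\<pi> \<eta> R' RS. scales G \<Phi> \<Psi> \<Theta> Jm Jz Ju Jc Am Ac S0 \<Omega> Stan Vm r c d H B a b \<epsilon> c' L \<rho> L\<Psi> LI C\<pi> \<eta> R' RS"
proof -
  have "cball 0 \<rho> \<subseteq> E" using H_near cs.\<rho> by (auto simp del: image_iff)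
  then obtain L\<Psi> where L\<Psi>: "0 \<le> L\<Psi>" "\<And>X X'. norm X \<le> \<rho> \<Longrightarrow> norm X' \<le> \<rho> \<Longrightarrow> norm (\<Psi> X - \<Psi> X') \<le> L\<Psi> * norm (X - X')"
    using Ck_on_1_lipschitz[OF \<Psi>_inv(5) compact_cball[of 0 \<rho>] convex_cball] by auto
  obtain R' where R': "0 < R'" "cball 0 R' \<subseteq> \<Omega>" using opens(2) zeros(3) open_contains_cball by blast
  obtain LI where LI: "0 \<le> LI"
    "\<And>y y'. norm y \<le> R' \<Longrightarrow> norm y' \<le> R' \<Longrightarrow> norm (inv_into E \<Psi> y - inv_into E \<Psi> y') \<le> LI * norm (y - y')"
    using Ck_on_1_lipschitz[OF \<Psi>_inv(1) compact_cball convex_cball R'(2)] by auto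
  obtain C\<pi> where C\<pi>: "0 \<le> C\<pi>" "\<And>x y. y \<in> {y \<in> Zset. P y = y \<and> norm y < \<rho>} \<Longrightarrow> cs.k * norm (x - P x) < \<rho> \<Longrightarrow>
      norm (cs.\<pi> x - P x) \<le> C\<pi> * norm (x - P x) * norm (P x - y)"
    using cs.\<pi>_estimate by blast
  obtain RS where RS: "0 < RS" "ball 0 RS \<inter> closure S0 \<subseteq> S0" using S0_locally_closed by blast
  have "\<forall>\<^sub>F \<eta> in at_right 0. 0 < \<eta> \<and> 2 * \<eta> < \<rho> \<and> cs.k * 2 * \<eta> < \<rho> \<and> C\<pi> * 2 * \<eta> < 1 / 2 \<and> 2 * (L\<Psi> * 2) * \<eta> < R' \<and>
      L\<Psi> * 2 * \<eta> < RS \<and> LI * (2 * (L\<Psi> * 2)) * \<eta> < \<rho>"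
    by (intro eventually_conj small_multiple cs.\<rho> R'(1) RS(1) eventually_at_right_less) simp
  then obtain \<eta> :: real where "0 < \<eta>" "2 * \<eta> < \<rho>" "cs.k * 2 * \<eta> < \<rho>" "C\<pi> * 2 * \<eta> < 1 / 2" "2 * (L\<Psi> * 2) * \<eta> < R'"
      "L\<Psi> * 2 * \<eta> < RS" "LI * (2 * (L\<Psi> * 2)) * \<eta> < \<rho>"
    using eventually_happens'[OF trivial_limit_at_right_real] by blast
  then have "scales G \<Phi> \<Psi> \<Theta> Jm Jz Ju Jc Am Ac S0 \<Omega> Stan Vm r c d H B a b \<epsilon> c' L \<rho> L\<Psi> LI C\<pi> \<eta> R' RS"
    by (intro scales.intro scales_axioms.intro phase_axioms L\<Psi> R'(2) LI C\<pi> RS(2)) (simp_all add: ac_simps)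
  then show ?thesis by blast
qed

section \<open>Invariance of the manifold and decay of the perturbation\<close>

context scales
begin

abbreviation "Zs \<equiv> {y \<in> Zset. P y = y \<and> norm y < \<rho>}"

lemma near_E: "norm X \<le> \<rho> \<Longrightarrow> X \<in> E \<and> H X = h X"
  using H_near[of X] cs.\<rho> by simp

lemma \<Psi>_norm: "norm X \<le> \<rho> \<Longrightarrow> norm (\<Psi> X) \<le> L\<Psi> * norm X"
  using L\<Psi>(2)[of X 0] \<Psi>D(1) cs.\<rho> by simp

lemma projection_bounds:
  assumes X: "norm X < \<eta>"
  shows "norm (X - P X) \<le> 2 * \<eta>" "norm (P X) \<le> \<eta>" "cs.k * norm (X - P X) < \<rho>" "C\<pi> * norm (X - P X) \<le> 1 / 2"
    "norm (cs.\<pi> X) \<le> 2 * \<eta>" "norm (X - cs.\<pi> X) \<le> (1 + C\<pi> * \<eta>) * norm (X - P X)"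
proof -
  show 1: "norm (X - P X) \<le> 2 * \<eta>" using cs.Q_norm[of X] X by simp
  show 2: "norm (P X) \<le> \<eta>" using block_norm[of Jc X] X by simp
  have k: "0 \<le> cs.k" using cs.k1 by simp
  show 3: "cs.k * norm (X - P X) < \<rho>" using mult_left_mono[OF 1 k] \<eta>(3) by linarith
  show 4: "C\<pi> * norm (X - P X) \<le> 1 / 2" using mult_left_mono[OF 1 C\<pi>(1)] \<eta>(4) by linarith
  have 5: "norm (cs.\<pi> X - P X) \<le> C\<pi> * norm (X - P X) * norm (P X)" using C\<pi>(2)[OF zero_Z 3] by simp
  also have "\<dots> \<le> 1 / 2 * \<eta>" using 4 2 by (intro mult_mono) auto
  finally show "norm (cs.\<pi> X) \<le> 2 * \<eta>"
    using norm_triangle_ineq[of "cs.\<pi> X - P X" "P X"] 2 \<eta>(1) by simp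
  have "C\<pi> * norm (X - P X) * norm (P X) \<le> C\<pi> * norm (X - P X) * \<eta>" using 2 C\<pi>(1) by (intro mult_left_mono) auto
  then have "norm (cs.\<pi> X - P X) \<le> C\<pi> * \<eta> * norm (X - P X)" using 5 by (simp add: ac_simps)
  then show "norm (X - cs.\<pi> X) \<le> (1 + C\<pi> * \<eta>) * norm (X - P X)"
    using norm_triangle_ineq4[of "X - P X" "cs.\<pi> X - P X"] by (simp add: algebra_simps)
qed

text \<open>On \<open>V\<close> the cut-off is not felt, so for a short time the orbit solves the
  equation with \<open>H\<close> and its phase follows the centre flow. \<open>\<Psi>\<close> turns
  the phase into an orbit of the field without cut-off that starts on \<open>S0\<close>, where the
  invariance of \<open>S0\<close> applies.\<close>

lemma manifold_invariant:
  assumes V: "open V" "V \<subseteq> \<Omega>" "\<And>y. y \<in> V \<Longrightarrow> norm (inv_into E \<Psi> y) < \<eta>"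
    and F: "\<And>X. X \<in> E \<Longrightarrow> \<Psi> X \<in> V \<Longrightarrow> coord_field \<Phi> D F X = h X"
  shows "locally_invariant (coord_field \<Theta> D F) \<Omega> {y \<in> V. \<Psi> (cs.\<pi> (inv_into E \<Psi> y)) \<in> S0}"
  unfolding locally_invariant_def
proof (intro allI impI, elim conjE)
  fix T :: "real set" and Y :: "real \<Rightarrow> real^'n"
  assume T: "open T" "is_interval T" "0 \<in> T" and Y: "orbit_on (coord_field \<Theta> D F) \<Omega> T Y"
    and Y0: "Y 0 \<in> {y \<in> V. \<Psi> (cs.\<pi> (inv_into E \<Psi> y)) \<in> S0}"
  define X where "X t = inv_into E \<Psi> (Y t)" for t
  define p where "p t = lf.flow t (cs.\<pi> (X 0))" for t
  have Yd: "Y t \<in> \<Omega>" "(Y has_vector_derivative coord_field \<Theta> D F (Y t)) (at t within T)" if "t \<in> T" for t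
    using Y that by (auto simp: orbit_on_def)
  have "(Y has_vector_derivative coord_field \<Theta> D F (Y 0)) (at 0)"
    using Yd(2)[OF T(3)] at_within_open[OF T(3,1)] by simp
  then have "isCont Y 0" by (rule has_vector_derivative_continuous)
  then have 1: "\<forall>\<^sub>F t in nhds 0. Y t \<in> V" using V(1) Y0 by (intro eventually_nhds_image) auto
  have "norm (X 0) < \<eta>" using V(3) Y0 by (simp add: X_def)
  then have "norm (cs.\<pi> (X 0)) \<le> 2 * \<eta>" by (rule projection_bounds(5))
  then have p0: "p 0 \<in> ball 0 (2 * \<rho>)" using \<eta>(2) cs.\<rho> by (simp add: p_def)
  have "isCont p 0" unfolding p_def using lf.flow_der by (rule has_vector_derivative_continuous)
  then have 2: "\<forall>\<^sub>F t in nhds 0. p t \<in> ball 0 (2 * \<rho>)" using p0 by (intro eventually_nhds_image) auto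
  have 3: "\<forall>\<^sub>F t in nhds 0. t \<in> T" using T eventually_nhds by blast
  have "\<forall>\<^sub>F t in nhds 0. Y t \<in> V \<and> p t \<in> ball 0 (2 * \<rho>) \<and> t \<in> T" using 1 2 3 by (simp add: eventually_conj_iff)
  then obtain e where e: "0 < e" "\<And>t. dist t 0 < e \<Longrightarrow> Y t \<in> V \<and> p t \<in> ball 0 (2 * \<rho>) \<and> t \<in> T"
    unfolding eventually_nhds_metric by blast
  define I where "I = ball (0::real) e"
  have I: "open I" "is_interval I" "0 \<in> I" using e(1) by (auto simp: I_def is_interval_ball_real)
  have It: "Y t \<in> V" "norm (p t) < 2 * \<rho>" "t \<in> T" if "t \<in> I" for t
    using e(2)[of t] that by (auto simp: I_def dist_commute)
  have IT: "I \<subseteq> T" using It by blast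
  have X: "X t = lf.flow t (X 0)" if "t \<in> I" for t
  proof (rule lf.flow_unique[OF I(2,3) that])
    fix t assume t: "t \<in> I"
    have Xt: "X t \<in> E" "\<Psi> (X t) = Y t" using \<Psi>_inv(3,4)[OF Yd(1)[OF It(3)[OF t]]] by (auto simp: X_def)
    have "norm (X t) < \<eta>" using V(3)[OF It(1)[OF t]] by (simp add: X_def)
    then have "H (X t) = h (X t)" using near_E \<eta>(1,2) by simp
    then have "coord_field \<Phi> D F (X t) = H (X t)" using F[OF Xt(1)] Xt(2) It(1)[OF t] by simp
    moreover have "(X has_vector_derivative coord_field \<Phi> D F (X t)) (at t within T)"
      unfolding X_def by (rule orbit_pull[OF Yd[OF It(3)[OF t]]])
    ultimately show "(X has_vector_derivative H (X t)) (at t within I)"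
      using has_vector_derivative_within_subset[OF _ IT] by metis
  qed
  have pX: "cs.\<pi> (X t) = p t" if "t \<in> I" for t
    using cs.\<pi>_flow[of t "X 0"] X[OF that] by (simp add: p_def)
  have "orbit_on g \<Omega> I (\<lambda>t. \<Psi> (p t))"
    unfolding orbit_on_def
  proof (intro ballI conjI)
    fix t assume t: "t \<in> I"
    have pt: "p t \<in> E" "H (p t) = h (p t)" using H_near[OF It(2)[OF t]] by auto
    show "\<Psi> (p t) \<in> \<Omega>" unfolding \<Omega>_E using pt(1) by (rule imageI)
    have "(p has_vector_derivative h (p t)) (at t within I)"
      unfolding pt(2)[symmetric] unfolding p_def by (rule has_vector_derivative_at_within[OF lf.flow_der])
    then show "((\<lambda>t. \<Psi> (p t)) has_vector_derivative g (\<Psi> (p t))) (at t within I)" by (rule orbit_push[where X = p, OF pt(1)])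
  qed
  moreover have "\<Psi> (p 0) \<in> S0" using Y0 by (simp add: p_def X_def)
  ultimately have "\<forall>\<^sub>F t in nhds 0. \<Psi> (p t) \<in> S0"
    by (intro S0_invariant[unfolded locally_invariant_def, rule_format, of I] conjI I)
  moreover have "\<forall>\<^sub>F t in nhds 0. t \<in> I" using I eventually_nhds by blast
  ultimately show "\<forall>\<^sub>F t in nhds 0. Y t \<in> {y \<in> V. \<Psi> (cs.\<pi> (inv_into E \<Psi> y)) \<in> S0}"
  proof eventually_elim
    case (elim t)
    then show ?case using It(1) pX[of t] by (simp add: X_def)
  qed
qed

text \<open>The equilibrium below \<open>p\<close> on the manifold \<open>{\<zeta> = 0}\<close>.\<close>

lemma anchor:
  assumes p: "P p = p" "norm p \<le> 2 * \<eta>"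
  shows "\<exists>y\<in>Zs. H y = 0 \<and> norm (p - y) \<le> LI * norm (block Jz (\<Psi> p))"
proof -
  have p\<rho>: "norm p \<le> \<rho>" using p(2) \<eta>(2) by simp
  have pE: "p \<in> E" using near_E[OF p\<rho>] by simp
  define z where "z = \<Psi> p"
  have "L\<Psi> * norm p \<le> L\<Psi> * (2 * \<eta>)" using p(2) L\<Psi>(1) by (rule mult_left_mono)
  then have z: "norm z \<le> L\<Psi> * (2 * \<eta>)" using \<Psi>_norm[OF p\<rho>] by (simp add: z_def)
  \<comment> \<open>In the final coordinates the equilibrium is found by setting \<zeta> to zero;
    its distance to \<open>z\<close> is the size of the \<zeta> component of
    \<open>z\<close>.\<close>
  define y1 where "y1 = z - block Jz z"
  have y1: "norm y1 \<le> 2 * (L\<Psi> * (2 * \<eta>))"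
    using norm_triangle_ineq4[of z "block Jz z"] block_norm[of Jz z] z by (simp add: y1_def)
  have nn: "0 \<le> L\<Psi> * (2 * \<eta>)" using L\<Psi>(1) \<eta>(1) by simp
  have R: "norm y1 \<le> R'" "norm z \<le> R'" "norm (0 :: real^'n) \<le> R'" using y1 z \<eta>(5) nn by auto
  define y where "y = inv_into E \<Psi> y1"
  have "y1 \<in> \<Omega>" using R(1) R' by auto
  then have y: "y \<in> E" "\<Psi> y = y1" using \<Psi>_inv(3,4) by (auto simp: y_def)
  have "norm y \<le> LI * norm y1" using LI(2)[OF R(1,3)] \<Psi>_inv(6) by (simp add: y_def)
  also have "\<dots> \<le> LI * (2 * (L\<Psi> * (2 * \<eta>)))" using y1 LI(1) by (rule mult_left_mono)
  also have "\<dots> < \<rho>" by (rule \<eta>(7))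
  finally have y\<rho>: "norm y < \<rho>" .
  have "block Jm z = 0" using \<Psi>m[OF pE] p(1) by (simp add: z_def Q_block)
  moreover have "block Jm (block Jz z) = 0"
    using split by (auto simp: block_def vec_eq_iff)
  ultimately have "block Jm y1 = 0" by (simp add: y1_def block_diff)
  then have "block Jm y = 0" using \<Psi>m[OF y(1)] y(2) by simp
  then have Py: "P y = y" by (simp add: Q_block)
  have "block Jz y1 = 0" by (simp add: y1_def block_diff)
  then have yZ: "y \<in> Zs" using y Py y\<rho> by (simp add: Zset_def)
  have "((\<lambda>t. lf.flow t y) has_vector_derivative H (lf.flow 0 y)) (at 0)" by (rule lf.flow_der)
  then have d1: "((\<lambda>t. y) has_vector_derivative H y) (at (0 :: real))" using cs.Z_fixed[OF yZ] by simp
  have "H y = 0" by (rule vector_derivative_unique_at[OF d1]) (rule has_vector_derivative_const)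
  moreover have "norm (p - y) \<le> LI * norm (block Jz z)"
    using LI(2)[OF R(2,1)] \<Psi>_inv(2)[OF pE] by (simp add: y_def z_def y1_def)
  ultimately show ?thesis using yZ by (auto simp: z_def)
qed

text \<open>Two errors occur: the phase against the projection, and the phase at the shifted time
  against the phase at the true one. Each is a decaying quantity times a distance to one equilibrium
  \<open>y\<close> on the manifold \<open>{\<zeta> = 0}\<close>. The distance is initially bounded
  by the \<zeta> component of the phase at time \<open>\<sigma> 0\<close> and grows at rate
  \<epsilon>; the other factor decays at rate \<open>c'\<close> or \<open>c / 2\<close> and is
  proportional to the initial stable component.\<close>

lemma decay_estimate:
  assumes X: "\<And>\<tau>. \<tau> \<in> T \<Longrightarrow> X \<tau> = lf.flow \<tau> x0" "\<And>\<tau>. \<tau> \<in> T \<Longrightarrow> norm (X \<tau>) < \<eta>"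
    and p: "\<And>s. p s = lf.flow s (cs.\<pi> x0)" "norm (p (\<sigma> 0)) \<le> 2 * \<eta>"
    and \<tau>: "\<tau> \<in> T" "0 \<le> \<tau>" and \<sigma>: "0 \<le> \<sigma> 0" "\<sigma> 0 \<le> q" "\<tau> \<le> \<sigma> \<tau>" "\<sigma> \<tau> \<le> \<tau> + q"
      "\<sigma> \<tau> - \<tau> \<le> K * norm (x0 - P x0) * exp (- (c / 2) * \<tau>)" and K: "0 \<le> K"
  shows "norm (P (X \<tau>) - p (\<sigma> \<tau>)) \<le> (2 * C\<pi> * cs.k + L * K) * (cs.k * exp (\<epsilon> * q) * LI) *
    norm (block Jz (\<Psi> (p (\<sigma> 0)))) * norm (x0 - P x0) * exp (- c * \<tau> / 4)"
proof -
  define \<zeta> where "\<zeta> = norm (block Jz (\<Psi> (p (\<sigma> 0))))"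
  define \<xi> where "\<xi> = norm (x0 - P x0)"
  define M where "M = cs.k * exp (\<epsilon> * q) * LI"
  have k: "0 \<le> cs.k" using cs.k1 by simp
  have nn: "0 \<le> \<zeta>" "0 \<le> \<xi>" "0 \<le> M" using k LI(1) by (auto simp: \<zeta>_def \<xi>_def M_def)
  have Pp: "P (p s) = p s" for s
    using cs.center_invariant[of s "cs.\<pi> x0"] by (simp add: p(1))
  obtain y where y: "y \<in> Zs" "H y = 0" "norm (p (\<sigma> 0) - y) \<le> LI * \<zeta>"
    using anchor[OF Pp p(2)] by (auto simp: \<zeta>_def)
  have Py: "P y = y" using y(1) by simp
  have py: "norm (p s - y) \<le> M * \<zeta> * exp (\<epsilon> * \<tau>)" if s: "\<tau> \<le> s" "s \<le> \<tau> + q" for s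
  proof -
    have "p s = lf.flow (s - \<sigma> 0) (P (p (\<sigma> 0)))"
      using lf.flow_add[of "s - \<sigma> 0" "\<sigma> 0" "cs.\<pi> x0"] unfolding Pp by (simp add: p(1))
    moreover have "y = lf.flow (s - \<sigma> 0) (P y)" using cs.Z_fixed[OF y(1)] Py by simp
    ultimately have "norm (p s - y) \<le> cs.k * exp (\<epsilon> * \<bar>s - \<sigma> 0\<bar>) * norm (P (p (\<sigma> 0)) - P y)"
      using cs.center_expansion[of "s - \<sigma> 0" "p (\<sigma> 0)" y] by metis
    also have "\<dots> \<le> cs.k * exp (\<epsilon> * (q + \<tau>)) * (LI * \<zeta>)"
      unfolding Pp Py using \<sigma> \<tau> s k cs.eps(1) y(3) by (intro mult_mono) auto
    also have "\<dots> = M * \<zeta> * exp (\<epsilon> * \<tau>)" by (simp add: M_def exp_add distrib_left)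
    finally show ?thesis .
  qed
  have x: "norm (X \<tau> - P (X \<tau>)) \<le> cs.k * exp (- c' * \<tau>) * \<xi>"
    using cs.Q_decay[OF \<tau>(2), of x0] X(1)[OF \<tau>(1)] by (simp add: \<xi>_def)
  have \<pi>X: "cs.\<pi> (X \<tau>) = p \<tau>" using cs.\<pi>_flow[of \<tau> x0] by (simp add: X(1)[OF \<tau>(1)] p(1))
  note pb = projection_bounds[OF X(2)[OF \<tau>(1)]]
  have e1: "norm (p \<tau> - P (X \<tau>)) \<le> C\<pi> * norm (X \<tau> - P (X \<tau>)) * norm (P (X \<tau>) - y)"
    using C\<pi>(2)[OF y(1) pb(3)] by (simp add: \<pi>X)
  \<comment> \<open>The bilinear estimate contains the distance from the projection to
    \<open>y\<close>, which no flow controls. With a factor of at most 1/2 it is absorbed and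
    replaced by twice the distance from the phase to \<open>y\<close>.\<close>
  have "C\<pi> * norm (X \<tau> - P (X \<tau>)) * norm (P (X \<tau>) - y) \<le> 1 / 2 * norm (P (X \<tau>) - y)"
    using pb(4) by (rule mult_right_mono) simp
  then have "norm (P (X \<tau>) - y) \<le> 2 * norm (p \<tau> - y)"
    using e1 norm_triangle_ineq4[of "p \<tau> - y" "p \<tau> - P (X \<tau>)"] by simp
  also have "\<dots> \<le> 2 * (M * \<zeta> * exp (\<epsilon> * \<tau>))" using py[of \<tau>] \<sigma> by simp
  finally have PX: "norm (P (X \<tau>) - y) \<le> 2 * (M * \<zeta> * exp (\<epsilon> * \<tau>))" .
  have ex1: "exp (- c' * \<tau>) * exp (\<epsilon> * \<tau>) \<le> exp (- c * \<tau> / 4)"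
    and ex2: "exp (\<epsilon> * \<tau>) * exp (- (c / 2) * \<tau>) \<le> exp (- c * \<tau> / 4)"
  proof -
    \<comment> \<open>Here \<open>\<epsilon> = c / 500\<close> and
      \<open>c' = 499 * c / 500\<close>, so both exponents are well below
      \<open>- c / 4\<close>.\<close>
    have 1: "- c' + \<epsilon> \<le> - c / 4" "\<epsilon> + - (c / 2) \<le> - c / 4" using c_pos by (auto simp: rates)
    have "- c' * \<tau> + \<epsilon> * \<tau> \<le> - c * \<tau> / 4" "\<epsilon> * \<tau> + - (c / 2) * \<tau> \<le> - c * \<tau> / 4"
      using mult_right_mono[OF 1(1) \<tau>(2)] mult_right_mono[OF 1(2) \<tau>(2)] by (simp_all add: algebra_simps)
    then show "exp (- c' * \<tau>) * exp (\<epsilon> * \<tau>) \<le> exp (- c * \<tau> / 4)"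
      "exp (\<epsilon> * \<tau>) * exp (- (c / 2) * \<tau>) \<le> exp (- c * \<tau> / 4)"
      by (simp_all only: exp_add[symmetric] exp_le_cancel_iff)
  qed
  have "norm (p \<tau> - P (X \<tau>)) \<le> C\<pi> * (cs.k * exp (- c' * \<tau>) * \<xi>) * (2 * (M * \<zeta> * exp (\<epsilon> * \<tau>)))"
    using e1 x PX C\<pi>(1) nn k by (elim order_trans) (intro mult_mono mult_nonneg_nonneg; simp)
  also have "\<dots> = 2 * C\<pi> * cs.k * M * \<zeta> * \<xi> * (exp (- c' * \<tau>) * exp (\<epsilon> * \<tau>))" by (simp add: ac_simps)
  also have "\<dots> \<le> 2 * C\<pi> * cs.k * M * \<zeta> * \<xi> * exp (- c * \<tau> / 4)"
    using ex1 C\<pi>(1) nn k by (intro mult_left_mono) auto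
  finally have b1: "norm (p \<tau> - P (X \<tau>)) \<le> 2 * C\<pi> * cs.k * M * \<zeta> * \<xi> * exp (- c * \<tau> / 4)" .
  \<comment> \<open>As \<open>H\<close> vanishes at \<open>y\<close>, the speed of the phase is
    bounded by its distance to \<open>y\<close>. This brings the factor \<zeta> into the error
    caused by the shift of time.\<close>
  have Hb: "norm (H (p s)) \<le> L * (M * \<zeta> * exp (\<epsilon> * \<tau>))" if "s \<in> {\<tau>..\<sigma> \<tau>}" for s
  proof -
    have "norm (H (p s)) \<le> L * norm (p s - y)" using lf.lip[of "p s" y] y(2) by simp
    also have "\<dots> \<le> L * (M * \<zeta> * exp (\<epsilon> * \<tau>))" using py[of s] that \<sigma> lf.L by (intro mult_left_mono) auto
    finally show ?thesis .
  qed
  have "norm (p (\<sigma> \<tau>) - p \<tau>) \<le> L * (M * \<zeta> * exp (\<epsilon> * \<tau>)) * norm (\<sigma> \<tau> - \<tau>)"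
  proof (rule derivative_bound_lipschitz[of "{\<tau>..\<sigma> \<tau>}" p "\<lambda>s v. v *\<^sub>R H (p s)"])
    show "(p has_derivative (\<lambda>v. v *\<^sub>R H (p s))) (at s)" for s
      using lf.flow_der[of "cs.\<pi> x0" s] by (simp add: has_vector_derivative_def flip: p(1))
    show "norm (v *\<^sub>R H (p s)) \<le> L * (M * \<zeta> * exp (\<epsilon> * \<tau>)) * norm v" if "s \<in> {\<tau>..\<sigma> \<tau>}" for s v
      using mult_left_mono[OF Hb[OF that], of "\<bar>v\<bar>"] by (simp add: ac_simps)
  qed (use \<sigma> nn lf.L in auto)
  also have "\<dots> \<le> L * (M * \<zeta> * exp (\<epsilon> * \<tau>)) * (K * \<xi> * exp (- (c / 2) * \<tau>))"
    using \<sigma> nn lf.L by (intro mult_left_mono) (auto simp: \<xi>_def)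
  also have "\<dots> = L * K * M * \<zeta> * \<xi> * (exp (\<epsilon> * \<tau>) * exp (- (c / 2) * \<tau>))" by (simp add: ac_simps)
  also have "\<dots> \<le> L * K * M * \<zeta> * \<xi> * exp (- c * \<tau> / 4)"
    using ex2 nn K lf.L by (intro mult_left_mono) auto
  finally have b2: "norm (p (\<sigma> \<tau>) - p \<tau>) \<le> L * K * M * \<zeta> * \<xi> * exp (- c * \<tau> / 4)" .
  have "norm (P (X \<tau>) - p (\<sigma> \<tau>)) \<le> norm (p \<tau> - P (X \<tau>)) + norm (p (\<sigma> \<tau>) - p \<tau>)"
    using norm_triangle_ineq[of "P (X \<tau>) - p \<tau>" "p \<tau> - p (\<sigma> \<tau>)"] by (simp add: norm_minus_commute)
  also have "\<dots> \<le> 2 * C\<pi> * cs.k * M * \<zeta> * \<xi> * exp (- c * \<tau> / 4) + L * K * M * \<zeta> * \<xi> * exp (- c * \<tau> / 4)"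
    using b1 b2 by (rule add_mono)
  also have "\<dots> = (2 * C\<pi> * cs.k + L * K) * M * \<zeta> * \<xi> * exp (- c * \<tau> / 4)" by (simp add: algebra_simps)
  finally show ?thesis by (simp add: M_def \<zeta>_def \<xi>_def)
qed

end

section \<open>Decomposition of orbits and choice of the radius\<close>

context scales
begin

text \<open>\<open>H\<close> is bounded on the centre, so the speed of all phases has one bound for
  all times. It makes the cut-off along a phase a globally Lipschitz function of time, as the scalar
  equation for the change of time requires.\<close>

lemma center_curve_lipschitz: "\<exists>C\<ge>0. \<forall>x s t. norm (lf.flow s (cs.\<pi> x) - lf.flow t (cs.\<pi> x)) \<le> C * \<bar>s - t\<bar>"
proof -
  obtain C where C: "\<And>X. norm (H (P X)) \<le> C" using H_bounded by blast
  have C0: "0 \<le> C" using C[of 0] norm_ge_zero order_trans by blast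
  have "norm (lf.flow s (cs.\<pi> x) - lf.flow t (cs.\<pi> x)) \<le> C * norm (s - t)" for x s t
  proof (rule derivative_bound_lipschitz[of UNIV "\<lambda>s. lf.flow s (cs.\<pi> x)" "\<lambda>s v. v *\<^sub>R H (lf.flow s (cs.\<pi> x))"])
    show "((\<lambda>s. lf.flow s (cs.\<pi> x)) has_derivative (\<lambda>v. v *\<^sub>R H (lf.flow s (cs.\<pi> x)))) (at s)" for s
      using lf.flow_der by (simp add: has_vector_derivative_def)
    show "norm (v *\<^sub>R H (lf.flow s (cs.\<pi> x))) \<le> C * norm v" for s v
    proof -
      have "P (lf.flow s (cs.\<pi> x)) = lf.flow s (cs.\<pi> x)" using cs.center_invariant[of s "cs.\<pi> x"] by simp
      then have "norm (H (lf.flow s (cs.\<pi> x))) \<le> C" using C by metis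
      from mult_left_mono[OF this, of "\<bar>v\<bar>"] show ?thesis by (simp add: ac_simps)
    qed
  qed (use C0 in auto)
  then show ?thesis using C0 by (auto simp: real_norm_def)
qed

text \<open>On the manifold the cut-off equals 1, so the orbit solves the equation with
  \<open>H\<close> and its phase \<open>p\<close> runs at full speed. The phase itself may lie where
  the cut-off is smaller than 1, which the change of time \<sigma> corrects. \<open>Y0\<close> is
  the image of the reparametrized phase, \<open>Ym\<close> the stable block of the orbit in the
  final coordinates, and \<open>Yp\<close> the rest.\<close>

lemma decomposition:
  assumes \<phi>: "cut_off \<delta> \<phi>" and \<delta>: "0 < \<delta>" "2 * \<delta> < r" and small: "\<And>U. norm U < \<delta> \<Longrightarrow> norm (\<Phi> U) < \<eta>"
  defines "f \<equiv> coord_field \<Theta> D (\<lambda>U. \<phi> U *\<^sub>R G U)"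
    and "M \<equiv> {y \<in> \<Theta> ` ball 0 \<delta>. \<Psi> (cs.\<pi> (inv_into E \<Psi> y)) \<in> S0}"
  shows "\<exists>C>0. \<forall>T Y. is_interval T \<and> 0 \<in> T \<and> orbit_on f \<Omega> T Y \<and> (\<forall>\<tau>\<in>T. Y \<tau> \<in> M) \<longrightarrow>
    decomposes Jz Jc \<Omega> f S0 C c T Y"
proof -
  let ?F = "\<lambda>U. \<phi> U *\<^sub>R G U"
  define \<theta> where "\<theta> X = (if X \<in> E then \<phi> (inv_into D \<Phi> X) else 0)" for X
  obtain K\<phi> where K\<phi>: "0 \<le> K\<phi>" "\<And>X X'. \<bar>\<theta> X - \<theta> X'\<bar> \<le> K\<phi> * norm (X - X')"
    using cut_off_lipschitz[OF \<phi> \<delta>] unfolding \<theta>_def by blast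
  have \<theta>01: "0 \<le> \<theta> X \<and> \<theta> X \<le> 1" for X using \<phi> by (simp add: \<theta>_def cut_off_def)
  obtain KH where KH: "0 \<le> KH" "\<And>x s t. norm (lf.flow s (cs.\<pi> x) - lf.flow t (cs.\<pi> x)) \<le> KH * \<bar>s - t\<bar>"
    using center_curve_lipschitz by blast
  have k: "0 \<le> cs.k" using cs.k1 by simp
  define K0 where "K0 = K\<phi> * ((1 + C\<pi> * \<eta>) * cs.k)"
  have K0: "0 \<le> K0" using K\<phi> C\<pi>(1) \<eta>(1) k by (simp add: K0_def)
  define K where "K = K0 / (c / 2)"
  have K: "0 \<le> K" using K0 c_pos by (simp add: K_def)
  define q where "q = K * (2 * \<eta>)"
  \<comment> \<open>The summand 1 makes the constant positive.\<close>
  define C where "C = L\<Psi> * ((2 * C\<pi> * cs.k + L * K) * (cs.k * exp (\<epsilon> * q) * LI)) + 1"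
  have C: "0 < C" using L\<Psi>(1) C\<pi>(1) k lf.L K LI(1) by (auto simp: C_def intro!: add_nonneg_pos mult_nonneg_nonneg)
  have "decomposes Jz Jc \<Omega> f S0 C c T Y"
    if T: "is_interval T" "0 \<in> T" and Y: "orbit_on f \<Omega> T Y" and YM: "\<And>\<tau>. \<tau> \<in> T \<Longrightarrow> Y \<tau> \<in> M" for T Y
  proof -
    define X where "X t = inv_into E \<Psi> (Y t)" for t
    define x0 where "x0 = X 0"
    define p where "p s = lf.flow s (cs.\<pi> x0)" for s
    have Yd: "Y t \<in> \<Omega>" "(Y has_vector_derivative coord_field \<Theta> D ?F (Y t)) (at t within T)" if "t \<in> T" for t
      using Y that by (auto simp: orbit_on_def f_def)
    have XU: "norm (X t) < \<eta>" "X t \<in> E" "\<theta> (X t) = 1" "\<Psi> (X t) = Y t" if t: "t \<in> T" for t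
    proof -
      obtain U where U: "norm U < \<delta>" "Y t = \<Psi> (\<Phi> U)" using YM[OF t] by (auto simp: M_def \<Theta>_eq)
      have UD: "U \<in> D" using U(1) \<delta> by simp
      then have X: "X t = \<Phi> U" using \<Psi>_inv(2)[of "\<Phi> U"] by (simp add: X_def U(2))
      show "norm (X t) < \<eta>" "X t \<in> E" "\<Psi> (X t) = Y t" using small[OF U(1)] UD X U(2) by auto
      have "inv_into D \<Phi> (X t) = U" unfolding X by (rule inv_into_f_f[OF injs(1) UD])
      then show "\<theta> (X t) = 1" using \<phi> U(1) UD X by (simp add: \<theta>_def cut_off_def)
    qed
    have X\<rho>: "norm (X t) \<le> \<rho>" if "t \<in> T" for t using XU(1)[OF that] \<eta>(1,2) by simp
    have Xflow: "X t = lf.flow t x0" if "t \<in> T" for t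
      unfolding x0_def
    proof (rule lf.flow_unique[OF T that])
      fix t assume t: "t \<in> T"
      have "(X has_vector_derivative coord_field \<Phi> D ?F (X t)) (at t within T)"
        unfolding X_def by (rule orbit_pull[OF Yd[OF t]])
      moreover have "coord_field \<Phi> D ?F (X t) = H (X t)"
        unfolding cut_field[OF XU(2)[OF t]] using XU(2,3)[OF t] near_E[OF X\<rho>[OF t]] by (simp add: \<theta>_def)
      ultimately show "(X has_vector_derivative H (X t)) (at t within T)" by simp
    qed
    have \<pi>X: "cs.\<pi> (X t) = p t" if "t \<in> T" for t
      using cs.\<pi>_flow[of t x0] by (simp add: Xflow[OF that] p_def)
    have Pp: "P (p s) = p s" for s using cs.center_invariant[of s "cs.\<pi> x0"] by (simp add: p_def)
    have pc: "continuous_on A p" for A unfolding p_def by (rule lf.flow_continuous)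
    have p_small: "norm (p s) \<le> 2 * \<eta>" if "s \<in> closure T" for s
    proof -
      have "p ` closure T \<subseteq> cball 0 (2 * \<eta>)"
        by (rule image_closure_subset[OF pc closed_cball]) (use projection_bounds(5) XU(1) \<pi>X in force)
      then show ?thesis using that by auto
    qed
    have pE: "p s \<in> E" "H (p s) = h (p s)" "norm (p s) \<le> \<rho>" if "s \<in> closure T" for s
      using near_E[of "p s"] p_small[OF that] \<eta>(2) by auto
    have pS0: "\<Psi> (p s) \<in> S0" if s: "s \<in> closure T" for s
    proof -
      have "continuous_on (closure T) (\<lambda>s. \<Psi> (p s))"
        by (rule continuous_on_compose2[OF has_derivative_imp_continuous_on[OF \<Psi>_der] pc]) (use pE in auto)
      moreover have "(\<lambda>s. \<Psi> (p s)) ` T \<subseteq> closure S0"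
      proof
        fix z assume "z \<in> (\<lambda>s. \<Psi> (p s)) ` T"
        then obtain t where t: "t \<in> T" "z = \<Psi> (p t)" by blast
        have "z \<in> S0" using YM[OF t(1)] \<pi>X[OF t(1)] by (simp add: M_def X_def t(2))
        then show "z \<in> closure S0" using closure_subset by blast
      qed
      ultimately have "\<Psi> (p s) \<in> closure S0"
        using image_closure_subset[of T "\<lambda>s. \<Psi> (p s)" "closure S0"] s by auto
      moreover have "norm (\<Psi> (p s)) < RS"
        using \<Psi>_norm[OF pE(3)[OF s]] mult_left_mono[OF p_small[OF s] L\<Psi>(1)] \<eta>(6) by linarith
      ultimately show ?thesis using RS by auto
    qed
    define m where "m s = \<theta> (p s)" for s
    have m: "lipschitz_field m (K\<phi> * KH)"
    proof (rule lipschitz_field.intro)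
      fix s t
      have "norm (m s - m t) \<le> K\<phi> * norm (p s - p t)" using K\<phi>(2) by (simp add: m_def)
      also have "\<dots> \<le> K\<phi> * (KH * \<bar>s - t\<bar>)" unfolding p_def using KH(2) K\<phi>(1) by (intro mult_left_mono)
      finally show "norm (m s - m t) \<le> K\<phi> * KH * norm (s - t)" by simp
    qed (use K\<phi> KH in simp)
    define \<xi> where "\<xi> = norm (x0 - P x0)"
    have \<xi>: "0 \<le> \<xi>" "\<xi> \<le> 2 * \<eta>" using projection_bounds(1)[OF XU(1)[OF T(2)]] by (auto simp: \<xi>_def x0_def)
    \<comment> \<open>The cut-off is 1 at the point \<open>X s\<close> of the orbit; hence its
      defect at the phase is at most its Lipschitz constant times the distance from the orbit to its
      phase, and this decays.\<close>
    have dec: "1 - m s \<le> K0 * \<xi> * exp (- (c / 2) * s)" if s: "s \<in> T" "0 \<le> s" for s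
    proof -
      have "1 - m s \<le> K\<phi> * norm (X s - p s)" using K\<phi>(2)[of "X s" "p s"] XU(3)[OF s(1)] by (simp add: m_def)
      also have "\<dots> \<le> K\<phi> * ((1 + C\<pi> * \<eta>) * norm (X s - P (X s)))"
        using projection_bounds(6)[OF XU(1)[OF s(1)]] K\<phi>(1) by (intro mult_left_mono) (simp_all add: \<pi>X[OF s(1)])
      also have "\<dots> \<le> K\<phi> * ((1 + C\<pi> * \<eta>) * (cs.k * exp (- c' * s) * \<xi>))"
        using cs.Q_decay[OF s(2), of x0] K\<phi>(1) C\<pi>(1) \<eta>(1)
        by (intro mult_left_mono) (simp_all add: Xflow[OF s(1)] \<xi>_def)
      also have "\<dots> = K0 * \<xi> * exp (- c' * s)" by (simp add: K0_def ac_simps)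
      also have "\<dots> \<le> K0 * \<xi> * exp (- (c / 2) * s)"
      proof (rule mult_left_mono)
        have "- c' \<le> - (c / 2)" using c_pos by (simp add: rates)
        from mult_right_mono[OF this s(2)] show "exp (- c' * s) \<le> exp (- (c / 2) * s)" by simp
      qed (use K0 \<xi> in simp)
      finally show ?thesis .
    qed
    obtain \<sigma> where \<sigma>: "\<And>t. (\<sigma> has_real_derivative m (\<sigma> t)) (at t)" "\<And>t. t \<in> T \<Longrightarrow> \<sigma> t \<in> closure T"
      "\<And>t. t \<in> T \<Longrightarrow> 0 \<le> t \<Longrightarrow> t \<le> \<sigma> t \<and> \<sigma> t \<le> t + K0 * \<xi> / (c / 2) * exp (- (c / 2) * t)"
    proof (rule time_change[OF m _ T _ _ dec])
      show "0 \<le> m s \<and> m s \<le> 1" for s using \<theta>01 by (simp add: m_def)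
      show "0 < c / 2" "0 \<le> K0 * \<xi>" using c_pos K0 \<xi> by auto
    qed (assumption | rule that; assumption)+
    define Y0 where "Y0 t = \<Psi> (p (\<sigma> t))" for t
    define Ym where "Ym t = block Jm (Y t)" for t
    define Yp where "Yp t = Y t - Y0 t - Ym t" for t
    have "orbit_on f \<Omega> T Y0"
      unfolding orbit_on_def
    proof (intro ballI conjI)
      fix t assume t: "t \<in> T"
      note e = pE[OF \<sigma>(2)[OF t]]
      show "Y0 t \<in> \<Omega>" unfolding \<Omega>_E Y0_def using e(1) by (rule imageI)
      have "(\<sigma> has_vector_derivative m (\<sigma> t)) (at t)"
        using \<sigma>(1) by (simp add: has_real_derivative_iff_has_vector_derivative)
      moreover have "(p has_vector_derivative H (p (\<sigma> t))) (at (\<sigma> t))" unfolding p_def by (rule lf.flow_der)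
      ultimately have "(p \<circ> \<sigma> has_vector_derivative m (\<sigma> t) *\<^sub>R H (p (\<sigma> t))) (at t)" by (rule vector_diff_chain_at)
      moreover have "m (\<sigma> t) *\<^sub>R H (p (\<sigma> t)) = coord_field \<Phi> D ?F (p (\<sigma> t))"
        unfolding cut_field[OF e(1)] using e by (simp add: m_def \<theta>_def)
      ultimately have "((\<lambda>t. p (\<sigma> t)) has_vector_derivative coord_field \<Phi> D ?F (p (\<sigma> t))) (at t within T)"
        by (simp add: comp_def has_vector_derivative_at_within)
      then show "(Y0 has_vector_derivative f (Y0 t)) (at t within T)"
        unfolding Y0_def f_def by (rule orbit_push[where X = "\<lambda>t. p (\<sigma> t)", OF e(1)])
    qed
    moreover have "Y0 t \<in> S0" if "t \<in> T" for t unfolding Y0_def by (rule pS0[OF \<sigma>(2)[OF that]])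
    moreover have "continuous_on T Ym"
      unfolding Ym_def
      by (intro bounded_linear.continuous_on[OF block_bl] continuous_on_vector_derivative[OF Yd(2)])
    moreover have "Ym t \<in> stable_manifold Jc \<Omega>" if t: "t \<in> T" for t
    proof -
      have "norm (Ym t) \<le> norm (Y t)" unfolding Ym_def by (rule block_norm)
      also have "\<dots> \<le> L\<Psi> * norm (X t)" using \<Psi>_norm[OF X\<rho>[OF t]] XU(4)[OF t] by simp
      also have "\<dots> \<le> L\<Psi> * (2 * \<eta>)" using XU(1)[OF t] \<eta>(1) L\<Psi>(1) by (intro mult_left_mono) auto
      also have "\<dots> \<le> R'" using \<eta>(5) mult_nonneg_nonneg[OF L\<Psi>(1), of "2 * \<eta>"] \<eta>(1) by linarith
      finally have "Ym t \<in> \<Omega>" using R' by auto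
      then show ?thesis by (simp add: stable_manifold_def Ym_def)
    qed
    moreover have "norm (Yp t) \<le> C * norm (block Jz (Y0 0)) * norm (Ym 0) * exp (- c * t / 4)"
      if t: "t \<in> T" "0 \<le> t" for t
    proof -
      have Ym0: "norm (Ym 0) = \<xi>"
        using \<Psi>m[OF XU(2)[OF T(2)]] XU(4)[OF T(2)] by (simp add: Ym_def \<xi>_def x0_def Q_block)
      have q: "K0 * \<xi> / (c / 2) * exp (- (c / 2) * s) = K * \<xi> * exp (- (c / 2) * s)" for s by (simp add: K_def)
      have Kq: "K * \<xi> * exp (- (c / 2) * s) \<le> q" if "0 \<le> s" for s
      proof -
        have "K * \<xi> * exp (- (c / 2) * s) \<le> K * (2 * \<eta>) * 1"
          using K \<xi> c_pos that by (intro mult_mono) auto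
        then show ?thesis by (simp add: q_def)
      qed
      have \<sigma>0: "0 \<le> \<sigma> 0" "\<sigma> 0 \<le> q" using \<sigma>(3)[OF T(2)] Kq[of 0] unfolding q by auto
      have \<sigma>t: "t \<le> \<sigma> t" "\<sigma> t \<le> t + q" "\<sigma> t - t \<le> K * \<xi> * exp (- (c / 2) * t)"
        using \<sigma>(3)[OF t] Kq[OF t(2)] unfolding q by auto
      have est: "norm (P (X t) - p (\<sigma> t)) \<le> (2 * C\<pi> * cs.k + L * K) * (cs.k * exp (\<epsilon> * q) * LI) *
          norm (block Jz (\<Psi> (p (\<sigma> 0)))) * norm (x0 - P x0) * exp (- c * t / 4)"
        by (rule decay_estimate[OF Xflow XU(1) p_def p_small[OF \<sigma>(2)[OF T(2)]] t \<sigma>0 \<sigma>t[unfolded \<xi>_def] K])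
      have PX: "norm (P (X t)) \<le> \<rho>" using block_norm[of Jc "X t"] X\<rho>[OF t(1)] by simp
      have PXE: "P (X t) \<in> E" using near_E[OF PX] by simp
      \<comment> \<open>\<open>\<Psi>\<close> keeps the stable block, and its centre block depends
        on \<open>P X\<close> alone. Subtracting \<open>Ym t\<close> from \<open>Y t\<close>
        therefore leaves \<open>\<Psi> (P (X t))\<close>, and \<open>Yp t\<close> is a difference of
        two values of \<open>\<Psi>\<close> on the centre.\<close>
      have "block Jm (\<Psi> (P (X t))) = 0" using \<Psi>m[OF PXE] by simp
      then have "P (\<Psi> (P (X t))) = \<Psi> (P (X t))" by (simp add: Q_block)
      moreover have "P (\<Psi> (X t)) = P (\<Psi> (P (X t)))" by (rule \<Psi>c[OF XU(2)[OF t(1)] PXE]) simp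
      ultimately have "Yp t = \<Psi> (P (X t)) - \<Psi> (p (\<sigma> t))"
        using XU(4)[OF t(1)] by (simp add: Yp_def Ym_def Y0_def Q_block)
      then have "norm (Yp t) \<le> L\<Psi> * norm (P (X t) - p (\<sigma> t))"
        using L\<Psi>(2)[OF PX pE(3)[OF \<sigma>(2)[OF t(1)]]] by simp
      also have "\<dots> \<le> L\<Psi> * ((2 * C\<pi> * cs.k + L * K) * (cs.k * exp (\<epsilon> * q) * LI) *
          norm (block Jz (\<Psi> (p (\<sigma> 0)))) * norm (x0 - P x0) * exp (- c * t / 4))"
        using est L\<Psi>(1) by (rule mult_left_mono)
      also have "\<dots> = (C - 1) * (norm (block Jz (Y0 0)) * norm (Ym 0) * exp (- c * t / 4))"
        unfolding Ym0 by (simp add: C_def Y0_def \<xi>_def ac_simps)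
      also have "\<dots> \<le> C * (norm (block Jz (Y0 0)) * norm (Ym 0) * exp (- c * t / 4))"
        by (intro mult_right_mono) auto
      finally show ?thesis by (simp add: ac_simps)
    qed
    moreover have "Y t = Y0 t + Ym t + Yp t" for t by (simp add: Yp_def)
    ultimately show ?thesis
      unfolding decomposes_def by (intro exI[of _ Y0] exI[of _ Ym] exI[of _ Yp] conjI ballI impI)
  qed
  then show ?thesis using C by blast
qed

text \<open>The field \<open>H\<close>, its phase and the set \<open>S\<close> are built from the
  field without cut-off. So \<open>\<delta>0\<close> can be fixed before the cut-off \<phi> is
  given, and \<phi> influences nothing but the constant \<open>C\<close>.\<close>

lemma uniformly_stable_manifold:
  "\<exists>\<delta>0>0. 2 * \<delta>0 < r \<and>
       (\<forall>\<delta> \<phi> F f E. 0 < \<delta> \<and> \<delta> < \<delta>0 \<and> cut_off \<delta> \<phi> \<and> F = (\<lambda>U. \<phi> U *\<^sub>R G U) \<and>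
          f = coord_field \<Theta> (ball 0 r) F \<and> E = {s + x | s x. s \<in> Stan \<and> x \<in> Vm} \<longrightarrow>
          (\<exists>Mus. C1_submanifold (dim E) Mus \<and> 0 \<in> Mus \<and>
             locally_invariant f \<Omega> Mus \<and>
             C1_parameterized_by Mus E (\<Theta> ` ball 0 \<delta>) \<and> tangent_space_at Mus 0 = E \<and>
             (\<exists>C>0. \<forall>T Y. is_interval T \<and> 0 \<in> T \<and> orbit_on f \<Omega> T Y \<and> (\<forall>\<tau>\<in>T. Y \<tau> \<in> Mus) \<longrightarrow>
                decomposes Jz Jc \<Omega> f S0 C c T Y)))"
proof -
  define W where "W = {s + x | s x. s \<in> Stan \<and> x \<in> Vm}"
  obtain S where S1: "open S \<and> 0 \<in> S \<and> S \<subseteq> \<Omega> \<and> (\<forall>V. open V \<longrightarrow> 0 \<in> V \<longrightarrow> V \<subseteq> S \<longrightarrow>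
    (\<exists>M. M = {y \<in> V. \<Psi> (cs.\<pi> (inv_into E \<Psi> y)) \<in> S0} \<and>
      C1_submanifold (dim W) M \<and> C1_parameterized_by M W V \<and> tangent_space_at M 0 = W))"
    using invariant_manifold_exists[folded W_def] by (elim exE) (rule that)
  then have S: "open S" "0 \<in> S" "S \<subseteq> \<Omega>" by simp_all
  have SM: "\<exists>M. M = {y \<in> V. \<Psi> (cs.\<pi> (inv_into E \<Psi> y)) \<in> S0} \<and>
      C1_submanifold (dim W) M \<and> C1_parameterized_by M W V \<and> tangent_space_at M 0 = W"
    if "open V" "0 \<in> V" "V \<subseteq> S" for V using S1 that by simp
  have "isCont \<Phi> 0" using has_derivative_continuous[OF \<Phi>_der[OF zeros(1)]] .
  then have 1: "\<forall>\<^sub>F U in nhds 0. \<Phi> U \<in> ball 0 \<eta>" by (rule eventually_nhds_image) (use \<Phi>D \<eta> in auto)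
  have "isCont \<Theta> 0" using has_derivative_continuous[OF \<Theta>_der[OF zeros(1)]] .
  then have 2: "\<forall>\<^sub>F U in nhds 0. \<Theta> U \<in> S" by (rule eventually_nhds_image) (use S \<Phi>D \<Psi>D \<Theta>_eq in auto)
  have "\<forall>\<^sub>F U in nhds 0. \<Phi> U \<in> ball 0 \<eta> \<and> \<Theta> U \<in> S" using 1 2 by (rule eventually_conj)
  then obtain e where e: "0 < e" "\<And>U. dist U 0 < e \<Longrightarrow> \<Phi> U \<in> ball 0 \<eta> \<and> \<Theta> U \<in> S"
    unfolding eventually_nhds_metric by blast
  \<comment> \<open>\<open>e\<close> keeps the ball of radius \<delta> in the region of the local
    estimates and its image in the domain of the defining function; \<open>r / 3\<close> yields
    \<open>2 * \<delta>0 < r\<close>.\<close>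
  define \<delta>0 where "\<delta>0 = min e (r / 3)"
  have \<delta>0: "0 < \<delta>0" "2 * \<delta>0 < r" using e(1) r_pos by (auto simp: \<delta>0_def)
  have main: "\<exists>Mus. C1_submanifold (dim W) Mus \<and> 0 \<in> Mus \<and> locally_invariant (coord_field \<Theta> D (\<lambda>U. \<phi> U *\<^sub>R G U)) \<Omega> Mus \<and>
      C1_parameterized_by Mus W (\<Theta> ` ball 0 \<delta>) \<and> tangent_space_at Mus 0 = W \<and>
      (\<exists>C>0. \<forall>T Y. is_interval T \<and> 0 \<in> T \<and> orbit_on (coord_field \<Theta> D (\<lambda>U. \<phi> U *\<^sub>R G U)) \<Omega> T Y \<and> (\<forall>\<tau>\<in>T. Y \<tau> \<in> Mus) \<longrightarrow>
        decomposes Jz Jc \<Omega> (coord_field \<Theta> D (\<lambda>U. \<phi> U *\<^sub>R G U)) S0 C c T Y)"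
    if \<delta>: "0 < \<delta>" "\<delta> < \<delta>0" and \<phi>: "cut_off \<delta> \<phi>" for \<delta> \<phi>
  proof -
    define V where "V = \<Theta> ` ball 0 \<delta>"
    have \<delta>r: "2 * \<delta> < r" using \<delta> \<delta>0 by simp
    have small: "norm (\<Phi> U) < \<eta>" and US: "\<Theta> U \<in> S" and UD: "U \<in> D" if "norm U < \<delta>" for U
      using e(2)[of U] that \<delta> r_pos by (auto simp: \<delta>0_def)
    have VE: "V = \<Psi> ` \<Phi> ` ball 0 \<delta>" by (simp add: V_def \<Theta>_eq image_comp)
    have inv: "continuous_on E (inv_into D \<Phi>)" "continuous_on \<Omega> (inv_into E \<Psi>)"
    proof -
      have "Ck_on 2 (inv_into D \<Phi>) E" using \<Phi>D(2) unfolding Ck_diffeo_def by (elim conjE)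
      then show "continuous_on E (inv_into D \<Phi>)" by (rule has_derivative_imp_continuous_on[OF Ck_on_2D(1)])
      show "continuous_on \<Omega> (inv_into E \<Psi>)" by (rule has_derivative_imp_continuous_on[OF Ck_on_1D(1)[OF \<Psi>_inv(1)]])
    qed
    have "\<Phi> ` ball 0 \<delta> = E \<inter> inv_into D \<Phi> -` ball 0 \<delta>"
      using UD inv_into_f_f[OF injs(1)] by (auto simp: image_iff) 
    then have o1: "open (\<Phi> ` ball 0 \<delta>)" using continuous_open_preimage[OF inv(1) opens(1) open_ball] by simp
    have sub: "\<Phi> ` ball 0 \<delta> \<subseteq> E" using UD by auto
    have "V = \<Omega> \<inter> inv_into E \<Psi> -` (\<Phi> ` ball 0 \<delta>)"
    proof
      show "V \<subseteq> \<Omega> \<inter> inv_into E \<Psi> -` (\<Phi> ` ball 0 \<delta>)" using sub \<Psi>_inv(2) unfolding VE \<Omega>_E by auto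
      show "\<Omega> \<inter> inv_into E \<Psi> -` (\<Phi> ` ball 0 \<delta>) \<subseteq> V"
      proof
        fix y assume "y \<in> \<Omega> \<inter> inv_into E \<Psi> -` (\<Phi> ` ball 0 \<delta>)"
        then have "y = \<Psi> (inv_into E \<Psi> y)" "inv_into E \<Psi> y \<in> \<Phi> ` ball 0 \<delta>" using \<Psi>_inv(4) by auto
        then show "y \<in> V" unfolding VE by (metis imageI)
      qed
    qed
    then have oV: "open V" using continuous_open_preimage[OF inv(2) opens(2) o1] by simp
    have V0: "0 \<in> V" using \<delta>(1) \<Phi>D(1) \<Psi>D(1) unfolding VE by (metis centre_in_ball imageI)
    have VS: "V \<subseteq> S" using US by (auto simp: V_def)
    define M where "M = {y \<in> V. \<Psi> (cs.\<pi> (inv_into E \<Psi> y)) \<in> S0}"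
    have man: "C1_submanifold (dim W) M \<and> C1_parameterized_by M W V \<and> tangent_space_at M 0 = W"
      using SM[OF oV V0 VS, folded M_def] by (elim exE conjE) simp
    have M0: "0 \<in> M" using V0 S0_origin \<Psi>D(1) by (simp add: M_def \<Psi>_inv(6) \<pi>_0)
    have "locally_invariant (coord_field \<Theta> D (\<lambda>U. \<phi> U *\<^sub>R G U)) \<Omega> M"
      unfolding M_def
    proof (rule manifold_invariant[OF oV])
      show "V \<subseteq> \<Omega>" using VS S(3) by blast
      show "norm (inv_into E \<Psi> y) < \<eta>" if "y \<in> V" for y
        using that small UD \<Psi>_inv(2) unfolding VE by auto
      fix X assume X: "X \<in> E" "\<Psi> X \<in> V"
      then obtain U where U: "norm U < \<delta>" "\<Psi> X = \<Psi> (\<Phi> U)" unfolding VE by auto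
      have "X = \<Phi> U" using inj_onD[OF injs(2) U(2) X(1)] UD[OF U(1)] by blast
      then have "inv_into D \<Phi> X = U" using inv_into_f_f[OF injs(1) UD[OF U(1)]] by simp
      then show "coord_field \<Phi> D (\<lambda>U. \<phi> U *\<^sub>R G U) X = h X"
        unfolding cut_field[OF X(1)] using \<phi> U(1) by (simp add: cut_off_def)
    qed
    moreover have "\<exists>C>0. \<forall>T Y. is_interval T \<and> 0 \<in> T \<and> orbit_on (coord_field \<Theta> D (\<lambda>U. \<phi> U *\<^sub>R G U)) \<Omega> T Y \<and> (\<forall>\<tau>\<in>T. Y \<tau> \<in> M) \<longrightarrow>
        decomposes Jz Jc \<Omega> (coord_field \<Theta> D (\<lambda>U. \<phi> U *\<^sub>R G U)) S0 C c T Y"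
      unfolding M_def V_def by (rule decomposition[OF \<phi> \<delta>(1) \<delta>r small])
    ultimately show ?thesis using man M0 unfolding V_def by (elim conjE) (intro exI[of _ M] conjI; assumption)
  qed
  show ?thesis
    by (intro exI[of _ \<delta>0] conjI \<delta>0 allI impI; elim conjE; hypsubst; fold W_def; rule main; assumption)
qed

end

theorem proposition3p1:
  fixes G :: "real^'n \<Rightarrow> real^'n"
    and \<Phi> \<Psi> \<Theta> :: "real^'n \<Rightarrow> real^'n"
    and Jm Jz Ju Jc :: "'n set"
    and Am Ac :: "real^'n \<Rightarrow> real^'n^'n"
    and S0 \<Omega> Stan Vm :: "(real^'n) set"
    and r c :: real and d :: nat
  assumes G_regular: "Ck_on 2 G UNIV"
    and G_zero: "G 0 = 0"
    and G_spectrum: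
      "\<And>\<mu>. block_eigenvalue UNIV (matrix (frechet_derivative G (at 0))) \<mu> \<Longrightarrow> Re \<mu> \<le> 0"
    and r_pos: "r > 0"
    and coords: "coordinate_change r Jm Jz Ju \<Phi> \<Psi>"
    and Jc_eq: "Jc = Jz \<union> Ju"
    and \<Theta>_eq: "\<Theta> = \<Psi> \<circ> \<Phi>"
    and \<Omega>_eq: "\<Omega> = \<Theta> ` ball 0 r"
    and form: "split_form Jm Jc \<Omega> (coord_field \<Theta> (ball 0 r) G) Am Ac"
    and Z0: "\<And>X. X \<in> \<Omega> \<Longrightarrow> block Jz X = 0 \<Longrightarrow> block Jc (coord_field \<Theta> (ball 0 r) G X) = 0"
    and c_pos: "c > 0"
    and c_gap: "\<And>\<mu>. block_eigenvalue Jm (Am 0) \<mu> \<Longrightarrow> Re \<mu> < - c"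
    and S0_manifold: "C1_submanifold d S0"
    and S0_origin: "0 \<in> S0"
    and S0_center: "S0 \<subseteq> center_manifold Jm \<Omega>"
    and S0_invariant: "locally_invariant (coord_field \<Theta> (ball 0 r) G) \<Omega> S0"
    and Stan_eq: "Stan = tangent_space_at S0 0"
    and Vm_eq: "Vm = {X. block Jc X = 0}"
  shows
    "\<exists>\<delta>0>0. 2 * \<delta>0 < r \<and>
       (\<forall>\<delta> \<phi> F f E. 0 < \<delta> \<and> \<delta> < \<delta>0 \<and> cut_off \<delta> \<phi> \<and> F = (\<lambda>U. \<phi> U *\<^sub>R G U) \<and>
          f = coord_field \<Theta> (ball 0 r) F \<and> E = {s + x | s x. s \<in> Stan \<and> x \<in> Vm} \<longrightarrow>
          (\<exists>Mus. C1_submanifold (dim E) Mus \<and> 0 \<in> Mus \<and>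
             locally_invariant f \<Omega> Mus \<and>
             C1_parameterized_by Mus E (\<Theta> ` ball 0 \<delta>) \<and> tangent_space_at Mus 0 = E \<and>
             (\<exists>C>0. \<forall>T Y. is_interval T \<and> 0 \<in> T \<and> orbit_on f \<Omega> T Y \<and> (\<forall>\<tau>\<in>T. Y \<tau> \<in> Mus) \<longrightarrow>
                decomposes Jz Jc \<Omega> f S0 C c T Y)))"
proof -
  have "setting G \<Phi> \<Psi> \<Theta> Jm Jz Ju Jc Am Ac S0 \<Omega> Stan Vm r c d"
    by (rule setting.intro[OF G_regular G_zero r_pos coords Jc_eq \<Theta>_eq \<Omega>_eq form Z0 c_pos c_gap
        S0_manifold S0_origin S0_center S0_invariant Stan_eq Vm_eq])
  from setting.phase_exists[OF this] obtain H B a b \<epsilon> c' L \<rho> where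
    "phase G \<Phi> \<Psi> \<Theta> Jm Jz Ju Jc Am Ac S0 \<Omega> Stan Vm r c d H B a b \<epsilon> c' L \<rho>"
    by (elim exE) (rule that)
  from phase.scales_exist[OF this] obtain L\<Psi> LI C\<pi> \<eta> R' RS where
    "scales G \<Phi> \<Psi> \<Theta> Jm Jz Ju Jc Am Ac S0 \<Omega> Stan Vm r c d H B a b \<epsilon> c' L \<rho> L\<Psi> LI C\<pi> \<eta> R' RS"
    by (elim exE) (rule that)
  then show ?thesis by (rule scales.uniformly_stable_manifold)
qed

end
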